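(* Let $\{x_i,\widetilde V_i\}_{i=1}^N$ be an almost uniform Voronoi-Delaunay decomposition of $\mathbb{S}^2$ with mesh size $h$. Let $f\in L^2(\mathbb{S}^2)$ satisfy $\int_{\mathbb{S}^2} f\,ds=0$, and assume that the unique zero-mean weak solution $u$ of $-\Delta_s u=f$ on $\mathbb{S}^2$ belongs to $W^{2,\infty}(\mathbb{S}^2)\cap H^2(\mathbb{S}^2)\cap H^1_0(\mathbb{S}^2)$. Let $u_h\in\widetilde U_h$ be the unique solution of the discrete finite volume problem $$\overline{\mathcal A}_h(u_h,\widetilde I_h v_h)=(f,\widetilde I_h v_h)\quad\text{for all } v_h\in\widetilde U_h .$$ Then there exists a positive constant $C$, independent of $h$, such that $$\|u-u_h\|_{L^\infty(\mathbb{S}^2)}\le C\,h\,|\ln h|^{1/2}\left(\|u\|_{H^2(\mathbb{S}^2)}+\|f\|_{L^2(\mathbb{S}^2)}\right)+C h^2\|u\|_{W^{2,\infty}(\mathbb{S}^2)}.$$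
   Context: Sphere and spaces. $\mathbb{S}^2=\{x\in\mathbb{R}^3:\|x\|=1\}$, with surface measure $ds$, geodesic distance $d(x,y)=\arccos\langle x,y\rangle$; $m_a$ and $m_l$ denote area and curve length. $\nabla_s u=\nabla u-(\nabla u\cdot \vec n)\vec n$ is the tangential gradient ($\vec n$ the outer unit normal of $\mathbb{S}^2$), $\Delta_s=\nabla_s\cdot\nabla_s$. $L^p(\mathbb{S}^2)$, $W^{k,p}(\mathbb{S}^2)$, $H^k=W^{k,2}$ are the usual Sobolev spaces on the sphere, $(u,v)=\int_{\mathbb{S}^2}uv\,ds$, and here $H^1_0(\mathbb{S}^2)=\{u\in H^1(\mathbb{S}^2):\int_{\mathbb{S}^2}u\,ds=0\}$. The weak solution of $-\Delta_s u=f$ is the $u\in H^1_0(\mathbb{S}^2)$ with $\int_{\mathbb{S}^2}\nabla_su\cdot\nabla_sv\,ds=(f,v)$ for all $v\in H^1_0(\mathbb{S}^2)$. Voronoi-Delaunay decomposition. Given distinct points (vertices) $x_1,\dots,x_N\in\mathbb{S}^2$, the Voronoi cells are $\widetilde V_i=\{x\in\mathbb{S}^2: d(x,x_i)<d(x,x_j)\ \forall j\ne i\}$. The Voronoi edge is $\widetilde\Gamma_{ij}=\mathrm{cl}(\widetilde V_i)\cap\mathrm{cl}(\widetilde V_j)$ and $\Lambda(i)=\{j\neq i: m_l(\widetilde\Gamma_{ij})>0\}$ is the set of neighbors of $i$, so $\partial\widetilde V_i=\bigcup_{j\in\Lambda(i)}\widetilde\Gamma_{ij}$. The dual Delaunay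 decomposition $\widetilde{\mathcal T}_h$ consists of geodesic triangles $\widetilde T_{ijk}$ with mutually neighboring vertices $x_i,x_j,x_k$, and these triangles tile $\mathbb{S}^2$. The mesh size is $h=\max_i\max_{x\in\widetilde V_i}d(x_i,x)$. The decomposition is almost uniform if there are positive constants $C_0,C_1$ independent of $h$ with $h/C_0\le m_l(\widetilde\Gamma_{ij})\le C_0h$ and $h^2/C_1\le m_a(\widetilde V_i)\le C_1h^2$ for all $i$ and $j\in\Lambda(i)$. Constants "independent of $h$" may depend on these uniformity constants, but not on the decomposition otherwise nor on the functions involved. Discrete spaces. Let $T_{ijk}$ be the planar triangle with the same vertices as $\widetilde T_{ijk}$, $\mathbf S_h=\bigcup T_{ijk}$ the resulting polyhedral surface, and $\mathcal P:\mathbf S_h\to\mathbb{S}^2$, $\mathcal P(x^* )=x^*/\|x^*\|$, the (bijective) radial projection. $\widetilde U_h$ is the space of functions $u_h=\bar u_h\circ\mathcal P^{-1}$ with $\bar u_h$ continuous on $\mathbf S_h$ and affine on each $T_{ijk}$, such that $\int_{\mathbb{S}^2}u_h\,ds=0$. For $v_h\in\widetilde U_h$, $\widetilde I_hv_h$ is the piecewise constant function equal to $v_h(x_i)$ on $\widetilde V_i$. Finite volume form. $\overline{\mathcal F}_{ij}(u_h)=-m_l(\widetilde\Gamma_{ij})\dfrac{u_h(x_j)-u_h(x_i)}{\|x_j-x_i\|}$ and $\overline{\mathcal A}_h(u_h,\widetilde I_hv_h)=\sum_{i=1}^N v_h(x_i)\sum_{j\in\Lambda(i)}\overline{\mathcal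 F}_{ij}(u_h)$. *)

theory Defs
  imports "HOL-Analysis.Analysis" "HOL-Probability.Essential_Supremum"
begin

section \<open>The unit sphere\<close>

abbreviation S2 :: "(real^3) set" where
  "S2 \<equiv> sphere 0 1"

definition radial_proj :: "real^3 \<Rightarrow> real^3" where
  "radial_proj y = y /\<^sub>R norm y"

definition geo_dist :: "real^3 \<Rightarrow> real^3 \<Rightarrow> real" where
  "geo_dist y z = arccos (y \<bullet> z)"

text \<open>Surface measure as the cone measure: the area of \<open>A\<close> is three times the volume of the
  cone \<open>{t y | y \<in> A, 0 < t \<le> 1}\<close>.\<close>

definition sphere_measure :: "(real^3) measure" where
  "sphere_measure =
     scale_measure 3 (distr (restrict_space lborel (cball 0 1 - {0})) (restrict_space borel S2) radial_proj)"

definition area :: "(real^3) set \<Rightarrow> real" where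
  "area A = measure sphere_measure A"

text \<open>Length of a curve, given as a point set: its one-dimensional Hausdorff measure.
  The \<open>bounded\<close> requirement is needed since \<^const>\<open>diameter\<close> is only meaningful on bounded sets.\<close>

definition hausdorff1 :: "('a::metric_space) set \<Rightarrow> ennreal" where
  "hausdorff1 A =
     (SUP \<delta>\<in>{0::real<..}.
        INF C\<in>{C :: nat \<Rightarrow> 'a set. A \<subseteq> (\<Union>n. C n) \<and> (\<forall>n. bounded (C n) \<and> diameter (C n) \<le> \<delta>)}.
          \<Sum>n. ennreal (diameter (C n)))"

definition curve_length :: "(real^3) set \<Rightarrow> real" where
  "curve_length A = enn2real (hausdorff1 A)"


section \<open>Function spaces on the sphere\<close>

text \<open>Functions on the sphere are functions on \<open>real^3\<close> of which only the values on \<open>S2\<close>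
  matter, \<open>S2\<close> being the space of \<open>sphere_measure\<close>; elements of Lebesgue and Sobolev spaces are
  represented by Borel functions, and the definitions below do not depend on the representative.\<close>

definition in_Lp :: "ennreal \<Rightarrow> (real^3 \<Rightarrow> real) \<Rightarrow> bool" where
  "in_Lp p u \<longleftrightarrow> u \<in> borel_measurable sphere_measure \<and>
     (if p = \<infinity> then esssup sphere_measure (\<lambda>y. ereal \<bar>u y\<bar>) < \<infinity>
      else integrable sphere_measure (\<lambda>y. \<bar>u y\<bar> powr enn2real p))"

definition Lp_norm :: "ennreal \<Rightarrow> (real^3 \<Rightarrow> real) \<Rightarrow> real" where
  "Lp_norm p u =
     (if p = \<infinity> then real_of_ereal (esssup sphere_measure (\<lambda>y. ereal \<bar>u y\<bar>))
      else (\<integral>y. \<bar>u y\<bar> powr enn2real p \<partial>sphere_measure) powr (1 / enn2real p))"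

definition grad :: "(real^3 \<Rightarrow> real) \<Rightarrow> real^3 \<Rightarrow> real^3" where
  "grad \<phi> y = (\<chi> i. frechet_derivative \<phi> (at y) (axis i 1))"

definition C1_fun :: "(real^3 \<Rightarrow> real) \<Rightarrow> bool" where
  "C1_fun \<phi> \<longleftrightarrow> (\<forall>y. \<phi> differentiable (at y)) \<and> continuous_on UNIV (grad \<phi>)"

text \<open>The outer unit normal of the sphere at \<open>y\<close> is \<open>y\<close>.\<close>

definition tangential_grad :: "(real^3 \<Rightarrow> real) \<Rightarrow> real^3 \<Rightarrow> real^3" where
  "tangential_grad \<phi> y = grad \<phi> y - (grad \<phi> y \<bullet> y) *\<^sub>R y"

text \<open>Weak tangential gradient. The formula is integration by parts on the sphere,
  \<open>\<integral> \<nabla>\<^sub>s(u\<phi>) ds = \<integral> u\<phi> H n ds\<close>, where \<open>H = \<nabla>\<^sub>s\<cdot>n = 2\<close>. Restrictions of \<open>C\<^sup>1\<close> functions on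
  \<open>real^3\<close> are exactly the \<open>C\<^sup>1\<close> functions on the sphere.\<close>

definition has_weak_grad :: "(real^3 \<Rightarrow> real) \<Rightarrow> (real^3 \<Rightarrow> real^3) \<Rightarrow> bool" where
  "has_weak_grad u g \<longleftrightarrow> integrable sphere_measure u \<and> integrable sphere_measure g \<and>
     (\<forall>\<phi>. C1_fun \<phi> \<longrightarrow>
        (\<integral>y. \<phi> y *\<^sub>R g y \<partial>sphere_measure) =
          - (\<integral>y. u y *\<^sub>R tangential_grad \<phi> y \<partial>sphere_measure)
          + 2 *\<^sub>R (\<integral>y. (u y * \<phi> y) *\<^sub>R y \<partial>sphere_measure))"

definition weak_grad :: "(real^3 \<Rightarrow> real) \<Rightarrow> real^3 \<Rightarrow> real^3" where
  "weak_grad u = (SOME g. has_weak_grad u g)"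

primrec in_Sobolev :: "nat \<Rightarrow> ennreal \<Rightarrow> (real^3 \<Rightarrow> real) \<Rightarrow> bool" where
  "in_Sobolev 0 p u \<longleftrightarrow> in_Lp p u"
| "in_Sobolev (Suc k) p u \<longleftrightarrow>
     in_Lp p u \<and> (\<exists>g. has_weak_grad u g \<and> (\<forall>i. in_Sobolev k p (\<lambda>y. g y $ i)))"

text \<open>Unfolded, the \<open>p\<close>-th power of the norm is the sum of the \<open>p\<close>-th powers of the
  \<open>L\<^sup>p\<close> norms of all iterated tangential derivatives of order at most \<open>k\<close>
  (the maximum of these norms for \<open>p = \<infinity>\<close>).\<close>

primrec Sobolev_norm :: "nat \<Rightarrow> ennreal \<Rightarrow> (real^3 \<Rightarrow> real) \<Rightarrow> real" where
  "Sobolev_norm 0 p u = Lp_norm p u"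
| "Sobolev_norm (Suc k) p u =
     (if p = \<infinity> then
        max (Lp_norm p u) (MAX i\<in>UNIV. Sobolev_norm k p (\<lambda>y. weak_grad u y $ i))
      else
        (Lp_norm p u powr enn2real p
         + (\<Sum>i\<in>UNIV. Sobolev_norm k p (\<lambda>y. weak_grad u y $ i) powr enn2real p))
        powr (1 / enn2real p))"

definition H1_0 :: "(real^3 \<Rightarrow> real) set" where
  "H1_0 = {u. in_Sobolev 1 2 u \<and> (\<integral>y. u y \<partial>sphere_measure) = 0}"

definition weak_solution :: "(real^3 \<Rightarrow> real) \<Rightarrow> (real^3 \<Rightarrow> real) \<Rightarrow> bool" where
  "weak_solution f u \<longleftrightarrow> u \<in> H1_0 \<and>
     (\<forall>v\<in>H1_0. (\<integral>y. weak_grad u y \<bullet> weak_grad v y \<partial>sphere_measure)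
        = (\<integral>y. f y * v y \<partial>sphere_measure))"


section \<open>Voronoi-Delaunay decompositions\<close>

definition vcell :: "nat \<Rightarrow> (nat \<Rightarrow> real^3) \<Rightarrow> nat \<Rightarrow> (real^3) set" where
  "vcell N x i = {y \<in> S2. \<forall>j\<in>{1..N}. j \<noteq> i \<longrightarrow> geo_dist y (x i) < geo_dist y (x j)}"

definition vedge :: "nat \<Rightarrow> (nat \<Rightarrow> real^3) \<Rightarrow> nat \<Rightarrow> nat \<Rightarrow> (real^3) set" where
  "vedge N x i j = closure (vcell N x i) \<inter> closure (vcell N x j)"

definition nbrs :: "nat \<Rightarrow> (nat \<Rightarrow> real^3) \<Rightarrow> nat \<Rightarrow> nat set" where
  "nbrs N x i = {j \<in> {1..N}. j \<noteq> i \<and> curve_length (vedge N x i j) > 0}"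

definition mesh_size :: "nat \<Rightarrow> (nat \<Rightarrow> real^3) \<Rightarrow> real" where
  "mesh_size N x = (MAX i\<in>{1..N}. SUP y\<in>vcell N x i. geo_dist (x i) y)"

text \<open>Delaunay triangles, as sets of three vertex indices. Duality means that the three closed cells
  share a Voronoi vertex; mutual neighborhood alone would also admit the outer triangle formed by
  the three neighbors of a vertex of degree three.\<close>

definition delaunay :: "nat \<Rightarrow> (nat \<Rightarrow> real^3) \<Rightarrow> nat set set" where
  "delaunay N x =
     {{i, j, k} | i j k. i \<in> {1..N} \<and> j \<in> nbrs N x i \<and> k \<in> nbrs N x i \<and> k \<in> nbrs N x j \<and>
        closure (vcell N x i) \<inter> closure (vcell N x j) \<inter> closure (vcell N x k) \<noteq> {}}"

definition planar_tri :: "(nat \<Rightarrow> real^3) \<Rightarrow> nat set \<Rightarrow> (real^3) set" where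
  "planar_tri x t = convex hull (x ` t)"

definition geo_tri :: "(nat \<Rightarrow> real^3) \<Rightarrow> nat set \<Rightarrow> (real^3) set" where
  "geo_tri x t = radial_proj ` planar_tri x t"

definition poly_surface :: "nat \<Rightarrow> (nat \<Rightarrow> real^3) \<Rightarrow> (real^3) set" where
  "poly_surface N x = (\<Union>t\<in>delaunay N x. planar_tri x t)"

text \<open>The last three conditions say that the geodesic triangles tile the sphere and that
  \<^const>\<open>radial_proj\<close> is a bijection from the polyhedral surface onto the sphere. They exclude
  degenerate vertex sets such as those with four cells meeting in a point. Since
  \<open>radial_proj 0 = 0\<close>, they also exclude planar triangles through the origin.\<close>

definition voronoi_delaunay :: "nat \<Rightarrow> (nat \<Rightarrow> real^3) \<Rightarrow> bool" where
  "voronoi_delaunay N x \<longleftrightarrow>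
     x ` {1..N} \<subseteq> S2 \<and> inj_on x {1..N} \<and>
     (\<Union>t\<in>delaunay N x. geo_tri x t) = S2 \<and>
     (\<forall>s\<in>delaunay N x. \<forall>t\<in>delaunay N x. s \<noteq> t \<longrightarrow>
        (top_of_set S2 interior_of geo_tri x s) \<inter> (top_of_set S2 interior_of geo_tri x t) = {}) \<and>
     inj_on radial_proj (poly_surface N x)"

definition almost_uniform :: "real \<Rightarrow> real \<Rightarrow> nat \<Rightarrow> (nat \<Rightarrow> real^3) \<Rightarrow> bool" where
  "almost_uniform C\<^sub>0 C\<^sub>1 N x \<longleftrightarrow>
     (\<forall>i\<in>{1..N}.
        (\<forall>j\<in>nbrs N x i.
           mesh_size N x / C\<^sub>0 \<le> curve_length (vedge N x i j) \<and>
           curve_length (vedge N x i j) \<le> C\<^sub>0 * mesh_size N x) \<and>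
        (mesh_size N x)\<^sup>2 / C\<^sub>1 \<le> area (vcell N x i) \<and>
        area (vcell N x i) \<le> C\<^sub>1 * (mesh_size N x)\<^sup>2)"


section \<open>The finite volume scheme\<close>

definition U_h :: "nat \<Rightarrow> (nat \<Rightarrow> real^3) \<Rightarrow> (real^3 \<Rightarrow> real) set" where
  "U_h N x = {u.
     (\<exists>w. continuous_on (poly_surface N x) w \<and>
          (\<forall>t\<in>delaunay N x. \<exists>a b. \<forall>y\<in>planar_tri x t. w y = a \<bullet> y + b) \<and>
          (\<forall>y\<in>S2. u y = w (the_inv_into (poly_surface N x) radial_proj y))) \<and>
     (\<integral>y. u y \<partial>sphere_measure) = 0}"

text \<open>The value on cell boundaries, a null set, is set to \<open>0\<close>.\<close>

definition I_h :: "nat \<Rightarrow> (nat \<Rightarrow> real^3) \<Rightarrow> (real^3 \<Rightarrow> real) \<Rightarrow> real^3 \<Rightarrow> real" where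
  "I_h N x v y = (\<Sum>i\<in>{1..N}. v (x i) * indicator (vcell N x i) y)"

definition fv_flux :: "nat \<Rightarrow> (nat \<Rightarrow> real^3) \<Rightarrow> (real^3 \<Rightarrow> real) \<Rightarrow> nat \<Rightarrow> nat \<Rightarrow> real" where
  "fv_flux N x u i j = - curve_length (vedge N x i j) * ((u (x j) - u (x i)) / norm (x j - x i))"

text \<open>\<open>A_h N x u v\<close> is the form written with \<open>I_h v\<close> as second argument; it depends only on the
  vertex values of \<open>v\<close>, which are those of \<open>I_h v\<close>.\<close>

definition A_h :: "nat \<Rightarrow> (nat \<Rightarrow> real^3) \<Rightarrow> (real^3 \<Rightarrow> real) \<Rightarrow> (real^3 \<Rightarrow> real) \<Rightarrow> real" where
  "A_h N x u v = (\<Sum>i\<in>{1..N}. v (x i) * (\<Sum>j\<in>nbrs N x i. fv_flux N x u i j))"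

definition fv_solution ::
  "nat \<Rightarrow> (nat \<Rightarrow> real^3) \<Rightarrow> (real^3 \<Rightarrow> real) \<Rightarrow> (real^3 \<Rightarrow> real) \<Rightarrow> bool" where
  "fv_solution N x f u\<^sub>h \<longleftrightarrow> u\<^sub>h \<in> U_h N x \<and>
     (\<forall>v\<^sub>h\<in>U_h N x. A_h N x u\<^sub>h v\<^sub>h = (\<integral>y. f y * I_h N x v\<^sub>h y \<partial>sphere_measure))"

end

theory Submission
 imports Defs
begin

text \<open>The error splits into the interpolation error of \<open>u\<close>, of order \<open>h^2\<close>, and the
 nodal error \<open>e\<close>. Testing the scheme with \<open>e\<close> and subtracting the divergence theorem on the Voronoi
 cells leaves the flux residuals of \<open>u\<close> on the Voronoi edges. As the chord from \<open>x i\<close> to \<open>x j\<close> is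
 orthogonal to their edge, each residual compares the average of the normal derivative over the edge
 with its average over the chord; joining the points of the two by segments bounds it by \<open>h\<close> times
 the second derivatives of \<open>u\<close> on their hull, and Cauchy-Schwarz gives an \<open>O(h)\<close> bound of the
 discrete energy norm of \<open>e\<close>.

 Pairing the step function of \<open>e\<close> with the gradient of a logarithmic Green function, whose field at
 distance \<open>r\<close> is of size \<open>1/r\<close>, bounds its value at a vertex by
 \<open>\<Sum> m\<^sub>i\<^sub>j \<bar>e i - e j\<bar>/(h + norm (x i - x p))\<close> up to the mean. A dyadic decomposition of
 \<open>\<Sum> h^2/(h + norm (x i - x p))^2\<close> and Cauchy-Schwarz turn this into the discrete Sobolev
 inequality, which costs the factor \<open>\<bar>ln h\<bar>\<close> under the square root.

 Since \<open>u\<close> has only weak derivatives, the argument is run for its mollifications by powers of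
 \<open>1 + x \<bullet> y\<close>. The divergence theorem on a Voronoi cell is a limit of integrations by parts against
 products of \<open>C^1\<close> steps. Derivatives are taken along the rotation fields \<open>y \<times> v\<close>, which commute
 with the mollification.\<close>

section \<open>The sphere measure\<close>

text \<open>The hypotheses control areas and edge lengths, but not the distance between neighbouring
  vertices, and this shapes the proof. A vertex may be very close to its own Voronoi edges, where a
  Green field with pole at the vertex has no bound of order \<open>1/h\<close>; the pole is
  therefore averaged over the whole cell, whose area is controlled. A chord need not cross its edge,
  so the residual is estimated by joining every point of the one with every point of the other.
  Small distances \<open>ed i j\<close> are carried by the weight \<open>me i j/ed i j\<close> of
  the energy and are never bounded below. The discrete Sobolev inequality bounds only differences of
  nodal errors; the additive constant is left to the end, where the zero means of the two solutions
  fix it. At \<open>h = 1\<close> the factor with \<open>ln h\<close> vanishes and can absorb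
  nothing. For \<open>h > 1/2\<close> the residuals are therefore bounded by sup norms, and the
  whole error goes into the term with \<open>h^2\<close>; only for \<open>h <= 1/2\<close> do the
  square-integral bounds enter.\<close>

abbreviation sph :: "(real^3) measure" where "sph \<equiv> sphere_measure"
abbreviation (input) sphere_nn_integral (binder "NI " 10) where "sphere_nn_integral f \<equiv> nn_integral sph f"
abbreviation (input) sphere_integral (binder "SI " 10) where "sphere_integral f \<equiv> integral\<^sup>L sph f"
abbreviation (input) lborel_nn_integral (binder "NL " 10) where "lborel_nn_integral f \<equiv> nn_integral lborel f"
notation scaleR (infixr "*R" 75)
abbreviation (input) "rp \<equiv> radial_proj"

lemma radial_proj_measurable [measurable]: "rp \<in> borel_measurable borel"
 unfolding radial_proj_def by measurable

lemma radial_proj_S2: "y ~= 0 ==> rp y \<in> S2"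
 by (simp add: radial_proj_def)

lemma radial_proj_id: "y \<in> S2 ==> rp y = y"
 by (simp add: radial_proj_def)

lemma radial_proj_scale: "c > 0 ==> rp (c *R y) = rp y"
 by (simp add: radial_proj_def)

lemma space_sphere [simp]: "space sph = S2"
 by (simp add: sphere_measure_def space_scale_measure space_restrict_space)

lemma sets_sphere: "sets sph = sets (restrict_space borel S2)"
 by (simp add: sphere_measure_def)

lemma measurable_sphere_cong: "measurable sph M = measurable (restrict_space borel S2) M"
 by (rule measurable_cong_sets) (simp_all add: sets_sphere)

lemma borel_measurable_sphereI [measurable (raw)]:
 "f \<in> measurable borel M ==> f \<in> measurable sph M"
 unfolding measurable_sphere_cong by (rule measurable_restrict_space1)

lemma borel_measurable_sphere_cont:
 fixes f :: "real^3 => 'b::topological_space"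
 shows "continuous_on S2 f ==> f \<in> borel_measurable sph"
 unfolding measurable_sphere_cong by (rule borel_measurable_continuous_on_restrict)

lemma sets_sphere_borel: "A \<in> sets borel ==> A \<subseteq> S2 ==> A \<in> sets sph"
 unfolding sets_sphere by (subst sets_restrict_space_iff) auto

lemma sets_sphere_Int: "A \<in> sets borel ==> A \<inter> S2 \<in> sets sph"
 by (rule sets_sphere_borel) auto

lemma radial_proj_measurable_cone:
 "rp \<in> measurable (restrict_space lborel (cball 0 1 - {0})) (restrict_space borel S2)"
proof (rule measurable_restrict_space2)
 show "rp \<in> space (restrict_space lborel (cball 0 1 - {0})) \<rightarrow> S2"
  by (auto simp: space_restrict_space radial_proj_def)
 show "rp \<in> borel_measurable (restrict_space lborel (cball 0 1 - {0}))"
  by (rule measurable_restrict_space1) simp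
qed

text \<open>Unwinding the cone measure: the integrand on the right is the degree-zero extension of
  \<open>f\<close> to the punctured unit ball. All computations with the surface measure start from
  this form.\<close>

lemma nn_integral_sphere:
 assumes [measurable]: "f \<in> borel_measurable borel"
 shows "(NI y. f y) = 3*(NL y. f (rp y)*indicator (cball 0 1 - {0}) y)"
proof -
 have "(NI y. f y) = 3*(\<integral>\<^sup>+y. f y \<partial>distr (restrict_space lborel (cball 0 1 - {0})) (restrict_space borel S2) rp)"
  unfolding sphere_measure_def
  by (rule nn_integral_scale_measure) (auto intro: measurable_restrict_space1)
 also have "... = 3*(\<integral>\<^sup>+y. f (rp y) \<partial>restrict_space lborel (cball 0 1 - {0}))"
  by (subst nn_integral_distr[OF radial_proj_measurable_cone]) (auto intro: measurable_restrict_space1)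
 also have "... = 3*(NL y. f (rp y)*indicator (cball 0 1 - {0}) y)"
  by (subst nn_integral_restrict_space) auto
 finally show ?thesis .
qed

lemma emeasure_sphere:
 assumes "A \<in> sets borel"
 shows "emeasure sph (A \<inter> S2) = 3*emeasure lborel {y \<in> cball 0 1 - {0}. rp y \<in> A}"
proof -
 have [measurable]: "A \<in> sets borel" by fact
 have "emeasure sph (A \<inter> S2) = (NI y. indicator (A \<inter> S2) y)"
  by (simp add: sets_sphere_Int assms)
 also have "... = (NI y. indicator A y)"
  by (intro nn_integral_cong) (auto simp: indicator_def)
 also have "... = 3*(NL y. indicator A (rp y)*indicator (cball 0 1 - {0}) y)"
  by (rule nn_integral_sphere) auto
 also have "(NL y. indicator A (rp y)*indicator (cball 0 1 - {0}) y)
  = (NL y. indicator {y \<in> cball 0 1 - {0}. rp y \<in> A} y)"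
  by (intro nn_integral_cong) (auto simp: indicator_def)
 also have "... = emeasure lborel {y \<in> cball 0 1 - {0}. rp y \<in> A}"
  by (rule nn_integral_indicator) measurable
 finally show ?thesis .
qed

lemma finite_measure_sphere: "finite_measure sph"
proof
 have "emeasure sph (UNIV \<inter> S2) <= 3*emeasure lborel (cball (0::real^3) 1)"
  by (subst emeasure_sphere) (auto intro!: mult_left_mono emeasure_mono)
 also have "... < \<infinity>"
  using emeasure_lborel_cball_finite[of "0::real^3" 1] by (auto simp: ennreal_mult_less_top)
 finally show "emeasure sph (space sph) ~= \<infinity>" by simp
qed

interpretation sphere: finite_measure sphere_measure by (rule finite_measure_sphere)

interpretation sphere_pair: pair_sigma_finite sphere_measure sphere_measure ..

subsection \<open>Frames and rotations\<close>

definition frame3 :: "real^3 => real^3 => real^3 => bool" where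
 "frame3 a b n \<longleftrightarrow> norm a = 1 \<and> norm b = 1 \<and> norm n = 1 \<and> a \<bullet> b = 0 \<and> a \<bullet> n = 0 \<and> b \<bullet> n = 0"

lemma frame3_cross:
 assumes "norm a = 1" "norm n = 1" "a \<bullet> n = 0"
 shows "frame3 a (cross3 n a) n"
proof -
 have "(norm (cross3 n a))^2 = 1"
  using norm_cross_dot[of n a] assms by (simp add: inner_commute)
 hence "norm (cross3 n a) = 1" by (simp add: power2_eq_1_iff) (metis norm_ge_zero not_one_le_zero neg_0_le_iff_le)
 thus ?thesis using assms by (simp add: frame3_def dot_cross_self inner_commute)
qed

lemma norm_cross3_le: "norm (cross3 x y) <= norm x*norm y"
proof -
 have "(norm (cross3 x y))^2 <= (norm x*norm y)^2" using norm_cross_dot[of x y] by (smt (verit) zero_le_power2)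
 thus ?thesis by (rule power2_le_imp_le) simp
qed

lemma norm_frame3:
 assumes "frame3 a b n"
 shows "(norm (x *R a + y *R b + z *R n))^2 = x^2 + y^2 + z^2"
 using assms unfolding frame3_def power2_norm_eq_inner norm_eq_1
 by (simp add: inner_simps inner_commute power2_eq_square)

text \<open>A rotated box is no box, so its volume is taken from the invariance of Lebesgue
  measurable sets under orthogonal maps; \<open>lborel\<close> is then recognised by its values on
  boxes.\<close>

lemma emeasure_lborel_orthogonal:
 fixes f :: "real^3 => real^3"
 assumes f: "orthogonal_transformation f" 
 shows "distr lborel borel f = lborel"
proof (rule lborel_eqI[symmetric])
 fix l u :: "real^3" assume "\<And>b. b \<in> Basis ==> l \<bullet> b <= u \<bullet> b"
 have [measurable]: "f \<in> borel_measurable borel"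
  using orthogonal_transformation_linear[OF f] by (intro borel_measurable_continuous_onI linear_continuous_on) (simp add: linear_conv_bounded_linear)
 have inv: "orthogonal_transformation (inv f)" by (rule orthogonal_transformation_inv[OF f])
 have eq: "f -` box l u = inv f ` box l u"
  by (rule bij_vimage_eq_inv_image[OF orthogonal_transformation_bij[OF f]])
 have fm: "f -` box l u \<in> sets borel" using measurable_sets[of f borel borel "box l u"] by simp
 have bl: "box l u \<in> lmeasurable" by simp
 have lm: "f -` box l u \<in> lmeasurable" unfolding eq by (rule measurable_orthogonal_image[OF inv bl])
 have "emeasure (distr lborel borel f) (box l u) = emeasure lborel (f -` box l u)"
  by (subst emeasure_distr) auto
 also have "... = emeasure lebesgue (f -` box l u)" using fm by simp
 also have "... = ennreal (measure lebesgue (f -` box l u))"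
  using lm by (simp add: emeasure_eq_measure2 fmeasurableD2)
 also have "... = ennreal (measure lebesgue (box l u))"
  unfolding eq by (simp add: measure_orthogonal_image[OF inv bl])
 also have "... = emeasure lebesgue (box l u)" by (metis bl emeasure_eq_measure2)
 also have "... = emeasure lborel (box l u)" by simp
 also have "... = (\<Prod>b\<in>Basis. (u - l) \<bullet> b)"
  using \<open>\<And>b. b \<in> Basis ==> l \<bullet> b <= u \<bullet> b\<close> by (simp add: emeasure_lborel_box_eq)
 finally show "emeasure (distr lborel borel f) (box l u) = (\<Prod>b\<in>Basis. (u - l) \<bullet> b)" .
qed simp

lemma orthogonal_transformation_frame:
 assumes "frame3 a b n"
 shows "orthogonal_transformation (\<lambda>v::real^3. (v$1) *R a + (v$2) *R b + (v$3) *R n)"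
 unfolding orthogonal_transformation
proof
 let ?f = "\<lambda>v::real^3. (v$1) *R a + (v$2) *R b + (v$3) *R n"
 show "linear ?f" by (intro linearI) (simp_all add: algebra_simps)
 show "\<forall>v. norm (?f v) = norm v"
 proof
  fix v :: "real^3"
  have "(norm v)^2 = (v$1)^2 + (v$2)^2 + (v$3)^2"
   unfolding power2_norm_eq_inner by (simp add: inner_vec_def sum_3 power2_eq_square)
  hence "(norm (?f v))^2 = (norm v)^2" using norm_frame3[OF assms] by simp
  thus "norm (?f v) = norm v" by simp
 qed
qed

lemma Basis_vec3: "(Basis :: (real^3) set) = {axis 1 1, axis 2 1, axis 3 1}"
 by (auto simp: Basis_vec_def UNIV_3)

lemma borel_measurable_vec3:
 fixes f :: "'a => real^3"
 shows "f \<in> borel_measurable M \<longleftrightarrow> (\<forall>i. (\<lambda>x. f x $ i) \<in> borel_measurable M)"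
 by (subst borel_measurable_euclidean_space) (auto simp: Basis_vec3 inner_axis forall_3)

lemma borel_measurable_vec_nth [measurable (raw)]:
 fixes f :: "'a => real^3"
 shows "f \<in> borel_measurable M ==> (\<lambda>x. f x $ i) \<in> borel_measurable M"
 by (simp add: borel_measurable_vec3)

lemma borel_measurable_cross3 [measurable (raw)]:
 assumes [measurable]: "f \<in> borel_measurable M" "g \<in> borel_measurable M"
 shows "(\<lambda>x. cross3 (f x) (g x)) \<in> borel_measurable M"
 unfolding borel_measurable_vec3 forall_3 cross3_def by simp

lemma lborel_vec3: "distr (lborel \<Otimes>\<^sub>M (lborel \<Otimes>\<^sub>M lborel)) borel (\<lambda>(x,y,z). vector [x,y,z] :: real^3) = lborel"
proof (rule lborel_eqI[symmetric])
 fix l u :: "real^3" assume le: "\<And>b. b \<in> Basis ==> l \<bullet> b <= u \<bullet> b"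
 have le': "l $ i <= u $ i" for i
  using le[of "axis i 1"] by (simp add: axis_in_Basis_iff inner_axis)
 have m: "(\<lambda>(x,y,z). vector [x,y,z] :: real^3) \<in> borel_measurable (lborel \<Otimes>\<^sub>M (lborel \<Otimes>\<^sub>M lborel))"
  unfolding borel_measurable_vec3 forall_3 case_prod_beta by simp
 have "(\<lambda>(x,y,z). vector [x,y,z] :: real^3) -` box l u = {l$1<..<u$1} \<times> ({l$2<..<u$2} \<times> {l$3<..<u$3})"
  by (auto simp: mem_box_cart forall_3)
 hence "emeasure (distr (lborel \<Otimes>\<^sub>M (lborel \<Otimes>\<^sub>M lborel)) borel (\<lambda>(x,y,z). vector [x,y,z] :: real^3)) (box l u)
  = emeasure (lborel \<Otimes>\<^sub>M (lborel \<Otimes>\<^sub>M lborel)) ({l$1<..<u$1} \<times> ({l$2<..<u$2} \<times> {l$3<..<u$3}))"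
  by (subst emeasure_distr[OF m]) (simp_all add: space_pair_measure)
 also have "... = ennreal (u$1 - l$1)*(ennreal (u$2 - l$2)*ennreal (u$3 - l$3))"
  using le' by (simp add: lborel.emeasure_pair_measure_Times sigma_finite_measure.emeasure_pair_measure_Times lborel_pair.sigma_finite_measure_axioms sigma_finite_pair_measure)
 also have "... = (\<Prod>b\<in>Basis. (u - l) \<bullet> b)"
  using le' by (simp add: Basis_vec3 axis_eq_axis inner_axis ennreal_mult)
 finally show "emeasure (distr (lborel \<Otimes>\<^sub>M (lborel \<Otimes>\<^sub>M lborel)) borel (\<lambda>(x,y,z). vector [x,y,z] :: real^3)) (box l u) = (\<Prod>b\<in>Basis. (u - l) \<bullet> b)" .
qed simp

lemma nn_integral_lborel_frame:
 assumes fr: "frame3 a b n" and [measurable]: "f \<in> borel_measurable borel"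
 shows "(NL y. f y) = (NL x. NL y. NL z. f (x *R a + y *R b + z *R n))"
proof -
 let ?T = "\<lambda>v::real^3. (v$1) *R a + (v$2) *R b + (v$3) *R n"
 have m: "(\<lambda>(x,y,z). vector [x,y,z] :: real^3) \<in> borel_measurable (lborel \<Otimes>\<^sub>M (lborel \<Otimes>\<^sub>M lborel))"
  unfolding borel_measurable_vec3 forall_3 case_prod_beta by simp
 have T: "distr lborel borel ?T = lborel"
  by (rule emeasure_lborel_orthogonal[OF orthogonal_transformation_frame[OF fr]])
 have "(NL y. f y) = (NL y. f (?T y))"
  by (subst T[symmetric]) (simp add: nn_integral_distr)
 also have "... = (\<integral>\<^sup>+p. f (?T ((\<lambda>(x,y,z). vector [x,y,z]) p)) \<partial>(lborel \<Otimes>\<^sub>M (lborel \<Otimes>\<^sub>M lborel)))"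
  by (subst lborel_vec3[symmetric], subst nn_integral_distr[OF m]) simp_all
 also have "... = (\<integral>\<^sup>+p. f (fst p *R a + fst (snd p) *R b + snd (snd p) *R n) \<partial>(lborel \<Otimes>\<^sub>M (lborel \<Otimes>\<^sub>M lborel)))"
  by (intro nn_integral_cong) (auto simp: case_prod_beta)
 also have "... = (NL x. \<integral>\<^sup>+q. f (x *R a + fst q *R b + snd q *R n) \<partial>(lborel \<Otimes>\<^sub>M lborel))"
  by (subst sigma_finite_measure.nn_integral_fst[symmetric])
   (auto intro: sigma_finite_pair_measure lborel.sigma_finite_measure_axioms)
 also have "... = (NL x. NL y. NL z. f (x *R a + y *R b + z *R n))"
  by (subst lborel.nn_integral_fst[symmetric]) auto
 finally show ?thesis .
qed

lemma distr_sphere_orthogonal: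
 assumes f: "orthogonal_transformation f"
 shows "distr sph sph f = sph"
proof -
 have lin: "linear f" by (rule orthogonal_transformation_linear[OF f])
 have [measurable]: "f \<in> borel_measurable borel"
  using lin by (intro borel_measurable_continuous_onI linear_continuous_on) (simp add: linear_conv_bounded_linear)
 have nf: "norm (f y) = norm y" for y using f by (simp add: orthogonal_transformation)
 have [measurable]: "cball (0::real^3) 1 - {0} \<in> sets borel" by measurable
 have f0: "f y = 0 \<longleftrightarrow> y = 0" for y using nf by (metis norm_eq_zero)
 have rp: "f (rp y) = rp (f y)" for y
  unfolding radial_proj_def by (simp add: nf linear_scale[OF lin])
 have fm: "f \<in> measurable sph sph"
  unfolding measurable_sphere_cong measurable_cong_sets[OF refl sets_sphere]
  by (rule measurable_restrict_space3) (auto simp: nf)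
 show ?thesis
 proof (rule measure_eqI)
  fix A assume "A \<in> sets (distr sph sph f)"
  hence "A \<in> sets sph" by simp
  then obtain B where B: "B \<in> sets borel" "A = B \<inter> S2"
   by (auto simp: sets_sphere sets_restrict_space)
  have [measurable]: "B \<in> sets borel" by fact
  have "emeasure (distr sph sph f) A = emeasure sph (f -` B \<inter> S2)"
   using \<open>A \<in> sets sph\<close> B by (subst emeasure_distr[OF fm]) (auto simp: nf intro!: arg_cong[where f="emeasure sph"])
  also have "... = (NI y. indicator B (f y))"
   using measurable_sets[of f borel borel B] B
   by (subst nn_integral_indicator[symmetric]) (auto intro!: sets_sphere_Int nn_integral_cong simp: indicator_def)
  also have "... = 3*(NL y. indicator B (rp (f y))*indicator (cball 0 1 - {0}) (f y))"
   by (subst nn_integral_sphere) (auto intro!: arg_cong[where f="\<lambda>x. 3*x"] nn_integral_cong simp: rp indicator_def nf f0)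
  also have "... = 3*(\<integral>\<^sup>+y. indicator B (rp y)*indicator (cball 0 1 - {0}) y \<partial>distr lborel borel f)"
   by (subst nn_integral_distr) simp_all
  also have "... = (NI y. indicator B y)"
   unfolding emeasure_lborel_orthogonal[OF f] by (rule nn_integral_sphere[symmetric]) simp
  also have "... = emeasure sph A"
   unfolding B using B by (subst nn_integral_indicator[symmetric]) (auto intro!: sets_sphere_Int nn_integral_cong simp: indicator_def)
  finally show "emeasure (distr sph sph f) A = emeasure sph A" .
 qed simp
qed

lemma measurable_sphere_orthogonal:
 assumes f: "orthogonal_transformation f"
 shows "f \<in> measurable sph sph"
proof -
 have "f \<in> borel_measurable borel"
  using orthogonal_transformation_linear[OF f] by (intro borel_measurable_continuous_onI linear_continuous_on) (simp add: linear_conv_bounded_linear)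
 thus ?thesis
  unfolding measurable_sphere_cong measurable_cong_sets[OF refl sets_sphere]
  using f by (intro measurable_restrict_space3) (auto simp: orthogonal_transformation)
qed

lemma integral_sphere_orthogonal:
 fixes g :: "real^3 => 'b::{banach, second_countable_topology}"
 assumes f: "orthogonal_transformation f" and g: "g \<in> borel_measurable sph"
 shows "(SI y. g (f y)) = (SI y. g y)"
proof -
 have "(SI y. g y) = (\<integral>y. g y \<partial>distr sph sph f)" by (simp add: distr_sphere_orthogonal[OF f])
 also have "... = (SI y. g (f y))" by (rule integral_distr[OF measurable_sphere_orthogonal[OF f] g])
 finally show ?thesis by simp
qed

subsection \<open>Gnomonic coordinates and caps\<close>

lemma nn_integral_power2_ball:
 assumes "c > 0"
 shows "(NL x. indicator {0<..} x*ennreal (x^2)*indicator {x. x*c <= 1} x) = ennreal (1/(3*c^3))"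
proof -
 have "(NL x. indicator {0<..} x*ennreal (x^2)*indicator {x. x*c <= 1} x)
  = (NL x. ennreal (x^2)*indicator {0..1/c} x)"
  using assms by (intro nn_integral_cong) (auto simp: indicator_def field_simps)
 also have "... = ennreal ((1/c)^3/3 - 0^3/3)"
  using assms by (intro nn_integral_FTC_Icc) (auto intro!: derivative_eq_intros)
 finally show ?thesis by (simp add: field_simps power_divide)
qed

text \<open>On the cone over the open hemisphere around \<open>a\<close> the coordinates are
  \<open>x *R (a + s *R b + t *R n)\<close>, with Jacobian \<open>x^2\<close>. The unit ball cuts
  the ray at \<open>x = 1 / sqrt (1 + s^2 + t^2)\<close>, so the radial integral is a third of the
  cube of this value, and the third cancels the 3 of the cone measure.\<close>

lemma nn_integral_gnomonic:
 assumes fr: "frame3 a b n" and [measurable]: "f \<in> borel_measurable borel"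
 shows "(NI y. f y*indicator {y. y \<bullet> a > 0} y)
  = (NL s. NL t. f (rp (a + s *R b + t *R n))*ennreal (1/(sqrt (1 + s^2 + t^2))^3))"
proof -
 let ?p = "\<lambda>x s t. x *R a + (0 + x * s) *R b + (0 + x*t) *R n"
 have [measurable]: "cball (0::real^3) 1 \<in> sets borel" "{y. y \<bullet> a > 0} \<in> sets borel" by measurable
 let ?g = "\<lambda>s t. f (rp (a + s *R b + t *R n))"
 let ?I = "\<lambda>x s t. indicator {0<..} x*ennreal (x^2)*indicator {x. x * sqrt (1 + s^2 + t^2) <= 1} x"
 have "(NI y. f y*indicator {y. y \<bullet> a > 0} y)
  = 3*(NL y. f (rp y)*indicator {y. y \<bullet> a > 0} (rp y)*indicator (cball 0 1 - {0}) y)"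
  by (rule nn_integral_sphere) simp
 also have "(NL y. f (rp y)*indicator {y. y \<bullet> a > 0} (rp y)*indicator (cball 0 1 - {0}) y)
  = (NL y. f (rp y)*indicator {y. y \<bullet> a > 0} y*indicator (cball 0 1) y)"
  by (intro nn_integral_cong) (auto simp: indicator_def radial_proj_def zero_less_mult_iff zero_less_divide_iff)
 also have "... = (NL x. NL y. NL z. f (rp (x *R a + y *R b + z *R n))*indicator {y. y \<bullet> a > 0} (x *R a + y *R b + z *R n)*indicator (cball 0 1) (x *R a + y *R b + z *R n))"
  by (rule nn_integral_lborel_frame[OF fr]) simp
 also have "... = (NL x. NL s. NL t. ?g s t*?I x s t)"
 proof (rule nn_integral_cong)
  fix x :: real
  have ia: "(x *R a + y *R b + z *R n) \<bullet> a = x" for y z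
   using fr by (simp add: frame3_def inner_simps inner_commute norm_eq_1)
  show "(NL y. NL z. f (rp (x *R a + y *R b + z *R n))*indicator {y. y \<bullet> a > 0} (x *R a + y *R b + z *R n)*indicator (cball 0 1) (x *R a + y *R b + z *R n))
   = (NL s. NL t. ?g s t*?I x s t)"
  proof (cases "x > 0")
   case False
   thus ?thesis by (simp add: ia)
  next
   case True
   have eq: "x *R a + (0 + x * s) *R b + (0 + x*t) *R n = x *R (a + s *R b + t *R n)" for s t
    by (simp add: algebra_simps)
   have nn: "norm (a + s *R b + t *R n) = sqrt (1 + s^2 + t^2)" for s t
    using norm_frame3[OF fr, of 1 s t] by (metis norm_ge_zero one_power2 real_sqrt_unique scaleR_one)
   have "(NL y. NL z. f (rp (x *R a + y *R b + z *R n))*indicator {y. y \<bullet> a > 0} (x *R a + y *R b + z *R n)*indicator (cball 0 1) (x *R a + y *R b + z *R n))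
    = ennreal x*(NL s. ennreal x*(NL t. f (rp (?p x s t))*indicator {y. y \<bullet> a > 0} (?p x s t)*indicator (cball 0 1) (?p x s t)))"
    using True
    apply (subst nn_integral_real_affine[where c=x and t=0])
     apply simp
    apply simp
    apply (subst nn_integral_real_affine[where c=x and t=0 and f="\<lambda>z. f (rp (x *R a + (0 + x*_) *R b + z *R n))*indicator {y. y \<bullet> a > 0} (x *R a + (0 + x*_) *R b + z *R n)*indicator (cball 0 1) (x *R a + (0 + x*_) *R b + z *R n)"])
     apply simp_all
    done
   also have "... = (NL s. NL t. ennreal x*(ennreal x*(f (rp (?p x s t))*indicator {y. y \<bullet> a > 0} (?p x s t)*indicator (cball 0 1) (?p x s t))))"
    by (simp add: nn_integral_cmult)
   also have "... = (NL s. NL t. ?g s t*?I x s t)"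
   proof (intro nn_integral_cong)
    fix s t :: real
    have e2: "ennreal (x^2) = ennreal x*ennreal x" using True by (simp add: power2_eq_square ennreal_mult)
    show "ennreal x*(ennreal x*(f (rp (?p x s t))*indicator {y. y \<bullet> a > 0} (?p x s t)*indicator (cball 0 1) (?p x s t))) = ?g s t*?I x s t"
     unfolding e2 using True ia[of "0 + x * s" "0 + x*t"] nn[of s t]
     unfolding eq by (auto simp: indicator_def radial_proj_scale mult_ac)
   qed
   finally show ?thesis .
  qed
 qed
 also have "... = (NL s. NL x. NL t. ?g s t*?I x s t)"
  by (rule lborel_pair.Fubini') simp
 also have "... = (NL s. NL t. NL x. ?g s t*?I x s t)"
  by (intro nn_integral_cong lborel_pair.Fubini') simp
 also have "... = (NL s. NL t. ?g s t*ennreal (1/(3*(sqrt (1 + s^2 + t^2))^3)))"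
 proof (intro nn_integral_cong)
  fix s t :: real
  have "1 + s^2 + t^2 > 0" by (smt (verit) zero_le_power2)
  thus "(NL x. ?g s t*?I x s t) = ?g s t*ennreal (1/(3*(sqrt (1 + s^2 + t^2))^3))"
   by (subst nn_integral_cmult) (simp_all add: nn_integral_power2_ball)
 qed
 also have "3*... = (NL s. NL t. 3*(?g s t*ennreal (1/(3*(sqrt (1 + s^2 + t^2))^3))))"
  by (simp add: nn_integral_cmult)
 also have "... = (NL s. NL t. ?g s t*ennreal (1/(sqrt (1 + s^2 + t^2))^3))"
 proof (intro nn_integral_cong)
  fix s t :: real
  have "3*(?g s t*ennreal (1/(3*(sqrt (1 + s^2 + t^2))^3))) = ?g s t*(ennreal 3*ennreal (1/(3*(sqrt (1 + s^2 + t^2))^3)))"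
   by (simp add: mult_ac)
  also have "ennreal 3*ennreal (1/(3*(sqrt (1 + s^2 + t^2))^3)) = ennreal (1/(sqrt (1 + s^2 + t^2))^3)"
   by (subst ennreal_mult[symmetric]) (simp_all add: field_simps)
  finally show "3*(?g s t*ennreal (1/(3*(sqrt (1 + s^2 + t^2))^3))) = ?g s t*ennreal (1/(sqrt (1 + s^2 + t^2))^3)" .
 qed
 finally show ?thesis .
qed

lemma frame3_exists:
 fixes a :: "real^3"
 assumes "norm a = 1"
 obtains b n where "frame3 a b n"
proof -
 obtain x where x: "x ~= 0" "orthogonal a x"
  using orthogonal_to_vector_exists[of a] by auto
 define n where "n = x /\<^sub>R norm x"
 have "norm n = 1" "a \<bullet> n = 0" using x by (auto simp: n_def orthogonal_def)
 thus ?thesis using frame3_cross[of a n] assms that by blast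
qed

text \<open>The cone over the cap lies in the box with side \<open>[-1, 1]\<close> along
  \<open>a\<close> and \<open>[-r, r]\<close> along \<open>b\<close> and \<open>n\<close>: along a
  unit vector \<open>w\<close> orthogonal to \<open>a\<close>, a point \<open>v\<close> of the ball
  has the component of \<open>norm v *R (rp v - a)\<close>. The box has volume \<open>8*r^2\<close>,
  and three times this is the bound.\<close>

lemma emeasure_cap_le:
 assumes a: "a \<in> S2" and r: "r \<ge> 0"
 shows "emeasure sph (ball a r \<inter> S2) <= ennreal (24*r^2)"
proof -
 obtain b n where fr: "frame3 a b n" using frame3_exists[of a] a by auto
 let ?A = "{y \<in> cball 0 1 - {0}. rp y \<in> ball a r}"
 have [measurable]: "cball (0::real^3) 1 - {0} \<in> sets borel" "ball a r \<in> sets borel" by auto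
 have [measurable]: "?A \<in> sets borel" by measurable
 have sub: "\<bar>x\<bar> <= 1 \<and> \<bar>y\<bar> <= r \<and> \<bar>z\<bar> <= r" if "x *R a + y *R b + z *R n \<in> ?A" for x y z
 proof -
  let ?v = "x *R a + y *R b + z *R n"
  have ip: "?v \<bullet> a = x" "?v \<bullet> b = y" "?v \<bullet> n = z" "a \<bullet> b = 0" "a \<bullet> n = 0"
   using fr by (auto simp: frame3_def inner_simps inner_commute norm_eq_1)
  have nm: "norm a = 1" "norm b = 1" "norm n = 1" using fr by (auto simp: frame3_def)
  have v: "norm ?v <= 1" "?v ~= 0" "norm (rp ?v - a) < r"
   using that by (auto simp: dist_norm norm_minus_commute)
  have x: "\<bar>x\<bar> <= 1" using Cauchy_Schwarz_ineq2[of ?v a] v(1) nm ip by simp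
  have gen: "\<bar>?v \<bullet> w\<bar> <= r" if w: "norm w = 1" "a \<bullet> w = 0" for w
  proof -
   have "?v \<bullet> w = norm ?v * ((rp ?v - a) \<bullet> w)"
    using w v(2) by (simp add: radial_proj_def inner_diff_left)
   hence "\<bar>?v \<bullet> w\<bar> = norm ?v * \<bar>(rp ?v - a) \<bullet> w\<bar>" by (simp add: abs_mult)
   also have "... <= 1*(norm (rp ?v - a)*norm w)"
    using v(1) Cauchy_Schwarz_ineq2 by (intro mult_mono) auto
   also have "... <= r" using v(3) w by simp
   finally show ?thesis .
  qed
  show ?thesis using x gen[of b] gen[of n] nm ip by simp
 qed
 have "emeasure sph (ball a r \<inter> S2) = 3*emeasure lborel ?A" by (rule emeasure_sphere) simp
 also have "emeasure lborel ?A = (NL y. indicator ?A y)" by simp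
 also have "... = (NL x. NL y. NL z. indicator ?A (x *R a + y *R b + z *R n))"
  by (rule nn_integral_lborel_frame[OF fr]) simp
 also have "... <= (NL x. NL y. NL z. indicator {-1..1::real} x*(indicator {-r..r} y*indicator {-r..r} z))"
 proof (intro nn_integral_mono)
  fix x y z :: real
  show "indicator ?A (x *R a + y *R b + z *R n) <= (indicator {-1..1::real} x*(indicator {-r..r} y*indicator {-r..r} z) :: ennreal)"
  proof (cases "x *R a + y *R b + z *R n \<in> ?A")
   case True
   hence "x \<in> {-1..1}" "y \<in> {-r..r}" "z \<in> {-r..r}" using sub[OF True] by (auto simp: abs_le_iff)
   thus ?thesis by (simp add: indicator_def)
  qed (simp add: indicator_def)
 qed
 also have "... = (NL x. NL y. indicator {-1..1::real} x*(indicator {-r..r} y*ennreal (2*r)))"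
  using r by (intro nn_integral_cong) (simp add: nn_integral_cmult)
 also have "... = (NL x. indicator {-1..1::real} x*ennreal (4*r^2))"
  using r by (intro nn_integral_cong) (simp add: nn_integral_cmult nn_integral_multc ennreal_mult'[symmetric] power2_eq_square)
 also have "... = ennreal (8*r^2)"
  using ennreal_mult'[of 2 "4*r^2", symmetric] by (subst nn_integral_multc) simp_all
 finally have "emeasure sph (ball a r \<inter> S2) <= 3*ennreal (8*r^2)" by (simp add: mult_left_mono)
 also have "3*ennreal (8*r^2) = ennreal 3*ennreal (8*r^2)" by simp
 also have "... = ennreal (24*r^2)" by (subst ennreal_mult'[symmetric]) simp_all
 finally show ?thesis .
qed

text \<open>The point \<open>(1/2) *R y\<close> is interior to the cone over \<open>U\<close>, so
  the cone contains a nonempty open set.\<close>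

lemma emeasure_sphere_open_pos:
 assumes U: "open U" and y: "y \<in> U" "y \<in> S2"
 shows "emeasure sph (U \<inter> S2) > 0"
proof -
 have cont: "continuous_on (- {0}) rp"
  unfolding radial_proj_def by (intro continuous_intros) auto
 have "open (rp -` U \<inter> - {0})"
  using continuous_open_preimage[OF cont _ U] open_Compl[OF closed_singleton[of "0::real^3"]] by (subst Int_commute) blast
 hence op: "open (rp -` U \<inter> - {0} \<inter> ball 0 1)" by (rule open_Int[OF _ open_ball])
 have mem: "(1/2) *R y \<in> rp -` U \<inter> - {0} \<inter> ball 0 1"
  using y radial_proj_scale[of "1/2" y] radial_proj_id[of y] by auto
 have [measurable]: "cball (0::real^3) 1 - {0} \<in> sets borel" "U \<in> sets borel" using U by auto
 have mS: "{y \<in> cball 0 1 - {0}. rp y \<in> U} \<in> sets lborel" by measurable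
 let ?V = "rp -` U \<inter> - {0} \<inter> ball 0 1"
 have "\<not> negligible ?V" using open_not_negligible[OF op] mem by (metis empty_iff)
 hence "emeasure lebesgue ?V ~= 0" using op by (subst negligible_iff_emeasure0[symmetric]) auto
 hence "0 < emeasure lborel ?V" using op by (simp add: zero_less_iff_neq_zero)
 also have "emeasure lborel ?V <= emeasure lborel {y \<in> cball 0 1 - {0}. rp y \<in> U}"
  using U by (intro emeasure_mono mS) auto
 also have "... <= 3*..."
  by (rule order_trans[OF eq_refl mult_right_mono[of 1 3]]) auto
 also have "... = emeasure sph (U \<inter> S2)" using U by (intro emeasure_sphere[symmetric]) auto
 finally show ?thesis .
qed

text \<open>The cone over a great circle lies in a plane, hence is a null set.\<close>

lemma AE_sphere_not_orthogonal:
 assumes "v ~= 0"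
 shows "AE y in sph. y \<bullet> v ~= 0"
proof -
 let ?A = "{y. v \<bullet> y = 0}"
 have [measurable]: "?A \<in> sets borel" by measurable
 have "emeasure sph (?A \<inter> S2) = 3*emeasure lborel {y \<in> cball 0 1 - {0}. rp y \<in> ?A}"
  by (rule emeasure_sphere) simp
 also have "... <= 3*emeasure lborel ?A"
  by (intro mult_left_mono emeasure_mono) (auto simp: radial_proj_def)
 also have "emeasure lborel ?A = 0"
 proof -
  have "negligible ?A" using negligible_hyperplane[of v 0] assms by simp
  hence "emeasure lebesgue ?A = 0" by (simp add: negligible_iff_emeasure0)
  thus ?thesis by simp
 qed
 finally have "emeasure sph (?A \<inter> S2) = 0" by simp
 thus ?thesis
  by (intro AE_I[where N="?A \<inter> S2"]) (auto simp: sets_sphere_Int inner_commute)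
qed

subsection \<open>Integration by parts\<close>

text \<open>Rodrigues' formula: for a unit vector \<open>e\<close> this is the rotation about
  \<open>e\<close> by the angle \<open>t\<close>.\<close>

definition rot :: "real^3 => real => real^3 => real^3" where
 "rot e t y = cos t *R y + sin t *R cross3 e y + ((1 - cos t)*(e \<bullet> y)) *R e"

lemma rot_orthogonal:
 assumes "norm e = 1"
 shows "orthogonal_transformation (rot e t)"
 unfolding orthogonal_transformation
proof
 have lin: "linear (cross3 e)" by (intro linearI) (simp_all add: cross_add_right cross_mult_right)
 show "linear (rot e t)"
  by (intro linearI) (simp_all add: rot_def cross_add_right cross_mult_right algebra_simps)
 show "\<forall>v. norm (rot e t v) = norm v"
 proof
  fix v
  have e: "e \<bullet> e = 1" using assms by (simp add: norm_eq_1)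
  have o: "v \<bullet> cross3 e v = 0" "cross3 e v \<bullet> v = 0" "e \<bullet> cross3 e v = 0" "cross3 e v \<bullet> e = 0"
   by (auto simp: dot_cross_self)
  have c: "cross3 e v \<bullet> cross3 e v = v \<bullet> v - (e \<bullet> v)^2"
   using norm_cross_dot[of e v] assms by (simp add: power2_norm_eq_inner power_mult_distrib)
  have "rot e t v \<bullet> rot e t v = (cos t)^2*(v \<bullet> v) + (sin t)^2*(cross3 e v \<bullet> cross3 e v)
   + 2*cos t*(1 - cos t)*(e \<bullet> v)^2 + (1 - cos t)^2*(e \<bullet> v)^2"
   by (simp add: rot_def inner_simps o e inner_commute[of v e] power2_eq_square algebra_simps)
  also have "... = v \<bullet> v"
   unfolding c sin_squared_eq by (simp add: power2_eq_square algebra_simps)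
  finally show "norm (rot e t v) = norm v" by (simp add: norm_eq_sqrt_inner)
 qed
qed

lemma rot_has_derivative:
 assumes "norm e = 1"
 shows "((\<lambda>t. rot e t y) has_vector_derivative cross3 e (rot e t y)) (at t)"
proof -
 have e: "e \<bullet> e = 1" using assms by (simp add: norm_eq_1)
 have cc: "cross3 e (cross3 e y) = (e \<bullet> y) *R e - y"
  using Lagrange[of e e y] e by (simp add: inner_commute)
 have 3: "((\<lambda>t. (1 - cos t)*(e \<bullet> y)) has_real_derivative sin t*(e \<bullet> y)) (at t)"
  by (auto intro!: derivative_eq_intros)
 have "((\<lambda>t. cos t *R y + sin t *R cross3 e y + ((1 - cos t)*(e \<bullet> y)) *R e) has_vector_derivative
  (cos t *R 0 + (- sin t) *R y) + (sin t *R 0 + cos t *R cross3 e y) + (((1 - cos t)*(e \<bullet> y)) *R 0 + (sin t*(e \<bullet> y)) *R e)) (at t)"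
  by (intro has_vector_derivative_add has_vector_derivative_scaleR has_vector_derivative_const DERIV_cos DERIV_sin 3)
 thus ?thesis
  unfolding rot_def[abs_def]
  by (rule has_vector_derivative_eq_rhs) (simp add: cross_add_right cross_mult_right cc scaleR_diff_right)
qed

text \<open>The derivative is the full one in space, but required at points of the sphere only. This
  admits functions with the factor \<open>1/(1 + ep - y . z)\<close>, which are singular away from
  the sphere and so need not satisfy \<open>C1_fun\<close>.\<close>

definition sph_C1 :: "(real^3 => real) => (real^3 => real^3) => bool" where
 "sph_C1 f G \<longleftrightarrow> (\<forall>y\<in>S2. (f has_derivative (\<lambda>h. G y \<bullet> h)) (at y)) \<and> continuous_on S2 G"

lemma sph_C1_continuous: "sph_C1 f G ==> continuous_on S2 f"
 unfolding sph_C1_def by (meson continuous_at_imp_continuous_on has_derivative_continuous)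

lemma continuous_S2_integrable:
 fixes f :: "real^3 => 'b::{banach, second_countable_topology}"
 assumes "continuous_on S2 f"
 shows "integrable sph f"
proof -
 have "compact (f ` S2)" using assms by (intro compact_continuous_image) auto
 then obtain B where "\<And>y. y \<in> S2 ==> norm (f y) <= B"
  using compact_imp_bounded bounded_iff by (metis imageI)
 thus ?thesis
  by (intro sphere.integrable_const_bound[where B=B] borel_measurable_sphere_cont assms) auto
qed

text \<open>Rotations about \<open>e\<close> preserve the measure, so the difference quotients of
  \<open>f\<close> along \<open>rot e\<close> have integral 0. Their limit is the derivative of
  \<open>f\<close> along \<open>cross3 e y\<close>, which is the \<open>e\<close>-component of the
  integrand; the mean value theorem supplies the dominating constant.\<close>

lemma integral_cross_grad:
 assumes C: "sph_C1 f G"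
 shows "(SI y. cross3 y (G y)) = 0"
proof -
 have contG: "continuous_on S2 G" using C by (simp add: sph_C1_def)
 have contf: "continuous_on S2 f" by (rule sph_C1_continuous[OF C])
 have contX: "continuous_on S2 (\<lambda>y. cross3 y (G y))" by (intro continuous_on_cross contG continuous_on_id)
 have "compact (G ` S2)" using contG by (intro compact_continuous_image) auto
 then obtain B where B: "\<And>y. y \<in> S2 ==> norm (G y) <= B"
  using compact_imp_bounded bounded_iff by (metis imageI)
 have main: "(SI y. e \<bullet> cross3 y (G y)) = 0" if e: "norm e = 1" for e
 proof -
  have onS: "rot e t y \<in> S2" if "y \<in> S2" for t y
   using rot_orthogonal[OF e, of t] that by (simp add: orthogonal_transformation)
  have der: "((\<lambda>t. f (rot e t y)) has_real_derivative G (rot e t y) \<bullet> cross3 e (rot e t y)) (at t)" if y: "y \<in> S2" for y t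
  proof -
   have 1: "(f has_derivative (\<lambda>h. G (rot e t y) \<bullet> h)) (at (rot e t y))"
    using C onS[OF y] by (auto simp: sph_C1_def)
   have 2: "((\<lambda>t. rot e t y) has_derivative (\<lambda>s. s *R cross3 e (rot e t y))) (at t)"
    using rot_has_derivative[OF e] by (simp add: has_vector_derivative_def)
   have "((\<lambda>t. f (rot e t y)) has_derivative (\<lambda>s. G (rot e t y) \<bullet> (s *R cross3 e (rot e t y)))) (at t)"
    using diff_chain_at[OF 2 1] by (simp add: o_def)
   thus ?thesis
    unfolding has_field_derivative_def by (rule has_derivative_eq_rhs) (auto simp: mult.commute)
  qed
  have r0: "rot e 0 y = y" for y by (simp add: rot_def)
  let ?D = "\<lambda>k::nat. \<lambda>y. (f (rot e (inverse (Suc k)) y) - f y)/inverse (Suc k)"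
  have bnd: "norm (?D k y) <= B" if y: "y \<in> S2" for k y
  proof -
   have pos: "0 < inverse (real (Suc k))" by simp
   obtain z where z: "f (rot e (inverse (Suc k)) y) - f (rot e 0 y) = (inverse (Suc k) - 0)*(G (rot e z y) \<bullet> cross3 e (rot e z y))"
    using MVT2[OF pos, of "\<lambda>t. f (rot e t y)" "\<lambda>t. G (rot e t y) \<bullet> cross3 e (rot e t y)", OF der[OF y]] by blast
   have "?D k y = G (rot e z y) \<bullet> cross3 e (rot e z y)"
    unfolding z[unfolded r0 diff_zero] by (rule nonzero_mult_div_cancel_left) (use pos in linarith)
   hence "norm (?D k y) = \<bar>G (rot e z y) \<bullet> cross3 e (rot e z y)\<bar>" by (simp only: real_norm_def)
   also have "... <= norm (G (rot e z y))*norm (cross3 e (rot e z y))" by (rule Cauchy_Schwarz_ineq2)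
   also have "... <= B*(norm e*norm (rot e z y))"
    using B[OF onS[OF y, of z]] order_trans[OF norm_ge_zero B[OF y]] by (intro mult_mono norm_cross3_le) simp_all
   finally show ?thesis using e onS[OF y] by simp
  qed
  have lim: "(\<lambda>k. ?D k y) \<longlonglongrightarrow> e \<bullet> cross3 y (G y)" if y: "y \<in> S2" for y
  proof -
   have lim0: "((\<lambda>t. (f (rot e t y) - f y)/t) \<longlongrightarrow> G y \<bullet> cross3 e y) (at 0)"
    using der[OF y, of 0] unfolding has_field_derivative_iff r0 by simp
   moreover have "filterlim (\<lambda>k. inverse (real (Suc k))) (at 0) sequentially"
    unfolding filterlim_at using LIMSEQ_inverse_real_of_nat by (simp add: always_eventually)
   ultimately have "(\<lambda>k. ?D k y) \<longlonglongrightarrow> G y \<bullet> cross3 e y"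
    using filterlim_compose[OF lim0] by blast
   also have "G y \<bullet> cross3 e y = e \<bullet> cross3 y (G y)"
    using cross_triple[of e y "G y"] by (simp add: inner_commute)
   finally show ?thesis .
  qed
  have contr: "continuous_on S2 (\<lambda>y. f (rot e t y))" for t
  proof (rule continuous_on_compose2[OF contf])
   show "continuous_on S2 (rot e t)" unfolding rot_def[abs_def] by (intro continuous_intros continuous_on_cross)
  qed (use onS in auto)
  have zero: "(SI y. ?D k y) = 0" for k
  proof -
   have "(SI y. f (rot e (inverse (Suc k)) y)) = (SI y. f y)"
    by (rule integral_sphere_orthogonal[OF rot_orthogonal[OF e] borel_measurable_sphere_cont[OF contf]])
   thus ?thesis
    using continuous_S2_integrable[OF contr] continuous_S2_integrable[OF contf] by (simp add: Bochner_Integration.integral_diff)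
  qed
  have "(\<lambda>k. SI y. ?D k y) \<longlonglongrightarrow> (SI y. e \<bullet> cross3 y (G y))"
  proof (rule integral_dominated_convergence[where w="\<lambda>_. B"])
   show "(\<lambda>y. e \<bullet> cross3 y (G y)) \<in> borel_measurable sph"
    by (intro borel_measurable_sphere_cont continuous_intros contX)
   show "?D k \<in> borel_measurable sph" for k
    by (intro borel_measurable_sphere_cont continuous_intros contf contr) auto
  qed (use bnd lim in auto)
  hence "(\<lambda>k::nat. 0) \<longlonglongrightarrow> (SI y. e \<bullet> cross3 y (G y))" unfolding zero .
  thus ?thesis by (metis LIMSEQ_const_iff)
 qed
 have int: "integrable sph (\<lambda>y. cross3 y (G y))" by (rule continuous_S2_integrable[OF contX])
 have "(SI y. cross3 y (G y)) \<bullet> e = 0 \<bullet> e" if "e \<in> Basis" for e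
  using main[OF norm_Basis[OF that]] integral_inner_right[of e sph "\<lambda>y. cross3 y (G y)"] int
  by (metis inner_commute inner_zero_left)
 thus ?thesis by (rule euclidean_eqI)
qed

lemma sph_C1_mult:
 assumes "sph_C1 f F" "sph_C1 g G"
 shows "sph_C1 (\<lambda>y. f y*g y) (\<lambda>y. f y *R G y + g y *R F y)"
 unfolding sph_C1_def
proof
 show "\<forall>y\<in>S2. ((\<lambda>y. f y*g y) has_derivative (\<lambda>h. (f y *R G y + g y *R F y) \<bullet> h)) (at y)"
 proof
  fix y :: "real^3" assume y: "y \<in> S2"
  have "(f has_derivative (\<lambda>h. F y \<bullet> h)) (at y)" "(g has_derivative (\<lambda>h. G y \<bullet> h)) (at y)"
   using assms y by (auto simp: sph_C1_def)
  from has_derivative_mult[OF this]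
  show "((\<lambda>y. f y*g y) has_derivative (\<lambda>h. (f y *R G y + g y *R F y) \<bullet> h)) (at y)"
   by (rule has_derivative_eq_rhs) (auto simp: inner_add_left)
 qed
 show "continuous_on S2 (\<lambda>y. f y *R G y + g y *R F y)"
  using assms sph_C1_continuous[OF assms(1)] sph_C1_continuous[OF assms(2)]
  by (intro continuous_intros) (auto simp: sph_C1_def)
qed

lemma sph_C1_coord: "sph_C1 (\<lambda>y. y $ k) (\<lambda>_. axis k 1)"
 unfolding sph_C1_def
 by (auto intro!: derivative_eq_intros simp: inner_axis' cart_eq_inner_axis)

lemma cross_coord_sum:
 fixes w :: "real^3"
 shows "(\<Sum>l\<in>UNIV. cross3 (axis l 1) (y $ l *R w)) = cross3 y w"
  "(\<Sum>l\<in>UNIV. cross3 (axis l 1) (cross3 y (axis l 1))) = 2 *R y"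
 by (simp_all add: sum_3 cross3_def vec_eq_iff forall_3 axis_def)

lemma integral_cross:
 fixes g :: "real^3 => real^3"
 assumes "integrable M g"
 shows "(\<integral>y. cross3 e (g y) \<partial>M) = cross3 e (\<integral>y. g y \<partial>M)"
 using integral_bounded_linear[OF _ assms, of "cross3 e"] bilinear_cross
 by (simp add: bilinear_def linear_conv_bounded_linear)

text \<open>Apply the mean-zero property of rotation derivatives to \<open>y $ l * f y\<close>, take
  the cross product with the \<open>l\<close>-th axis and sum over \<open>l\<close>. The derivative
  of \<open>f\<close> contributes \<open>cross3 y (cross3 y (G y))\<close>, which is minus the
  tangential gradient, and the derivative of the coordinate contributes
  \<open>2 *R (f y *R y)\<close>.\<close>

lemma integral_tangential_grad:
 assumes C: "sph_C1 f G"
 shows "(SI y. G y - (G y \<bullet> y) *R y) = 2 *R (SI y. f y *R y)"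
proof -
 have contG: "continuous_on S2 G" using C by (simp add: sph_C1_def)
 have contf: "continuous_on S2 f" by (rule sph_C1_continuous[OF C])
 define X where "X l y = cross3 (axis l 1) (cross3 y (y $ l *R G y + f y *R axis l 1))" for l :: 3 and y
 have contX: "continuous_on S2 (X l)" for l
  unfolding X_def by (intro continuous_intros continuous_on_cross contG contf)
 have contY: "continuous_on S2 (\<lambda>y. cross3 y (y $ l *R G y + f y *R axis l 1))" for l
  by (intro continuous_intros continuous_on_cross contG contf)
 have zero: "(SI y. X l y) = 0" for l
  unfolding X_def integral_cross[OF continuous_S2_integrable[OF contY]]
  using integral_cross_grad[OF sph_C1_mult[OF sph_C1_coord[of l] C]] by simp
 have "(SI y. (\<Sum>l\<in>UNIV. X l y)) = 0"
  by (simp add: Bochner_Integration.integral_sum continuous_S2_integrable[OF contX] zero)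
 moreover have "(\<Sum>l\<in>UNIV. X l y) = 2 *R (f y *R y) - (G y - (G y \<bullet> y) *R y)" if "y \<in> S2" for y
 proof -
  have yy: "y \<bullet> y = 1" using that by (simp add: norm_eq_1)
  have "(\<Sum>l\<in>UNIV. X l y) = (\<Sum>l\<in>UNIV. cross3 (axis l 1) (y $ l *R cross3 y (G y))) + f y *R (\<Sum>l\<in>UNIV. cross3 (axis l 1) (cross3 y (axis l 1)))"
   unfolding X_def by (simp add: sum.distrib[symmetric] scaleR_sum_right cross_add_right cross_mult_right)
  also have "... = cross3 y (cross3 y (G y)) + f y *R (2 *R y)" unfolding cross_coord_sum ..
  finally show ?thesis unfolding Lagrange yy inner_commute[of y "G y"] by (simp add: mult.commute)
 qed
 ultimately have z: "(SI y. 2 *R (f y *R y) - (G y - (G y \<bullet> y) *R y)) = 0"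
  by (metis (no_types, lifting) Bochner_Integration.integral_cong space_sphere)
 have i: "integrable sph (\<lambda>y. 2 *R (f y *R y))" "integrable sph (\<lambda>y. G y - (G y \<bullet> y) *R y)"
  by (intro continuous_S2_integrable continuous_intros contG contf)+
 have "(SI y. 2 *R (f y *R y)) = (SI y. G y - (G y \<bullet> y) *R y)"
  using z[unfolded Bochner_Integration.integral_diff[OF i]] by (rule right_minus_eq[THEN iffD1])
 moreover have "(SI y. 2 *R (f y *R y)) = 2 *R (SI y. f y *R y)"
  by (intro integral_scaleR_right continuous_S2_integrable continuous_intros contf)
 ultimately show ?thesis by (simp only:)
qed

section \<open>Weak derivatives\<close>

lemma grad_unique:
 assumes "(f has_derivative (\<lambda>h. G \<bullet> h)) (at y)"
 shows "grad f y = G"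
 unfolding grad_def frechet_derivative_at[OF assms, symmetric]
 by (simp add: vec_eq_iff inner_axis)

lemma C1_fun_has_derivative:
 assumes "C1_fun ph"
 shows "(ph has_derivative (\<lambda>h. grad ph y \<bullet> h)) (at y)"
proof -
 have d: "(ph has_derivative frechet_derivative ph (at y)) (at y)"
  using assms by (simp add: C1_fun_def frechet_derivative_works)
 have lin: "linear (frechet_derivative ph (at y))" using d by (rule has_derivative_linear)
 have "frechet_derivative ph (at y) h = grad ph y \<bullet> h" for h
 proof -
  have "h = (\<Sum>i\<in>UNIV. (h $ i) *R axis i 1)" by (simp add: basis_expansion scalar_mult_eq_scaleR[symmetric])
  hence "frechet_derivative ph (at y) h = frechet_derivative ph (at y) (\<Sum>i\<in>UNIV. (h $ i) *R axis i 1)" by (rule arg_cong)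
  also have "... = (\<Sum>i\<in>UNIV. (h $ i)*frechet_derivative ph (at y) (axis i 1))"
   by (simp only: linear_sum[OF lin] linear_scale[OF lin] real_scaleR_def)
  finally have "frechet_derivative ph (at y) h = (\<Sum>i\<in>UNIV. (h $ i)*frechet_derivative ph (at y) (axis i 1))" .
  thus ?thesis by (simp add: grad_def inner_vec_def mult.commute)
 qed
 thus ?thesis using d by presburger
qed

lemma C1_funI:
 assumes "\<And>y. (ph has_derivative (\<lambda>h. G y \<bullet> h)) (at y)" "continuous_on UNIV G"
 shows "C1_fun ph" "grad ph = G"
proof -
 show "grad ph = G" using grad_unique[OF assms(1)] by auto
 thus "C1_fun ph" using assms by (auto simp: C1_fun_def differentiable_def)
qed

lemma C1_fun_sph_C1: "C1_fun ph ==> sph_C1 ph (grad ph)"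
 using C1_fun_has_derivative unfolding sph_C1_def C1_fun_def by (blast intro: continuous_on_subset)

lemma C1_fun_mult:
 assumes "C1_fun f" "C1_fun g"
 shows "C1_fun (\<lambda>y. f y*g y)" "grad (\<lambda>y. f y*g y) = (\<lambda>y. f y *R grad g y + g y *R grad f y)"
proof -
 have d: "((\<lambda>y. f y*g y) has_derivative (\<lambda>h. (f y *R grad g y + g y *R grad f y) \<bullet> h)) (at y)" for y
  by (rule has_derivative_eq_rhs[OF has_derivative_mult[OF C1_fun_has_derivative[OF assms(1)] C1_fun_has_derivative[OF assms(2)]]])
   (auto simp: inner_add_left)
 have "continuous_on UNIV f" "continuous_on UNIV g"
  using assms by (auto simp: C1_fun_def intro!: continuous_at_imp_continuous_on differentiable_imp_continuous_within)
 hence c: "continuous_on UNIV (\<lambda>y. f y *R grad g y + g y *R grad f y)"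
  using assms by (intro continuous_intros) (auto simp: C1_fun_def)
 show "C1_fun (\<lambda>y. f y*g y)" "grad (\<lambda>y. f y*g y) = (\<lambda>y. f y *R grad g y + g y *R grad f y)"
  using C1_funI[OF d c] by auto
qed

lemma C1_fun_coord: "C1_fun (\<lambda>y. y $ k)" "grad (\<lambda>y. y $ k) = (\<lambda>_. axis k 1)"
proof -
 have "((\<lambda>y. y $ k) has_derivative (\<lambda>h. axis k 1 \<bullet> h)) (at y)" for y :: "real^3"
  by (auto intro!: derivative_eq_intros simp: inner_axis' cart_eq_inner_axis)
 from C1_funI[OF this] show "C1_fun (\<lambda>y. y $ k)" "grad (\<lambda>y. y $ k) = (\<lambda>_. axis k 1)" by auto
qed

lemma has_weak_grad_sph_C1:
 assumes C: "sph_C1 f G"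
 shows "has_weak_grad f (\<lambda>y. G y - (G y \<bullet> y) *R y)"
 unfolding has_weak_grad_def
proof (intro conjI allI impI)
 have contG: "continuous_on S2 G" using C by (simp add: sph_C1_def)
 have contf: "continuous_on S2 f" by (rule sph_C1_continuous[OF C])
 show "integrable sph f" "integrable sph (\<lambda>y. G y - (G y \<bullet> y) *R y)"
  by (intro continuous_S2_integrable continuous_intros contG contf)+
 fix ph assume "C1_fun ph"
 hence P: "sph_C1 ph (grad ph)" by (rule C1_fun_sph_C1)
 have contP: "continuous_on S2 (grad ph)" "continuous_on S2 ph"
  using P sph_C1_continuous[OF P] by (auto simp: sph_C1_def)
 have int: "integrable sph (\<lambda>y. ph y *R (G y - (G y \<bullet> y) *R y))" "integrable sph (\<lambda>y. f y *R tangential_grad ph y)"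
  unfolding tangential_grad_def
  by (intro continuous_S2_integrable continuous_intros contG contf contP)+
 have "(SI y. ph y *R (G y - (G y \<bullet> y) *R y)) + (SI y. f y *R tangential_grad ph y)
  = (SI y. ph y *R (G y - (G y \<bullet> y) *R y) + f y *R tangential_grad ph y)"
  by (rule Bochner_Integration.integral_add[symmetric, OF int])
 also have "... = (SI y. (f y *R grad ph y + ph y *R G y) - ((f y *R grad ph y + ph y *R G y) \<bullet> y) *R y)"
  by (rule Bochner_Integration.integral_cong[OF refl]) (simp add: tangential_grad_def inner_add_left algebra_simps)
 also have "... = 2 *R (SI y. (f y*ph y) *R y)"
  by (rule integral_tangential_grad[OF sph_C1_mult[OF C P]])
 finally show "(SI y. ph y *R (G y - (G y \<bullet> y) *R y)) = - (SI y. f y *R tangential_grad ph y) + 2 *R (SI y. (f y*ph y) *R y)"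
  by (simp add: algebra_simps)
qed

text \<open>The \<open>e\<close>-component of \<open>cross3 y (grad u y)\<close> is the derivative
  of \<open>u\<close> along the rotation field \<open>cross3 e y\<close>. These fields are
  divergence free on the sphere, so the integration by parts carries no curvature term.\<close>

definition has_weak_rot :: "(real^3 => real) => (real^3 => real^3) => bool" where
 "has_weak_rot u a \<longleftrightarrow> integrable sph u \<and> integrable sph a \<and>
  (\<forall>ph. C1_fun ph \<longrightarrow> (SI y. ph y *R a y) = - (SI y. u y *R cross3 y (grad ph y)))"

lemma integrable_mult_continuous:
 fixes g :: "real^3 => 'b::{banach, second_countable_topology}"
 assumes g: "integrable sph g" and c: "continuous_on S2 (c :: real^3 => real)"
 shows "integrable sph (\<lambda>y. c y *R g y)"
proof -
 have "compact (c ` S2)" using c by (intro compact_continuous_image) auto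
 then obtain B where B: "\<And>y. y \<in> S2 ==> norm (c y) <= B"
  using compact_imp_bounded bounded_iff by (metis imageI)
 have [measurable]: "g \<in> borel_measurable sph" "c \<in> borel_measurable sph"
  using g borel_measurable_sphere_cont[OF c] by auto
 show ?thesis
 proof (rule Bochner_Integration.integrable_bound[OF integrable_scaleR_right[of B]])
  show "integrable sph g" by fact
  show "AE y in sph. norm (c y *R g y) <= norm (B *R g y)"
   using B by (intro AE_I2) (fastforce simp: intro!: mult_right_mono)
 qed simp
qed

lemma integrable_scaleR_continuous:
 fixes c :: "real^3 => 'b::euclidean_space"
 assumes g: "integrable sph (g :: real^3 => real)" and c: "continuous_on S2 c"
 shows "integrable sph (\<lambda>y. g y *R c y)"
proof -
 have "compact (c ` S2)" using c by (intro compact_continuous_image) auto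
 then obtain B where B: "\<And>y. y \<in> S2 ==> norm (c y) <= B"
  using compact_imp_bounded bounded_iff by (metis imageI)
 have [measurable]: "g \<in> borel_measurable sph" "c \<in> borel_measurable sph"
  using g borel_measurable_sphere_cont[OF c] by auto
 show ?thesis
 proof (rule Bochner_Integration.integrable_bound[OF integrable_mult_right[of B]])
  show "integrable sph g" by fact
  show "AE y in sph. norm (g y *R c y) <= norm (B*g y)"
  proof (intro AE_I2)
   fix y assume "y \<in> space sph"
   hence "norm (c y) <= \<bar>B\<bar>" using B[of y] by auto
   thus "norm (g y *R c y) <= norm (B*g y)" by (simp add: abs_mult mult.commute[of "\<bar>B\<bar>"] mult_left_mono)
  qed
 qed simp
qed

lemma integrable_cross:
 fixes g :: "real^3 => real^3"
 assumes "integrable M g"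
 shows "integrable M (\<lambda>y. cross3 e (g y))"
 using integrable_bounded_linear[OF _ assms, of "cross3 e"] bilinear_cross
 by (simp add: bilinear_def linear_conv_bounded_linear)

lemma C1_fun_cont:
 assumes "C1_fun ph"
 shows "continuous_on A ph" "continuous_on A (grad ph)"
proof -
 have "continuous_on UNIV ph"
  using assms by (auto simp: C1_fun_def intro!: continuous_at_imp_continuous_on differentiable_imp_continuous_within)
 thus "continuous_on A ph" by (rule continuous_on_subset) simp
 show "continuous_on A (grad ph)" using assms by (auto simp: C1_fun_def intro: continuous_on_subset)
qed

lemma integrable_cross_self:
 assumes "integrable sph g"
 shows "integrable sph (\<lambda>y. cross3 y (g y))"
proof -
 have "integrable sph (\<lambda>y. \<Sum>l\<in>UNIV. cross3 (axis l 1) (y $ l *R g y))"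
  by (intro Bochner_Integration.integrable_sum integrable_cross integrable_mult_continuous assms continuous_intros)
 thus ?thesis by (simp add: cross_coord_sum)
qed

text \<open>Test the gradient with \<open>ph y * y $ l\<close>, take the cross product with the
  \<open>l\<close>-th axis and sum over \<open>l\<close>. On the left this builds
  \<open>cross3 y (g y)\<close>; on the right all terms along \<open>y\<close>, among them the
  curvature term, and those along the axis itself drop out, leaving the gradient of
  \<open>ph\<close>.\<close>

lemma has_weak_grad_imp_rot:
 assumes "has_weak_grad u g"
 shows "has_weak_rot u (\<lambda>y. cross3 y (g y))"
 unfolding has_weak_rot_def
proof (intro conjI allI impI)
 show iu: "integrable sph u" using assms by (simp add: has_weak_grad_def)
 have ig: "integrable sph g" using assms by (simp add: has_weak_grad_def)
 show "integrable sph (\<lambda>y. cross3 y (g y))" by (rule integrable_cross_self[OF ig])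
 fix ph assume C: "C1_fun ph"
 note cont = C1_fun_cont[OF C]
 let ?A = "\<lambda>l y. (ph y*y $ l) *R g y"
 let ?B = "\<lambda>l y. u y *R tangential_grad (\<lambda>y. ph y*y $ l) y"
 let ?D = "\<lambda>l y. (u y*(ph y*y $ l)) *R y"
 have tg: "tangential_grad (\<lambda>y. ph y*y $ l) = (\<lambda>y. ph y *R axis l 1 + y $ l *R grad ph y - ((ph y *R axis l 1 + y $ l *R grad ph y) \<bullet> y) *R y)" for l
  by (simp add: fun_eq_iff tangential_grad_def C1_fun_mult[OF C C1_fun_coord(1)] C1_fun_coord)
 have iA: "integrable sph (?A l)" for l by (intro integrable_mult_continuous ig continuous_intros cont)
 have iB: "integrable sph (?B l)" for l unfolding tg by (intro integrable_scaleR_continuous iu continuous_intros cont)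
 have iD: "integrable sph (?D l)" for l
  unfolding scaleR_scaleR[symmetric] by (intro integrable_scaleR_continuous iu continuous_intros cont)
 have eq: "(SI y. ?A l y) = - (SI y. ?B l y) + 2 *R (SI y. ?D l y)" for l
  using assms C1_fun_mult(1)[OF C C1_fun_coord(1)] unfolding has_weak_grad_def by blast
 have "(SI y. ph y *R cross3 y (g y)) = (SI y. (\<Sum>l\<in>UNIV. cross3 (axis l 1) (?A l y)))"
 proof (intro Bochner_Integration.integral_cong refl)
  fix y
  have "(\<Sum>l\<in>UNIV. cross3 (axis l 1) (?A l y)) = ph y *R (\<Sum>l\<in>UNIV. cross3 (axis l 1) (y $ l *R g y))"
   by (simp add: scaleR_sum_right cross_mult_right)
  thus "ph y *R cross3 y (g y) = (\<Sum>l\<in>UNIV. cross3 (axis l 1) (?A l y))" unfolding cross_coord_sum by simp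
 qed
 also have "... = (\<Sum>l\<in>UNIV. cross3 (axis l 1) (SI y. ?A l y))"
  by (simp add: Bochner_Integration.integral_sum integrable_cross iA integral_cross)
 also have "... = - (\<Sum>l\<in>UNIV. cross3 (axis l 1) (SI y. ?B l y)) + 2 *R (\<Sum>l\<in>UNIV. cross3 (axis l 1) (SI y. ?D l y))"
  unfolding eq by (simp add: Cross3.right_diff_distrib sum_subtractf cross_mult_right scaleR_sum_right)
 also have "(\<Sum>l\<in>UNIV. cross3 (axis l 1) (SI y. ?D l y)) = (SI y. (\<Sum>l\<in>UNIV. cross3 (axis l 1) (?D l y)))"
  by (simp add: Bochner_Integration.integral_sum integrable_cross iD integral_cross)
 also have "... = (SI y. 0)"
 proof (intro Bochner_Integration.integral_cong refl)
  fix y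
  have "(\<Sum>l\<in>UNIV. cross3 (axis l 1) (?D l y)) = (u y*ph y) *R (\<Sum>l\<in>UNIV. cross3 (axis l 1) (y $ l *R y))"
   by (simp add: scaleR_sum_right cross_mult_right mult_ac)
  thus "(\<Sum>l\<in>UNIV. cross3 (axis l 1) (?D l y)) = 0" by (simp add: cross_coord_sum)
 qed
 also have "(\<Sum>l\<in>UNIV. cross3 (axis l 1) (SI y. ?B l y)) = (SI y. (\<Sum>l\<in>UNIV. cross3 (axis l 1) (?B l y)))"
  by (simp add: Bochner_Integration.integral_sum integrable_cross iB integral_cross)
 also have "... = (SI y. u y *R cross3 y (grad ph y))"
 proof (intro Bochner_Integration.integral_cong refl)
  fix y :: "real^3" assume "y \<in> space sph"
  have s1: "(\<Sum>l\<in>UNIV. (axis l 1 \<bullet> y) *R cross3 (axis l 1) y) = 0"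
   by (simp add: sum_3 cross3_def vec_eq_iff forall_3 axis_def inner_vec_def)
  have "(\<Sum>l\<in>UNIV. cross3 (axis l 1) (?B l y)) = u y *R ((\<Sum>l\<in>UNIV. cross3 (axis l 1) (y $ l *R grad ph y))
    - ph y *R (\<Sum>l\<in>UNIV. (axis l 1 \<bullet> y) *R cross3 (axis l 1) y) - (grad ph y \<bullet> y) *R (\<Sum>l\<in>UNIV. cross3 (axis l 1) (y $ l *R y)))"
   unfolding tg scaleR_sum_right sum_subtractf[symmetric]
   by (intro sum.cong refl)
    (simp add: cross_mult_right cross_add_right Cross3.right_diff_distrib inner_add_left scaleR_diff_right scaleR_add_left scaleR_add_right mult.commute mult.left_commute)
  thus "(\<Sum>l\<in>UNIV. cross3 (axis l 1) (?B l y)) = u y *R cross3 y (grad ph y)"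
   unfolding s1 cross_coord_sum by simp
 qed
 finally show "(SI y. ph y *R cross3 y (g y)) = - (SI y. u y *R cross3 y (grad ph y))" by simp
qed

lemma has_weak_rot_sph_C1:
 assumes C: "sph_C1 f G"
 shows "has_weak_rot f (\<lambda>y. cross3 y (G y))"
proof -
 have "cross3 y (G y - (G y \<bullet> y) *R y) = cross3 y (G y)" for y
  by (simp add: Cross3.right_diff_distrib cross_mult_right)
 thus ?thesis using has_weak_grad_imp_rot[OF has_weak_grad_sph_C1[OF C]] by simp
qed

text \<open>Product rule with a coordinate. It turns weak gradients of the components of
  \<open>weak_grad u\<close> into weak rotation derivatives of the components of
  \<open>cross3 y (weak_grad u y)\<close>.\<close>

lemma has_weak_rot_mult_coord:
 assumes "has_weak_rot u a"
 shows "has_weak_rot (\<lambda>y. y $ l*u y) (\<lambda>y. y $ l *R a y + u y *R cross3 y (axis l 1))"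
 unfolding has_weak_rot_def
proof (intro conjI allI impI)
 have iu: "integrable sph u" and ia: "integrable sph a" using assms by (auto simp: has_weak_rot_def)
 show "integrable sph (\<lambda>y. y $ l*u y)"
  using integrable_mult_continuous[OF iu, of "\<lambda>y. y $ l"] by (simp add: continuous_intros)
 show "integrable sph (\<lambda>y. y $ l *R a y + u y *R cross3 y (axis l 1))"
  by (intro Bochner_Integration.integrable_add integrable_mult_continuous ia integrable_scaleR_continuous iu continuous_intros continuous_on_cross)
 fix ph assume C: "C1_fun ph"
 note cont = C1_fun_cont[OF C]
 have i1: "integrable sph (\<lambda>y. (ph y*y $ l) *R a y)" by (intro integrable_mult_continuous ia continuous_intros cont)
 have i2: "integrable sph (\<lambda>y. u y *R (ph y *R cross3 y (axis l 1)))"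
  by (intro integrable_scaleR_continuous iu continuous_intros cont continuous_on_cross)
 have i3: "integrable sph (\<lambda>y. u y *R (y $ l *R cross3 y (grad ph y)))"
  by (intro integrable_scaleR_continuous iu continuous_intros cont continuous_on_cross)
 have "(SI y. ph y *R (y $ l *R a y + u y *R cross3 y (axis l 1)))
   = (SI y. (ph y*y $ l) *R a y + u y *R (ph y *R cross3 y (axis l 1)))"
  by (simp add: scaleR_add_right mult_ac)
 also have "... = (SI y. (ph y*y $ l) *R a y) + (SI y. u y *R (ph y *R cross3 y (axis l 1)))"
  by (rule Bochner_Integration.integral_add[OF i1 i2])
 also have "(SI y. (ph y*y $ l) *R a y) = - (SI y. u y *R cross3 y (grad (\<lambda>y. ph y*y $ l) y))"
  using assms C1_fun_mult(1)[OF C C1_fun_coord(1)] unfolding has_weak_rot_def by blast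
 also have "(SI y. u y *R cross3 y (grad (\<lambda>y. ph y*y $ l) y))
  = (SI y. u y *R (ph y *R cross3 y (axis l 1)) + u y *R (y $ l *R cross3 y (grad ph y)))"
  by (simp add: C1_fun_mult[OF C C1_fun_coord(1)] C1_fun_coord cross_add_right cross_mult_right scaleR_add_right)
 also have "... = (SI y. u y *R (ph y *R cross3 y (axis l 1))) + (SI y. u y *R (y $ l *R cross3 y (grad ph y)))"
  by (rule Bochner_Integration.integral_add[OF i2 i3])
 finally show "(SI y. ph y *R (y $ l *R a y + u y *R cross3 y (axis l 1)))
  = - (SI y. (y $ l*u y) *R cross3 y (grad ph y))" by (simp add: mult_ac)
qed

lemma has_weak_rot_diff:
 assumes "has_weak_rot u a" "has_weak_rot v b"
 shows "has_weak_rot (\<lambda>y. u y - v y) (\<lambda>y. a y - b y)"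
 unfolding has_weak_rot_def
proof (intro conjI allI impI)
 have i: "integrable sph u" "integrable sph a" "integrable sph v" "integrable sph b" using assms by (auto simp: has_weak_rot_def)
 thus "integrable sph (\<lambda>y. u y - v y)" "integrable sph (\<lambda>y. a y - b y)" by auto
 fix ph assume C: "C1_fun ph"
 note cont = C1_fun_cont[OF C]
 have i1: "integrable sph (\<lambda>y. ph y *R a y)" "integrable sph (\<lambda>y. ph y *R b y)"
  "integrable sph (\<lambda>y. u y *R cross3 y (grad ph y))" "integrable sph (\<lambda>y. v y *R cross3 y (grad ph y))"
  by (intro integrable_mult_continuous integrable_scaleR_continuous i cont continuous_intros continuous_on_cross)+
 have "(SI y. ph y *R a y) = - (SI y. u y *R cross3 y (grad ph y))"
  "(SI y. ph y *R b y) = - (SI y. v y *R cross3 y (grad ph y))"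
  using assms C unfolding has_weak_rot_def by blast+
 thus "(SI y. ph y *R (a y - b y)) = - (SI y. (u y - v y) *R cross3 y (grad ph y))"
  using i1 by (simp add: scaleR_diff_right scaleR_diff_left)
qed

subsection \<open>Uniqueness\<close>

text \<open>The bumps \<open>max 0 (1 - k*infdist y K)\<close> tend to the indicator of a compact
  \<open>K\<close>, so the integral over every compact set is nonnegative. The negative part of
  \<open>g\<close>, taken as a density, then vanishes on all compact subsets of \<open>g < 0\<close>
  and by inner regularity on this set itself.\<close>

lemma AE_nonneg_of_tests:
 fixes g :: "real^3 => real"
 assumes g: "integrable sph g"
  and test: "\<And>ph. continuous_on UNIV ph ==> (\<And>y. ph y \<ge> 0) ==> (SI y. ph y*g y) \<ge> 0"
 shows "AE y in sph. g y \<ge> 0"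
proof -
 have [measurable]: "g \<in> borel_measurable sph" using g by simp
 have compact_set: "(SI y. indicator K y*g y) \<ge> 0" if K: "compact K" "K ~= {}" for K
 proof -
  define ph where "ph k y = max 0 (1 - real k*infdist y K)" for k y
  have ph01: "0 <= ph k y" "ph k y <= 1" for k y by (auto simp: ph_def infdist_nonneg)
  have c: "continuous_on UNIV (ph k)" for k unfolding ph_def by (intro continuous_intros)
  hence [measurable]: "ph k \<in> borel_measurable borel" for k by (rule borel_measurable_continuous_onI)
  have [measurable]: "K \<in> sets borel" using K by (simp add: compact_imp_closed)
  have lim: "(\<lambda>k. ph k y) \<longlonglongrightarrow> indicator K y" for y
  proof (cases "y \<in> K")
   case True thus ?thesis by (simp add: ph_def)
  next
   case False
   hence "infdist y K > 0" using K by (metis compact_imp_closed in_closed_iff_infdist_zero infdist_nonneg less_eq_real_def)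
   then obtain k0 where k0: "1 < real k0*infdist y K" using reals_Archimedean3 by blast
   have "ph k y = 0" if "k \<ge> k0" for k
   proof -
    have "real k0*infdist y K <= real k*infdist y K" using that by (intro mult_right_mono) (auto simp: infdist_nonneg)
    thus ?thesis using k0 by (simp add: ph_def)
   qed
   thus ?thesis using False by (intro tendsto_eventually) (auto simp: eventually_sequentially)
  qed
  have "(\<lambda>k. SI y. ph k y*g y) \<longlonglongrightarrow> (SI y. indicator K y*g y)"
  proof (rule integral_dominated_convergence[where w="\<lambda>y. norm (g y)"])
   show "integrable sph (\<lambda>y. norm (g y))" using g by simp
   show "AE y in sph. norm (ph k y*g y) <= norm (g y)" for k
    using ph01[of k] by (intro AE_I2) (simp add: abs_mult mult_left_le_one_le)
   show "AE y in sph. (\<lambda>k. ph k y*g y) \<longlonglongrightarrow> indicator K y*g y"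
    using lim by (intro AE_I2 tendsto_mult) auto
  qed measurable
  thus ?thesis by (rule LIMSEQ_le_const) (use test c ph01 in blast)
 qed
 \<comment> \<open>The density lives on the sphere only; its image on the Borel sets of the whole
   space is a measure to which inner regularity applies.\<close>
 define M where "M = distr (density sph (\<lambda>y. ennreal (- g y))) borel (\<lambda>y. y)"
 have idm: "(\<lambda>y. y) \<in> measurable (density sph (\<lambda>y. ennreal (- g y))) borel" by simp
 define A where "A = {y. indicator S2 y*g y < 0}"
 have [measurable]: "(\<lambda>y. indicator S2 y*g y) \<in> borel_measurable borel"
 proof -
  have "g \<in> borel_measurable (restrict_space borel S2)"
   using \<open>g \<in> borel_measurable sph\<close> by (simp only: measurable_sphere_cong)
  thus ?thesis
   by (subst (asm) borel_measurable_restrict_space_iff) (auto simp: mult.commute)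
 qed
 have A: "A \<in> sets borel" unfolding A_def by measurable
 have emM: "emeasure M X = (NI y. ennreal (- g y)*indicator X y)" if [measurable]: "X \<in> sets borel" for X
  unfolding M_def by (subst emeasure_distr[OF idm that], subst emeasure_density)
   (auto simp: sets_sphere_Int Int_commute intro!: nn_integral_cong split: split_indicator)
 have "emeasure M (space M) <= (NI y. ennreal (norm (g y)))"
  by (subst emM) (auto simp: M_def intro!: nn_integral_mono ennreal_leI)
 also have "... < \<infinity>" using g by (simp add: integrable_iff_bounded)
 finally have fin: "emeasure M (space M) ~= \<infinity>" by simp
 have sM: "sets M = sets borel" by (simp add: M_def)
 have "emeasure M K = 0" if K: "K \<subseteq> A" "compact K" for K
 proof (cases "K = {}")
  case False
  have [measurable]: "K \<in> sets borel" using K by (simp add: compact_imp_closed)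
  have neg: "indicator K y*g y <= 0" if "y \<in> S2" for y
   using K that by (auto simp: A_def indicator_def)
  have int: "integrable sph (\<lambda>y. indicator K y*g y)"
   by (rule Bochner_Integration.integrable_bound[OF g]) (auto simp: indicator_def)
  have "emeasure M K = (NI y. ennreal (- (indicator K y*g y)))"
   by (subst emM) (auto intro!: nn_integral_cong simp: indicator_def)
  also have "... = ennreal (SI y. - (indicator K y*g y))"
   using neg int by (intro nn_integral_eq_integral) auto
  also have "... = 0" using compact_set[OF K(2) False] by (simp add: ennreal_eq_0_iff)
  finally show ?thesis .
 qed simp
 hence "emeasure M A = 0"
  unfolding inner_regular[OF sM fin A] by (intro SUP_eq_const) auto
 hence "(NI y. ennreal (- g y)*indicator A y) = 0" using emM[OF A] by simp
 hence "AE y in sph. ennreal (- g y)*indicator A y = 0"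
  using A by (subst (asm) nn_integral_0_iff_AE) auto
 thus ?thesis
  by (rule AE_mp) (intro AE_I2, auto simp: A_def indicator_def ennreal_eq_0_iff split: if_splits)
qed

section \<open>A polynomial mollifier\<close>

text \<open>A zonal kernel: it depends on \<open>x . y\<close> alone, so it is symmetric and
  invariant under rotating both arguments; on the sphere it is nonnegative with its peak at
  \<open>y = x\<close>. Being a polynomial in \<open>x\<close>, it makes mollified functions smooth
  on all of \<open>real^3\<close>.\<close>

definition zk :: "nat => real^3 => real^3 => real" where "zk n x y = (1 + x \<bullet> y)^n"

definition zint :: "nat => (real^3 => real) => real^3 => real" where
 "zint n w x = (SI y. zk n x y*w y)"

definition zc :: "nat => real" where "zc n = zint n (\<lambda>_. 1) (axis 1 1)"

definition mol :: "nat => (real^3 => real) => real^3 => real" where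
 "mol n w x = zint n w x/zc n"

lemma zk_cont [continuous_intros]:
 "continuous_on A f ==> continuous_on A g ==> continuous_on A (\<lambda>y. zk n (f y) (g y))"
 unfolding zk_def by (intro continuous_intros)

lemma zk_measurable [measurable (raw)]:
 "f \<in> borel_measurable M ==> g \<in> borel_measurable M ==> (\<lambda>y. zk n (f y) (g y)) \<in> borel_measurable M"
 unfolding zk_def by measurable

lemma integrable_cont_mult:
 fixes c w :: "real^3 => real"
 shows "integrable sph w ==> continuous_on S2 c ==> integrable sph (\<lambda>y. c y*w y)"
 using integrable_mult_continuous[of w c] by simp

lemma zint_Suc:
 assumes w: "integrable sph w"
 shows "zint (Suc n) w x = zint n w x + (\<Sum>k\<in>UNIV. x $ k*zint n (\<lambda>y. y $ k*w y) x)"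
proof -
 have i: "integrable sph (\<lambda>y. zk n x y*w y)" "\<And>k. integrable sph (\<lambda>y. zk n x y*(y $ k*w y))"
  by (intro integrable_cont_mult w continuous_intros)+
 have "zint (Suc n) w x = (SI y. zk n x y*w y + (\<Sum>k\<in>UNIV. x $ k*(zk n x y*(y $ k*w y))))"
  unfolding zint_def
  by (intro Bochner_Integration.integral_cong refl)
   (simp add: zk_def inner_vec_def sum_3 algebra_simps)
 also have "... = zint n w x + (\<Sum>k\<in>UNIV. x $ k*zint n (\<lambda>y. y $ k*w y) x)"
  unfolding zint_def using i by simp
 finally show ?thesis .
qed

text \<open>Induction on \<open>n\<close> through \<open>zint_Suc\<close>, which expresses a power
  by lower ones with coordinate weights. In this way no limit is taken under the integral.\<close>

lemma zint_has_derivative: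
 assumes w: "integrable sph w"
 shows "(zint n w has_derivative (\<lambda>h. SI y. (real n*zk (n-1) x y*(y \<bullet> h))*w y)) (at x)"
 using w
proof (induction n arbitrary: w)
 case 0
 have "zint 0 w = (\<lambda>x. SI y. w y)" by (simp add: zint_def zk_def fun_eq_iff)
 thus ?case by simp
next
 case (Suc n)
 note w = Suc.prems
 let ?d = "\<lambda>h y. real n*zk (n-1) x y*(y \<bullet> h)"
 have wk: "integrable sph (\<lambda>y. y $ k*w y)" for k by (intro integrable_cont_mult w continuous_intros)
 let ?D = "\<lambda>w h. SI y. ?d h y*w y"
 have eq: "zint (Suc n) w = (\<lambda>x. zint n w x + (\<Sum>k\<in>UNIV. x $ k*zint n (\<lambda>y. y $ k*w y) x))"
  using zint_Suc[OF w] by auto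
 have dk: "((\<lambda>x. x $ k*zint n (\<lambda>y. y $ k*w y) x) has_derivative
   (\<lambda>h. x $ k*?D (\<lambda>y. y $ k*w y) h + h $ k*zint n (\<lambda>y. y $ k*w y) x)) (at x)" for k
  by (rule has_derivative_mult[OF bounded_linear_imp_has_derivative[OF bounded_linear_vec_nth] Suc.IH[OF wk]])
 have "(zint (Suc n) w has_derivative (\<lambda>h. ?D w h + (\<Sum>k\<in>UNIV. x $ k*?D (\<lambda>y. y $ k*w y) h + h $ k*zint n (\<lambda>y. y $ k*w y) x))) (at x)"
  unfolding eq by (intro has_derivative_add Suc.IH[OF w] has_derivative_sum dk)
 thus ?case
 proof (rule has_derivative_eq_rhs, intro ext)
  fix h
  have i: "integrable sph (\<lambda>y. ?d h y*w y)"
   "\<And>k. integrable sph (\<lambda>y. ?d h y*(y $ k*w y))"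
   "\<And>k. integrable sph (\<lambda>y. zk n x y*(y $ k*w y))"
   by (intro integrable_cont_mult w wk continuous_intros)+
  have "(SI y. (real (Suc n)*zk (Suc n - 1) x y*(y \<bullet> h))*w y)
   = (SI y. ?d h y*w y + (\<Sum>k\<in>UNIV. x $ k*(?d h y*(y $ k*w y)) + h $ k*(zk n x y*(y $ k*w y))))"
  proof (intro Bochner_Integration.integral_cong refl)
   fix y :: "real^3"
   \<comment> \<open>For \<open>n = 0\<close> the truncated exponent \<open>n - 1\<close> is wrong,
     but the factor \<open>real n\<close> removes it.\<close>
   have 1: "real n*zk (n-1) x y*(1 + x \<bullet> y) = real n*zk n x y"
    by (cases n) (auto simp: zk_def)
   have "(\<Sum>k\<in>UNIV. x $ k*(?d h y*(y $ k*w y)) + h $ k*(zk n x y*(y $ k*w y)))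
    = ?d h y*w y*(x \<bullet> y) + zk n x y*w y*(y \<bullet> h)"
    by (simp add: inner_vec_def sum_3 algebra_simps)
   hence "?d h y*w y + (\<Sum>k\<in>UNIV. x $ k*(?d h y*(y $ k*w y)) + h $ k*(zk n x y*(y $ k*w y)))
    = (real n*zk (n-1) x y*(1 + x \<bullet> y))*((y \<bullet> h)*w y) + zk n x y*w y*(y \<bullet> h)"
    by (simp add: algebra_simps)
   also have "... = (real (Suc n)*zk (Suc n - 1) x y*(y \<bullet> h))*w y"
    unfolding 1 by (simp add: algebra_simps)
   finally show "(real (Suc n)*zk (Suc n - 1) x y*(y \<bullet> h))*w y = ?d h y*w y + (\<Sum>k\<in>UNIV. x $ k*(?d h y*(y $ k*w y)) + h $ k*(zk n x y*(y $ k*w y)))" by simp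
  qed
  also have "... = ?D w h + (\<Sum>k\<in>UNIV. x $ k*?D (\<lambda>y. y $ k*w y) h + h $ k*zint n (\<lambda>y. y $ k*w y) x)"
   using i unfolding zint_def by simp
  finally show "?D w h + (\<Sum>k\<in>UNIV. x $ k*?D (\<lambda>y. y $ k*w y) h + h $ k*zint n (\<lambda>y. y $ k*w y) x)
   = (SI y. (real (Suc n)*zk (Suc n - 1) x y*(y \<bullet> h))*w y)" by simp
 qed
qed

lemma zint_continuous: "integrable sph w ==> continuous_on A (zint n w)"
 using zint_has_derivative by (meson continuous_at_imp_continuous_on has_derivative_continuous)

definition zgrad :: "nat => (real^3 => real) => real^3 => real^3" where
 "zgrad n w x = (\<chi> k. real n*zint (n-1) (\<lambda>y. y $ k*w y) x)"

lemma zint_C1: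
 assumes w: "integrable sph w"
 shows "C1_fun (zint n w)" "grad (zint n w) = zgrad n w"
proof -
 have wk: "integrable sph (\<lambda>y. y $ k*w y)" for k by (intro integrable_cont_mult w continuous_intros)
 have "(zint n w has_derivative (\<lambda>h. zgrad n w x \<bullet> h)) (at x)" for x
 proof (rule has_derivative_eq_rhs[OF zint_has_derivative[OF w]], intro ext)
  fix h
  have i: "integrable sph (\<lambda>y. zk (n-1) x y*(y $ k*w y))" for k by (intro integrable_cont_mult wk continuous_intros)
  have "(SI y. (real n*zk (n-1) x y*(y \<bullet> h))*w y) = (SI y. (\<Sum>k\<in>UNIV. (real n*h $ k)*(zk (n-1) x y*(y $ k*w y))))"
   by (intro Bochner_Integration.integral_cong refl) (simp add: inner_vec_def sum_3 algebra_simps)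
  also have "... = (\<Sum>k\<in>UNIV. (real n*h $ k)*zint (n-1) (\<lambda>y. y $ k*w y) x)"
   unfolding zint_def using i by simp
  finally show "(SI y. (real n*zk (n-1) x y*(y \<bullet> h))*w y) = zgrad n w x \<bullet> h"
   by (simp add: zgrad_def inner_vec_def mult_ac)
 qed
 note d = this
 have c: "continuous_on UNIV (zgrad n w)"
  unfolding zgrad_def by (intro continuous_on_vec_lambda continuous_intros zint_continuous wk)
 show "C1_fun (zint n w)" "grad (zint n w) = zgrad n w" using C1_funI[OF d c] by auto
qed

lemma zk_C1: "C1_fun (zk n x)" "grad (zk n x) = (\<lambda>y. (real n*zk (n-1) x y) *R x)"
proof -
 have d: "(zk n x has_derivative (\<lambda>h. ((real n*zk (n-1) x y) *R x) \<bullet> h)) (at y)" for y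
  unfolding zk_def[abs_def] by (auto intro!: derivative_eq_intros simp: mult_ac)
 have c: "continuous_on UNIV (\<lambda>y. (real n*zk (n-1) x y) *R x)" by (intro continuous_intros)
 show "C1_fun (zk n x)" "grad (zk n x) = (\<lambda>y. (real n*zk (n-1) x y) *R x)" using C1_funI[OF d c] by auto
qed

text \<open>The gradients of \<open>(1 + x . y)^n\<close> in \<open>x\<close> and in
  \<open>y\<close> are the same multiple of \<open>y\<close> and of \<open>x\<close>. So the
  rotation derivatives in the two variables differ by sign only, and the weak integration by parts
  absorbs the sign. Tangential gradients at different points have no such relation, whence the
  rotation fields.\<close>

lemma zint_rot:
 assumes "has_weak_rot w a"
 shows "cross3 x (zgrad n w x) $ k = zint n (\<lambda>y. a y $ k) x"
proof -
 have w: "integrable sph w" and a: "integrable sph a" using assms by (auto simp: has_weak_rot_def)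
 have wl: "integrable sph (\<lambda>y. y $ l*w y)" for l by (intro integrable_cont_mult w continuous_intros)
 have i1: "integrable sph (\<lambda>y. zk (n-1) x y*(y $ l*w y))" for l by (intro integrable_cont_mult wl continuous_intros)
 have i2: "integrable sph (\<lambda>y. w y *R cross3 y (grad (zk n x) y))"
  unfolding zk_C1 by (intro integrable_scaleR_continuous w continuous_intros continuous_on_cross)
 have i3: "integrable sph (\<lambda>y. zk n x y *R a y)"
  by (intro integrable_mult_continuous a continuous_intros)
 have nth: "(SI y. f y) $ k = (SI y. f y $ k)" if "integrable sph f" for f :: "real^3 => real^3" and k
  using integral_bounded_linear[OF bounded_linear_vec_nth that] by simp
 have "zint n (\<lambda>y. a y $ k) x = (SI y. zk n x y *R a y) $ k"
  by (simp add: zint_def nth[OF i3])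
 also have "... = - (SI y. w y *R cross3 y (grad (zk n x) y)) $ k"
  using assms zk_C1(1) unfolding has_weak_rot_def by simp
 also have "... = - (SI y. w y*cross3 y (grad (zk n x) y) $ k)"
  by (simp add: nth[OF i2])
 also have "... = (SI y. real n*zk (n-1) x y*cross3 x y $ k*w y)"
  unfolding zk_C1 by (subst Bochner_Integration.integral_minus[symmetric], intro Bochner_Integration.integral_cong refl)
   (simp add: cross_mult_right cross_skew[of x] algebra_simps)
 also have "... = cross3 x (zgrad n w x) $ k"
 proof -
  have A: "(SI y. real n*zk (n-1) x y*(x $ p*y $ q - x $ q*y $ p)*w y) = x $ p*zgrad n w x $ q - x $ q*zgrad n w x $ p" for p q
  proof -
   have "(SI y. real n*zk (n-1) x y*(x $ p*y $ q - x $ q*y $ p)*w y)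
    = (SI y. (real n*x $ p)*(zk (n-1) x y*(y $ q*w y)) - (real n*x $ q)*(zk (n-1) x y*(y $ p*w y)))"
    by (intro Bochner_Integration.integral_cong refl) (simp add: algebra_simps)
   also have "... = (real n*x $ p)*zint (n-1) (\<lambda>y. y $ q*w y) x - (real n*x $ q)*zint (n-1) (\<lambda>y. y $ p*w y) x"
    using i1 unfolding zint_def by simp
   also have "... = x $ p*zgrad n w x $ q - x $ q*zgrad n w x $ p" by (simp add: zgrad_def)
   finally show ?thesis .
  qed
  show ?thesis
   using exhaust_3[of k] A[of 2 3] A[of 3 1] A[of 1 2] by (auto simp: cross_components mult.commute)
 qed
 finally show ?thesis by simp
qed

text \<open>An orthogonal map takes the first axis to \<open>x\<close> and leaves measure and kernel
  invariant, so the mass of the kernel is the same everywhere on the sphere.\<close>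

lemma zint_one: 
 assumes "x \<in> S2"
 shows "zint n (\<lambda>_. 1) x = zc n"
proof -
 have "\<exists>f. orthogonal_transformation f \<and> f (axis 1 1 :: real^3) = x"
 proof (rule orthogonal_transformation_exists)
  show "norm (axis 1 1 :: real^3) = norm x" using assms by simp
  show "\<exists>f. orthogonal_transformation f \<and> f (axis 1 1 :: real^3) = x"
   if "orthogonal_transformation g" "g (axis 1 1 :: real^3) = x" for g using that by (intro exI[of _ g] conjI)
 qed
 then obtain f where f: "orthogonal_transformation f" "f (axis 1 1 :: real^3) = x" by (elim exE conjE)
 have "zint n (\<lambda>_. 1) x = (SI y. zk n x (f y)*1)"
  unfolding zint_def by (rule integral_sphere_orthogonal[OF f(1), symmetric]) simp
 also have "... = (SI y. zk n (axis 1 1) y*1)"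
  using f by (intro Bochner_Integration.integral_cong refl) (auto simp: zk_def orthogonal_transformation_def)
 finally show ?thesis by (simp add: zc_def zint_def)
qed

lemma zk_bounds:
 assumes "x \<in> S2" "y \<in> S2"
 shows "0 <= zk n x y" "1 + x \<bullet> y = 2 - (dist x y)^2/2" "zk n x y <= 2^n"
proof -
 have "\<bar>x \<bullet> y\<bar> <= 1" using Cauchy_Schwarz_ineq2[of x y] assms by simp
 hence "0 <= 1 + x \<bullet> y" "1 + x \<bullet> y <= 2" by auto
 thus "0 <= zk n x y" "zk n x y <= 2^n" by (auto simp: zk_def intro: power_mono)
 have "(dist x y)^2 = 2 - 2*(x \<bullet> y)"
  using assms by (simp add: dist_norm power2_norm_eq_inner inner_diff_left inner_diff_right inner_commute norm_eq_1)
 thus "1 + x \<bullet> y = 2 - (dist x y)^2/2" by (simp add: field_simps)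
qed

text \<open>Only the part of the mass in a cap is counted, where the kernel is at least
  \<open>(2 - r^2/2)^n\<close>. With \<open>r = d/2\<close> this beats the values
  \<open>(2 - d^2/2)^n\<close> at distance \<open>d\<close> by a geometric factor.\<close>

lemma zc_lower:
 assumes x: "x \<in> S2" and r: "0 <= r" "r <= 1"
 shows "(2 - r^2/2)^n * measure sph (ball x r \<inter> S2) <= zc n"
proof -
 have "(2 - r^2/2)^n * measure sph (ball x r \<inter> S2) = (SI y. (2 - r^2/2)^n*indicator (ball x r \<inter> S2) y)"
  by (simp add: sets_sphere_Int)
 also have "... <= (SI y. zk n x y*1)"
 proof (rule integral_mono)
  show "integrable sph (\<lambda>y. (2 - r^2/2)^n*indicator (ball x r \<inter> S2) y)" by (intro integrable_mult_right integrable_real_indicator) (auto simp: sets_sphere_Int sphere.emeasure_finite less_top[symmetric])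
  show "integrable sph (\<lambda>y. zk n x y*1)" by (intro continuous_S2_integrable continuous_intros)
  fix y assume "y \<in> space sph"
  hence y: "y \<in> S2" by simp
  show "(2 - r^2/2)^n*indicator (ball x r \<inter> S2) y <= zk n x y*1"
  proof (cases "y \<in> ball x r")
   case True
   hence "(dist x y)^2 <= r^2" by (intro power_mono) auto
   moreover have "r^2 <= 1" using r by (simp add: power_le_one)
   ultimately have "(2 - r^2/2)^n <= zk n x y" unfolding zk_def zk_bounds(2)[OF x y] by (intro power_mono) auto
   thus ?thesis using y True by (simp add: indicator_def)
  qed (use zk_bounds(1)[OF x y] in \<open>simp add: indicator_def\<close>)
 qed
 also have "... = zc n" using zint_one[OF x] by (simp add: zint_def)
 finally show ?thesis .
qed

lemma measure_cap_pos:
 assumes "x \<in> S2" "r > 0"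
 shows "measure sph (ball x r \<inter> S2) > 0"
 using emeasure_sphere_open_pos[of "ball x r" x] assms
 by (simp add: sphere.emeasure_eq_measure)

lemma zc_pos: "zc n > 0"
proof -
 have a: "axis 1 1 \<in> S2" by simp
 have "0 < (2 - 1^2/2 :: real)^n * measure sph (ball (axis 1 1) 1 \<inter> S2)"
  using measure_cap_pos[OF a, of 1] by simp
 also have "... <= zc n" by (rule zc_lower[OF a]) auto
 finally show ?thesis .
qed

lemma mol_one: "x \<in> S2 ==> mol n (\<lambda>_. 1) x = 1"
 using zint_one[of x n] zc_pos[of n] by (simp add: mol_def)

lemma mol_C1:
 assumes w: "integrable sph w"
 shows "C1_fun (mol n w)" "grad (mol n w) = (\<lambda>x. zgrad n w x /\<^sub>R zc n)"
proof -
 have d: "(mol n w has_derivative (\<lambda>h. (zgrad n w x /\<^sub>R zc n) \<bullet> h)) (at x)" for x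
  unfolding mol_def[abs_def]
  by (rule has_derivative_eq_rhs[OF has_derivative_divide'[OF C1_fun_has_derivative[OF zint_C1(1)[OF w]] has_derivative_const]])
   (use zc_pos[of n] in \<open>auto simp: zint_C1[OF w] fun_eq_iff field_simps\<close>)
 have c: "continuous_on UNIV (\<lambda>x. zgrad n w x /\<^sub>R zc n)"
  using C1_fun_cont(2)[OF zint_C1(1)[OF w], of UNIV] unfolding zint_C1(2)[OF w] by (intro continuous_intros)
 show "C1_fun (mol n w)" "grad (mol n w) = (\<lambda>x. zgrad n w x /\<^sub>R zc n)" using C1_funI[OF d c] by auto
qed

lemma mol_continuous: "integrable sph w ==> continuous_on A (mol n w)"
 by (rule C1_fun_cont[OF mol_C1(1)])

lemma mol_rot:
 assumes "has_weak_rot w a"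
 shows "cross3 x (grad (mol n w) x) $ k = mol n (\<lambda>y. a y $ k) x"
proof -
 have w: "integrable sph w" using assms by (simp add: has_weak_rot_def)
 show ?thesis
  unfolding mol_C1[OF w] cross_mult_right mol_def zint_rot[OF assms, symmetric] by (simp add: field_simps)
qed

lemma mol_bound:
 assumes w: "integrable sph w" and M: "AE y in sph. \<bar>w y\<bar> <= M" and x: "x \<in> S2"
 shows "\<bar>mol n w x\<bar> <= M"
proof -
 have i: "integrable sph (\<lambda>y. zk n x y*w y)" by (intro integrable_cont_mult w continuous_intros)
 have ik: "integrable sph (\<lambda>y. M*zk n x y)" by (intro continuous_S2_integrable continuous_intros)
 have "\<bar>zint n w x\<bar> <= (SI y. \<bar>zk n x y*w y\<bar>)" unfolding zint_def by (rule integral_abs_bound)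
 also have "... <= (SI y. M*zk n x y)"
 proof (rule integral_mono_AE)
  show "AE y in sph. \<bar>zk n x y*w y\<bar> <= M*zk n x y"
   using M
  proof (rule AE_mp, intro AE_I2 impI)
   fix y assume "y \<in> space sph" "\<bar>w y\<bar> <= M"
   thus "\<bar>zk n x y*w y\<bar> <= M*zk n x y"
    using zk_bounds(1)[OF x, of y n] by (simp add: abs_mult mult.commute[of M] mult_left_mono)
  qed
 qed (use i ik in auto)
 also have "... = M*zc n"
  using zint_one[OF x, of n] by (simp add: zint_def continuous_S2_integrable continuous_intros)
 finally show ?thesis using zc_pos[of n] by (simp add: mol_def field_simps)
qed

text \<open>Fubini and the symmetry of the kernel. It moves the mollifier from a merely integrable
  function to a bounded one.\<close>

lemma mol_selfadjoint:
 assumes w: "integrable sph w" and v: "v \<in> borel_measurable sph" and B: "\<And>y. y \<in> S2 ==> \<bar>v y\<bar> <= B"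
 shows "(SI x. mol n w x * v x) = (SI x. w x * mol n v x)"
proof -
 have [measurable]: "w \<in> borel_measurable sph" "v \<in> borel_measurable sph" using w v by auto
 have [measurable]: "(\<lambda>y. y) \<in> borel_measurable sph" by (rule borel_measurable_sphereI) simp
 have im: "(\<lambda>(x,y). zk n x y*w y * v x) \<in> borel_measurable (sph \<Otimes>\<^sub>M sph)" by measurable
 have int: "integrable (sph \<Otimes>\<^sub>M sph) (\<lambda>(x,y). zk n x y*w y * v x)"
 proof (rule Bochner_Integration.integrable_bound[OF _ im])
  show "integrable (sph \<Otimes>\<^sub>M sph) (\<lambda>(x,y). (2^n*B)*w y)"
   by (rule sphere_pair.Fubini_integrable) (use w in auto)
  show "AE p in sph \<Otimes>\<^sub>M sph. norm (case p of (x, y) => zk n x y*w y * v x) <= norm (case p of (x, y) => (2^n*B)*w y)"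
  proof (intro AE_I2)
   fix p assume "p \<in> space (sph \<Otimes>\<^sub>M sph)"
   then obtain x y where p: "p = (x, y)" "x \<in> S2" "y \<in> S2" by (auto simp: space_pair_measure)
   have "\<bar>zk n x y\<bar>*\<bar>v x\<bar> <= 2^n*B"
    using zk_bounds(1)[OF p(2,3), of n] zk_bounds(3)[OF p(2,3), of n] B[OF p(2)] by (intro mult_mono) auto
   moreover have "0 <= B" using B[OF p(2)] by linarith
   ultimately show "norm (case p of (x, y) => zk n x y*w y * v x) <= norm (case p of (x, y) => (2^n*B)*w y)"
    unfolding p by (simp add: abs_mult) (metis abs_ge_zero mult.assoc mult.commute mult_right_mono)
  qed
 qed
 have "(SI x. zint n w x * v x) = (SI x. SI y. zk n x y*w y * v x)"
  unfolding zint_def by simp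
 also have "... = (SI y. SI x. zk n x y*w y * v x)"
  using sphere_pair.Fubini_integral[OF int] by simp
 also have "... = (SI y. w y*zint n v y)"
 proof (intro Bochner_Integration.integral_cong refl)
  fix y
  have "(SI x. zk n x y*w y * v x) = (SI x. w y*(zk n y x * v x))"
   by (intro Bochner_Integration.integral_cong refl) (simp add: zk_def inner_commute)
  thus "(SI x. zk n x y*w y * v x) = w y*zint n v y" by (simp add: zint_def)
 qed
 finally show ?thesis unfolding mol_def by simp
qed

lemma bounded_sphere_integrable:
 fixes v :: "real^3 => real"
 shows "v \<in> borel_measurable sph ==> (\<And>y. y \<in> S2 ==> \<bar>v y\<bar> <= B) ==> integrable sph v"
 by (rule sphere.integrable_const_bound[where B=B]) auto

text \<open>The variance of \<open>w\<close> under the probability density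
  \<open>zk n x y/zc n\<close> is nonnegative.\<close>

lemma mol_jensen:
 assumes w: "integrable sph w" and w2: "integrable sph (\<lambda>y. (w y)^2)" and x: "x \<in> S2"
 shows "(mol n w x)^2 <= mol n (\<lambda>y. (w y)^2) x"
proof -
 let ?m = "mol n w x"
 have i: "integrable sph (\<lambda>y. zk n x y*w y)" "integrable sph (\<lambda>y. zk n x y*(w y)^2)" "integrable sph (\<lambda>y. zk n x y)"
  by (intro integrable_cont_mult w w2 continuous_S2_integrable continuous_intros)+
 have "0 <= (SI y. zk n x y*(w y - ?m)^2)"
  using zk_bounds(1)[OF x] by (intro integral_nonneg_AE AE_I2) auto
 also have "... = (SI y. zk n x y*(w y)^2 - (2*?m)*(zk n x y*w y) + ?m^2*zk n x y)"
  by (intro Bochner_Integration.integral_cong refl) (simp add: power2_eq_square algebra_simps)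
 also have "... = zint n (\<lambda>y. (w y)^2) x - 2*?m*zint n w x + ?m^2*zc n"
  using i zint_one[OF x, of n] unfolding zint_def by simp
 also have "... = zc n*(mol n (\<lambda>y. (w y)^2) x - ?m^2)"
  using zc_pos[of n] by (simp add: mol_def power2_eq_square field_simps)
 finally show ?thesis using zc_pos[of n] by (simp add: zero_le_mult_iff)
qed

text \<open>Jensen at each point; then self-adjointness moves the averaging onto the constant 1,
  which it reproduces.\<close>

lemma mol_L2:
 assumes w: "integrable sph w" and w2: "integrable sph (\<lambda>y. (w y)^2)"
 shows "(SI x. (mol n w x)^2) <= (SI y. (w y)^2)"
proof -
 have "(SI x. (mol n w x)^2) <= (SI x. mol n (\<lambda>y. (w y)^2) x*1)"
  using mol_jensen[OF w w2]
  by (intro integral_mono continuous_S2_integrable continuous_intros mol_continuous w w2) auto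
 also have "... = (SI y. (w y)^2 * mol n (\<lambda>_. 1) y)"
  by (rule mol_selfadjoint[OF w2, where B=1]) auto
 also have "... = (SI y. (w y)^2)"
  by (intro Bochner_Integration.integral_cong refl) (simp add: mol_one)
 finally show ?thesis .
qed

text \<open>Split at distance \<open>d\<close> from \<open>x\<close>. Nearby, \<open>w\<close>
  varies by less than \<open>r/2\<close>. Further away the kernel is at most
  \<open>(2 - d^2/2)^n\<close>, while its mass is at least \<open>A*(2 - d^2/8)^n\<close>, so this
  part decays like \<open>q^n\<close>.\<close>

lemma mol_tendsto:
 assumes w: "w \<in> borel_measurable sph" and B: "\<And>y. y \<in> S2 ==> \<bar>w y\<bar> <= B"
  and x: "x \<in> S2" and c: "continuous (at x within S2) w"
 shows "(\<lambda>n. mol n w x) \<longlonglongrightarrow> w x"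
proof (rule LIMSEQ_I)
 fix r :: real assume r: "r > 0"
 have iw: "integrable sph w" by (rule bounded_sphere_integrable[OF w B])
 have B0: "0 <= B" using B[OF x] by linarith
 obtain d0 where d0: "d0 > 0" "\<And>y. y \<in> S2 ==> dist y x < d0 ==> dist (w y) (w x) < r/2"
  using c r unfolding continuous_within_eps_delta by (metis half_gt_zero)
 define d where "d = min d0 1"
 have d: "d > 0" "d <= 1" "\<And>y. y \<in> S2 ==> dist y x < d ==> \<bar>w y - w x\<bar> < r/2"
  using d0 by (auto simp: d_def dist_real_def)
 define A where "A = measure sph (ball x (d/2) \<inter> S2)"
 define S where "S = measure sph S2"
 have A: "A > 0" unfolding A_def using measure_cap_pos[OF x] d by auto
 have S: "S \<ge> 0" unfolding S_def by simp
 define q where "q = (2 - d^2/2)/(2 - (d/2)^2/2)"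
 have d2: "0 < d^2" "d^2 <= 1" using d by (auto simp: power_le_one)
 have q: "0 <= q" "q < 1" using d2 by (auto simp: q_def power_divide divide_simps)
 have est: "\<bar>mol n w x - w x\<bar> <= r/2 + 2*B*S/A*q^n" for n
 proof -
  have i: "integrable sph (\<lambda>y. zk n x y*w y)" "integrable sph (\<lambda>y. zk n x y)"
   by (intro integrable_cont_mult iw continuous_S2_integrable continuous_intros)+
  have "zc n*(mol n w x - w x) = (SI y. zk n x y*w y - w x*zk n x y)"
   using i zint_one[OF x, of n] zc_pos[of n] by (simp add: mol_def zint_def field_simps)
  also have "... = (SI y. zk n x y*(w y - w x))" by (simp add: algebra_simps)
  finally have "zc n*\<bar>mol n w x - w x\<bar> = \<bar>(SI y. zk n x y*(w y - w x))\<bar>"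
   using zc_pos[of n] by (metis abs_mult abs_of_pos)
  also have "... <= (SI y. \<bar>zk n x y*(w y - w x)\<bar>)" by (rule integral_abs_bound)
  also have "... <= (SI y. r/2*zk n x y + 2*B*(2 - d^2/2)^n)"
  proof (rule integral_mono)
   have "integrable sph (\<lambda>y. w y - w x)" using iw by auto
   hence "integrable sph (\<lambda>y. zk n x y*(w y - w x))" by (intro integrable_cont_mult continuous_intros)
   thus "integrable sph (\<lambda>y. \<bar>zk n x y*(w y - w x)\<bar>)" by simp
   show "integrable sph (\<lambda>y. r/2*zk n x y + 2*B*(2 - d^2/2)^n)" using i by auto
   fix y assume "y \<in> space sph"
   hence y: "y \<in> S2" by simp
   note zb = zk_bounds[OF x y]
   show "\<bar>zk n x y*(w y - w x)\<bar> <= r/2*zk n x y + 2*B*(2 - d^2/2)^n"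
   proof (cases "dist y x < d")
    case True
    have "\<bar>zk n x y*(w y - w x)\<bar> <= zk n x y*(r/2)"
     unfolding abs_mult abs_of_nonneg[OF zb(1)] using d(3)[OF y True] zb(1)[of n] by (intro mult_left_mono) auto
    also have "... <= r/2*zk n x y + 2*B*(2 - d^2/2)^n" using B0 d2 by simp
    finally show ?thesis .
   next
    case False
    hence "d^2 <= (dist x y)^2" using d by (intro power_mono) (auto simp: dist_commute)
    hence "zk n x y <= (2 - d^2/2)^n"
     using zb(1)[of 1] unfolding zk_def zb(2) by (intro power_mono) auto
    moreover have "\<bar>w y - w x\<bar> <= 2*B" using B[OF y] B[OF x] by linarith
    ultimately have "\<bar>zk n x y*(w y - w x)\<bar> <= (2 - d^2/2)^n*(2*B)"
     using zb(1)[of n] by (auto simp: abs_mult intro!: mult_mono)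
    thus ?thesis using zb(1)[of n] r by (simp add: mult.commute add_nonneg_nonneg) (smt (verit) mult_nonneg_nonneg divide_nonneg_pos)
   qed
  qed
  also have "... = r/2*zc n + 2*B*(2 - d^2/2)^n*S"
   using i zint_one[OF x, of n] by (simp add: zint_def S_def)
  finally have 1: "zc n*\<bar>mol n w x - w x\<bar> <= r/2*zc n + 2*B*S*(2 - d^2/2)^n" by (simp add: mult_ac)
  have "(2 - (d/2)^2/2)^n*A <= zc n" unfolding A_def by (rule zc_lower[OF x]) (use d in auto)
  hence "q^n*((2 - (d/2)^2/2)^n*A) <= q^n*zc n" using q by (intro mult_left_mono) auto
  moreover have "q^n*(2 - (d/2)^2/2)^n = (2 - d^2/2)^n"
   using d2 by (simp add: q_def power_divide)
  ultimately have "(2 - d^2/2)^n*A <= q^n*zc n" by (simp only: mult.assoc[symmetric])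
  hence "(2 - d^2/2)^n <= q^n*zc n/A" by (simp only: pos_le_divide_eq[OF A])
  hence "2*B*S*(2 - d^2/2)^n <= 2*B*S*(q^n*zc n/A)" using B0 S by (intro mult_left_mono) auto
  with 1 have "zc n*\<bar>mol n w x - w x\<bar> <= zc n*(r/2 + 2*B*S/A*q^n)" by (simp add: algebra_simps)
  thus ?thesis using zc_pos[of n] by (simp add: mult_le_cancel_left)
 qed
 have "(\<lambda>n. r/2 + 2*B*S/A*q^n) \<longlonglongrightarrow> r/2 + 2*B*S/A*0"
  using q by (intro tendsto_intros LIMSEQ_power_zero) auto
 hence "eventually (\<lambda>n. r/2 + 2*B*S/A*q^n < r) sequentially"
  by (rule order_tendstoD(2)) (use r in auto)
 thus "\<exists>no. \<forall>n\<ge>no. norm (mol n w x - w x) < r"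
  unfolding eventually_sequentially using est by (metis le_less_trans real_norm_def)
qed

subsection \<open>Uniqueness of weak gradients and Sobolev norms\<close>

lemma C1_fun_add:
 assumes "C1_fun f" "C1_fun g"
 shows "C1_fun (\<lambda>y. f y + g y)"
proof -
 have d: "((\<lambda>y. f y + g y) has_derivative (\<lambda>h. (grad f y + grad g y) \<bullet> h)) (at y)" for y
  by (rule has_derivative_eq_rhs[OF has_derivative_add[OF C1_fun_has_derivative[OF assms(1)] C1_fun_has_derivative[OF assms(2)]]])
   (auto simp: inner_add_left)
 have c: "continuous_on UNIV (\<lambda>y. grad f y + grad g y)"
  using C1_fun_cont(2)[OF assms(1), of UNIV] C1_fun_cont(2)[OF assms(2), of UNIV] by (intro continuous_intros)
 show ?thesis using C1_funI[OF d c] by auto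
qed

lemma C1_fun_const: "C1_fun (\<lambda>_. c)" "grad (\<lambda>_. c) = (\<lambda>_. 0)"
proof -
 have d: "((\<lambda>_. c) has_derivative (\<lambda>h. (0::real^3) \<bullet> h)) (at y)" for y by auto
 show "C1_fun (\<lambda>_. c)" "grad (\<lambda>_. c) = (\<lambda>_. 0)" using C1_funI[OF d] by auto
qed

lemma C1_fun_linear:
 assumes "bounded_linear (f :: real^3 => real)"
 shows "C1_fun f"
proof -
 have lin: "linear f" using assms by (rule bounded_linear.linear)
 define v where "v = (\<chi> i. f (axis i 1))"
 have "f h = v \<bullet> h" for h
 proof -
  have "h = (\<Sum>i\<in>UNIV. (h $ i) *R axis i 1)" by (simp add: basis_expansion scalar_mult_eq_scaleR[symmetric])
  hence "f h = f (\<Sum>i\<in>UNIV. (h $ i) *R axis i 1)" by (rule arg_cong)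
  also have "... = (\<Sum>i\<in>UNIV. (h $ i)*f (axis i 1))"
   by (simp only: linear_sum[OF lin] linear_scale[OF lin] real_scaleR_def)
  finally show ?thesis by (simp add: v_def inner_vec_def mult.commute)
 qed
 hence f: "f = (\<lambda>h. v \<bullet> h)" by auto
 have d: "(f has_derivative (\<lambda>h. v \<bullet> h)) (at y)" for y
  unfolding f by (auto intro!: derivative_eq_intros)
 show ?thesis using C1_funI(1)[OF d] by auto
qed

lemma C1_fun_polynomial: "real_polynomial_function p ==> C1_fun (p :: real^3 => real)"
 by (induction rule: real_polynomial_function.induct)
  (auto intro: C1_fun_linear C1_fun_const C1_fun_add C1_fun_mult(1))

text \<open>Polynomials satisfy \<open>C1_fun\<close> and are uniformly dense in the continuous
  functions on the sphere by Stone-Weierstrass. This reduces the claim to continuous tests, where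
  both signs of \<open>g\<close> are treated by \<open>AE_nonneg_of_tests\<close>.\<close>

lemma AE_zero_of_tests:
 fixes g :: "real^3 => real"
 assumes g: "integrable sph g"
  and test: "\<And>ph. C1_fun ph ==> (SI y. ph y*g y) = 0"
 shows "AE y in sph. g y = 0"
proof -
 have zero: "(SI y. ph y*g y) = 0" if c: "continuous_on UNIV ph" for ph
 proof -
  let ?I = "SI y. ph y*g y"
  let ?N = "SI y. \<bar>g y\<bar>"
  have c2: "continuous_on S2 ph" using c by (rule continuous_on_subset) simp
  have "\<bar>?I\<bar> <= e*?N" if e: "e > 0" for e
  proof -
   obtain p where p: "real_polynomial_function p" "\<And>y. y \<in> S2 ==> \<bar>ph y - p y\<bar> < e"
    using Stone_Weierstrass_real_polynomial_function[OF compact_sphere c2 e] by auto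
   have C: "C1_fun p" by (rule C1_fun_polynomial[OF p(1)])
   have i: "integrable sph (\<lambda>y. ph y*g y)" "integrable sph (\<lambda>y. p y*g y)"
    by (intro integrable_cont_mult g c2 C1_fun_cont[OF C])+
   have "?I = ?I - (SI y. p y*g y)" using test[OF C] by simp
   also have "... = (SI y. ph y*g y - p y*g y)" using i by simp
   finally have "\<bar>?I\<bar> <= (SI y. \<bar>ph y*g y - p y*g y\<bar>)" by (metis integral_abs_bound)
   also have "... <= (SI y. e*\<bar>g y\<bar>)"
   proof (rule integral_mono)
    fix y assume "y \<in> space sph"
    hence "\<bar>ph y - p y\<bar> <= e" using p(2)[of y] by simp
    thus "\<bar>ph y*g y - p y*g y\<bar> <= e*\<bar>g y\<bar>"
     by (metis abs_ge_zero abs_mult left_diff_distrib mult_right_mono)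
   qed (use i g in auto)
   finally show ?thesis by simp
  qed
  hence "\<bar>?I\<bar> <= 0"
  proof (rule_tac field_le_epsilon)
   fix e :: real assume e: "e > 0" and *: "\<And>e. 0 < e ==> \<bar>?I\<bar> <= e*?N"
   have N: "?N \<ge> 0" by simp
   have "0 < e/(?N + 1)" using e N by (intro divide_pos_pos) linarith+
   hence "\<bar>?I\<bar> <= e/(?N + 1)*?N" by (rule *)
   also have "e/(n + 1)*n <= e" if "n \<ge> 0" for n using e that by (simp add: field_simps)
   note this[OF N]
   finally show "\<bar>?I\<bar> <= 0 + e" by simp
  qed
  thus ?thesis by simp
 qed
 have "AE y in sph. g y \<ge> 0" by (rule AE_nonneg_of_tests[OF g]) (use zero in auto)
 moreover have "AE y in sph. - g y \<ge> 0"
  by (rule AE_nonneg_of_tests) (use zero g in auto)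
 ultimately show ?thesis by eventually_elim auto
qed

lemma has_weak_grad_test:
 "has_weak_grad u g ==> C1_fun ph ==> (SI y. ph y *R g y) =
     - (SI y. u y *R tangential_grad ph y) + 2 *R (SI y. (u y*ph y) *R y)"
 unfolding has_weak_grad_def by blast

lemma has_weak_grad_unique:
 assumes "has_weak_grad u g" "has_weak_grad u g'"
 shows "AE y in sph. g y = g' y"
proof -
 have i: "integrable sph g" "integrable sph g'" using assms by (auto simp: has_weak_grad_def)
 have "AE y in sph. g y $ k - g' y $ k = 0" for k
 proof (rule AE_zero_of_tests)
  have ik: "integrable sph (\<lambda>y. g y $ k)" "integrable sph (\<lambda>y. g' y $ k)"
   using i by (auto intro: integrable_bounded_linear[OF bounded_linear_vec_nth])
  thus "integrable sph (\<lambda>y. g y $ k - g' y $ k)" by simp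
  fix ph assume C: "C1_fun ph"
  have ig: "integrable sph (\<lambda>y. ph y *R g y)" "integrable sph (\<lambda>y. ph y *R g' y)"
   by (intro integrable_mult_continuous i C1_fun_cont[OF C])+
  have "(SI y. ph y *R g y) = (SI y. ph y *R g' y)" 
   using has_weak_grad_test[OF assms(1) C] has_weak_grad_test[OF assms(2) C] by (rule trans[OF _ sym])
  hence "(SI y. ph y *R g y) $ k = (SI y. ph y *R g' y) $ k" by simp
  hence "(SI y. ph y*g y $ k) = (SI y. ph y*g' y $ k)"
   using integral_bounded_linear[OF bounded_linear_vec_nth ig(1), of k] integral_bounded_linear[OF bounded_linear_vec_nth ig(2), of k]
   by (simp only: vector_scaleR_component real_scaleR_def)
  thus "(SI y. ph y*(g y $ k - g' y $ k)) = 0"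
   using integrable_cont_mult[OF ik(1) C1_fun_cont(1)[OF C]] integrable_cont_mult[OF ik(2) C1_fun_cont(1)[OF C]]
   by (simp add: right_diff_distrib)
 qed
 hence "AE y in sph. \<forall>k. g y $ k - g' y $ k = 0" by (subst AE_all_countable) auto
 thus ?thesis by eventually_elim (simp add: vec_eq_iff)
qed

lemma has_weak_grad_weak_grad: "has_weak_grad u g ==> has_weak_grad u (weak_grad u)"
 unfolding weak_grad_def by (rule someI[of "has_weak_grad u"])

lemma has_weak_grad_cong_AE:
 assumes "has_weak_grad u g" "AE y in sph. u y = v y" and v: "v \<in> borel_measurable sph"
 shows "has_weak_grad v g"
 unfolding has_weak_grad_def
proof (intro conjI allI impI)
 have iu: "integrable sph u" using assms by (simp add: has_weak_grad_def)
 show "integrable sph v" using integrable_cong_AE[OF _ v assms(2)] iu by auto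
 show "integrable sph g" using assms by (simp add: has_weak_grad_def)
 fix ph assume C: "C1_fun ph"
 have um: "u \<in> borel_measurable sph" using iu by auto
 have [measurable]: "ph \<in> borel_measurable sph" "grad ph \<in> borel_measurable sph" "(\<lambda>y. y) \<in> borel_measurable sph"
  by (intro borel_measurable_sphere_cont C1_fun_cont[OF C] continuous_intros)+
 have 1: "(SI y. u y *R tangential_grad ph y) = (SI y. v y *R tangential_grad ph y)"
  unfolding tangential_grad_def by (rule integral_cong_AE) (use assms um in auto)
 have 2: "(SI y. (u y*ph y) *R y) = (SI y. (v y*ph y) *R y)"
  by (rule integral_cong_AE) (use assms um in auto)
 show "(SI y. ph y *R g y) = - (SI y. v y *R tangential_grad ph y) + 2 *R (SI y. (v y*ph y) *R y)"
  using has_weak_grad_test[OF assms(1) C] unfolding 1 2 .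
qed

lemma in_Lp_cong_AE:
 assumes "in_Lp p u" "AE y in sph. u y = v y" and v: "v \<in> borel_measurable sph"
 shows "in_Lp p v"
proof -
 have u: "u \<in> borel_measurable sph" using assms by (simp add: in_Lp_def)
 have e1: "esssup sph (\<lambda>y. ereal \<bar>u y\<bar>) = esssup sph (\<lambda>y. ereal \<bar>v y\<bar>)"
  by (rule esssup_AE_cong) (use assms u in \<open>auto elim!: eventually_mono\<close>)
 have e2: "integrable sph (\<lambda>y. \<bar>u y\<bar> powr enn2real p) \<longleftrightarrow> integrable sph (\<lambda>y. \<bar>v y\<bar> powr enn2real p)"
  by (rule integrable_cong_AE) (use assms u in \<open>auto elim!: eventually_mono\<close>)
 show ?thesis using assms(1) v unfolding in_Lp_def e1 e2 by blast
qed

lemma in_Sobolev_1_cong_AE: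
 assumes "in_Sobolev (Suc 0) p u" "AE y in sph. u y = v y" "v \<in> borel_measurable sph"
 shows "in_Sobolev (Suc 0) p v"
 using assms in_Lp_cong_AE[OF _ assms(2,3)] has_weak_grad_cong_AE[OF _ assms(2,3)] by auto

lemma has_weak_grad_nth_measurable:
 assumes "has_weak_grad u g"
 shows "(\<lambda>y. g y $ k) \<in> borel_measurable sph"
 using assms unfolding has_weak_grad_def by (intro borel_measurable_vec_nth) auto

text \<open>The Sobolev hypothesis speaks of some gradients, \<open>weak_grad\<close> of a chosen
  one. Uniqueness almost everywhere lets the chosen gradients inherit integrability and, at the next
  order, differentiability.\<close>

lemma in_Sobolev_2_weak_grad:
 assumes "in_Sobolev 2 p u"
 shows "in_Lp p u" "has_weak_grad u (weak_grad u)"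
  "in_Lp p (\<lambda>y. weak_grad u y $ k)" "has_weak_grad (\<lambda>y. weak_grad u y $ k) (weak_grad (\<lambda>y. weak_grad u y $ k))"
  "in_Lp p (\<lambda>y. weak_grad (\<lambda>y. weak_grad u y $ k) y $ m)"
proof -
 have s: "in_Lp p u \<and> (\<exists>g. has_weak_grad u g \<and> (\<forall>i. in_Sobolev (Suc 0) p (\<lambda>y. g y $ i)))"
  using assms unfolding numeral_2_eq_2 in_Sobolev.simps(2)[of "Suc 0"] by blast
 thus "in_Lp p u" by blast
 obtain g where g: "has_weak_grad u g" "\<And>i. in_Sobolev (Suc 0) p (\<lambda>y. g y $ i)" using s by blast
 show wg: "has_weak_grad u (weak_grad u)" by (rule has_weak_grad_weak_grad[OF g(1)])
 have ae: "AE y in sph. g y $ k = weak_grad u y $ k" for k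
  using has_weak_grad_unique[OF g(1) wg] by eventually_elim simp
 have S1: "in_Sobolev (Suc 0) p (\<lambda>y. weak_grad u y $ k)"
  by (rule in_Sobolev_1_cong_AE[OF g(2) ae has_weak_grad_nth_measurable[OF wg]])
 thus "in_Lp p (\<lambda>y. weak_grad u y $ k)" by simp
 obtain h where h: "has_weak_grad (\<lambda>y. weak_grad u y $ k) h" "\<And>i. in_Lp p (\<lambda>y. h y $ i)" using S1 by auto
 show wh: "has_weak_grad (\<lambda>y. weak_grad u y $ k) (weak_grad (\<lambda>y. weak_grad u y $ k))"
  by (rule has_weak_grad_weak_grad[OF h(1)])
 have "AE y in sph. h y $ m = weak_grad (\<lambda>y. weak_grad u y $ k) y $ m"
  using has_weak_grad_unique[OF h(1) wh] by eventually_elim simp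
 thus "in_Lp p (\<lambda>y. weak_grad (\<lambda>y. weak_grad u y $ k) y $ m)"
  by (rule in_Lp_cong_AE[OF h(2) _ has_weak_grad_nth_measurable[OF wh]])
qed

lemma esssup_sphere_nonneg: "0 <= esssup sph (\<lambda>y. ereal \<bar>u y\<bar>)"
proof -
 have "emeasure sph (space sph) ~= 0"
  using emeasure_sphere_open_pos[of UNIV "axis 1 1"] by simp
 hence "0 = esssup sph (\<lambda>y. 0::ereal)" by (simp add: esssup_const)
 also have "... <= esssup sph (\<lambda>y. ereal \<bar>u y\<bar>)" by (rule esssup_mono) auto
 finally show ?thesis .
qed

lemma AE_le_Lp_norm_inf:
 assumes "in_Lp \<infinity> u"
 shows "AE y in sph. \<bar>u y\<bar> <= Lp_norm \<infinity> u"
proof -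
 let ?E = "esssup sph (\<lambda>y. ereal \<bar>u y\<bar>)"
 have "?E < \<infinity>" using assms by (simp add: in_Lp_def)
 hence e: "ereal (real_of_ereal ?E) = ?E" using esssup_sphere_nonneg[of u] by (intro ereal_real') auto
 have "AE y in sph. ereal \<bar>u y\<bar> <= ?E" by (rule esssup_AE)
 hence "AE y in sph. ereal \<bar>u y\<bar> <= ereal (real_of_ereal ?E)" by (simp only: e)
 thus ?thesis by (simp add: Lp_norm_def)
qed

lemma Lp_norm_inf_le:
 assumes "u \<in> borel_measurable sph" "AE y in sph. \<bar>u y\<bar> <= c"
 shows "Lp_norm \<infinity> u <= c"
proof -
 let ?E = "esssup sph (\<lambda>y. ereal \<bar>u y\<bar>)"
 have "?E <= ereal c" using assms by (intro esssup_I) auto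
 thus ?thesis
  using esssup_sphere_nonneg[of u] by (cases ?E) (auto simp: Lp_norm_def)
qed

lemma Lp_norm_2:
 assumes "in_Lp 2 u"
 shows "u \<in> borel_measurable sph" "integrable sph (\<lambda>y. (u y)^2)" "(SI y. (u y)^2) = (Lp_norm 2 u)^2" "integrable sph u" "0 <= Lp_norm 2 u"
proof -
 have e: "enn2real 2 = 2" by simp
 have p: "\<bar>u y\<bar> powr 2 = (u y)^2" for y by (simp add: powr_numeral)
 have t: "(2::ennreal) ~= \<infinity>" by simp
 show m: "u \<in> borel_measurable sph" using assms by (simp add: in_Lp_def)
 show i: "integrable sph (\<lambda>y. (u y)^2)" using assms by (simp add: in_Lp_def p)
 have nn: "(SI y. (u y)^2) \<ge> 0" by simp
 have n: "Lp_norm 2 u = (SI y. (u y)^2) powr (1/2)" by (simp add: Lp_norm_def p)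
 show "(SI y. (u y)^2) = (Lp_norm 2 u)^2"
  unfolding n using nn by (simp add: powr_half_sqrt)
 show "0 <= Lp_norm 2 u" unfolding n by simp
 show "integrable sph u"
 proof (rule Bochner_Integration.integrable_bound)
  show "integrable sph (\<lambda>y. 1 + (u y)^2)" using i by simp
  show "AE y in sph. norm (u y) <= norm (1 + (u y)^2)"
  proof (intro AE_I2)
   fix y
   have "0 <= (\<bar>u y\<bar> - 1)^2" by simp
   hence "2*\<bar>u y\<bar> <= 1 + (u y)^2" by (simp add: power2_diff)
   thus "norm (u y) <= norm (1 + (u y)^2)" by simp
  qed
 qed (rule m)
qed

lemma Sobolev_norm_Suc_2_ge:
 shows "Lp_norm 2 u <= Sobolev_norm (Suc k) 2 u" "Sobolev_norm k 2 (\<lambda>y. weak_grad u y $ i) <= Sobolev_norm (Suc k) 2 u"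
proof -
 have sq: "a <= (a powr 2 + s) powr (1/2)" if "s \<ge> 0" "0 <= a" for a s :: real
 proof -
  have "a = sqrt (a powr 2)" using that by (simp add: powr_numeral)
  also have "... <= sqrt (a powr 2 + s)" using that by (intro real_sqrt_le_mono) auto
  finally show ?thesis using that by (simp add: powr_half_sqrt)
 qed
 have L0: "0 <= Lp_norm 2 v" for v by (simp add: Lp_norm_def)
 have S0: "0 <= Sobolev_norm k 2 v" for v by (cases k) (auto simp: L0)
 have n: "Sobolev_norm (Suc k) 2 u = (Lp_norm 2 u powr 2 + (\<Sum>i\<in>UNIV. Sobolev_norm k 2 (\<lambda>y. weak_grad u y $ i) powr 2)) powr (1/2)"
  by simp
 show "Lp_norm 2 u <= Sobolev_norm (Suc k) 2 u" unfolding n by (rule sq) (auto intro: sum_nonneg L0)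
 have "Sobolev_norm k 2 (\<lambda>y. weak_grad u y $ i) <= (Sobolev_norm k 2 (\<lambda>y. weak_grad u y $ i) powr 2 + (Lp_norm 2 u powr 2 + (\<Sum>j\<in>UNIV-{i}. Sobolev_norm k 2 (\<lambda>y. weak_grad u y $ j) powr 2))) powr (1/2)"
  by (rule sq) (auto intro!: sum_nonneg add_nonneg_nonneg S0)
 also have "... = Sobolev_norm (Suc k) 2 u" unfolding n
  by (subst (2) sum.remove[of _ i]) (auto simp: algebra_simps)
 finally show "Sobolev_norm k 2 (\<lambda>y. weak_grad u y $ i) <= Sobolev_norm (Suc k) 2 u" .
qed

lemma Sobolev_norm_Suc_inf_ge:
 shows "Lp_norm \<infinity> u <= Sobolev_norm (Suc k) \<infinity> u" "Sobolev_norm k \<infinity> (\<lambda>y. weak_grad u y $ i) <= Sobolev_norm (Suc k) \<infinity> u"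
 by (auto intro!: max.coboundedI2 Max_ge)

text \<open>The first and second derivatives of \<open>u\<close> along the rotation fields, with the bounds
 inherited from its Sobolev norms.\<close>

definition rot_data :: "(real^3 => real) => (real^3 => real^3) => (3 => real^3 => real^3) => real => real => bool" where
 "rot_data u a b M Q \<longleftrightarrow> has_weak_rot u a \<and> (\<forall>k. has_weak_rot (\<lambda>y. a y $ k) (b k)) \<and>
  (AE y in sph. \<bar>u y\<bar> <= M) \<and> (\<forall>k. AE y in sph. \<bar>a y $ k\<bar> <= M) \<and> (\<forall>k m. AE y in sph. \<bar>b k y $ m\<bar> <= M) \<and>
  (\<forall>k. integrable sph (\<lambda>y. (a y $ k)^2) \<and> (SI y. (a y $ k)^2) <= Q^2) \<and>
  (\<forall>k m. integrable sph (\<lambda>y. (b k y $ m)^2) \<and> (SI y. (b k y $ m)^2) <= Q^2)"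

text \<open>Sup bound and square bound are carried together, because each operation used below
  multiplies both by the same factor.\<close>

definition MQ_bound :: "(real^3 => real) => real => real => bool" where
 "MQ_bound w M Q \<longleftrightarrow> w \<in> borel_measurable sph \<and> (AE y in sph. \<bar>w y\<bar> <= M) \<and>
  integrable sph (\<lambda>y. (w y)^2) \<and> (SI y. (w y)^2) <= Q^2"

lemma MQ_bound_mono:
 assumes "MQ_bound w M Q" "M <= M'" "0 <= Q" "Q <= Q'"
 shows "MQ_bound w M' Q'"
proof -
 have "Q^2 <= Q'^2" using assms by (intro power_mono) auto
 thus ?thesis using assms unfolding MQ_bound_def by (auto elim!: eventually_mono intro: order_trans)
qed

lemma MQ_bound_times:
 assumes "MQ_bound w M Q" "continuous_on S2 c" "\<And>y. y \<in> S2 ==> \<bar>c y\<bar> <= 1"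
 shows "MQ_bound (\<lambda>y. c y*w y) M Q"
proof -
 have w: "w \<in> borel_measurable sph" "AE y in sph. \<bar>w y\<bar> <= M" "integrable sph (\<lambda>y. (w y)^2)" "(SI y. (w y)^2) <= Q^2"
  using assms by (auto simp: MQ_bound_def)
 have c: "c \<in> borel_measurable sph" by (rule borel_measurable_sphere_cont[OF assms(2)])
 have ab: "\<bar>c y*w y\<bar> <= \<bar>w y\<bar>" if "y \<in> S2" for y
  using assms(3)[OF that] by (simp add: abs_mult mult_left_le_one_le)
 have sq: "(c y*w y)^2 <= (w y)^2" if "y \<in> S2" for y
  using ab[OF that] by (simp only: abs_le_square_iff)
 have i: "integrable sph (\<lambda>y. (c y*w y)^2)"
  by (rule Bochner_Integration.integrable_bound[OF w(3)]) (use sq c w in auto)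
 have "(SI y. (c y*w y)^2) <= (SI y. (w y)^2)"
  by (rule integral_mono[OF i w(3)]) (use sq in auto)
 moreover have "AE y in sph. \<bar>c y*w y\<bar> <= M"
  using w(2) by (rule AE_mp) (use ab in \<open>fastforce intro!: AE_I2\<close>)
 ultimately show ?thesis using i w c by (auto simp: MQ_bound_def)
qed

lemma MQ_bound_diff:
 assumes "MQ_bound v M Q" "MQ_bound w M Q"
 shows "MQ_bound (\<lambda>y. v y - w y) (2*M) (2*Q)"
proof -
 have v: "v \<in> borel_measurable sph" "AE y in sph. \<bar>v y\<bar> <= M" "integrable sph (\<lambda>y. (v y)^2)" "(SI y. (v y)^2) <= Q^2"
 and w: "w \<in> borel_measurable sph" "AE y in sph. \<bar>w y\<bar> <= M" "integrable sph (\<lambda>y. (w y)^2)" "(SI y. (w y)^2) <= Q^2"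
  using assms by (auto simp: MQ_bound_def)
 have sq: "(v y - w y)^2 <= 2*(v y)^2 + 2*(w y)^2" for y
  using zero_le_power2[of "v y + w y"] unfolding power2_sum power2_diff by linarith
 have i2: "integrable sph (\<lambda>y. 2*(v y)^2 + 2*(w y)^2)" using v w by auto
 have i: "integrable sph (\<lambda>y. (v y - w y)^2)"
  by (rule Bochner_Integration.integrable_bound[OF i2]) (use sq v w in auto)
 have "(SI y. (v y - w y)^2) <= (SI y. 2*(v y)^2 + 2*(w y)^2)"
  by (rule integral_mono[OF i i2]) (use sq in auto)
 also have "... = 2*(SI y. (v y)^2) + 2*(SI y. (w y)^2)" using v w by simp
 also have "... <= (2*Q)^2" using v w by (simp add: power_mult_distrib)
 finally have "(SI y. (v y - w y)^2) <= (2*Q)^2" .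
 moreover have "AE y in sph. \<bar>v y - w y\<bar> <= 2*M" using v(2) w(2) by eventually_elim linarith
 ultimately show ?thesis using i v w by (auto simp: MQ_bound_def)
qed

lemma MQ_bound_minus: "MQ_bound w M Q ==> MQ_bound (\<lambda>y. - w y) M Q"
 by (simp add: MQ_bound_def)

lemma MQ_bound_add:
 assumes "MQ_bound v M Q" "MQ_bound w M Q"
 shows "MQ_bound (\<lambda>y. v y + w y) (2*M) (2*Q)"
 using MQ_bound_diff[OF assms(1) MQ_bound_minus[OF assms(2)]] by simp

lemma MQ_bound_Sobolev:
 assumes "in_Lp \<infinity> w" "in_Lp 2 w" "Lp_norm \<infinity> w <= M" "Lp_norm 2 w <= Q"
 shows "MQ_bound w M Q"
proof -
 have "MQ_bound w (Lp_norm \<infinity> w) (Lp_norm 2 w)"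
  using Lp_norm_2[OF assms(2)] AE_le_Lp_norm_inf[OF assms(1)] by (simp add: MQ_bound_def)
 thus ?thesis using assms Lp_norm_2(5)[OF assms(2)] by (auto intro: MQ_bound_mono)
qed

lemma abs_nth_S2: "y \<in> S2 ==> \<bar>y $ k\<bar> <= (1::real)"
 using component_le_norm_cart[of y k] by simp

lemma MQ_bound_coord: "MQ_bound w M Q ==> MQ_bound (\<lambda>y. y $ k*w y) M Q"
 by (rule MQ_bound_times) (auto simp: abs_nth_S2 intro: continuous_intros)

lemma MQ_bound_cross:
 assumes "\<And>i. MQ_bound (\<lambda>y. v y $ i) M Q"
 shows "MQ_bound (\<lambda>y. cross3 y (v y) $ m) (2*M) (2*Q)"
proof -
 have A: "MQ_bound (\<lambda>y. y $ p * v y $ q - y $ r * v y $ s) (2*M) (2*Q)" for p q r s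
  by (intro MQ_bound_diff MQ_bound_coord assms)
 show ?thesis
  using exhaust_3[of m] A[of 2 3 3 2] A[of 3 1 1 3] A[of 1 2 2 1]
  by (auto simp: cross_components mult.commute)
qed

text \<open>The factor 8 is three doublings: the two terms in a component of a cross product, the
  two terms of the product rule, and the difference of two such expressions in
  \<open>B\<close>.\<close>

lemma rot_data_exists:
 assumes S2u: "in_Sobolev 2 2 u" and Siu: "in_Sobolev 2 \<infinity> u"
 shows "\<exists>a b. rot_data u a b (8*Sobolev_norm 2 \<infinity> u) (8*Sobolev_norm 2 2 u)"
proof -
 let ?M = "Sobolev_norm 2 \<infinity> u" and ?Q = "Sobolev_norm 2 2 u"
 let ?g = "weak_grad u" and ?h = "\<lambda>k. weak_grad (\<lambda>y. weak_grad u y $ k)"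
 note p2 = in_Sobolev_2_weak_grad[OF S2u] and pinf = in_Sobolev_2_weak_grad[OF Siu]
 have b0: "MQ_bound u ?M ?Q"
  unfolding numeral_2_eq_2
  by (intro MQ_bound_Sobolev pinf p2 Sobolev_norm_Suc_inf_ge(1) Sobolev_norm_Suc_2_ge(1))
 have b1: "MQ_bound (\<lambda>y. ?g y $ k) ?M ?Q" for k
  unfolding numeral_2_eq_2
  by (intro MQ_bound_Sobolev pinf p2 order_trans[OF _ Sobolev_norm_Suc_inf_ge(2)[of "Suc 0" _ k]] order_trans[OF _ Sobolev_norm_Suc_2_ge(2)[of "Suc 0" _ k]])
   (rule Sobolev_norm_Suc_inf_ge(1) Sobolev_norm_Suc_2_ge(1))+
 have b2: "MQ_bound (\<lambda>y. ?h k y $ m) ?M ?Q" for k m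
 proof -
  have 1: "Lp_norm \<infinity> (\<lambda>y. ?h k y $ m) <= Sobolev_norm (Suc 0) \<infinity> (\<lambda>y. ?g y $ k)"
   using Sobolev_norm_Suc_inf_ge(2)[of 0 "\<lambda>y. ?g y $ k" m] by (simp only: Sobolev_norm.simps(1))
  have 2: "Lp_norm 2 (\<lambda>y. ?h k y $ m) <= Sobolev_norm (Suc 0) 2 (\<lambda>y. ?g y $ k)"
   using Sobolev_norm_Suc_2_ge(2)[of 0 "\<lambda>y. ?g y $ k" m] by (simp only: Sobolev_norm.simps(1))
  show ?thesis unfolding numeral_2_eq_2
   by (intro MQ_bound_Sobolev pinf p2 order_trans[OF 1 Sobolev_norm_Suc_inf_ge(2)] order_trans[OF 2 Sobolev_norm_Suc_2_ge(2)])
 qed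
 have Q0: "?Q \<ge> 0" using order_trans[OF Lp_norm_2(5)[OF p2(1)] Sobolev_norm_Suc_2_ge(1)[of u "Suc 0"]] by (simp only: numeral_2_eq_2)
 have M0: "?M \<ge> 0"
 proof (rule ccontr)
  assume "\<not> ?M \<ge> 0"
  hence "AE y in sph. False" using b0 unfolding MQ_bound_def by (auto elim!: eventually_mono)
  hence "emeasure sph (space sph) = 0" by (simp add: eventually_False ae_filter_eq_bot_iff)
  thus False using emeasure_sphere_open_pos[of UNIV "axis 1 1"] by simp
 qed
 define a where "a y = cross3 y (?g y)" for y
 \<comment> \<open>Product rule for \<open>y $ p * ?g y $ q - y $ q * ?g y $ p\<close>; these
   differences are the components of \<open>cross3 y (?g y)\<close>.\<close>
 define B where "B p q y = (y $ p *R cross3 y (?h q y) + ?g y $ q *R cross3 y (axis p 1)) - (y $ q *R cross3 y (?h p y) + ?g y $ p *R cross3 y (axis q 1))" for p q :: 3 and y :: "real^3"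
 define b :: "3 => real^3 => real^3" where "b k = (if k = 1 then B 2 3 else if k = 2 then B 3 1 else B 1 2)" for k
 have ra: "has_weak_rot u a" unfolding a_def by (rule has_weak_grad_imp_rot[OF p2(2)])
 have rB: "has_weak_rot (\<lambda>y. y $ p*?g y $ q - y $ q*?g y $ p) (B p q)" for p q
  unfolding B_def by (intro has_weak_rot_diff has_weak_rot_mult_coord has_weak_grad_imp_rot p2)
 have rb: "has_weak_rot (\<lambda>y. a y $ k) (b k)" for k
  using exhaust_3[of k] rB[of 2 3] rB[of 3 1] rB[of 1 2]
  by (auto simp: a_def b_def cross_components mult.commute)
 have BB: "MQ_bound (\<lambda>y. B p q y $ m) (8*?M) (8*?Q)" for p q m
 proof -
  have t1: "MQ_bound (\<lambda>y. y $ p*cross3 y (?h q y) $ m) (2*?M) (2*?Q)" for p q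
   by (intro MQ_bound_coord MQ_bound_cross b2)
  have t2: "MQ_bound (\<lambda>y. cross3 y (axis p 1) $ m*?g y $ q) (2*?M) (2*?Q)" for p q
  proof (rule MQ_bound_mono[OF MQ_bound_times[OF b1]])
   show "continuous_on S2 (\<lambda>y. cross3 y (axis p 1) $ m)" by (intro continuous_intros continuous_on_cross)
   fix y :: "real^3" assume "y \<in> S2"
   thus "\<bar>cross3 y (axis p 1) $ m\<bar> <= 1"
    using component_le_norm_cart[of "cross3 y (axis p 1)" m] norm_cross3_le[of y "axis p 1"] by simp
  qed (use Q0 M0 in auto)
  have "MQ_bound (\<lambda>y. (y $ p*cross3 y (?h q y) $ m + cross3 y (axis p 1) $ m*?g y $ q) - (y $ q*cross3 y (?h p y) $ m + cross3 y (axis q 1) $ m*?g y $ p)) (2*(2*(2*?M))) (2*(2*(2*?Q)))"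
   by (intro MQ_bound_diff MQ_bound_add t1 t2)
  thus ?thesis by (simp add: B_def mult.commute)
 qed
 have Bb: "MQ_bound (\<lambda>y. b k y $ m) (8*?M) (8*?Q)" for k m
  unfolding b_def using BB[of 2 3 m] BB[of 3 1 m] BB[of 1 2 m] by presburger
 have Ba: "MQ_bound (\<lambda>y. a y $ m) (8*?M) (8*?Q)" for m
  unfolding a_def by (rule MQ_bound_mono[OF MQ_bound_cross[OF b1]]) (use Q0 M0 in auto)
 have Bu: "MQ_bound u (8*?M) (8*?Q)" by (rule MQ_bound_mono[OF b0]) (use Q0 M0 in auto)
 have "rot_data u a b (8*?M) (8*?Q)"
  using ra rb Bb Ba Bu unfolding rot_data_def MQ_bound_def by blast
 thus ?thesis by blast
qed

section \<open>Degree-zero extensions and the flux through a Voronoi edge\<close>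

text \<open>For fixed \<open>t\<close>, the point \<open>ga th s\<close> has the gnomonic
  coordinates \<open>xi th\<close> and \<open>t*s/X th\<close>, where \<open>X th\<close> is its
  component along \<open>a\<close>. The Jacobian of this change of variables is at least
  \<open>t*(1 - t)/4\<close>, because \<open>X th <= 1\<close> and
  \<open>xi' th >= (1 - t)/4\<close>. The coordinates stay in \<open>[-2, 2]\<close>, where the
  gnomonic density is at least \<open>1/27\<close>. This gives \<open>108 = 4*27\<close>.\<close>

lemma nn_integral_edge_average:
 fixes Q :: "real^3 => ennreal"
 assumes fr: "frame3 a b n" and [measurable]: "Q \<in> borel_measurable borel"
  and rho: "1/2 <= rh" "rh <= 1" and delta: "0 <= de" "de <= 1" and t: "0 < t" "t < 1"
  and E: "al < be" "-1 <= al" "be <= 1"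
 defines "ga \<equiv> \<lambda>th s. (1 - t) *R (cos th *R a + sin th *R b) + t *R (rh *R a + s *R n)"
 shows "(NL th. (NL s. Q (rp (ga th s))*indicator {-de..de} s)*indicator {al..be} th)
  <= ennreal (108/(t*(1 - t)))*(NI y. Q y)"
proof -
 let ?E = "\<lambda>th. NL s. Q (rp (ga th s))*indicator {-de..de} s"
 let ?w = "\<lambda>x y. ennreal (1/(sqrt (1 + x^2 + y^2))^3)"
 let ?Q = "\<lambda>x y. Q (rp (a + x *R b + y *R n))"
 define X where "X th = (1 - t)*cos th + t*rh" for th
 define xi where "xi th = (1 - t) * sin th/X th" for th
 define xi' where "xi' th = (1 - t)*((1 - t) + t*rh*cos th)/(X th)^2" for th
 define G where "G x = (NL y. ?Q x y*indicator {-2..2} y)" for x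
 have [measurable]: "X \<in> borel_measurable borel" unfolding X_def by measurable
 hence [measurable]: "xi \<in> borel_measurable borel" "xi' \<in> borel_measurable borel" unfolding xi_def xi'_def by measurable
 have Gm [measurable]: "G \<in> borel_measurable borel" unfolding G_def[abs_def] by measurable
 have cosb: "1/2 <= cos th" "cos th <= 1" if "th \<in> {al..be}" for th
 proof -
  have "\<bar>th\<bar> <= 1" using that E by auto
  hence "cos 1 <= cos \<bar>th\<bar>" using pi_gt3 by (intro cos_monotone_0_pi_le) auto
  moreover have "1/2 <= cos (1::real)"
  proof -
   have "cos (pi/3) <= cos (1::real)" using pi_gt3 by (intro cos_monotone_0_pi_le) auto
   thus ?thesis by (simp add: cos_60)
  qed
  ultimately show "1/2 <= cos th" by simp
 qed simp
 have Xb: "1/2 <= X th" "X th <= 1" if "th \<in> {al..be}" for th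
 proof -
  have "(1-t)*(1/2) + t*(1/2) <= X th" unfolding X_def
   using cosb[OF that] rho t by (intro add_mono mult_left_mono) auto
  thus "1/2 <= X th" by (simp add: field_simps)
  have "X th <= (1-t)*1 + t*1" unfolding X_def
   using cosb[OF that] rho t by (intro add_mono mult_left_mono) auto
  thus "X th <= 1" by simp
 qed
 have inner: "?E th <= ennreal (1/t)*G (xi th)"
  if th: "th \<in> {al..be}" for th
 proof -
  have X0: "X th > 0" using Xb[OF th] by linarith
  have c: "X th/t ~= 0" using X0 t by auto
  have g: "rp (ga th (0 + X th/t*y)) = rp (a + xi th *R b + y *R n)" for y
  proof -
   have "ga th (0 + X th/t*y) = X th *R (a + xi th *R b + y *R n)"
   proof -
    have e1: "X th*xi th = (1-t) * sin th" "t*(0 + X th/t*y) = X th*y" using X0 t by (auto simp: xi_def)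
    have "ga th (0 + X th/t*y) = X th *R a + ((1-t) * sin th) *R b + (t*(0 + X th/t*y)) *R n"
     unfolding ga_def X_def by (simp add: scaleR_add_right scaleR_add_left)
    thus ?thesis unfolding e1(1)[symmetric] e1(2) by (simp add: scaleR_add_right)
   qed
   thus ?thesis using radial_proj_scale[OF X0] by simp
  qed
  have [measurable]: "(\<lambda>s. ga th s) \<in> borel_measurable borel" unfolding ga_def by measurable
  have "?E th
   = ennreal \<bar>X th/t\<bar>*(NL y. Q (rp (ga th (0 + X th/t*y)))*indicator {-de..de} (0 + X th/t*y))"
   by (rule nn_integral_real_affine[OF _ c]) measurable
  also have "... <= ennreal (1/t)*G (xi th)"
   unfolding G_def g
  proof (intro mult_mono nn_integral_mono)
   show "ennreal \<bar>X th/t\<bar> <= ennreal (1/t)" using Xb[OF th] t X0 by (intro ennreal_leI) (auto simp: divide_right_mono)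
   fix y :: real
   have "y \<in> {-2..2}" if "0 + X th/t*y \<in> {-de..de}"
   proof -
    have "\<bar>X th/t*y\<bar> <= 1" using that delta by auto
    hence "\<bar>X th*y\<bar> <= t" using t by (simp add: abs_mult field_simps)
    hence "X th*\<bar>y\<bar> <= 1" using t X0 by (simp add: abs_mult)
    moreover have "(1/2)*\<bar>y\<bar> <= X th*\<bar>y\<bar>" using Xb[OF th] by (intro mult_right_mono) auto
    ultimately show ?thesis by auto
   qed
   thus "(indicator {-de..de} (0 + X th/t*y) :: ennreal) <= indicator {-2..2} y"
    by (auto simp: indicator_def)
  qed auto
  finally show ?thesis .
 qed
 have dxi: "(xi has_real_derivative xi' th) (at th)" if th: "th \<in> {al..be}" for th
 proof -
  have X0: "X th ~= 0" using Xb[OF th] by linarith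
  have "(xi has_real_derivative ((1-t)*cos th*X th - (1-t) * sin th*((1-t)*(- sin th)))/(X th*X th)) (at th)"
   unfolding xi_def[abs_def] X_def using X0[unfolded X_def]
   by (auto intro!: derivative_eq_intros)
  moreover have "(1-t)*cos th*X th - (1-t) * sin th*((1-t)*(- sin th)) = (1 - t)*((1 - t)*((cos th)^2 + (sin th)^2) + t*rh*cos th)"
   unfolding X_def power2_eq_square by algebra
  ultimately show ?thesis by (simp add: xi'_def power2_eq_square)
 qed
 have contX: "continuous_on A X" for A unfolding X_def by (intro continuous_intros)
 have cont': "continuous_on {al..be} xi'"
  unfolding xi'_def using Xb by (intro continuous_intros contX) (fastforce simp:)
 have low: "(1 - t)/4 <= xi' th" if th: "th \<in> {al..be}" for th
 proof -
  have "1/2*(1/2) <= rh*cos th" using cosb[OF th] rho by (intro mult_mono) auto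
  hence "t*(1/2*(1/2)) <= t*(rh*cos th)" using t by (intro mult_left_mono) auto
  hence 1: "1/4 <= (1 - t) + t*rh*cos th" using t unfolding mult.assoc by linarith
  have "(X th)^2 <= 1" "(X th)^2 > 0" using Xb[OF th] by (auto simp: power_le_one)
  hence "(1 - t)/4*(X th)^2 <= (1 - t)/4" using t by (intro mult_right_le_one_le) auto
  also have "... <= (1 - t)*((1 - t) + t*rh*cos th)" using 1 t mult_left_mono[OF 1, of "1-t"] by simp
  finally show ?thesis unfolding xi'_def using \<open>(X th)^2 > 0\<close> by (simp add: pos_le_divide_eq)
 qed
 have xib: "\<bar>xi th\<bar> <= 2" if th: "th \<in> {al..be}" for th
 proof -
  have "\<bar>(1 - t) * sin th\<bar> <= 1*1" unfolding abs_mult using t by (intro mult_mono) auto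
  also have "... <= 2*X th" using Xb[OF th] by simp
  finally show ?thesis using Xb[OF th] by (simp add: xi_def abs_mult divide_le_eq)
 qed
 have "(NL th. ?E th*indicator {al..be} th)
   <= (NL th. ennreal (4/(t*(1-t)))*(G (xi th)*ennreal (xi' th)*indicator {al..be} th))"
 proof (intro nn_integral_mono)
  fix th :: real
  show "?E th*indicator {al..be} th
   <= ennreal (4/(t*(1-t)))*(G (xi th)*ennreal (xi' th)*indicator {al..be} th)"
  proof (cases "th \<in> {al..be}")
   case True
   have "1/t <= 4/(t*(1-t))*xi' th"
   proof -
    have "1/t = (1 - t)/(t*(1-t))" using t by simp
    also have "... <= (4*xi' th)/(t*(1-t))" using low[OF True] t by (intro divide_right_mono) auto
    finally show ?thesis by simp
   qed
   hence "ennreal (1/t) <= ennreal (4/(t*(1-t)))*ennreal (xi' th)"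
    using t by (subst ennreal_mult'[symmetric]) (auto intro!: ennreal_leI)
   hence "ennreal (1/t)*G (xi th) <= ennreal (4/(t*(1-t)))*ennreal (xi' th)*G (xi th)"
    by (intro mult_right_mono) auto
   with inner[OF True] show ?thesis using True by (simp add: mult_ac)
  qed simp
 qed
 also have "... = ennreal (4/(t*(1-t)))*(NL th. G (xi th)*ennreal (xi' th)*indicator {al..be} th)"
  by (rule nn_integral_cmult) measurable
 also have "(NL th. G (xi th)*ennreal (xi' th)*indicator {al..be} th) = (NL x. G x*indicator {xi al..xi be} x)"
  by (rule nn_integral_substitution_aux[symmetric, OF Gm _ dxi cont'])
   (use low t E in \<open>auto intro: order_trans[of 0 "(1-t)/4"]\<close>)
 also have "... <= (NL x. NL y. 27*(?Q x y*?w x y))"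
 proof (intro nn_integral_mono)
  fix x :: real
  show "G x*indicator {xi al..xi be} x <= (NL y. 27*(?Q x y*?w x y))"
  proof (cases "x \<in> {xi al..xi be}")
   case True
   hence x2: "\<bar>x\<bar> <= 2" using xib[of al] xib[of be] E by auto
   have "G x <= (NL y. 27*(?Q x y*?w x y))"
    unfolding G_def
   proof (intro nn_integral_mono)
    fix y :: real
    show "?Q x y*indicator {-2..2} y <= 27*(?Q x y*?w x y)"
    proof (cases "y \<in> {-2..2}")
     case y: True
     have "x^2 <= 2^2" "y^2 <= 2^2" using x2 y power_mono[of "\<bar>x\<bar>" 2 2] power_mono[of "\<bar>y\<bar>" 2 2] by auto
     hence "sqrt (1 + x^2 + y^2) <= sqrt 9" by (intro real_sqrt_le_mono) auto
     hence "sqrt (1 + x^2 + y^2) <= 3" by (simp add: real_sqrt_unique[of 3 9])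
     hence "(sqrt (1 + x^2 + y^2))^3 <= 3^3" by (intro power_mono) auto
     moreover have pos: "(sqrt (1 + x^2 + y^2))^3 > 0"
      by (intro zero_less_power) (smt (verit) real_sqrt_gt_zero zero_le_power2)
     ultimately have "1 <= 27*(1/(sqrt (1 + x^2 + y^2))^3)" by (simp add: field_simps)
     hence "ennreal 1 <= ennreal (27*(1/(sqrt (1 + x^2 + y^2))^3))" by (rule ennreal_leI)
     also have "... = ennreal 27*?w x y" by (rule ennreal_mult') simp
     finally have "?Q x y*1 <= ?Q x y*(ennreal 27*?w x y)"
      by (intro mult_left_mono) auto
     thus ?thesis using y by (simp add: mult_ac)
    qed simp
   qed
   thus ?thesis using True by simp
  qed simp
 qed
 also have "... = 27*(NL x. NL y. ?Q x y*?w x y)"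
  by (simp add: nn_integral_cmult)
 also have "... = 27*(NI y. Q y*indicator {y. y \<bullet> a > 0} y)"
  by (simp add: nn_integral_gnomonic[OF fr])
 also have "... <= 27*(NI y. Q y)"
  by (intro mult_left_mono nn_integral_mono) (auto simp: indicator_def)
 also have "ennreal (4/(t*(1-t)))*(27*(NI y. Q y)) = (ennreal (4/(t*(1-t)))*ennreal 27)*(NI y. Q y)"
  by (simp add: mult.assoc)
 also have "ennreal (4/(t*(1-t)))*ennreal 27 = ennreal (108/(t*(1 - t)))"
  using t by (subst ennreal_mult'[symmetric]) auto
 finally show ?thesis by (simp add: mult_left_mono)
qed

section \<open>Derivatives of degree-zero extensions and the estimate for one edge\<close>

lemma cross3_inner: "cross3 x y \<bullet> cross3 z w = (x \<bullet> z)*(y \<bullet> w) - (x \<bullet> w)*(y \<bullet> (z::real^3))"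
 by (simp add: cross3_def inner_vec_def sum_3 algebra_simps)

lemma radial_proj_has_derivative:
 assumes y: "y ~= 0"
 shows "(rp has_derivative (\<lambda>w. w /\<^sub>R norm y - ((y \<bullet> w)/norm y^3) *R y)) (at y)"
proof -
 have n: "(norm has_derivative (\<lambda>w. (y \<bullet> w)/norm y)) (at y)"
  by (rule has_derivative_eq_rhs[OF has_derivative_norm[OF y]]) (simp add: sgn_div_norm fun_eq_iff inner_commute divide_inverse)
 have ny: "norm y ~= 0" using y by simp
 have "((\<lambda>y. inverse (norm y)) has_derivative (\<lambda>w. - (inverse (norm y)*((y \<bullet> w)/norm y)*inverse (norm y)))) (at y)"
  by (rule Deriv.has_derivative_inverse[OF ny n])
 from has_derivative_scaleR[OF this has_derivative_ident]
 show ?thesis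
  unfolding radial_proj_def[abs_def]
  by (rule has_derivative_eq_rhs) (use ny in \<open>auto simp: fun_eq_iff field_simps power3_eq_cube\<close>)
qed

text \<open>The extension is constant along rays, so its derivative sees only the tangential part of
  the gradient, and this part is determined by the rotation derivative at
  \<open>rp y\<close>.\<close>

lemma degree_zero_derivative:
 assumes C: "C1_fun f" and y: "y ~= 0"
 shows "((\<lambda>y. f (rp y)) has_derivative (\<lambda>w. (cross3 (rp y) (grad f (rp y)) \<bullet> cross3 y w)/(norm y)^2)) (at y)"
proof (rule has_derivative_eq_rhs[OF has_derivative_compose[OF radial_proj_has_derivative[OF y] C1_fun_has_derivative[OF C]]], intro ext)
 fix w
 have ny: "norm y ~= 0" using y by simp
 let ?G = "grad f (rp y)"
 have 1: "rp y \<bullet> y = norm y" using ny by (simp add: radial_proj_def power2_norm_eq_inner[symmetric] power2_eq_square)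
 have 2: "rp y \<bullet> w = (y \<bullet> w)/norm y" by (simp add: radial_proj_def divide_inverse mult.commute)
 have "cross3 (rp y) ?G \<bullet> cross3 y w = norm y*(?G \<bullet> w) - (y \<bullet> w)/norm y*(?G \<bullet> y)"
  unfolding cross3_inner 1 2 ..
 show "?G \<bullet> (w /\<^sub>R norm y - (y \<bullet> w/norm y^3) *R y) = (cross3 (rp y) ?G \<bullet> cross3 y w)/(norm y)^2"
  unfolding \<open>cross3 (rp y) ?G \<bullet> cross3 y w = _\<close>
  using ny by (simp add: inner_diff_right field_simps power2_eq_square power3_eq_cube)
qed

text \<open>\<open>l\<close> and \<open>m\<close> collect the first and second rotation derivatives
  of \<open>u\<close>. The identities are required at every point of space; mollified functions
  satisfy them there because \<open>zint_rot\<close> holds for all \<open>x\<close>.\<close>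

definition rot_smooth :: "(real^3 => real) => (real^3 => real^3) => (3 => real^3 => real^3) => bool" where
 "rot_smooth u l m \<longleftrightarrow> C1_fun u \<and> (\<forall>x. cross3 x (grad u x) = l x) \<and>
  (\<forall>k. C1_fun (\<lambda>x. l x $ k)) \<and> (\<forall>k x. cross3 x (grad (\<lambda>x. l x $ k) x) = m k x)"

text \<open>The constants are those of \<open>dirv_deriv_bound\<close>: for
  \<open>norm y >= 1/2\<close> the factor \<open>1/(norm y)^2\<close> is at most 4, and the two
  terms with \<open>l\<close> contribute \<open>4 + 8 = 12\<close>.\<close>

definition rot_size :: "(real^3 => real^3) => (3 => real^3 => real^3) => real^3 => real" where
 "rot_size l m x = 4*(\<Sum>k\<in>UNIV. norm (m k x)) + 12*norm (l x)"

text \<open>The derivative at \<open>y\<close> in direction \<open>n\<close> of the degree-zero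
  extension of a function whose rotation derivative is \<open>l\<close>.\<close>

definition dirv :: "(real^3 => real^3) => real^3 => real^3 => real" where
 "dirv l n y = (l (rp y) \<bullet> cross3 y n)/(norm y)^2"

lemma rot_smooth_cont:
 assumes "rot_smooth u l m"
 shows "continuous_on A l" "continuous_on A (m k)" "continuous_on A (rot_size l m)"
proof -
 have lk: "continuous_on A (\<lambda>x. l x $ k)" for A k using assms C1_fun_cont(1) unfolding rot_smooth_def by blast
 have "continuous_on A (\<lambda>x. \<chi> k. l x $ k)" for A by (intro continuous_on_vec_lambda lk)
 thus l: "continuous_on A l" for A by simp
 have mk: "m k = (\<lambda>x. cross3 x (grad (\<lambda>x. l x $ k) x))" for k using assms by (auto simp: rot_smooth_def)
 show m: "continuous_on A (m k)" for k
  unfolding mk using assms by (intro continuous_on_cross continuous_intros C1_fun_cont) (auto simp: rot_smooth_def)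
 show "continuous_on A (rot_size l m)" unfolding rot_size_def by (intro continuous_intros l m)
qed

lemma rot_size_nonneg: "0 <= rot_size l m x"
 unfolding rot_size_def by (intro add_nonneg_nonneg mult_nonneg_nonneg sum_nonneg) auto

lemma rot_smooth_deriv:
 assumes "rot_smooth u l m" "y ~= 0"
 shows "((\<lambda>y. u (rp y)) has_derivative (\<lambda>w. dirv l w y)) (at y)"
 using degree_zero_derivative[of u y] assms unfolding rot_smooth_def dirv_def by simp

lemma dirv_deriv:
 assumes "rot_smooth u l m" "y ~= 0"
 shows "(dirv l n has_derivative (\<lambda>w.
  (\<Sum>k\<in>UNIV. (m k (rp y) \<bullet> cross3 y w)/(norm y)^2*(cross3 y n $ k))/(norm y)^2
  + (l (rp y) \<bullet> cross3 w n)/(norm y)^2 - 2*(y \<bullet> w)*(l (rp y) \<bullet> cross3 y n)/norm y^4)) (at y)"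
proof -
 have ny: "norm y ~= 0" "(norm y)^2 ~= 0" using assms by auto
 have lk: "((\<lambda>y. l (rp y) $ k) has_derivative (\<lambda>w. (m k (rp y) \<bullet> cross3 y w)/(norm y)^2)) (at y)" for k
  using degree_zero_derivative[of "\<lambda>x. l x $ k" y] assms unfolding rot_smooth_def by simp
 have ck: "((\<lambda>y. cross3 y n $ k) has_derivative (\<lambda>w. cross3 w n $ k)) (at y)" for k
 proof (rule bounded_linear_imp_has_derivative)
  have "linear (\<lambda>y. cross3 y n $ k)" by (intro linearI) (simp_all add: cross_add_left cross_mult_left)
  thus "bounded_linear (\<lambda>y. cross3 y n $ k)" by (simp add: linear_conv_bounded_linear)
 qed
 have sq: "((\<lambda>y::real^3. (norm y)^2) has_derivative (\<lambda>w. 2*(y \<bullet> w))) (at y)"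
  unfolding power2_norm_eq_inner by (auto intro!: derivative_eq_intros simp: inner_commute)
 have num: "((\<lambda>y. \<Sum>k\<in>UNIV. l (rp y) $ k*cross3 y n $ k) has_derivative
  (\<lambda>w. \<Sum>k\<in>UNIV. l (rp y) $ k*cross3 w n $ k + (m k (rp y) \<bullet> cross3 y w)/(norm y)^2*cross3 y n $ k)) (at y)"
  by (intro has_derivative_sum has_derivative_mult lk ck)
 have d: "dirv l n = (\<lambda>y. (\<Sum>k\<in>UNIV. l (rp y) $ k*cross3 y n $ k)/(norm y)^2)"
  by (simp add: fun_eq_iff dirv_def inner_vec_def)
 show ?thesis
  unfolding d
 proof (rule has_derivative_eq_rhs[OF has_derivative_divide[OF num sq ny(2)]], intro ext)
  fix w
  show "- (\<Sum>k\<in>UNIV. l (rp y) $ k*cross3 y n $ k)*(inverse ((norm y)^2)*(2*(y \<bullet> w))*inverse ((norm y)^2)) +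
    (\<Sum>k\<in>UNIV. l (rp y) $ k*cross3 w n $ k + m k (rp y) \<bullet> cross3 y w/(norm y)^2*cross3 y n $ k)/(norm y)^2 =
    (\<Sum>k\<in>UNIV. m k (rp y) \<bullet> cross3 y w/(norm y)^2*cross3 y n $ k)/(norm y)^2 +
    l (rp y) \<bullet> cross3 w n/(norm y)^2 - 2*(y \<bullet> w)*(l (rp y) \<bullet> cross3 y n)/norm y^4"
  proof -
   have a: "norm y^4 = (norm y)^2*(norm y)^2" by (simp add: power2_eq_square power4_eq_xxxx)
   have b: "(\<Sum>k\<in>UNIV. l (rp y) $ k*c $ k) = l (rp y) \<bullet> c" for c by (simp add: inner_vec_def)
   have ai: "inverse (norm y^4) = inverse ((norm y)^2)*inverse ((norm y)^2)" unfolding a by (rule inverse_mult_distrib)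
   show ?thesis unfolding sum.distrib b using ny by (simp add: add_divide_distrib divide_inverse ai algebra_simps del: inverse_mult_distrib power_inverse)
  qed
 qed
qed

lemma dirv_deriv_bound:
 assumes "norm n = 1" "1/2 <= norm y"
 shows "\<bar>(\<Sum>k\<in>UNIV. (m k (rp y) \<bullet> cross3 y w)/(norm y)^2*(cross3 y n $ k))/(norm y)^2
  + (l (rp y) \<bullet> cross3 w n)/(norm y)^2 - 2*(y \<bullet> w)*(l (rp y) \<bullet> cross3 y n)/norm y^4\<bar>
  <= norm w*rot_size l m (rp y)"
proof -
 let ?r = "norm y"
 have r: "?r > 0" using assms by linarith
 have i: "1/?r^2 <= 4"
 proof -
  have "(1/2)^2 <= ?r^2" using assms by (intro power_mono) auto
  thus ?thesis using r by (simp add: field_simps power2_eq_square)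
 qed
 have cn: "\<bar>cross3 y n $ k\<bar> <= ?r" for k
  using component_le_norm_cart[of "cross3 y n" k] norm_cross3_le[of y n] assms by simp
 have t1: "\<bar>(\<Sum>k\<in>UNIV. (m k (rp y) \<bullet> cross3 y w)/?r^2*(cross3 y n $ k))/?r^2\<bar> <= 4*norm w*(\<Sum>k\<in>UNIV. norm (m k (rp y)))"
 proof -
  have "\<bar>(m k (rp y) \<bullet> cross3 y w)/?r^2*(cross3 y n $ k)\<bar> <= (norm (m k (rp y))*(?r*norm w))/?r^2*?r" for k
  proof -
   have "\<bar>m k (rp y) \<bullet> cross3 y w\<bar> <= norm (m k (rp y))*(?r*norm w)"
    by (rule order_trans[OF Cauchy_Schwarz_ineq2 mult_left_mono[OF norm_cross3_le]]) simp
   thus ?thesis using cn[of k] unfolding abs_mult abs_divide abs_power2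
    by (intro mult_mono divide_right_mono) auto
  qed
  also have "(norm (m k (rp y))*(?r*norm w))/?r^2*?r = norm (m k (rp y))*norm w" for k
   using r by (simp add: power2_eq_square)
  finally have "\<bar>\<Sum>k\<in>UNIV. (m k (rp y) \<bullet> cross3 y w)/?r^2*(cross3 y n $ k)\<bar> <= (\<Sum>k\<in>UNIV. norm (m k (rp y))*norm w)"
   by (intro order_trans[OF sum_abs] sum_mono)
  hence "\<bar>\<Sum>k\<in>UNIV. (m k (rp y) \<bullet> cross3 y w)/?r^2*(cross3 y n $ k)\<bar>*(1/?r^2) <= (\<Sum>k\<in>UNIV. norm (m k (rp y))*norm w)*4"
   using i by (intro mult_mono) (auto intro: sum_nonneg)
  thus ?thesis by (simp add: sum_distrib_left mult_ac)
 qed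
 have t2: "\<bar>(l (rp y) \<bullet> cross3 w n)/?r^2\<bar> <= 4*norm w*norm (l (rp y))"
 proof -
  have "\<bar>l (rp y) \<bullet> cross3 w n\<bar> <= norm (l (rp y))*(norm w*norm n)"
   by (rule order_trans[OF Cauchy_Schwarz_ineq2 mult_left_mono[OF norm_cross3_le]]) simp
  hence "\<bar>l (rp y) \<bullet> cross3 w n\<bar>*(1/?r^2) <= norm (l (rp y))*(norm w*norm n)*4"
   using i by (intro mult_mono) auto
  thus ?thesis using assms by (simp add: mult_ac)
 qed
 have t3: "\<bar>2*(y \<bullet> w)*(l (rp y) \<bullet> cross3 y n)/?r^4\<bar> <= 8*norm w*norm (l (rp y))"
 proof -
  have "\<bar>l (rp y) \<bullet> cross3 y n\<bar> <= norm (l (rp y))*(?r*norm n)"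
   by (rule order_trans[OF Cauchy_Schwarz_ineq2 mult_left_mono[OF norm_cross3_le]]) simp
  hence "\<bar>2*(y \<bullet> w)*(l (rp y) \<bullet> cross3 y n)\<bar> <= 2*(?r*norm w)*(norm (l (rp y))*(?r*norm n))"
   unfolding abs_mult using Cauchy_Schwarz_ineq2[of y w] by (intro mult_mono) auto
  also have "... = (2*norm w*norm (l (rp y)))*?r^2" using assms by (simp add: power2_eq_square)
  finally have "\<bar>2*(y \<bullet> w)*(l (rp y) \<bullet> cross3 y n)\<bar>/?r^4 <= (2*norm w*norm (l (rp y)))*?r^2/?r^4"
   by (intro divide_right_mono) auto
  also have "... = (2*norm w*norm (l (rp y)))*(1/?r^2)" using r by (simp add: power2_eq_square power4_eq_xxxx)
  also have "... <= (2*norm w*norm (l (rp y)))*4" using i by (intro mult_left_mono) auto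
  finally show ?thesis by (simp add: abs_mult)
 qed
 have tri: "\<bar>x + y - z\<bar> <= X + Y + Z" if "\<bar>x\<bar> <= X" "\<bar>y\<bar> <= Y" "\<bar>z\<bar> <= Z" for x y z X Y Z :: real
  using that by linarith
 have "norm w*rot_size l m (rp y) = 4*norm w*(\<Sum>k\<in>UNIV. norm (m k (rp y))) + 4*norm w*norm (l (rp y)) + 8*norm w*norm (l (rp y))"
  unfolding rot_size_def by (simp add: distrib_left)
 thus ?thesis using tri[OF t1 t2 t3] by simp
qed

text \<open>Fundamental theorem of calculus along the segment. The bound is phrased as a nonnegative
  integral over the whole line so that the order of integration can be exchanged freely in
  \<open>edge_estimate\<close>.\<close>

lemma dirv_segment_bound:
 assumes sm: "rot_smooth u l m" and n: "norm n = 1"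
  and seg: "\<And>t. 0 <= t ==> t <= 1 ==> 1/2 <= norm ((1 - t) *R z + t *R s)"
  and H: "norm (s - z) <= H"
 shows "ennreal \<bar>dirv l n s - dirv l n z\<bar> <= (NL t. ennreal (H*rot_size l m (rp ((1 - t) *R z + t *R s)))*indicator {0..1} t)"
proof -
 define ga where "ga t = (1 - t) *R z + t *R s" for t
 have ga0: "ga t ~= 0" if "t \<in> {0..1}" for t using seg[of t] that by (auto simp: ga_def)
 have cga: "continuous_on A ga" for A unfolding ga_def by (intro continuous_intros)
 define D where "D y w = (\<Sum>k\<in>UNIV. (m k (rp y) \<bullet> cross3 y w)/(norm y)^2*(cross3 y n $ k))/(norm y)^2
  + (l (rp y) \<bullet> cross3 w n)/(norm y)^2 - 2*(y \<bullet> w)*(l (rp y) \<bullet> cross3 y n)/norm y^4" for y w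
 have crp: "continuous_on {0..1} (\<lambda>t. rp (ga t))"
  unfolding radial_proj_def using ga0 by (intro continuous_intros cga) auto
 have cq: "continuous_on {0..1} (\<lambda>t. H*rot_size l m (rp (ga t)))"
  by (intro continuous_intros continuous_on_compose2[OF rot_smooth_cont(3)[OF sm] crp]) auto
 have der: "((\<lambda>t. dirv l n (ga t)) has_vector_derivative D (ga t) (s - z)) (at t within {0..1})" if t: "t \<in> {0..1}" for t
 proof -
  have 1: "(dirv l n has_derivative D (ga t)) (at (ga t))"
   unfolding D_def by (rule dirv_deriv[OF sm ga0[OF t]])
  have 2: "(ga has_derivative (\<lambda>h. h *R (s - z))) (at t within {0..1})"
   unfolding ga_def[abs_def] by (auto intro!: derivative_eq_intros simp: algebra_simps)
  have lin: "linear (D (ga t))" using 1 by (rule has_derivative_linear)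
  have "((\<lambda>t. dirv l n (ga t)) has_derivative (\<lambda>h. D (ga t) (h *R (s - z)))) (at t within {0..1})"
   by (rule has_derivative_compose[OF 2 1])
  thus ?thesis unfolding has_vector_derivative_def linear_scale[OF lin] .
 qed
 have FTC: "((\<lambda>t. D (ga t) (s - z)) has_integral (dirv l n (ga 1) - dirv l n (ga 0))) {0..1}"
  by (rule fundamental_theorem_of_calculus[OF _ der]) auto
 have H0: "0 <= H" using H norm_ge_zero order_trans by blast
 have bnd: "norm (D (ga t) (s - z)) <= H*rot_size l m (rp (ga t))" if t: "t \<in> {0..1}" for t
 proof -
  have "1/2 <= norm (ga t)" using seg[of t] t by (simp add: ga_def)
  from dirv_deriv_bound[OF n this, of m "s - z" l]
  have "norm (D (ga t) (s - z)) <= norm (s - z)*rot_size l m (rp (ga t))" unfolding D_def by simp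
  also have "... <= H*rot_size l m (rp (ga t))" by (intro mult_right_mono H rot_size_nonneg)
  finally show ?thesis .
 qed
 have iq: "(\<lambda>t. H*rot_size l m (rp (ga t))) integrable_on {0..1}"
  by (rule integrable_continuous_real[OF cq])
 have "norm (integral {0..1} (\<lambda>t. D (ga t) (s - z))) <= integral {0..1} (\<lambda>t. H*rot_size l m (rp (ga t)))"
  by (rule integral_norm_bound_integral[OF _ iq bnd]) (use FTC in blast)
 hence le: "\<bar>dirv l n s - dirv l n z\<bar> <= integral {0..1} (\<lambda>t. H*rot_size l m (rp (ga t)))"
  using integral_unique[OF FTC] by (simp add: ga_def)
 have "ennreal (integral {0..1} (\<lambda>t. H*rot_size l m (rp (ga t)))) = (NL t. ennreal (indicator {0..1} t*(H*rot_size l m (rp (ga t)))))"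
  by (rule nn_integral_has_integral_lebesgue[symmetric, OF _ integrable_integral[OF iq]]) (use H0 rot_size_nonneg in auto)
 also have "... = (NL t. ennreal (H*rot_size l m (rp (ga t)))*indicator {0..1} t)"
  by (intro nn_integral_cong) (auto simp: indicator_def)
 finally show ?thesis using ennreal_leI[OF le] unfolding ga_def by simp
qed

lemma ennreal_power2_le_imp:
 assumes "x^2 <= ennreal (r^2)" "0 <= r"
 shows "x <= ennreal r"
proof (cases x)
 case (real y)
 hence "y^2 <= r^2" using assms by (simp add: ennreal_power)
 hence "y <= r" using assms(2) by (rule power2_le_imp_le)
 thus ?thesis using real by (simp add: ennreal_leI)
next
 case top
 thus ?thesis using assms by (simp add: top_power_ennreal top_unique)
qed

text \<open>The exact value is \<open>pi\<close>. Splitting at \<open>1/2\<close>, where one of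
  \<open>sqrt t\<close> and \<open>sqrt (1 - t)\<close> is at least \<open>1/2\<close>, reduces it
  to integrals of \<open>t powr (-1/2)\<close> and costs a larger constant.\<close>

lemma nn_integral_inverse_sqrt:
 "(NL t. ennreal (1 / sqrt (t*(1 - t)))*indicator {0<..<1} t) <= ennreal 8"
proof -
 define f where "f t = ennreal (indicator {0..1} t*(t powr (-1/2)))" for t :: real
 have fm [measurable]: "f \<in> borel_measurable borel" unfolding f_def by measurable
 have base: "(NL t. f t) = ennreal 2"
  unfolding f_def
 proof (rule nn_integral_has_integral_lebesgue)
  show "((\<lambda>t. t powr (-1/2)) has_integral (2::real)) {0..1}"
   using has_integral_powr_from_0[of "-1/2" 1] by simp
 qed simp
 have refl: "(NL t. f (1 + -1*t)) = ennreal 2"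
 proof -
  have "(NL t. f t) = ennreal \<bar>-1\<bar>*(NL t. f (1 + -1*t))"
   by (rule nn_integral_real_affine[OF fm]) simp
  also have "ennreal \<bar>-1\<bar> = 1" by simp
  finally show ?thesis unfolding base by (metis mult_1)
 qed
 have "(NL t. ennreal (1 / sqrt (t*(1 - t)))*indicator {0<..<1} t)
  <= (NL t. ennreal 2*(f t + f (1 + -1*t)))"
 proof (intro nn_integral_mono)
  fix t :: real
  show "ennreal (1 / sqrt (t*(1 - t)))*indicator {0<..<1} t
   <= ennreal 2*(f t + f (1 + -1*t))"
  proof (cases "t \<in> {0<..<1}")
   case True
   have pw: "x powr (-1/2) = 1 / sqrt x" if "x > 0" for x :: real
    using powr_minus_divide[of x "1/2"] that by (simp add: powr_half_sqrt)
   have h: "1 / sqrt (x*y) <= 2*(1 / sqrt x)" if "x > 0" "y \<ge> 1/2" for x y :: real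
   proof -
    have "1/2 <= sqrt y" using that by (intro real_le_rsqrt) (auto simp: power2_eq_square)
    hence "1 / sqrt y <= 2" using that by (simp add: field_simps)
    hence "1 / sqrt x*(1 / sqrt y) <= 1 / sqrt x*2" using that by (intro mult_left_mono) auto
    thus ?thesis by (simp add: real_sqrt_mult)
   qed
   have gen: "x <= 2*(a + b)" if "x <= 2*a" "0 <= b" for x a b :: real using that by simp
   have nn: "0 <= 1 / sqrt t" "0 <= 1 / sqrt (1 - t)" using True by auto
   have "1 / sqrt (t*(1 - t)) <= 2*(1 / sqrt t + 1 / sqrt (1 - t))"
   proof (cases "t <= 1/2")
    case True
    hence "1 / sqrt (t*(1 - t)) <= 2*(1 / sqrt t)" using \<open>t \<in> {0<..<1}\<close> by (intro h) auto
    thus ?thesis by (rule gen) (rule nn(2))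
   next
    case False
    hence "1 / sqrt ((1 - t)*t) <= 2*(1 / sqrt (1 - t))" using \<open>t \<in> {0<..<1}\<close> by (intro h) auto
    thus ?thesis unfolding mult.commute[of "1 - t"] add.commute[of "1 / sqrt t"] by (rule gen) (rule nn(1))
   qed
   hence "ennreal (1 / sqrt (t*(1 - t))) <= ennreal (2*(1 / sqrt t + 1 / sqrt (1 - t)))" by (rule ennreal_leI)
   also have "... = ennreal 2*(ennreal (1 / sqrt t) + ennreal (1 / sqrt (1 - t)))"
    using nn by (simp only: ennreal_mult' ennreal_plus zero_le_numeral)
   finally have "ennreal (1 / sqrt (t*(1 - t))) <= ennreal 2*(ennreal (1 / sqrt t) + ennreal (1 / sqrt (1 - t)))" .
   moreover have "f t = ennreal (1 / sqrt t)" "f (1 + -1*t) = ennreal (1 / sqrt (1 - t))"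
    using True pw[of t] pw[of "1 - t"] by (auto simp: f_def)
   ultimately show ?thesis using True by simp
  qed simp
 qed
 also have "... = ennreal 2*(ennreal 2 + ennreal 2)"
  by (subst nn_integral_cmult, measurable, subst nn_integral_add, measurable) (simp only: base refl)
 also have "... = ennreal 8" by (simp add: ennreal_mult'[symmetric] ennreal_plus[symmetric] del: ennreal_plus ennreal_numeral)
 finally show ?thesis .
qed

lemma abs_integral_le_nn_integral:
 fixes f :: "real => real"
 assumes "continuous_on {a..b} f"
 shows "ennreal \<bar>integral {a..b} f\<bar> <= (NL x. ennreal \<bar>f x\<bar>*indicator {a..b} x)"
proof -
 have c: "continuous_on {a..b} (\<lambda>x. \<bar>f x\<bar>)" by (intro continuous_intros assms)
 have i: "(\<lambda>x. \<bar>f x\<bar>) integrable_on {a..b}" by (rule integrable_continuous_real[OF c])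
 have "\<bar>integral {a..b} f\<bar> <= integral {a..b} (\<lambda>x. \<bar>f x\<bar>)"
  using integral_norm_bound_integral[OF integrable_continuous_real[OF assms] i] by simp
 hence "ennreal \<bar>integral {a..b} f\<bar> <= ennreal (integral {a..b} (\<lambda>x. \<bar>f x\<bar>))" by (rule ennreal_leI)
 also have "... = (NL x. ennreal (indicator {a..b} x*\<bar>f x\<bar>))"
  by (rule nn_integral_has_integral_lebesgue[symmetric, OF _ integrable_integral[OF i]]) simp
 also have "... = (NL x. ennreal \<bar>f x\<bar>*indicator {a..b} x)"
  by (intro nn_integral_cong) (auto simp: indicator_def)
 finally show ?thesis .
qed

text \<open>The integral of \<open>dirv l n\<close> over the chord is the difference of
  \<open>u\<close> at its ends. Hence the expression inside the square is the double integral, over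
  edge and chord, of the differences of \<open>dirv l n\<close> at \<open>z th\<close> and
  \<open>s ta\<close>. Each difference is at most \<open>H\<close> times the integral of
  \<open>rot_size\<close> along the joining segment. At fixed \<open>t\<close>, Cauchy-Schwarz and
  \<open>nn_integral_edge_average\<close> bound the double integral by a multiple of
  \<open>1 / sqrt (t*(1 - t))\<close>; integrating in \<open>t\<close> costs 8, and
  \<open>6912 = 8^2*108\<close>.\<close>

lemma edge_estimate:
 assumes sm: "rot_smooth u l m" and fr: "frame3 a b n"
  and rd: "rh^2 + de^2 = 1" "1/2 <= rh" "0 < de"
  and E: "al < be" "-1 <= al" "be <= 1"
 defines "z \<equiv> \<lambda>th. cos th *R a + sin th *R b"
 defines "s \<equiv> \<lambda>ta. rh *R a + ta *R n"
 assumes A: "A \<in> sets borel"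
  and H: "\<And>th ta. al <= th ==> th <= be ==> \<bar>ta\<bar> <= de ==> norm (s ta - z th) <= H"
  and nA: "\<And>th ta t. al <= th ==> th <= be ==> \<bar>ta\<bar> <= de ==> 0 <= t ==> t <= 1 ==> rp ((1 - t) *R z th + t *R s ta) \<in> A"
  and nh: "\<And>th ta t. al <= th ==> th <= be ==> \<bar>ta\<bar> <= de ==> 0 <= t ==> t <= 1 ==> 1/2 <= norm ((1 - t) *R z th + t *R s ta)"
 shows "(2*de*integral {al..be} (\<lambda>th. dirv l n (z th)) - (be - al)*(u (rp (s de)) - u (rp (s (-de)))))^2
  <= 6912*H^2*(2*de)*(be - al)*(SI y. (rot_size l m y)^2*indicator A y)"
proof -
 let ?M = "lborel \<Otimes>\<^sub>M lborel :: (real \<times> real) measure"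
 let ?V = "dirv l n"
 let ?q = "rot_size l m"
 let ?I = "SI y. (?q y)^2*indicator A y"
 define ga where "ga t th ta = (1 - t) *R z th + t *R s ta" for t th ta
 have n1: "norm n = 1" using fr by (simp add: frame3_def)
 have "de^2 <= 1" "rh^2 <= 1" using rd(1) zero_le_power2[of rh] zero_le_power2[of de] by linarith+
 hence d1: "de <= 1" and r1: "rh <= 1" using power2_le_imp_le[of de 1] power2_le_imp_le[of rh 1] by simp_all
 have cz: "continuous_on B z" and cs: "continuous_on B s" for B unfolding z_def s_def by (intro continuous_intros)+
 have [measurable]: "?q \<in> borel_measurable borel"
  using rot_smooth_cont(3)[OF sm] by (intro borel_measurable_continuous_onI)
 have [measurable]: "z \<in> borel_measurable borel" "s \<in> borel_measurable borel"
  using cz cs by (auto intro: borel_measurable_continuous_onI)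
 have [measurable]: "A \<in> sets borel" by fact
 have s0: "s ta ~= 0" if "\<bar>ta\<bar> <= de" for ta using nh[of al ta 1] E that by auto
 have z0: "z th ~= 0" if "al <= th" "th <= be" for th using nh[of th 0 0] that rd by auto
 have cV: "continuous_on (- {0}) ?V"
  using dirv_deriv[OF sm] by (intro continuous_at_imp_continuous_on ballI has_derivative_continuous) auto
 have cVz: "continuous_on {al..be} (\<lambda>th. ?V (z th))" and cVs: "continuous_on {-de..de} (\<lambda>ta. ?V (s ta))"
  using z0 s0 by (auto intro!: continuous_on_compose2[OF cV] cz cs)
 have chord: "integral {-de..de} (\<lambda>ta. ?V (s ta)) = u (rp (s de)) - u (rp (s (-de)))"
 proof (rule integral_unique, rule fundamental_theorem_of_calculus)
  show "-de <= de" using rd by simp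
  fix ta assume "ta \<in> {-de..de}"
  hence "s ta ~= 0" by (intro s0) auto
  have lin: "linear (\<lambda>w. dirv l w (s ta))" using rot_smooth_deriv[OF sm \<open>s ta ~= 0\<close>] by (rule has_derivative_linear)
  have "(s has_derivative (\<lambda>h. h *R n)) (at ta within {-de..de})"
   unfolding s_def by (auto intro!: derivative_eq_intros)
  from has_derivative_compose[OF this rot_smooth_deriv[OF sm \<open>s ta ~= 0\<close>]]
  show "((\<lambda>ta. u (rp (s ta))) has_vector_derivative ?V (s ta)) (at ta within {-de..de})"
   unfolding has_vector_derivative_def linear_scale[OF lin] .
 qed
 define J where "J = integral {-de..de} (\<lambda>ta. ?V (s ta))"
 define Ph where "Ph = integral {al..be} (\<lambda>th. 2*de*?V (z th) - J)"
 have Ph: "Ph = 2*de*integral {al..be} (\<lambda>th. ?V (z th)) - (be - al)*(u (rp (s de)) - u (rp (s (-de))))"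
  unfolding Ph_def J_def chord using E
  by (subst Henstock_Kurzweil_Integration.integral_diff) (auto intro!: integrable_continuous_real continuous_intros cVz)
 define P where "P = 108*?I*(be - al)*(2*de)"
 have I0: "?I \<ge> 0" by (intro integral_nonneg_AE AE_I2) auto
 have P0: "P \<ge> 0" unfolding P_def using I0 E rd by auto
 have H0: "H \<ge> 0" using H[of al 0] E rd by (auto intro: order_trans[OF norm_ge_zero])
 have Ieq: "(NI y. ennreal ((?q y)^2)*indicator A y) = ennreal ?I"
 proof -
  have "integrable sph (\<lambda>y. (?q y)^2)" by (intro continuous_S2_integrable continuous_intros rot_smooth_cont[OF sm])
  hence "integrable sph (\<lambda>y. (?q y)^2*indicator A y)"
   by (rule Bochner_Integration.integrable_bound) (auto simp: indicator_def)
  hence "(NI y. ennreal ((?q y)^2*indicator A y)) = ennreal ?I"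
   by (intro nn_integral_eq_integral AE_I2) auto
  moreover have "(NI y. ennreal ((?q y)^2)*indicator A y) = (NI y. ennreal ((?q y)^2*indicator A y))"
   by (intro nn_integral_cong) (auto simp: indicator_def)
  ultimately show ?thesis by simp
 qed
 let ?ith = "\<lambda>th::real. indicator {al..be} th :: ennreal" and ?ita = "\<lambda>ta::real. indicator {-de..de} ta :: ennreal"
 define Y where "Y t = (NL th. NL ta. ennreal (?q (rp (ga t th ta)))*(?ith th*?ita ta))" for t
 have [measurable]: "(\<lambda>p. ga (f p) (g p) (h p)) \<in> borel_measurable N"
  if [measurable]: "f \<in> borel_measurable N" "g \<in> borel_measurable N" "h \<in> borel_measurable N" for f g h :: "'c => real" and N
  unfolding ga_def by measurable
 \<comment> \<open>Cauchy-Schwarz in all three variables at once would meet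
   \<open>1/(t*(1 - t))\<close>, which is not integrable on \<open>(0, 1)\<close>. Applied at fixed
   \<open>t\<close>, it leaves only the square root of this function.\<close>
 have Ybound: "Y t <= ennreal (sqrt P*(1 / sqrt (t*(1 - t))))" if t: "t \<in> {0<..<1}" for t
 proof (rule ennreal_power2_le_imp)
  let ?F = "\<lambda>p. ennreal (?q (rp (ga t (fst p) (snd p))))*(?ith (fst p)*?ita (snd p))"
  let ?G = "\<lambda>p::real\<times>real. ?ith (fst p)*?ita (snd p)"
  have Fm: "?F \<in> borel_measurable ?M" by measurable
  have Gm: "?G \<in> borel_measurable ?M" by measurable
  have F2m: "(\<lambda>p. (?F p)^2) \<in> borel_measurable ?M" by measurable
  have G2m: "(\<lambda>p. (?G p)^2) \<in> borel_measurable ?M" by measurable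
  have "Y t = (\<integral>\<^sup>+p. ?F p \<partial>?M)"
   unfolding Y_def using lborel.nn_integral_fst[OF Fm] by simp
  also have "... = (\<integral>\<^sup>+p. ?F p*?G p \<partial>?M)"
   by (intro nn_integral_cong) (auto simp: indicator_def)
  finally have "(Y t)^2 <= (\<integral>\<^sup>+p. (?F p)^2 \<partial>?M)*(\<integral>\<^sup>+p. (?G p)^2 \<partial>?M)"
   using Cauchy_Schwarz_nn_integral[OF Fm Gm] by simp
  also have "(\<integral>\<^sup>+p. (?G p)^2 \<partial>?M) = ennreal ((be - al)*(2*de))"
  proof -
   have "(\<integral>\<^sup>+p. (?G p)^2 \<partial>?M) = (\<integral>\<^sup>+p. indicator ({al..be} \<times> {-de..de}) p \<partial>?M)"
    by (intro nn_integral_cong) (auto simp: indicator_def)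
   also have "... = ennreal (be - al)*ennreal (2*de)"
    using E rd by (simp add: lborel.emeasure_pair_measure_Times)
   finally show ?thesis using E rd by (simp add: ennreal_mult')
  qed
  also have "(\<integral>\<^sup>+p. (?F p)^2 \<partial>?M) <= ennreal (108/(t*(1 - t)))*ennreal ?I"
  proof -
   let ?Q = "\<lambda>y. ennreal ((?q y)^2)*indicator A y"
   have "(\<integral>\<^sup>+p. (?F p)^2 \<partial>?M) = (NL th. NL ta. (?F (th, ta))^2)"
    by (rule lborel.nn_integral_fst[OF F2m, symmetric])
   also have "... <= (NL th. (NL ta. ?Q (rp (ga t th ta))*?ita ta)*?ith th)"
   proof (intro nn_integral_mono)
    fix th :: real
    show "(NL ta. (?F (th, ta))^2) <= (NL ta. ?Q (rp (ga t th ta))*?ita ta)*?ith th"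
    proof (cases "th \<in> {al..be}")
     case True
     have "(NL ta. (?F (th, ta))^2) <= (NL ta. ?Q (rp (ga t th ta))*?ita ta)"
     proof (intro nn_integral_mono)
      fix ta :: real
      show "(?F (th, ta))^2 <= ?Q (rp (ga t th ta))*?ita ta"
       using nA[of th ta t] True t rot_size_nonneg[of l m] unfolding ga_def[symmetric]
       by (cases "ta \<in> {-de..de}") (auto simp: ennreal_power)
     qed
     thus ?thesis using True by simp
    qed simp
   qed
   also have "... <= ennreal (108/(t*(1 - t)))*(NI y. ?Q y)"
    unfolding ga_def z_def s_def
    by (rule nn_integral_edge_average[OF fr]) (use rd d1 r1 t E in auto)
   finally show ?thesis unfolding Ieq .
  qed
  also have "ennreal (108/(t*(1 - t)))*ennreal ?I*ennreal ((be - al)*(2*de)) = ennreal ((sqrt P*(1 / sqrt (t*(1 - t))))^2)"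
  proof -
   have tt: "0 < t*(1 - t)" using t by auto
   have "(sqrt P*(1 / sqrt (t*(1 - t))))^2 = P/(t*(1 - t))"
    using P0 tt by (simp add: power_mult_distrib power_divide)
   also have "... = 108/(t*(1 - t))*?I*((be - al)*(2*de))" by (simp add: P_def)
   finally have e: "(sqrt P*(1 / sqrt (t*(1 - t))))^2 = 108/(t*(1 - t))*?I*((be - al)*(2*de))" .
   have nn: "0 <= 108/(t*(1 - t))" using tt by simp
   show ?thesis unfolding e using nn I0 by (simp only: ennreal_mult' mult_nonneg_nonneg)
  qed
  finally show "(Y t)^2 <= ennreal ((sqrt P*(1 / sqrt (t*(1 - t))))^2)" by (simp add: mult_right_mono)
  show "0 <= sqrt P*(1 / sqrt (t*(1 - t)))" using P0 t by auto
 qed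
 let ?K = "\<lambda>th ta t. ennreal H*(ennreal (?q (rp (ga t th ta)))*(?ith th*?ita ta))*indicator {0..1} t"
 have "ennreal \<bar>Ph\<bar> <= (NL th. ennreal \<bar>2*de*?V (z th) - J\<bar>*?ith th)"
  unfolding Ph_def by (intro abs_integral_le_nn_integral continuous_intros cVz)
 also have "... <= (NL th. NL ta. NL t. ?K th ta t)"
 proof (intro nn_integral_mono)
  fix th :: real
  show "ennreal \<bar>2*de*?V (z th) - J\<bar>*?ith th <= (NL ta. NL t. ?K th ta t)"
  proof (cases "th \<in> {al..be}")
   case True
   have c: "continuous_on {-de..de} (\<lambda>ta. ?V (s ta) - ?V (z th))" by (intro continuous_intros cVs)
   have "integral {-de..de} (\<lambda>ta. ?V (s ta) - ?V (z th)) = J - 2*de*?V (z th)"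
    unfolding J_def using rd
    by (subst Henstock_Kurzweil_Integration.integral_diff) (auto intro!: integrable_continuous_real cVs)
   hence "ennreal \<bar>2*de*?V (z th) - J\<bar> = ennreal \<bar>integral {-de..de} (\<lambda>ta. ?V (s ta) - ?V (z th))\<bar>"
    by (simp only: abs_minus_commute)
   also have "... <= (NL ta. ennreal \<bar>?V (s ta) - ?V (z th)\<bar>*?ita ta)"
    by (rule abs_integral_le_nn_integral[OF c])
   also have "... <= (NL ta. NL t. ?K th ta t)"
   proof (intro nn_integral_mono)
    fix ta :: real
    show "ennreal \<bar>?V (s ta) - ?V (z th)\<bar>*?ita ta <= (NL t. ?K th ta t)"
    proof (cases "ta \<in> {-de..de}")
     case tau: True
     have "ennreal \<bar>?V (s ta) - ?V (z th)\<bar> <= (NL t. ennreal (H*?q (rp ((1 - t) *R z th + t *R s ta)))*indicator {0..1} t)"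
      using True tau by (intro dirv_segment_bound[OF sm n1] nh H) auto
     also have "... = (NL t. ?K th ta t)"
      using True tau H0 by (intro nn_integral_cong) (simp add: ga_def ennreal_mult' rot_size_nonneg)
     finally show ?thesis using tau by simp
    qed simp
   qed
   finally show ?thesis using True by simp
  qed simp
 qed
 also have "... = (NL th. NL t. NL ta. ?K th ta t)"
  by (intro nn_integral_cong lborel_pair.Fubini') measurable
 also have "... = (NL t. NL th. NL ta. ?K th ta t)"
  by (rule lborel_pair.Fubini') measurable
 also have "... = (NL t. ennreal H*Y t*indicator {0..1} t)"
  unfolding Y_def by (simp add: nn_integral_cmult nn_integral_multc)
 also have "... <= (NL t. ennreal (H * sqrt P)*(ennreal (1 / sqrt (t*(1 - t)))*indicator {0<..<1} t))"
 proof (rule nn_integral_mono_AE)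
  \<comment> \<open>At \<open>t = 0\<close> and \<open>t = 1\<close> the majorant is 0, by its
    indicator; these two parameters form a null set.\<close>
  have "AE t in lborel. t ~= (0::real)" "AE t in lborel. t ~= (1::real)" by (rule AE_lborel_singleton)+
  thus "AE t in lborel. ennreal H*Y t*indicator {0..1} t <= ennreal (H * sqrt P)*(ennreal (1 / sqrt (t*(1 - t)))*indicator {0<..<1} t)"
  proof eventually_elim
   fix t :: real assume "t ~= 0" "t ~= 1"
   show "ennreal H*Y t*indicator {0..1} t <= ennreal (H * sqrt P)*(ennreal (1 / sqrt (t*(1 - t)))*indicator {0<..<1} t)"
   proof (cases "t \<in> {0<..<1}")
    case True
    have "ennreal H*Y t <= ennreal H*ennreal (sqrt P*(1 / sqrt (t*(1 - t))))"
     by (intro mult_left_mono Ybound True) simp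
    also have "... = ennreal (H * sqrt P)*ennreal (1 / sqrt (t*(1 - t)))"
     using H0 P0 True by (simp only: ennreal_mult'[symmetric] mult.assoc mult_nonneg_nonneg real_sqrt_ge_zero)
    finally show ?thesis using True by simp
   qed (use \<open>t ~= 0\<close> \<open>t ~= 1\<close> in \<open>auto simp: indicator_def\<close>)
  qed
 qed
 also have "... = ennreal (H * sqrt P)*(NL t. ennreal (1 / sqrt (t*(1 - t)))*indicator {0<..<1} t)"
  by (rule nn_integral_cmult) measurable
 also have "... <= ennreal (H * sqrt P)*ennreal 8"
  by (intro mult_left_mono nn_integral_inverse_sqrt) simp
 also have "... = ennreal (H * sqrt P*8)" using H0 P0 by (simp add: ennreal_mult')
 finally have "\<bar>Ph\<bar> <= H * sqrt P*8" using H0 P0 by (subst (asm) ennreal_le_iff) auto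
 hence "Ph^2 <= (H * sqrt P*8)^2" using power_mono[of "\<bar>Ph\<bar>" "H * sqrt P*8" 2] by simp
 also have "... = 64*H^2*P" using P0 by (simp add: power_mult_distrib)
 also have "... = 6912*H^2*(2*de)*(be - al)*?I" by (simp add: P_def)
 finally show ?thesis unfolding Ph .
qed

section \<open>Hausdorff length of circular arcs\<close>

lemma chord_formula:
 assumes fr: "frame3 a b n"
 shows "(norm ((cos s *R a + sin s *R b) - (cos t *R a + sin t *R b)))^2 = (2 * sin ((s - t)/2))^2"
proof -
 have "(cos s *R a + sin s *R b) - (cos t *R a + sin t *R b) = (cos s - cos t) *R a + (sin s - sin t) *R b + 0 *R n"
  by (simp add: algebra_simps)
 hence "(norm ((cos s *R a + sin s *R b) - (cos t *R a + sin t *R b)))^2 = (cos s - cos t)^2 + (sin s - sin t)^2"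
  using norm_frame3[OF fr, of "cos s - cos t" "sin s - sin t" 0] by simp
 also have "... = 2 - 2*cos (s - t)"
  by (simp add: power2_diff cos_diff algebra_simps)
 also have "cos (s - t) = 1 - 2*(sin ((s - t)/2))^2"
  using cos_double_sin[of "(s - t)/2"] by (simp only: mult_2 field_sum_of_halves)
 finally show ?thesis by (simp add: power_mult_distrib)
qed

lemma arc_chord_le:
 assumes fr: "frame3 a b n"
 shows "norm ((cos s *R a + sin s *R b) - (cos t *R a + sin t *R b)) <= \<bar>s - t\<bar>"
proof -
 have "\<bar>sin ((s - t)/2)\<bar> <= \<bar>(s - t)/2\<bar>" by (rule abs_sin_x_le_abs_x)
 hence "(2 * sin ((s - t)/2))^2 <= (s - t)^2" by (subst abs_le_square_iff[symmetric]) (simp add: abs_mult)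
 thus ?thesis unfolding chord_formula[OF fr, symmetric]
  using abs_le_square_iff[of "norm ((cos s *R a + sin s *R b) - (cos t *R a + sin t *R b))" "s - t"] by simp
qed

text \<open>With \<open>x\<close> half the angle, the arc is \<open>2*x\<close> and the chord
  \<open>2 * sin x\<close>. Monotonicity of \<open>sin x - x*cos x\<close> gives
  \<open>x*cos x <= sin x\<close>, and a chord of length at most \<open>et\<close> forces
  \<open>cos x >= sqrt (1 - et^2)\<close>.\<close>

lemma chord_arc_le:
 assumes fr: "frame3 a b n" and st: "\<bar>s - t\<bar> < pi" and et: "0 < et" "et <= 1"
  and c: "norm ((cos s *R a + sin s *R b) - (cos t *R a + sin t *R b)) <= et"
 shows "\<bar>s - t\<bar> * sqrt (1 - et^2) <= norm ((cos s *R a + sin s *R b) - (cos t *R a + sin t *R b))"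
proof -
 define x where "x = \<bar>s - t\<bar>/2"
 have x: "0 <= x" "x < pi/2" using st by (auto simp: x_def)
 have sx: "0 <= sin x" using x by (intro sin_ge_zero) auto
 have cx: "0 < cos x" using x by (intro cos_gt_zero_pi) auto
 let ?c = "norm ((cos s *R a + sin s *R b) - (cos t *R a + sin t *R b))"
 have "(s - t)/2 = x \<or> (s - t)/2 = - x" by (auto simp: x_def abs_if field_simps)
 hence "?c^2 = (2 * sin x)^2" unfolding chord_formula[OF fr] by (elim disjE) simp_all
 from power2_eq_imp_eq[OF this] have c2: "?c = 2 * sin x" using sx by simp
 have "sin 0 - 0*cos 0 <= sin x - x*cos x"
 proof (rule DERIV_nonneg_imp_nondecreasing[of 0 x "\<lambda>x. sin x - x*cos x"])
  fix y assume y: "0 <= y" "y <= x"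
  have "((\<lambda>x. sin x - x*cos x) has_real_derivative y * sin y) (at y)"
   by (auto intro!: derivative_eq_intros)
  moreover have "0 <= y * sin y" using x y by (intro mult_nonneg_nonneg sin_ge_zero) auto
  ultimately show "\<exists>l. ((\<lambda>x. sin x - x*cos x) has_real_derivative l) (at y) \<and> 0 <= l" by blast
 qed (use x in auto)
 hence "2*x*cos x <= 2 * sin x" by simp
 moreover have "sqrt (1 - et^2) <= cos x"
 proof (rule real_le_lsqrt)
  have "(2 * sin x)^2 <= et^2" using c c2 sx by (intro power_mono) auto
  hence "(sin x)^2 <= et^2" by (simp add: power_mult_distrib) (smt (verit) zero_le_power2)
  thus "1 - et^2 <= (cos x)^2" by (simp add: cos_squared_eq)
 qed (use cx in auto)
 ultimately have "2*x * sqrt (1 - et^2) <= 2 * sin x"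
  using x by (meson mult_left_mono mult_nonneg_nonneg order_trans zero_le_numeral)
 thus ?thesis unfolding c2 by (simp add: x_def)
qed

text \<open>Equal subarcs of angle at most \<open>de\<close> give the upper bound. For the lower
  bound, a covering set of diameter at most \<open>et\<close> meets the arc in angles that span at
  most its diameter divided by \<open>sqrt (1 - et^2)\<close>; countable subadditivity of Lebesgue
  measure and \<open>et\<close> tending to 0 conclude.\<close>

lemma hausdorff1_arc:
 assumes fr: "frame3 a b n" and ab: "al <= be" "be - al < pi"
 shows "hausdorff1 ((\<lambda>t. cos t *R a + sin t *R b) ` {al..be}) = ennreal (be - al)" (is "hausdorff1 (?z ` _) = _")
proof (rule antisym)
 show "hausdorff1 (?z ` {al..be}) <= ennreal (be - al)"
  unfolding hausdorff1_def
 proof (rule SUP_least)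
  fix de :: real assume "de \<in> {0<..}"
  hence d: "de > 0" by simp
  obtain k :: nat where k: "(be - al)/de < real k" using reals_Archimedean2 by blast
  have k0: "k > 0" using k ab d by (metis divide_nonneg_pos gr0I le_less_trans diff_ge_0_iff_ge less_irrefl of_nat_0)
  define w where "w = (be - al) / k"
  have w: "0 <= w" "w <= de" using k d k0 ab by (auto simp: w_def field_simps)
  define C where "C m = (if m < k then ?z ` {al + real m*w .. al + real (Suc m)*w} else {})" for m
  have dist: "dist u v <= w" if "u \<in> C m" "v \<in> C m" for u v m
  proof -
   have "m < k" using that by (auto simp: C_def split: if_splits)
   hence "u \<in> ?z ` {al + real m*w .. al + real (Suc m)*w}" "v \<in> ?z ` {al + real m*w .. al + real (Suc m)*w}"
    using that by (simp_all only: C_def if_True)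
   then obtain s t where st: "u = ?z s" "v = ?z t" "s \<in> {al + real m*w .. al + real (Suc m)*w}" "t \<in> {al + real m*w .. al + real (Suc m)*w}"
    by (elim imageE)
   have "\<bar>s - t\<bar> <= w" using st(3,4) by (auto simp: algebra_simps)
   thus ?thesis using arc_chord_le[OF fr, of s t] st by (simp add: dist_norm)
  qed
  have bd: "bounded (C m)" for m
  proof (cases "C m = {}")
   case False
   then obtain v where "v \<in> C m" by blast
   thus ?thesis unfolding bounded_def using dist by blast
  qed simp
  have di: "diameter (C m) <= w" for m
   using w dist by (intro diameter_le) (auto simp: dist_norm)
  have di0: "diameter (C m) = 0" if "m \<ge> k" for m using that by (simp add: C_def)
  have cov: "?z ` {al..be} \<subseteq> (\<Union>m. C m)"
  proof
   fix y assume "y \<in> ?z ` {al..be}"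
   then obtain t where t: "t \<in> {al..be}" "y = ?z t" by blast
   show "y \<in> (\<Union>m. C m)"
   proof (cases "w = 0")
    case True
    hence "al = be" using k0 by (simp add: w_def)
    thus ?thesis using t k0 True by (auto simp: C_def intro!: exI[of _ 0])
   next
    case False
    hence w0: "w > 0" using w by simp
    \<comment> \<open>The minimum with \<open>k - 1\<close> puts the right end of the arc into the
      last piece.\<close>
    define m where "m = min (nat \<lfloor>(t - al)/w\<rfloor>) (k - 1)"
    have f0: "0 <= (t - al)/w" using t w0 by simp
    have kw: "real k*w = be - al" using k0 by (simp add: w_def)
    have mk: "m < k" using k0 by (simp add: m_def)
    have m1: "real m <= (t - al)/w" using f0 by (simp add: m_def min_le_iff_disj) linarith
    have m2: "(t - al)/w <= real (Suc m)"
    proof (cases "nat \<lfloor>(t - al)/w\<rfloor> <= k - 1")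
     case True
     thus ?thesis using f0 by (simp add: m_def) linarith
    next
     case False
     hence "real (Suc m) = real k" using k0 by (simp add: m_def)
     moreover have "t - al <= real k*w" using t kw by simp
     ultimately show ?thesis using w0 by (simp add: field_simps)
    qed
    have "real m*w <= t - al" "t - al <= real (Suc m)*w" using m1 m2 w0 by (simp_all add: field_simps)
    hence "y \<in> C m" using t mk by (auto simp: C_def)
    thus ?thesis by blast
   qed
  qed
  have "(INF C\<in>{C. ?z ` {al..be} \<subseteq> (\<Union>n. C n) \<and> (\<forall>n. bounded (C n) \<and> diameter (C n) <= de)}. \<Sum>n. ennreal (diameter (C n))) <= (\<Sum>m. ennreal (diameter (C m)))"
   using cov bd order_trans[OF di w(2)] by (intro INF_lower) auto
  also have "... = (\<Sum>m<k. ennreal (diameter (C m)))"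
   by (rule suminf_finite) (use di0 in auto)
  also have "... <= (\<Sum>m<k. ennreal w)" using di by (intro sum_mono ennreal_leI)
  also have "... = ennreal (be - al)" using w k0 by (simp add: w_def ennreal_of_nat_eq_real_of_nat ennreal_mult[symmetric])
  finally show "(INF C\<in>{C. ?z ` {al..be} \<subseteq> (\<Union>n. C n) \<and> (\<forall>n. bounded (C n) \<and> diameter (C n) <= de)}. \<Sum>n. ennreal (diameter (C n))) <= ennreal (be - al)" .
 qed
next
 have key: "ennreal ((be - al) * sqrt (1 - et^2)) <= hausdorff1 (?z ` {al..be})" if et: "0 < et" "et <= 1" for et
 proof -
  have "ennreal ((be - al) * sqrt (1 - et^2)) <= (INF C\<in>{C. ?z ` {al..be} \<subseteq> (\<Union>n. C n) \<and> (\<forall>n. bounded (C n) \<and> diameter (C n) <= et)}. \<Sum>n. ennreal (diameter (C n)))"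
  proof (rule INF_greatest)
   fix C assume "C \<in> {C :: nat => (real^3) set. ?z ` {al..be} \<subseteq> (\<Union>n. C n) \<and> (\<forall>n. bounded (C n) \<and> diameter (C n) <= et)}"
   hence C: "?z ` {al..be} \<subseteq> (\<Union>n. C n)" "\<And>n. bounded (C n)" "\<And>n. diameter (C n) <= et" by auto
   define r where "r = sqrt (1 - et^2)"
   have r0: "0 <= r" using et by (simp add: r_def power_le_one)
   define T where "T m = {t \<in> {al..be}. ?z t \<in> C m}" for m
   \<comment> \<open>The set of angles \<open>T m\<close> need not be Borel; it is replaced by its
     interval hull, whose length is controlled by the same diameter.\<close>
   define B where "B m = (if T m = {} then {} else {Inf (T m)..Sup (T m)})" for m
   have Tb: "bdd_above (T m)" "bdd_below (T m)" for m
    unfolding T_def by (auto intro!: bdd_aboveI[of _ be] bdd_belowI[of _ al])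
   have TB: "T m \<subseteq> B m" for m
    using Tb[of m] by (auto simp: B_def intro: cInf_lower cSup_upper)
   have len: "ennreal r*emeasure lborel (B m) <= ennreal (diameter (C m))" for m
   proof (cases "T m = {}")
    case False
    have diam: "(s - t)*r <= diameter (C m)" if "s \<in> T m" "t \<in> T m" for s t
    proof -
     have "norm (?z s - ?z t) <= diameter (C m)"
      using diameter_bounded_bound[OF C(2)[of m]] that by (auto simp: T_def dist_norm)
     moreover from this have "norm (?z s - ?z t) <= et" using C(3)[of m] by linarith
     hence "\<bar>s - t\<bar>*r <= norm (?z s - ?z t)"
      unfolding r_def using that ab by (intro chord_arc_le[OF fr _ et]) (auto simp: T_def)
     moreover have "(s - t)*r <= \<bar>s - t\<bar>*r" using r0 by (intro mult_right_mono) auto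
     ultimately show ?thesis by linarith
    qed
    have "(Sup (T m) - Inf (T m))*r <= diameter (C m)"
    proof (cases "r = 0")
     case True
     thus ?thesis using diameter_ge_0[OF C(2)[of m]] by simp
    next
     case r: False
     hence rp: "r > 0" using r0 by simp
     have "Sup (T m) <= diameter (C m)/r + t" if "t \<in> T m" for t
      using diam[OF _ that] rp by (intro cSup_least[OF False]) (simp add: field_simps)
     hence "Sup (T m) - diameter (C m)/r <= Inf (T m)"
      by (intro cInf_greatest[OF False]) (simp add: algebra_simps)
     thus ?thesis using rp by (simp add: field_simps)
    qed
    moreover have "Inf (T m) <= Sup (T m)" using False Tb[of m] by (intro cInf_le_cSup) auto
    ultimately show ?thesis using False r0
     by (simp add: B_def ennreal_mult[symmetric] mult.commute ennreal_leI)
   qed (simp add: B_def)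
   have Bs: "range B \<subseteq> sets lborel" by (auto simp: B_def)
   have "{al..be} \<subseteq> (\<Union>m. B m)"
   proof
    fix t assume t: "t \<in> {al..be}"
    then obtain m where "?z t \<in> C m" using C(1) by blast
    hence "t \<in> T m" using t by (simp add: T_def)
    thus "t \<in> (\<Union>m. B m)" using TB by blast
   qed
   hence "emeasure lborel {al..be} <= emeasure lborel (\<Union>m. B m)"
    using Bs by (intro emeasure_mono) auto
   also have "... <= (\<Sum>m. emeasure lborel (B m))" by (rule emeasure_subadditive_countably[OF Bs])
   finally have "ennreal (be - al) <= (\<Sum>m. emeasure lborel (B m))" using ab by simp
   hence "ennreal r*ennreal (be - al) <= ennreal r*(\<Sum>m. emeasure lborel (B m))" by (intro mult_left_mono) auto
   also have "... = (\<Sum>m. ennreal r*emeasure lborel (B m))" by simp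
   also have "... <= (\<Sum>m. ennreal (diameter (C m)))" using len by (intro suminf_le) auto
   finally show "ennreal ((be - al) * sqrt (1 - et^2)) <= (\<Sum>n. ennreal (diameter (C n)))"
    using r0 ab by (simp add: r_def[symmetric] ennreal_mult mult.commute)
  qed
  also have "... <= hausdorff1 (?z ` {al..be})"
   unfolding hausdorff1_def by (rule SUP_upper) (use et in auto)
  finally show ?thesis .
 qed
 have "(\<lambda>k::nat. ennreal ((be - al) * sqrt (1 - (1/real (Suc k))^2))) \<longlonglongrightarrow> ennreal ((be - al) * sqrt (1 - 0^2))"
  by (intro tendsto_ennrealI tendsto_intros LIMSEQ_Suc[OF lim_1_over_n])
 hence "ennreal ((be - al) * sqrt (1 - 0^2)) <= hausdorff1 (?z ` {al..be})"
  by (rule LIMSEQ_le_const2) (intro exI[of _ 0] allI impI key, simp_all)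
 thus "ennreal (be - al) <= hausdorff1 (?z ` {al..be})" by simp
qed

section \<open>Geometry of Voronoi cells\<close>

lemma inner_S2_le: "y \<in> S2 ==> z \<in> S2 ==> \<bar>y \<bullet> z\<bar> <= (1::real)"
 using Cauchy_Schwarz_ineq2[of y z] by simp

lemma inner_S2_self: "y \<in> S2 ==> y \<bullet> y = (1::real)"
 by (simp add: norm_eq_1)

lemma inner_S2_less: "y \<in> S2 ==> z \<in> S2 ==> y ~= z ==> y \<bullet> z < (1::real)"
proof -
 assume a: "y \<in> S2" "z \<in> S2" "y ~= z"
 have "0 < (norm (y - z))^2" using a by simp
 also have "(norm (y - z))^2 = 2 - 2*(y \<bullet> z)"
  using a inner_S2_self unfolding power2_norm_eq_inner by (simp add: inner_diff_left inner_diff_right inner_commute)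
 finally show ?thesis by simp
qed

lemma norm_diff_S2: "y \<in> S2 ==> z \<in> S2 ==> (norm (y - z))^2 = 2 - 2*(y \<bullet> z)"
 using inner_S2_self unfolding power2_norm_eq_inner by (simp add: inner_diff_left inner_diff_right inner_commute)

lemma geo_dist_less_iff: "y \<in> S2 ==> v \<in> S2 ==> w \<in> S2 ==> geo_dist y v < geo_dist y w \<longleftrightarrow> y \<bullet> w < y \<bullet> v"
 unfolding geo_dist_def using inner_S2_le by (intro arccos_less_mono) auto

locale vmesh =
 fixes N :: nat and x :: "nat => real^3"
 assumes vd: "voronoi_delaunay N x"
begin

abbreviation "V \<equiv> vcell N x"
abbreviation "h \<equiv> mesh_size N x"

text \<open>The cell written with inner products, as the part of the sphere cut out by homogeneous
  linear inequalities; \<open>closure_vcell\<close> identifies it with the closure of the Voronoi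
  cell.\<close>

definition ccell :: "nat => (real^3) set" where
 "ccell i = {y \<in> S2. \<forall>j\<in>{1..N}. y \<bullet> x j <= y \<bullet> x i}"

lemma vd_parts:
 "x ` {1..N} \<subseteq> S2" "inj_on x {1..N}" "(\<Union>t\<in>delaunay N x. geo_tri x t) = S2" "inj_on rp (poly_surface N x)"
proof -
 note v = vd[unfolded voronoi_delaunay_def]
 show "x ` {1..N} \<subseteq> S2" by (rule v[THEN conjunct1])
 show "inj_on x {1..N}" by (rule v[THEN conjunct2, THEN conjunct1])
 show "(\<Union>t\<in>delaunay N x. geo_tri x t) = S2" by (rule v[THEN conjunct2, THEN conjunct2, THEN conjunct1])
 show "inj_on rp (poly_surface N x)" by (rule v[THEN conjunct2, THEN conjunct2, THEN conjunct2, THEN conjunct2])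
qed

lemma x_S2: "i \<in> {1..N} ==> x i \<in> S2"
 using vd_parts(1) by blast

lemma x_inj: "i \<in> {1..N} ==> j \<in> {1..N} ==> x i = x j \<longleftrightarrow> i = j"
 by (rule inj_on_eq_iff[OF vd_parts(2)])

lemma vcell_eq: "i \<in> {1..N} ==> V i = {y \<in> S2. \<forall>j\<in>{1..N}. j ~= i \<longrightarrow> y \<bullet> x j < y \<bullet> x i}"
 unfolding vcell_def using geo_dist_less_iff x_S2 by auto

lemma delaunay_subset: "t \<in> delaunay N x ==> t \<subseteq> {1..N}"
 by (auto simp: delaunay_def nbrs_def)

lemma cover: "y \<in> S2 ==> \<exists>t\<in>delaunay N x. y \<in> rp ` planar_tri x t"
 using vd_parts(3) unfolding geo_tri_def by blast

text \<open>If all vertices had nonpositive product with \<open>y\<close>, so would every planar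
  triangle. But one of them contains a point on the ray through \<open>y\<close>.\<close>

lemma exists_pos:
 assumes y: "y \<in> S2"
 shows "\<exists>i\<in>{1..N}. y \<bullet> x i > 0"
proof (rule ccontr)
 assume "\<not> ?thesis"
 hence neg: "y \<bullet> x i <= 0" if "i \<in> {1..N}" for i using that by (meson linorder_not_less)
 obtain t w where t: "t \<in> delaunay N x" "w \<in> convex hull (x ` t)" "y = rp w"
  using cover[OF y] by (auto simp: planar_tri_def)
 have "convex hull (x ` t) \<subseteq> {w. y \<bullet> w <= 0}"
  using neg delaunay_subset[OF t(1)] by (intro hull_minimal convex_halfspace_le) auto
 hence "y \<bullet> w <= 0" using t by auto
 moreover have "w ~= 0" using t y by (auto simp: radial_proj_def)
 hence "y \<bullet> w = norm w" unfolding t by (simp add: radial_proj_def power2_norm_eq_inner[symmetric] power2_eq_square)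
 ultimately show False using \<open>w ~= 0\<close> by simp
qed

lemma N_pos: "0 < N"
proof -
 have "(axis 1 1 :: real^3) \<in> S2" by simp
 from exists_pos[OF this] show ?thesis by auto
qed

lemma exists_ccell: 
 assumes y: "y \<in> S2"
 obtains i where "i \<in> {1..N}" "y \<in> ccell i"
proof -
 let ?A = "(\<lambda>i. y \<bullet> x i) ` {1..N}"
 have "finite ?A" "?A ~= {}" using N_pos by auto
 hence "Max ?A \<in> ?A" by (rule Max_in)
 then obtain i where i: "i \<in> {1..N}" "Max ?A = y \<bullet> x i" by auto
 have "y \<bullet> x j <= y \<bullet> x i" if "j \<in> {1..N}" for j unfolding i(2)[symmetric] using that by (intro Max_ge) auto
 thus ?thesis using that[of i] i y by (auto simp: ccell_def)
qed

lemma ccell_pos: "i \<in> {1..N} ==> y \<in> ccell i ==> y \<bullet> x i > 0"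
 using exists_pos[of y] by (force simp: ccell_def)

text \<open>The sum of the \<open>max 0 (y . x i)\<close> is continuous and positive on the compact
  sphere, and some summand is at least the \<open>N\<close>-th part of its minimum. The constant
  depends on the mesh; it enters limits on a fixed mesh only, never an estimate.\<close>

lemma exists_lower_bound: "\<exists>c>0. \<forall>y\<in>S2. \<exists>i\<in>{1..N}. c <= y \<bullet> x i"
proof -
 let ?f = "\<lambda>y. \<Sum>i\<in>{1..N}. max 0 (y \<bullet> x i)"
 have "continuous_on S2 ?f" by (intro continuous_intros)
 moreover have "S2 ~= ({} :: (real^3) set)" by simp
 ultimately obtain y0 where y0: "y0 \<in> S2" "\<And>y. y \<in> S2 ==> ?f y0 <= ?f y"
  using continuous_attains_inf[of S2 ?f] compact_sphere by blast
 have Np: "real N > 0" using N_pos by simp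
 obtain i where i: "i \<in> {1..N}" "y0 \<bullet> x i > 0" using exists_pos[OF y0(1)] by blast
 have f0: "?f y0 > 0" using i by (intro sum_pos2[of _ i]) auto
 have "\<exists>i\<in>{1..N}. ?f y0/N <= y \<bullet> x i" if y: "y \<in> S2" for y
 proof (rule ccontr)
  assume "\<not> ?thesis"
  hence lt: "\<And>i. i \<in> {1..N} ==> max 0 (y \<bullet> x i) < ?f y0/N" using f0 Np by (auto simp: not_le)
  have "?f y < (\<Sum>i\<in>{1..N}. ?f y0/N)" using lt N_pos by (intro sum_strict_mono) auto
  also have "... = ?f y0" using Np by simp
  finally show False using y0(2)[OF y] by simp
 qed
 thus ?thesis using f0 Np by (intro exI[of _ "?f y0/N"]) auto
qed

lemma vcell_subset_ccell: "i \<in> {1..N} ==> V i \<subseteq> ccell i"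
 unfolding vcell_eq ccell_def by (auto intro: order.strict_implies_order)

lemma ccell_closed: "closed (ccell i)"
proof -
 have "ccell i = S2 \<inter> (\<Inter>j\<in>{1..N}. {y. (x j - x i) \<bullet> y <= 0})"
  by (auto simp: ccell_def inner_diff_left inner_commute[of _ "x _"])
 thus ?thesis by (auto intro!: closed_Int closed_INT closed_halfspace_le)
qed

text \<open>Adding a small positive multiple of \<open>x i\<close> to a point of
  \<open>ccell i\<close> makes all inequalities strict, because \<open>x i . x j < 1\<close> for the
  other vertices.\<close>

lemma closure_vcell:
 assumes i: "i \<in> {1..N}"
 shows "closure (V i) = ccell i"
proof
 show "closure (V i) \<subseteq> ccell i" by (rule closure_minimal[OF vcell_subset_ccell[OF i] ccell_closed])
 show "ccell i \<subseteq> closure (V i)"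
 proof
  fix y assume y: "y \<in> ccell i"
  define w where "w k = y + inverse (real (Suc k)) *R x i" for k
  have yS: "y \<in> S2" using y by (simp add: ccell_def)
  have wi: "w k \<bullet> x i > 0" for k
   using ccell_pos[OF i y] inner_S2_self[OF x_S2[OF i]] by (simp add: w_def inner_add_left add_pos_pos)
  have w0: "w k ~= 0" for k using wi[of k] by auto
  have "rp (w k) \<in> V i" for k
   unfolding vcell_eq[OF i]
  proof (intro CollectI conjI ballI impI)
   show "rp (w k) \<in> S2" by (rule radial_proj_S2[OF w0])
   fix j assume j: "j \<in> {1..N}" "j ~= i"
   have 1: "y \<bullet> x j <= y \<bullet> x i" using y j by (simp add: ccell_def)
   have "x i \<bullet> x j < x i \<bullet> x i"
    using inner_S2_less[OF x_S2[OF i] x_S2[OF j(1)]] x_inj[OF i j(1)] j inner_S2_self[OF x_S2[OF i]] by auto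
   hence "inverse (real (Suc k))*(x i \<bullet> x j) < inverse (real (Suc k))*(x i \<bullet> x i)" by (intro mult_strict_left_mono) auto
   from add_le_less_mono[OF 1 this] have "w k \<bullet> x j < w k \<bullet> x i" by (simp add: w_def inner_add_left)
   thus "rp (w k) \<bullet> x j < rp (w k) \<bullet> x i"
    using w0[of k] by (simp add: radial_proj_def)
  qed
  moreover have "(\<lambda>k. rp (w k)) \<longlonglongrightarrow> y"
  proof -
   have "w \<longlonglongrightarrow> y + 0 *R x i" unfolding w_def by (intro tendsto_intros LIMSEQ_inverse_real_of_nat)
   hence "(\<lambda>k. rp (w k)) \<longlonglongrightarrow> rp y"
    unfolding radial_proj_def using yS by (intro tendsto_intros) auto
   thus ?thesis by (simp add: radial_proj_id[OF yS])
  qed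
  ultimately show "y \<in> closure (V i)" unfolding closure_sequential by (intro exI[of _ "\<lambda>k. rp (w k)"] conjI allI)
 qed
qed

lemma x_in_vcell: "i \<in> {1..N} ==> x i \<in> V i"
 unfolding vcell_eq using inner_S2_less[OF x_S2 x_S2] inner_S2_self[OF x_S2] x_inj x_S2 by auto

lemma mesh_ge:
 assumes i: "i \<in> {1..N}" and y: "y \<in> ccell i"
 shows "arccos (x i \<bullet> y) <= h"
proof -
 have V: "arccos (x i \<bullet> y) <= h" if "y \<in> V i" for y
 proof -
  have bdd: "bdd_above ((\<lambda>y. geo_dist (x i) y) ` V i)"
   using inner_S2_le[OF x_S2[OF i]] by (intro bdd_aboveI2[of _ _ pi]) (auto simp: geo_dist_def vcell_eq[OF i] abs_le_iff intro!: arccos_ubound)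
  have "geo_dist (x i) y <= (SUP y\<in>V i. geo_dist (x i) y)" by (rule cSUP_upper[OF that bdd])
  also have "... <= h" unfolding mesh_size_def using i by (intro Max_ge) auto
  finally show ?thesis by (simp add: geo_dist_def)
 qed
 have "closed {y \<in> S2. arccos (x i \<bullet> y) <= h}"
 proof -
  have "continuous_on S2 (\<lambda>y. arccos (x i \<bullet> y))"
   using inner_S2_le[OF x_S2[OF i]] by (intro continuous_on_arccos continuous_intros) (auto simp: abs_le_iff)
  hence "closed (S2 \<inter> (\<lambda>y. arccos (x i \<bullet> y)) -` {..h})" by (intro continuous_closed_preimage) auto
  moreover have "S2 \<inter> (\<lambda>y. arccos (x i \<bullet> y)) -` {..h} = {y \<in> S2. arccos (x i \<bullet> y) <= h}" by auto
  ultimately show ?thesis by (simp only:)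
 qed
 hence "ccell i \<subseteq> {y \<in> S2. arccos (x i \<bullet> y) <= h}"
  unfolding closure_vcell[OF i, symmetric] using V by (intro closure_minimal) (auto simp: vcell_eq[OF i])
 thus ?thesis using y by auto
qed

lemma ccell_S2: "y \<in> ccell i ==> y \<in> S2" by (simp add: ccell_def)

lemma h_nonneg: "0 <= h"
 using mesh_ge[of 1 "x 1"] x_in_vcell[of 1] vcell_subset_ccell[of 1] N_pos inner_S2_self[OF x_S2[of 1]] by auto

lemma ccell_cos:
 assumes i: "i \<in> {1..N}" and y: "y \<in> ccell i" and hpi: "h <= pi"
 shows "cos h <= y \<bullet> x i"
proof -
 have b: "\<bar>x i \<bullet> y\<bar> <= 1" using inner_S2_le[OF x_S2[OF i] ccell_S2[OF y]] .
 have "cos h <= cos (arccos (x i \<bullet> y))"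
  using mesh_ge[OF i y] b hpi by (intro cos_monotone_0_pi_le) (auto intro: arccos_lbound)
 thus ?thesis using b by (simp add: inner_commute abs_le_iff)
qed

lemma ccell_norm:
 assumes i: "i \<in> {1..N}" and y: "y \<in> ccell i"
 shows "norm (y - x i) <= h"
proof -
 have b: "\<bar>x i \<bullet> y\<bar> <= 1" using inner_S2_le[OF x_S2[OF i] ccell_S2[OF y]] .
 let ?a = "arccos (x i \<bullet> y)"
 have "(norm (y - x i))^2 = 2 - 2*cos ?a" using norm_diff_S2[OF ccell_S2[OF y] x_S2[OF i]] b by (simp add: inner_commute abs_le_iff)
 also have "... = (2 * sin (?a/2))^2" using cos_double_sin[of "?a/2"] by (simp add: power_mult_distrib)
 also have "... <= ?a^2" using abs_sin_x_le_abs_x[of "?a/2"] by (subst abs_le_square_iff[symmetric]) (simp add: abs_mult)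
 finally have "(norm (y - x i))^2 <= ?a^2" .
 moreover have "0 <= ?a" using b by (intro arccos_lbound) (auto simp: abs_le_iff)
 ultimately have "norm (y - x i) <= ?a" by (rule power2_le_imp_le)
 thus ?thesis using mesh_ge[OF i y] by simp
qed

text \<open>If \<open>h\<close> were 0, each closed cell would be its vertex and the sphere finite;
  but the sphere is connected and has more than one point.\<close>

lemma h_pos: "0 < h"
proof (rule ccontr)
 assume "\<not> 0 < h"
 hence "y = x i" if "i \<in> {1..N}" "y \<in> ccell i" for i y
 proof -
  have "norm (y - x i) = 0" using ccell_norm[OF that] norm_ge_zero[of "y - x i"] \<open>\<not> 0 < h\<close> by linarith
  thus ?thesis by simp
 qed
 hence "S2 \<subseteq> x ` {1..N}" using exists_ccell by (metis image_eqI subsetI)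
 hence "finite (S2 :: (real^3) set)" by (rule finite_subset) simp
 moreover have "connected (S2 :: (real^3) set)" by (rule connected_sphere) simp
 ultimately obtain v where "(S2 :: (real^3) set) \<subseteq> {v}" by (metis connected_finite_iff_sing empty_subsetI order_refl)
 moreover have "(axis 1 1 :: real^3) \<in> S2" "- (axis 1 1 :: real^3) \<in> S2" by simp_all
 ultimately have "(axis 1 1 :: real^3) = v" "- (axis 1 1 :: real^3) = v" by blast+
 hence "(axis 1 1 :: real^3) = - axis 1 1" by (rule trans[OF _ sym])
 hence "(axis 1 1 :: real^3) $ 1 = (- axis 1 1 :: real^3) $ 1" by (rule arg_cong)
 thus False by (simp add: axis_def)
qed

lemma h_le_pi: "h <= pi"
proof -
 have "(SUP y\<in>V i. geo_dist (x i) y) <= pi" if i: "i \<in> {1..N}" for i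
  using x_in_vcell[OF i] inner_S2_le[OF x_S2[OF i]]
  by (intro cSUP_least) (auto simp: geo_dist_def vcell_eq[OF i] abs_le_iff intro!: arccos_ubound)
 thus ?thesis unfolding mesh_size_def using N_pos by (intro Max.boundedI) auto
qed

lemma vcell_borel: "i \<in> {1..N} ==> V i \<in> sets borel"
proof -
 assume i: "i \<in> {1..N}"
 have "V i = S2 \<inter> (\<Inter>j\<in>{1..N}-{i}. {y. (x j - x i) \<bullet> y < 0})"
  by (auto simp: vcell_eq[OF i] inner_diff_left inner_commute[of _ "x _"])
 moreover have "open (\<Inter>j\<in>{1..N}-{i}. {y. (x j - x i) \<bullet> y < 0})" by (intro open_INT ballI open_halfspace_lt) auto
 ultimately show ?thesis by (metis borel_closed borel_open closed_sphere sets.Int)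
qed

lemma AE_vcell: "AE y in sph. \<exists>!i. i \<in> {1..N} \<and> y \<in> V i"
proof -
 have "AE y in sph. \<forall>i\<in>{1..N}. \<forall>j\<in>{1..N}. i ~= j \<longrightarrow> y \<bullet> (x i - x j) ~= 0"
  using AE_sphere_not_orthogonal x_inj by (auto intro!: AE_finite_allI AE_impI)
 thus ?thesis
 proof (rule AE_mp, intro AE_I2 impI)
  fix y assume y: "y \<in> space sph" and ne: "\<forall>i\<in>{1..N}. \<forall>j\<in>{1..N}. i ~= j \<longrightarrow> y \<bullet> (x i - x j) ~= 0"
  hence yS: "y \<in> S2" by simp
  obtain i where i: "i \<in> {1..N}" "y \<in> ccell i" by (rule exists_ccell[OF yS])
  have "y \<in> V i" unfolding vcell_eq[OF i(1)]
  proof (intro CollectI conjI ballI impI yS)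
   fix j assume j: "j \<in> {1..N}" "j ~= i"
   hence "y \<bullet> x j <= y \<bullet> x i" using i by (auto simp: ccell_def)
   moreover have "y \<bullet> (x i - x j) ~= 0" by (rule ne[rule_format, OF i(1) j(1) j(2)[symmetric]])
   ultimately show "y \<bullet> x j < y \<bullet> x i" by (simp add: inner_diff_right)
  qed
  moreover have "j = i" if "j \<in> {1..N}" "y \<in> V j" for j
  proof (rule ccontr)
   assume "j ~= i"
   hence "y \<bullet> x j < y \<bullet> x i" "y \<bullet> x i < y \<bullet> x j"
    using that i(1) \<open>y \<in> V i\<close> by (auto simp: vcell_eq)
   thus False by simp
  qed
  ultimately show "\<exists>!i. i \<in> {1..N} \<and> y \<in> V i" using i by blast
 qed
qed

subsection \<open>Voronoi edges\<close>

text \<open>Frame of the pair \<open>i j\<close>: the bisecting great circle lies in the plane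
  orthogonal to the chord direction \<open>en\<close>; \<open>ea\<close> points to the midpoint
  \<open>em\<close> of the chord, and \<open>eb\<close> completes the frame. So \<open>ez\<close>
  parametrises the circle by the angle from the point nearest to both vertices.\<close>

definition ed :: "nat => nat => real" where "ed i j = norm (x j - x i)"
definition en :: "nat => nat => real^3" where "en i j = (x j - x i) /\<^sub>R ed i j"
definition em :: "nat => nat => real^3" where "em i j = (1/2) *R (x i + x j)"
definition ea :: "nat => nat => real^3" where "ea i j = em i j /\<^sub>R norm (em i j)"
definition eb :: "nat => nat => real^3" where "eb i j = cross3 (en i j) (ea i j)"
definition ez :: "nat => nat => real => real^3" where
 "ez i j th = cos th *R ea i j + sin th *R eb i j"

text \<open>The angles of the points of the Voronoi edge on its great circle; the set is empty if
 \<open>x i\<close> and \<open>x j\<close> are antipodal, when \<open>ea i j\<close> is the junk value \<open>0\<close>.\<close>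

definition eE :: "nat => nat => real set" where
 "eE i j = {th \<in> {-pi/2..pi/2}. ez i j th \<in> ccell i}"

lemma ed_pos: "i \<in> {1..N} ==> j \<in> {1..N} ==> i ~= j ==> ed i j > 0"
 using x_inj by (auto simp: ed_def)

lemma em_orth: "i \<in> {1..N} ==> j \<in> {1..N} ==> em i j \<bullet> (x j - x i) = 0"
 using inner_S2_self[OF x_S2[of i]] inner_S2_self[OF x_S2[of j]]
 by (simp add: em_def inner_add_left inner_diff_right inner_commute[of "x j" "x i"])

lemma edge_frame:
 assumes "i \<in> {1..N}" "j \<in> {1..N}" "i ~= j" "em i j ~= 0"
 shows "frame3 (ea i j) (eb i j) (en i j)"
 unfolding eb_def
proof (rule frame3_cross)
 show "norm (ea i j) = 1" using assms by (simp add: ea_def)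
 show "norm (en i j) = 1" using ed_pos[OF assms(1-3)] by (simp add: en_def ed_def)
 show "ea i j \<bullet> en i j = 0" using em_orth[OF assms(1,2)] by (simp add: ea_def en_def)
qed

lemma edge_points:
 assumes "i \<in> {1..N}" "j \<in> {1..N}" "i ~= j" "em i j ~= 0"
 shows "x i = norm (em i j) *R ea i j + (- (ed i j/2)) *R en i j" "x j = norm (em i j) *R ea i j + (ed i j/2) *R en i j"
  "(norm (em i j))^2 + (ed i j/2)^2 = 1"
proof -
 have "ed i j *R en i j = x j - x i" "norm (em i j) *R ea i j = em i j"
  using ed_pos[OF assms(1-3)] assms(4) by (auto simp: en_def ea_def)
 moreover have "(ed i j/2) *R en i j = (1/2) *R (ed i j *R en i j)" by simp
 moreover have "em i j - (1/2) *R (x j - x i) = (1/2 + 1/2) *R x i" "em i j + (1/2) *R (x j - x i) = (1/2 + 1/2) *R x j"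
  unfolding em_def scaleR_add_left scaleR_add_right scaleR_diff_right by simp_all
 ultimately show 1: "x i = norm (em i j) *R ea i j + (- (ed i j/2)) *R en i j" and 2: "x j = norm (em i j) *R ea i j + (ed i j/2) *R en i j"
  by simp_all
 have "1 = (norm (x j))^2" using x_S2[OF assms(2)] by simp
 also have "x j = norm (em i j) *R ea i j + 0 *R eb i j + (ed i j/2) *R en i j" using 2 by simp
 also have "(norm (norm (em i j) *R ea i j + 0 *R eb i j + (ed i j/2) *R en i j))^2 = (norm (em i j))^2 + 0^2 + (ed i j/2)^2"
  by (rule norm_frame3[OF edge_frame[OF assms]])
 finally show "(norm (em i j))^2 + (ed i j/2)^2 = 1" by simp
qed

lemma ez_props:
 assumes "i \<in> {1..N}" "j \<in> {1..N}" "i ~= j" "em i j ~= 0"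
 shows "ez i j th \<in> S2" "ez i j th \<bullet> en i j = 0" "ez i j th \<bullet> ea i j = cos th" "ez i j th \<bullet> x i = norm (em i j)*cos th" "ez i j th \<bullet> x j = norm (em i j)*cos th"
proof -
 note fr = edge_frame[OF assms]
 have "(norm (cos th *R ea i j + sin th *R eb i j + 0 *R en i j))^2 = 1"
  unfolding norm_frame3[OF fr] by simp
 thus "ez i j th \<in> S2" by (simp add: ez_def power2_eq_1_iff) (metis norm_ge_zero not_one_le_zero neg_0_le_iff_le)
 show n: "ez i j th \<bullet> en i j = 0" and a: "ez i j th \<bullet> ea i j = cos th"
  using fr by (auto simp: ez_def frame3_def inner_simps inner_commute norm_eq_1)
 show "ez i j th \<bullet> x i = norm (em i j)*cos th" "ez i j th \<bullet> x j = norm (em i j)*cos th"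
  using n a by (subst edge_points[OF assms], simp add: inner_simps)+
qed

text \<open>The junk value \<open>ea i j = 0\<close> makes \<open>ez i j\<close> constantly 0, which
  is not on the sphere.\<close>

lemma eE_empty: "em i j = 0 ==> eE i j = {}"
 by (simp add: eE_def ez_def ea_def eb_def ccell_def)

lemma eE_sym_ccell:
 assumes "i \<in> {1..N}" "j \<in> {1..N}" "i ~= j" "em i j ~= 0"
 shows "ez i j th \<in> ccell i \<longleftrightarrow> ez i j th \<in> ccell j"
 using ez_props[OF assms, of th] by (simp add: ccell_def)

text \<open>A common point is equidistant from both vertices, so it lies on the bisecting circle;
  its positive product with \<open>x i\<close> makes the cosine of the angle positive, and the
  arcsine recovers the angle. For antipodal vertices there is no common point, since it would have
  positive product with \<open>x i + x j\<close>.\<close>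

lemma ccell_inter:
 assumes ij: "i \<in> {1..N}" "j \<in> {1..N}" "i ~= j"
 shows "ccell i \<inter> ccell j = ez i j ` eE i j"
proof (cases "em i j = 0")
 case True
 have "y \<notin> ccell i \<inter> ccell j" for y
 proof
  assume y: "y \<in> ccell i \<inter> ccell j"
  hence "0 < y \<bullet> (x i + x j)" using ccell_pos[OF ij(1), of y] ccell_pos[OF ij(2), of y] by (simp add: inner_add_right)
  moreover have "x i + x j = 2 *R em i j" by (simp add: em_def)
  ultimately show False using True by simp
 qed
 thus ?thesis using eE_empty[OF True] by auto
next
 case False
 note fr = edge_frame[OF ij False] and ep = edge_points[OF ij False]
 have m0: "norm (em i j) > 0" using False by simp
 show ?thesis
 proof (intro equalityI subsetI)
  fix y assume "y \<in> ez i j ` eE i j"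
  thus "y \<in> ccell i \<inter> ccell j" using eE_sym_ccell[OF ij False] by (auto simp: eE_def)
 next
  fix y assume y: "y \<in> ccell i \<inter> ccell j"
  have eq: "y \<bullet> x i = y \<bullet> x j" using y ij by (auto simp: ccell_def intro: antisym)
  hence n0: "y \<bullet> en i j = 0" by (simp add: en_def inner_diff_right)
  have "y \<bullet> x i = norm (em i j)*(y \<bullet> ea i j)" using n0 by (subst ep(1)) (simp add: inner_simps)
  hence a0: "y \<bullet> ea i j > 0" using ccell_pos[OF ij(1), of y] y m0 by (simp add: zero_less_mult_iff)
  define p q where "p = y \<bullet> ea i j" and "q = y \<bullet> eb i j"
  have rep: "y = p *R ea i j + q *R eb i j"
  proof -
   let ?T = "\<lambda>v::real^3. (v$1) *R ea i j + (v$2) *R eb i j + (v$3) *R en i j"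
   have sj: "surj ?T" by (rule orthogonal_transformation_surj[OF orthogonal_transformation_frame[OF fr]])
   then obtain v where v: "y = ?T v" using surjD[OF sj, of y] by (elim exE)
   have "v $ 3 = 0" "v $ 1 = p" "v $ 2 = q" using n0 fr unfolding p_def q_def v
    by (auto simp: frame3_def inner_simps inner_commute norm_eq_1)
   thus ?thesis using v by simp
  qed
  have "(norm (p *R ea i j + q *R eb i j + 0 *R en i j))^2 = p^2 + q^2" unfolding norm_frame3[OF fr] by simp
  hence pq: "p^2 + q^2 = 1" using rep ccell_S2[of y i] y by simp
  define th where "th = arcsin q"
  have q1: "-1 <= q" "q <= 1" 
 proof -
  have "q^2 <= 1" using pq zero_le_power2[of p] by linarith
  hence "\<bar>q\<bar> <= 1" by (simp only: abs_square_le_1)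
  thus "-1 <= q" "q <= 1" by (simp_all add: abs_le_iff)
 qed
  have th: "th \<in> {-pi/2..pi/2}" "sin th = q" using q1 arcsin_bounded[OF q1] by (auto simp: th_def)
  have "cos th = sqrt (1 - q^2)" unfolding th_def by (rule cos_arcsin[OF q1])
  also have "... = p" using pq a0 unfolding p_def by (intro real_sqrt_unique) auto
  finally have "y = ez i j th" using rep th by (simp add: ez_def)
  thus "y \<in> ez i j ` eE i j" using y th by (auto simp: eE_def)
 qed
qed

lemma ez_cont: "continuous_on A (ez i j)"
 unfolding ez_def by (intro continuous_intros)

lemma eE_compact: "compact (eE i j)"
proof -
 have "eE i j = {-pi/2..pi/2} \<inter> ez i j -` ccell i" by (auto simp: eE_def)
 moreover have "closed ({-pi/2..pi/2} \<inter> ez i j -` ccell i)"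
  by (intro continuous_closed_preimage ez_cont ccell_closed) auto
 ultimately have "closed (eE i j)" by (simp only:)
 moreover have "bounded (eE i j)" by (rule bounded_subset[OF bounded_closed_interval[of "-pi/2" "pi/2"]]) (auto simp: eE_def)
 ultimately show ?thesis by (simp add: compact_eq_bounded_closed)
qed

lemma eE_cos_pos:
 assumes "i \<in> {1..N}" "j \<in> {1..N}" "i ~= j" and th: "th \<in> eE i j"
 shows "em i j ~= 0" "cos th > 0" "-pi/2 < th" "th < pi/2"
proof -
 show e: "em i j ~= 0" using th eE_empty by auto
 have "ez i j th \<bullet> x i > 0" using ccell_pos[OF assms(1)] th by (auto simp: eE_def)
 thus c: "cos th > 0" using e unfolding ez_props[OF assms(1-3) e] by (simp add: zero_less_mult_iff)
 have "th \<in> {-pi/2..pi/2}" using th by (simp add: eE_def)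
 moreover have "cos (-pi/2) = 0" "cos (pi/2) = 0" by simp_all
 hence "th ~= -pi/2" "th ~= pi/2" using c by (metis less_irrefl)+
 ultimately show "-pi/2 < th" "th < pi/2" by auto
qed

text \<open>A point between two points of the edge is, up to the positive factor
  \<open>sin (?b - ?a)\<close>, their combination with the positive weights
  \<open>sin (?b - th)\<close> and \<open>sin (th - ?a)\<close>. The homogeneous linear inequalities
  of the cell pass to such combinations.\<close>

lemma eE_interval:
 assumes ij: "i \<in> {1..N}" "j \<in> {1..N}" "i ~= j"
 shows "\<exists>al be. eE i j = {al..be}"
proof (cases "eE i j = {}")
 case True
 hence "eE i j = {1..0}" by simp
 thus ?thesis by blast
next
 case False
 let ?a = "Inf (eE i j)" and ?b = "Sup (eE i j)"
 have bd: "bounded (eE i j)" "closed (eE i j)" using eE_compact compact_eq_bounded_closed by blast+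
 have ab: "?a \<in> eE i j" "?b \<in> eE i j"
  using False bd by (auto intro: closed_contains_Inf closed_contains_Sup bounded_imp_bdd_above bounded_imp_bdd_below)
 have sub: "eE i j \<subseteq> {?a..?b}"
  using bounded_imp_bdd_above[OF bd(1)] bounded_imp_bdd_below[OF bd(1)] by (auto intro: cInf_lower cSup_upper)
 note e = eE_cos_pos(1)[OF ij ab(1)]
 have "th \<in> eE i j" if th: "?a < th" "th < ?b" for th
 proof -
  have r: "-pi/2 < ?a" "?b < pi/2" using eE_cos_pos[OF ij ab(1)] eE_cos_pos[OF ij ab(2)] by auto
  have s: "sin (?b - th) > 0" "sin (th - ?a) > 0" "sin (?b - ?a) > 0"
   using th r by (intro sin_gt_zero; linarith)+
  have comb: "sin (?b - th) *R ez i j ?a + sin (th - ?a) *R ez i j ?b = sin (?b - ?a) *R ez i j th"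
  proof -
   have c: "sin (?b - th)*cos ?a + sin (th - ?a)*cos ?b = sin (?b - ?a)*cos th"
    unfolding sin_diff by algebra
   have d: "sin (?b - th) * sin ?a + sin (th - ?a) * sin ?b = sin (?b - ?a) * sin th"
    unfolding sin_diff by algebra
   have "sin (?b - th) *R ez i j ?a + sin (th - ?a) *R ez i j ?b = (sin (?b - th)*cos ?a + sin (th - ?a)*cos ?b) *R ea i j + (sin (?b - th) * sin ?a + sin (th - ?a) * sin ?b) *R eb i j"
    by (simp add: ez_def scaleR_add_right scaleR_add_left)
   also have "... = sin (?b - ?a) *R ez i j th" unfolding c d by (simp add: ez_def scaleR_add_right)
   finally show ?thesis .
  qed
  have "ez i j th \<bullet> x k <= ez i j th \<bullet> x i" if k: "k \<in> {1..N}" for k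
  proof -
   have "ez i j ?a \<bullet> x k <= ez i j ?a \<bullet> x i" "ez i j ?b \<bullet> x k <= ez i j ?b \<bullet> x i"
    using ab k by (auto simp: eE_def ccell_def)
   hence "sin (?b - th)*(ez i j ?a \<bullet> x k) + sin (th - ?a)*(ez i j ?b \<bullet> x k) <= sin (?b - th)*(ez i j ?a \<bullet> x i) + sin (th - ?a)*(ez i j ?b \<bullet> x i)"
    using s by (intro add_mono mult_left_mono) auto
   hence "(sin (?b - ?a) *R ez i j th) \<bullet> x k <= (sin (?b - ?a) *R ez i j th) \<bullet> x i"
    unfolding comb[symmetric] by (simp add: inner_add_left)
   thus ?thesis using s(3) by simp
  qed
  hence "ez i j th \<in> ccell i" using ez_props(1)[OF ij e] by (simp add: ccell_def)
  thus ?thesis using th r by (auto simp: eE_def)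
 qed
 hence "{?a..?b} \<subseteq> eE i j" using ab by (metis atLeastAtMost_iff less_eq_real_def subsetI)
 thus ?thesis using sub by blast
qed

lemma edge_length:
 assumes ij: "i \<in> {1..N}" "j \<in> {1..N}" "i ~= j"
 shows "curve_length (vedge N x i j) = measure lborel (eE i j)"
proof -
 have v: "vedge N x i j = ez i j ` eE i j"
  unfolding vedge_def closure_vcell[OF ij(1)] closure_vcell[OF ij(2)] by (rule ccell_inter[OF ij])
 obtain al be where E: "eE i j = {al..be}" using eE_interval[OF ij] by blast
 show ?thesis
 proof (cases "al <= be")
  case False
  have "hausdorff1 ({} :: (real^3) set) <= 0"
   unfolding hausdorff1_def
   by (intro SUP_least INF_lower2[of "\<lambda>_. {}"]) auto
  thus ?thesis using False by (simp add: curve_length_def v E)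
 next
  case True
  hence m: "al \<in> eE i j" "be \<in> eE i j" using E by auto
  note e = eE_cos_pos[OF ij m(1)] eE_cos_pos[OF ij m(2)]
  have "hausdorff1 (ez i j ` {al..be}) = ennreal (be - al)"
   unfolding ez_def[abs_def] using e True by (intro hausdorff1_arc[OF edge_frame[OF ij e(1)]]) auto
  thus ?thesis using True by (simp add: curve_length_def v E)
 qed
qed

end

section \<open>The divergence theorem on a Voronoi cell\<close>

text \<open>A \<open>C^1\<close> step from 0 to 1 on \<open>[0, 1]\<close>, written as a quadratic
  spline with knots 0, 1/2 and 1. Its derivative \<open>dstp\<close> is the hat function of height
  2.\<close>

definition stp :: "real => real" where
 "stp t = 2*((max 0 t)^2 - 2*(max 0 (t - 1/2))^2 + (max 0 (t - 1))^2)"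

definition dstp :: "real => real" where
 "dstp t = 4*(max 0 t - 2 * max 0 (t - 1/2) + max 0 (t - 1))"

lemma DERIV_max_square: "((\<lambda>t. (max 0 t)^2) has_real_derivative 2 * max 0 t) (at (t::real))"
proof -
 consider "t > 0" | "t < 0" | "t = 0" by linarith
 thus ?thesis
 proof cases
  case 1
  show ?thesis
   by (rule has_field_derivative_transform_within_open[of "\<lambda>t. t^2" _ _ "{0<..}"]) (use 1 in \<open>auto intro!: derivative_eq_intros\<close>)
 next
  case 2
  show ?thesis
   by (rule has_field_derivative_transform_within_open[of "\<lambda>t. 0" _ _ "{..<0}"]) (use 2 in auto)
 next
  case 3
  have "(\<lambda>h. ((max 0 (0 + h))^2 - (max 0 0)^2)/h) \<midarrow>0\<rightarrow> (0::real)"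
  proof (rule Lim_null_comparison[OF _ tendsto_rabs_zero[OF tendsto_ident_at]])
   show "\<forall>\<^sub>F h in at 0. norm (((max 0 (0 + h))^2 - (max 0 0)^2)/h) <= \<bar>h\<bar>"
    by (intro always_eventually) (auto simp: max_def power2_eq_square)
  qed
  thus ?thesis unfolding 3 DERIV_def by simp
 qed
qed

lemma stp_deriv: "(stp has_real_derivative dstp t) (at t)"
proof -
 have s: "((\<lambda>t. (max 0 (t - c))^2) has_real_derivative 2 * max 0 (t - c)) (at t)" for c :: real
 proof -
  have "((\<lambda>t. t - c) has_real_derivative 1) (at t)" by (auto intro!: derivative_eq_intros)
  from DERIV_chain2[OF DERIV_max_square this] show ?thesis by simp
 qed
 show ?thesis unfolding stp_def[abs_def] dstp_def
  by (rule derivative_eq_intros s[of 0, simplified] s refl)+ simp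
qed

lemma stp_simps: "t <= 0 ==> stp t = 0" "1 <= t ==> stp t = 1" "t <= 0 ==> dstp t = 0" "1 <= t ==> dstp t = 0"
 by (simp_all add: stp_def dstp_def max_def power2_eq_square algebra_simps)

lemma dstp_bounds: "0 <= dstp t" "dstp t <= 2"
 by (auto simp: dstp_def max_def)

lemma stp_bounds: "0 <= stp t" "stp t <= 1"
proof -
 have "stp a <= stp b" if "a <= b" for a b
  using DERIV_nonneg_imp_nondecreasing[OF that, of stp] stp_deriv dstp_bounds(1) by blast
 from this[of "min 0 t" t] this[of t "max 1 t"] show "0 <= stp t" "stp t <= 1" by (simp_all add: stp_simps)
qed

lemma stp_cont: "continuous_on A stp" "continuous_on A dstp"
 unfolding stp_def[abs_def] dstp_def[abs_def] by (intro continuous_intros)+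

lemma stp_measurable [measurable]: "stp \<in> borel_measurable borel" "dstp \<in> borel_measurable borel"
 by (intro borel_measurable_continuous_onI stp_cont)+

lemma nn_integral_dstp:
 assumes c: "c > 0"
 shows "(NL ta. ennreal (dstp (c*ta))) = ennreal (1/c)"
proof -
 have "(NL ta. ennreal (dstp (c*ta))) = (NL ta. ennreal (dstp (c*ta))*indicator {0..1/c} ta)"
 proof (intro nn_integral_cong)
  fix ta
  have "dstp (c*ta) = 0" if "ta \<notin> {0..1/c}"
  proof (cases "ta < 0")
   case True
   thus ?thesis using c by (intro stp_simps(3)) (simp add: mult_nonneg_nonpos)
  next
   case False
   thus ?thesis using c that by (intro stp_simps(4)) (simp add: field_simps)
  qed
  thus "ennreal (dstp (c*ta)) = ennreal (dstp (c*ta))*indicator {0..1/c} ta" by (auto simp: indicator_def)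
 qed
 also have "... = ennreal (stp (c*(1/c))/c - stp (c*0)/c)"
 proof (rule nn_integral_FTC_Icc[where F="\<lambda>ta. stp (c*ta)/c"])
  fix ta
  show "((\<lambda>ta. stp (c*ta)/c) has_real_derivative dstp (c*ta)) (at ta)"
   using c by (auto intro!: derivative_eq_intros DERIV_chain2[OF stp_deriv])
 qed (use c dstp_bounds in auto)
 also have "... = ennreal (1/c)" using c by (simp add: stp_simps)
 finally show ?thesis .
qed

context vmesh
begin

text \<open>Otherwise \<open>x l - x i\<close> would be parallel to the chord direction; but the
  line through \<open>x i\<close> and \<open>x j\<close> meets the sphere in these two points only.
  Consequently almost no point of the bisecting circle is equidistant from a third vertex.\<close>

lemma off_circle:
 assumes ij: "i \<in> {1..N}" "j \<in> {1..N}" "i ~= j" "em i j ~= 0" and l: "l \<in> {1..N}" "l ~= i" "l ~= j"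
 shows "ea i j \<bullet> (x l - x i) ~= 0 \<or> eb i j \<bullet> (x l - x i) ~= 0"
proof (rule ccontr)
 assume "\<not> ?thesis"
 hence z: "ea i j \<bullet> (x l - x i) = 0" "eb i j \<bullet> (x l - x i) = 0" by auto
 note fr = edge_frame[OF ij] and ep = edge_points[OF ij]
 let ?T = "\<lambda>v::real^3. (v$1) *R ea i j + (v$2) *R eb i j + (v$3) *R en i j"
 have sj: "surj ?T" by (rule orthogonal_transformation_surj[OF orthogonal_transformation_frame[OF fr]])
 obtain v where v: "x l - x i = ?T v" using surjD[OF sj, of "x l - x i"] by (elim exE)
 have "v $ 1 = 0" "v $ 2 = 0" using z fr unfolding v by (auto simp: frame3_def inner_simps inner_commute norm_eq_1)
 hence xl: "x l = x i + (v $ 3) *R en i j" using v by (simp add: algebra_simps)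
 let ?q = "v $ 3"
 have nn: "en i j \<bullet> en i j = 1" using fr by (simp add: frame3_def norm_eq_1)
 have an: "ea i j \<bullet> en i j = 0" using fr by (simp add: frame3_def)
 have xn: "x i \<bullet> en i j = - (ed i j/2)" by (subst ep(1)) (simp add: inner_simps nn an)
 have "1 = x l \<bullet> x l" using inner_S2_self[OF x_S2[OF l(1)]] by simp
 also have "... = x i \<bullet> x i + 2*?q*(x i \<bullet> en i j) + ?q*?q" unfolding xl by (simp add: inner_simps nn inner_commute algebra_simps)
 finally have "1 = 1 + 2*?q*(- (ed i j/2)) + ?q*?q" by (simp only: inner_S2_self[OF x_S2[OF ij(1)]] xn)
 hence "?q*(?q - ed i j) = 0" by (simp only: right_diff_distrib)
 hence "?q = 0 \<or> ?q - ed i j = 0" by (simp only: mult_eq_0_iff)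
 hence "?q = 0 \<or> ?q = ed i j" by linarith
 thus False
 proof
  assume "?q = 0"
  thus False using xl x_inj[OF l(1) ij(1)] l by simp
 next
  assume "?q = ed i j"
  hence "x l = x j" using xl ed_pos[OF ij(1-3)] by (simp add: en_def)
  thus False using x_inj[OF l(1) ij(2)] l by simp
 qed
qed

text \<open>Gnomonic coordinates of the hemisphere around \<open>ea i j\<close>, with the bisecting
  circle at \<open>t = 0\<close>. The factor \<open>gw\<close> is the inverse of the norm before
  projection, and its cube is the density of the surface measure.\<close>

definition gY :: "nat => nat => real => real => real^3" where
 "gY i j s t = rp (ea i j + s *R eb i j + t *R en i j)"

definition gw :: "real => real => real" where "gw s t = 1 / sqrt (1 + s^2 + t^2)"

lemma gw_pos: "gw s t > 0" "gw s t <= 1" "\<bar>s\<bar>*gw s t <= 1"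
proof -
 have r: "1 <= sqrt (1 + s^2 + t^2)" by simp
 show "gw s t > 0" "gw s t <= 1" unfolding gw_def using r by (auto simp: divide_le_eq) (smt (verit) zero_le_power2)+
 have "\<bar>s\<bar> <= sqrt (1 + s^2 + t^2)" by (intro real_le_rsqrt) (simp add: add_nonneg_nonneg)
 moreover have "0 < sqrt (1 + s^2 + t^2)" using r by linarith
 ultimately show "\<bar>s\<bar>*gw s t <= 1" unfolding gw_def by (simp only: times_divide_eq_right mult_1_right pos_divide_le_eq mult_1)
qed

lemma gY_props:
 assumes ij: "i \<in> {1..N}" "j \<in> {1..N}" "i ~= j" "em i j ~= 0"
 shows "gY i j s t \<in> S2" "gY i j s t \<bullet> v = gw s t*((ea i j + s *R eb i j + t *R en i j) \<bullet> v)"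
  "gY i j s t \<bullet> em i j = gw s t*norm (em i j)" "gY i j (tan th) 0 = ez i j th \<or> cos th <= 0"
proof -
 note fr = edge_frame[OF ij]
 have n2: "(norm (ea i j + s *R eb i j + t *R en i j))^2 = 1 + s^2 + t^2" for s t using norm_frame3[OF fr, of 1 s t] by simp
 hence n: "norm (ea i j + s *R eb i j + t *R en i j) = sqrt (1 + s^2 + t^2)" for s t
  by (metis norm_ge_zero real_sqrt_unique)
 have "norm (ea i j + s *R eb i j + t *R en i j) > 0" unfolding n by (smt (verit) real_sqrt_gt_zero zero_le_power2)
 thus "gY i j s t \<in> S2" unfolding gY_def by (intro radial_proj_S2) auto
 show g: "gY i j s t \<bullet> v = gw s t*((ea i j + s *R eb i j + t *R en i j) \<bullet> v)" for v
  by (simp add: gY_def radial_proj_def n gw_def divide_inverse)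
 have "em i j = norm (em i j) *R ea i j" using ij(4) by (simp add: ea_def)
 hence "(ea i j + s *R eb i j + t *R en i j) \<bullet> em i j = norm (em i j)*((ea i j + s *R eb i j + t *R en i j) \<bullet> ea i j)"
  by (metis inner_scaleR_right)
 also have "(ea i j + s *R eb i j + t *R en i j) \<bullet> ea i j = 1"
  using fr by (simp add: frame3_def inner_simps inner_commute norm_eq_1)
 finally show "gY i j s t \<bullet> em i j = gw s t*norm (em i j)" unfolding g by simp
 show "gY i j (tan th) 0 = ez i j th \<or> cos th <= 0"
 proof (cases "cos th > 0")
  case True
  have "ez i j th = cos th *R (ea i j + tan th *R eb i j + 0 *R en i j)"
   using True by (simp add: ez_def tan_def scaleR_add_right)
  hence "rp (ez i j th) = gY i j (tan th) 0" unfolding gY_def using radial_proj_scale[OF True] by simp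
  thus ?thesis using radial_proj_id[OF ez_props(1)[OF ij]] by simp
 qed auto
qed

lemma gw_measurable [measurable (raw)]:
 assumes [measurable]: "f \<in> borel_measurable M" "g \<in> borel_measurable M"
 shows "(\<lambda>p. gw (f p) (g p)) \<in> borel_measurable M"
 unfolding gw_def by measurable

lemma gY_measurable [measurable (raw)]:
 assumes [measurable]: "f \<in> borel_measurable M" "g \<in> borel_measurable M"
 shows "(\<lambda>p. gY i j (f p) (g p)) \<in> borel_measurable M"
 unfolding gY_def by measurable

text \<open>Substitute \<open>s = tan th\<close>: at \<open>t = 0\<close> the square of
  \<open>gw\<close> equals \<open>(cos th)^2\<close>, which cancels the derivative of the
  tangent.\<close>

lemma edge_integral_gnomonic:
 assumes ij: "i \<in> {1..N}" "j \<in> {1..N}" "i ~= j" "em i j ~= 0"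
  and F: "F \<in> borel_measurable borel" "continuous_on S2 F" "\<And>y. y \<in> S2 ==> 0 <= F y"
 shows "(NL s. ennreal (F (gY i j s 0)*(gw s 0)^2/ed i j)*indicator {s. gY i j s 0 \<in> ccell i} s)
  = ennreal (integral (eE i j) (\<lambda>th. F (ez i j th))/ed i j)"
proof -
 obtain al be where E: "eE i j = {al..be}" using eE_interval[OF ij(1-3)] by blast
 have [measurable]: "F \<in> borel_measurable borel" by fact
 have d0: "ed i j > 0" by (rule ed_pos[OF ij(1-3)])
 have mem: "gY i j (tan th) 0 \<in> ccell i \<longleftrightarrow> th \<in> {al..be}" if th: "-pi/2 < th" "th < pi/2" for th
 proof -
  have "cos th > 0" using th by (intro cos_gt_zero_pi) auto
  hence "gY i j (tan th) 0 = ez i j th" using gY_props(4)[OF ij, of th] by auto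
  thus ?thesis using th by (simp add: E[symmetric] eE_def)
 qed
 have ran: "-pi/2 < th" "th < pi/2" if "th \<in> {al..be}" for th using eE_cos_pos(3,4)[OF ij(1-3), of th] that E by auto
 have set: "{s. gY i j s 0 \<in> ccell i} = tan ` {al..be}"
 proof (intro equalityI subsetI)
  fix s assume "s \<in> {s. gY i j s 0 \<in> ccell i}"
  hence "arctan s \<in> {al..be}" using mem[of "arctan s"] arctan_lbound[of s] arctan_ubound[of s] by (simp add: tan_arctan)
  thus "s \<in> tan ` {al..be}" by (metis imageI tan_arctan)
 next
  fix s assume "s \<in> tan ` {al..be}"
  thus "s \<in> {s. gY i j s 0 \<in> ccell i}" using mem ran by auto
 qed
 consider "al > be" | "al = be" | "al < be" by linarith
 thus ?thesis
 proof cases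
  case 1
  thus ?thesis unfolding set E by simp
 next
  case 2
  have "(NL s. ennreal (F (gY i j s 0)*(gw s 0)^2/ed i j)*indicator {tan al} s) = (\<integral>\<^sup>+s. 0 \<partial>(lborel :: real measure))"
   by (rule nn_integral_cong_AE) (use AE_lborel_singleton[of "tan al"] in \<open>eventually_elim, auto\<close>)
  thus ?thesis unfolding set E 2 by simp
 next
  case 3
  have ims: "tan ` {al..be} = {tan al..tan be}"
  proof (intro equalityI subsetI)
   fix s assume "s \<in> tan ` {al..be}"
   then obtain th where th: "th \<in> {al..be}" "s = tan th" by blast
   have "tan al <= tan th" "tan th <= tan be"
    using th ran[of al] ran[of be] ran[OF th(1)] 3 by (auto simp: tan_mono_le_eq)
   thus "s \<in> {tan al..tan be}" using th by simp
  next
   fix s assume s: "s \<in> {tan al..tan be}"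
   have "arctan (tan al) <= arctan s" "arctan s <= arctan (tan be)" using s by (auto intro: arctan_monotone')
   hence "arctan s \<in> {al..be}" using ran[of al] ran[of be] 3 by (simp add: arctan_tan)
   thus "s \<in> tan ` {al..be}" by (metis imageI tan_arctan)
  qed
  let ?f = "\<lambda>s. ennreal (F (gY i j s 0)*(gw s 0)^2/ed i j)"
  have cz: "continuous_on {al..be} (\<lambda>th. F (ez i j th)/ed i j)"
   using d0 ez_props(1)[OF ij] by (intro continuous_intros continuous_on_compose2[OF F(2) ez_cont]) auto
  have cpos: "cos th > 0" if "th \<in> {al..be}" for th using ran[OF that] by (intro cos_gt_zero_pi) auto
  have "(NL s. ?f s * indicator {tan al..tan be} s) = (NL th. ?f (tan th)*ennreal (inverse ((cos th)^2))*indicator {al..be} th)"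
  proof (rule nn_integral_substitution_aux)
   show "(tan has_real_derivative inverse ((cos th)^2)) (at th)" if "th \<in> {al..be}" for th
    using cpos[OF that] by (intro DERIV_tan) auto
   show "continuous_on {al..be} (\<lambda>th. inverse ((cos th)^2))" using cpos by (intro continuous_intros) force
  qed (use 3 in auto)
  also have "... = (NL th. ennreal (indicator {al..be} th*(F (ez i j th)/ed i j)))"
  proof (intro nn_integral_cong)
   fix th :: real
   show "?f (tan th)*ennreal (inverse ((cos th)^2))*indicator {al..be} th = ennreal (indicator {al..be} th*(F (ez i j th)/ed i j))"
   proof (cases "th \<in> {al..be}")
    case True
    have c: "cos th > 0" by (rule cpos[OF True])
    have Y: "gY i j (tan th) 0 = ez i j th" using gY_props(4)[OF ij, of th] c by auto
    have "(gw (tan th) 0)^2 = 1/(1 + (tan th)^2)" unfolding gw_def by (simp add: power_divide)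
    also have "1 + (tan th)^2 = inverse ((cos th)^2)" using tan_sec[of th] c by (simp add: power_inverse)
    finally have g: "(gw (tan th) 0)^2 = (cos th)^2" by (simp only: inverse_eq_divide divide_divide_eq_right mult_1 div_by_1)
    have "?f (tan th)*ennreal (inverse ((cos th)^2)) = ennreal (F (ez i j th)*(cos th)^2/ed i j*inverse ((cos th)^2))"
     unfolding Y g using F(3)[OF ez_props(1)[OF ij, of th]] d0 by (intro ennreal_mult[symmetric]) auto
    also have "F (ez i j th)*(cos th)^2/ed i j*inverse ((cos th)^2) = F (ez i j th)/ed i j" using c by simp
    finally show ?thesis using True by simp
   qed simp
  qed
  also have "... = ennreal (integral {al..be} (\<lambda>th. F (ez i j th)/ed i j))"
   by (rule nn_integral_has_integral_lebesgue[OF _ integrable_integral[OF integrable_continuous_real[OF cz]]])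
    (use F(3) ez_props(1)[OF ij] d0 in auto)
  finally show ?thesis unfolding set ims E by simp
 qed
qed

lemma edge_integral_cont:
 assumes ij: "i \<in> {1..N}" "j \<in> {1..N}" "i ~= j" and F: "continuous_on S2 F"
 shows "continuous_on (eE i j) (\<lambda>th. F (ez i j th))" "(\<lambda>th. F (ez i j th) :: real) integrable_on (eE i j)"
proof -
 have e: "ez i j th \<in> S2" if "th \<in> eE i j" for th using that ccell_S2 by (auto simp: eE_def)
 show c: "continuous_on (eE i j) (\<lambda>th. F (ez i j th))"
  by (rule continuous_on_compose2[OF F ez_cont]) (use e in auto)
 obtain al be where E: "eE i j = {al..be}" using eE_interval[OF ij] by blast
 show "(\<lambda>th. F (ez i j th)) integrable_on (eE i j)" using c unfolding E by (rule integrable_continuous_real)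
qed

text \<open>The cell \<open>i\<close> is approximated by the product of the steps
  \<open>stp (K*(y . (x i - x l)))\<close>. \<open>cutp\<close> collects the factors other than the
  \<open>j\<close>-th, and \<open>cutd\<close> is the coefficient of \<open>x i - x j\<close> in the
  gradient of the whole product; it lives in a strip of width about \<open>1/K\<close> along the
  edge.\<close>

definition cutp :: "real => nat => nat => real^3 => real" where
 "cutp K i j y = (\<Prod>l\<in>{1..N}-{i}-{j}. stp (K*(y \<bullet> (x i - x l))))"

definition cutd :: "real => nat => nat => real^3 => real" where
 "cutd K i j y = K*dstp (K*(y \<bullet> (x i - x j)))*cutp K i j y"

lemma cutp_bounds: "0 <= cutp K i j y" "cutp K i j y <= 1"
 unfolding cutp_def by (intro prod_nonneg prod_le_1 ballI conjI stp_bounds)+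

lemma cut_measurable [measurable]: "cutp K i j \<in> borel_measurable borel" "cutd K i j \<in> borel_measurable borel"
 unfolding cutp_def[abs_def] cutd_def[abs_def] by measurable

lemma cutd_cont: "continuous_on A (cutd K i j)"
 unfolding cutd_def[abs_def] cutp_def
 by (intro continuous_intros continuous_on_compose2[OF stp_cont(1)[of UNIV]] continuous_on_compose2[OF stp_cont(2)[of UNIV]]) auto

text \<open>On the support all \<open>y . (x i - x l)\<close> are positive, so
  \<open>y . x i\<close> is the largest product and at least \<open>c\<close>; the difference to
  \<open>y . x j\<close> is below \<open>1/K <= c\<close>. Thus the strip stays inside the
  hemisphere of the gnomonic chart, uniformly in \<open>K\<close>.\<close>

lemma cutd_support:
 assumes ij: "i \<in> {1..N}" "j \<in> {1..N}" "i ~= j" and c: "\<exists>l\<in>{1..N}. c <= y \<bullet> x l" and K: "K > 0" "1/K <= c"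
  and nz: "cutd K i j y ~= 0"
 shows "c/2 <= y \<bullet> em i j"
proof -
 have p: "y \<bullet> (x i - x l) > 0" if l: "l \<in> {1..N}" "l ~= i" for l
 proof (rule ccontr)
  assume "\<not> ?thesis"
  hence s: "K*(y \<bullet> (x i - x l)) <= 0" using K by (simp add: mult_nonneg_nonpos)
  show False
  proof (cases "l = j")
   case True
   thus ?thesis using nz stp_simps(3)[OF s] by (simp add: cutd_def)
  next
   case False
   hence "cutp K i j y = 0" unfolding cutp_def using l stp_simps(1)[OF s] by (intro prod_zero) auto
   thus ?thesis using nz by (simp add: cutd_def)
  qed
 qed
 have "\<not> 1 <= K*(y \<bullet> (x i - x j))" using nz stp_simps(4) by (auto simp: cutd_def)
 hence "y \<bullet> (x i - x j) < c" using K by (simp add: field_simps) (smt (verit) mult_le_cancel_left_pos)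
 moreover have "c <= y \<bullet> x i"
 proof -
  obtain l where l: "l \<in> {1..N}" "c <= y \<bullet> x l" using c by blast
  thus ?thesis using p[of l] by (cases "l = i") (auto simp: inner_diff_right)
 qed
 ultimately show ?thesis by (simp add: em_def inner_add_right inner_diff_right)
qed

lemma gY_tendsto:
 assumes ij: "i \<in> {1..N}" "j \<in> {1..N}" "i ~= j" "em i j ~= 0" and t: "t \<longlonglongrightarrow> 0"
 shows "(\<lambda>k. gY i j s (t k)) \<longlonglongrightarrow> gY i j s 0" "(\<lambda>k. gw s (t k)) \<longlonglongrightarrow> gw s 0"
proof -
 have "(norm (ea i j + s *R eb i j + 0 *R en i j))^2 = 1 + s^2 + 0^2" using norm_frame3[OF edge_frame[OF ij], of 1 s 0] by simp
 hence "ea i j + s *R eb i j + 0 *R en i j ~= 0" by (smt (verit) norm_zero zero_le_power2 zero_power2)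
 from has_derivative_continuous[OF radial_proj_has_derivative[OF this]]
 have "isCont rp (ea i j + s *R eb i j + 0 *R en i j)" .
 moreover have "(\<lambda>k. ea i j + s *R eb i j + t k *R en i j) \<longlonglongrightarrow> ea i j + s *R eb i j + 0 *R en i j"
  by (intro tendsto_intros t)
 ultimately show "(\<lambda>k. gY i j s (t k)) \<longlonglongrightarrow> gY i j s 0" unfolding gY_def by (rule isCont_tendsto_compose)
 have "sqrt (1 + s^2 + 0^2) ~= 0" by (smt (verit) real_sqrt_eq_zero_cancel_iff zero_le_power2 zero_power2)
 thus "(\<lambda>k. gw s (t k)) \<longlonglongrightarrow> gw s 0" unfolding gw_def by (intro tendsto_intros t)
qed

lemma stp_scaled_limit:
 assumes Y: "Y \<longlonglongrightarrow> Y0" and K: "filterlim K at_top sequentially" and q: "Y0 \<bullet> v ~= 0"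
 shows "eventually (\<lambda>k. stp (K k*(Y k \<bullet> v)) = (if Y0 \<bullet> v > 0 then 1 else 0)) sequentially"
proof -
 have l: "(\<lambda>k. Y k \<bullet> v) \<longlonglongrightarrow> Y0 \<bullet> v" by (intro tendsto_intros Y)
 have K0: "eventually (\<lambda>k. 0 <= K k) sequentially" using K by (simp add: filterlim_at_top)
 show ?thesis
 proof (cases "Y0 \<bullet> v > 0")
  case True
  have "filterlim (\<lambda>k. (Y k \<bullet> v)*K k) at_top sequentially" by (rule filterlim_tendsto_pos_mult_at_top[OF l True K])
  hence "eventually (\<lambda>k. 1 <= (Y k \<bullet> v)*K k) sequentially" by (simp add: filterlim_at_top)
  thus ?thesis by eventually_elim (simp add: True stp_simps mult.commute)
 next
  case False
  hence "eventually (\<lambda>k. Y k \<bullet> v < 0) sequentially" using q by (intro order_tendstoD(2)[OF l]) auto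
  with K0 show ?thesis by eventually_elim (use False in \<open>simp add: stp_simps mult_nonneg_nonpos\<close>)
 qed
qed

lemma AE_generic:
 assumes ij: "i \<in> {1..N}" "j \<in> {1..N}" "i ~= j" "em i j ~= 0"
 shows "AE s in lborel. \<forall>l\<in>{1..N}-{i}-{j}. (ea i j + s *R eb i j) \<bullet> (x l - x i) ~= 0"
proof (intro AE_finite_allI)
 fix l assume l: "l \<in> {1..N}-{i}-{j}"
 let ?a = "ea i j \<bullet> (x l - x i)" and ?b = "eb i j \<bullet> (x l - x i)"
 have "AE s in lborel. s ~= - ?a/?b" by (rule AE_lborel_singleton)
 thus "AE s in lborel. (ea i j + s *R eb i j) \<bullet> (x l - x i) ~= 0"
 proof eventually_elim
  fix s assume s: "s ~= - ?a/?b"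
  show "(ea i j + s *R eb i j) \<bullet> (x l - x i) ~= 0"
  proof
   assume "(ea i j + s *R eb i j) \<bullet> (x l - x i) = 0"
   hence e: "?a + s * ?b = 0" by (simp add: inner_add_left)
   hence "?b ~= 0" using off_circle[OF ij, of l] l by auto
   thus False using s e by (simp add: field_simps)
  qed
 qed
qed simp

text \<open>In gnomonic coordinates the edge circle is the \<open>s\<close>-axis; rescaling the transversal coordinate
 by \<open>K\<close> turns \<open>K*dstp (K*(y \<bullet> (x i - x j)))\<close> into a bump of fixed width.\<close>

lemma cutd_limit:
 assumes ij: "i \<in> {1..N}" "j \<in> {1..N}" "i ~= j"
  and F: "F \<in> borel_measurable borel" "continuous_on S2 F" "\<And>y. y \<in> S2 ==> 0 <= F y"
 shows "(\<lambda>k. NI y. ennreal (cutd (real k) i j y*F y)) \<longlonglongrightarrow> ennreal (integral (eE i j) (\<lambda>th. F (ez i j th))/ed i j)"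
proof -
 obtain c where c: "c > 0" "\<And>y. y \<in> S2 ==> \<exists>l\<in>{1..N}. c <= y \<bullet> x l" using exists_lower_bound by blast
 obtain k0 where k0: "1/c <= real k0" using real_arch_simple by blast
 \<comment> \<open>The shift makes \<open>1/K k <= c\<close> for every \<open>k\<close>, so that the
   support bound is available throughout; it is undone at the end by an offset of the
   sequence.\<close>
 define K where "K k = real (k + Suc k0)" for k
 have K: "K k > 0" "1/K k <= c" for k
 proof -
  show K0: "K k > 0" by (simp add: K_def)
  have "1/c <= K k" using k0 by (simp add: K_def)
  thus "1/K k <= c" using c(1) K0 by (simp add: field_simps)
 qed
 have supp: "c/2 <= y \<bullet> em i j" if "y \<in> S2" "cutd (K k) i j y ~= 0" for k y
  by (rule cutd_support[OF ij c(2)[OF that(1)] K that(2)])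
 have "(\<lambda>k. NI y. ennreal (cutd (K k) i j y*F y)) \<longlonglongrightarrow> ennreal (integral (eE i j) (\<lambda>th. F (ez i j th))/ed i j)"
 proof (cases "em i j = 0")
  case True
  have "(NI y. ennreal (cutd (K k) i j y*F y)) = (NI y. 0)" for k
  proof (intro nn_integral_cong)
   fix y assume "y \<in> space sph"
   hence "cutd (K k) i j y = 0" using supp[of y k] True c(1) by auto
   thus "ennreal (cutd (K k) i j y*F y) = 0" by simp
  qed
  thus ?thesis using eE_empty[OF True] by simp
 next
  case False
  note ij4 = ij False
  note fr = edge_frame[OF ij4]
  have [measurable]: "F \<in> borel_measurable borel" by fact
  have [measurable]: "ccell i \<in> sets borel" using ccell_closed by (rule borel_closed)
  have d0: "ed i j > 0" by (rule ed_pos[OF ij])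
  have m0: "norm (em i j) > 0" using False by simp
  have "(norm (em i j))^2 <= 1^2"
   unfolding one_power2 using edge_points(3)[OF ij4] zero_le_power2[of "ed i j/2"] by linarith
  from power2_le_imp_le[OF this] have m1: "norm (em i j) <= 1" by simp
  have "compact (F ` S2)" using F(2) by (intro compact_continuous_image) auto
  then obtain B where B: "\<And>y. y \<in> S2 ==> F y <= B"
   using compact_imp_bounded bounded_iff by (metis abs_le_D1 imageI real_norm_def)
  let ?Y = "\<lambda>k s ta. gY i j s (- ta/K k)" and ?w = "\<lambda>k s ta. gw s (- ta/K k)"
  \<comment> \<open>The integrand after \<open>t = - ta/K k\<close>. The sign is negative because
    \<open>y . (x i - x j)\<close> is positive where the coordinate along \<open>en i j\<close> is
    negative; the argument of \<open>dstp\<close> then depends on \<open>K k\<close> only through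
    the weight.\<close>
  define g where "g k s ta = ennreal (dstp (ed i j*?w k s ta*ta)*cutp (K k) i j (?Y k s ta)*F (?Y k s ta)*(?w k s ta)^3)" for k s ta
  have gm [measurable]: "(\<lambda>p. g k (f p) (q p)) \<in> borel_measurable M" if [measurable]: "f \<in> borel_measurable M" "q \<in> borel_measurable M" for f q k and M :: "'m measure"
   unfolding g_def by measurable
  have arg: "K k*(?Y k s ta \<bullet> (x i - x j)) = ed i j*?w k s ta*ta" for k s ta
  proof -
   have "x i - x j = - (ed i j *R en i j)" using d0 by (simp add: en_def)
   hence "(ea i j + s *R eb i j + (- ta/K k) *R en i j) \<bullet> (x i - x j) = ta/K k*ed i j"
    using fr by (simp add: frame3_def inner_simps norm_eq_1)
   thus ?thesis using K(1)[of k] unfolding gY_props(2)[OF ij4] by simp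
  qed
  have Y: "?Y k s ta \<in> S2" for k s ta by (rule gY_props(1)[OF ij4])
  have w: "0 < ?w k s ta" "?w k s ta <= 1" for k s ta by (rule gw_pos)+
  have repr: "(NI y. ennreal (cutd (K k) i j y*F y)) = (NL s. NL ta. g k s ta)" for k
  proof -
   let ?f = "\<lambda>y. ennreal (cutd (K k) i j y*F y)"
   have "(NI y. ?f y) = (NI y. ?f y*indicator {y. y \<bullet> ea i j > 0} y)"
   proof (intro nn_integral_cong)
    fix y assume "y \<in> space sph"
    hence y: "y \<in> S2" by simp
    have "y \<bullet> ea i j > 0" if "cutd (K k) i j y ~= 0"
     using supp[OF y that] c(1) m0 by (simp add: ea_def)
    thus "?f y = ?f y*indicator {y. y \<bullet> ea i j > 0} y" by (cases "cutd (K k) i j y = 0") auto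
   qed
   also have "... = (NL s. NL t. ?f (gY i j s t)*ennreal ((gw s t)^3))"
    unfolding gY_def gw_def power_one_over by (rule nn_integral_gnomonic[OF fr]) measurable
   also have "... = (NL s. NL ta. g k s ta)"
   proof (rule nn_integral_cong)
    fix s :: real
    have ci: "- 1/K k ~= 0" using K(1)[of k] by simp
    have "(NL t. ?f (gY i j s t)*ennreal ((gw s t)^3))
     = ennreal \<bar>- 1/K k\<bar>*(NL ta. ?f (gY i j s (0 + - 1/K k*ta))*ennreal ((gw s (0 + - 1/K k*ta))^3))"
     by (rule nn_integral_real_affine[OF _ ci]) measurable
    also have "... = (NL ta. ennreal (1/K k)*(?f (?Y k s ta)*ennreal ((?w k s ta)^3)))"
     using K(1)[of k] by (subst nn_integral_cmult) simp_all
    also have "... = (NL ta. g k s ta)"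
    proof (intro nn_integral_cong)
     fix ta
     have nn: "0 <= cutd (K k) i j (?Y k s ta)*F (?Y k s ta)" "0 <= (?w k s ta)^3" "0 <= 1/K k"
      using F(3)[OF Y] w(1) K(1)[of k] dstp_bounds(1) cutp_bounds(1)
      by (auto simp: cutd_def intro!: mult_nonneg_nonneg less_imp_le)
     have "ennreal (1/K k)*(?f (?Y k s ta)*ennreal ((?w k s ta)^3)) = ennreal (1/K k*(cutd (K k) i j (?Y k s ta)*F (?Y k s ta)*(?w k s ta)^3))"
      by (simp only: ennreal_mult[OF nn(1,2), symmetric] ennreal_mult[OF nn(3) mult_nonneg_nonneg[OF nn(1,2)], symmetric])
     also have "... = g k s ta" unfolding cutd_def arg g_def using K(1)[of k] by (simp add: mult.assoc)
     finally show "ennreal (1/K k)*(?f (?Y k s ta)*ennreal ((?w k s ta)^3)) = g k s ta" .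
    qed
    finally show "(NL t. ?f (gY i j s t)*ennreal ((gw s t)^3)) = (NL ta. g k s ta)" .
   qed
   finally show ?thesis .
  qed
  let ?r = "2/(c*ed i j)"
  \<comment> \<open>Majorant independent of \<open>k\<close>: on the support the weight is at least
    \<open>c/2\<close>, which confines \<open>s\<close> to \<open>2/c\<close> in absolute value and
    \<open>ta\<close> to at most \<open>?r\<close>; the values are bounded by
    \<open>dstp <= 2\<close> and \<open>F <= B\<close>.\<close>
  have gb: "g k s ta <= ennreal (2*B)*indicator {0..?r} ta*indicator {-2/c..2/c} s" for k s ta
  proof (cases "cutd (K k) i j (?Y k s ta) = 0")
   case True
   hence "dstp (ed i j*?w k s ta*ta)*cutp (K k) i j (?Y k s ta) = 0" using K(1)[of k] unfolding cutd_def arg by simp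
   thus ?thesis unfolding g_def by (simp only: mult_zero_left ennreal_0 zero_le)
  next
   case False
   have "c/2 <= ?w k s ta*norm (em i j)" using supp[OF Y False] gY_props(3)[OF ij4] by simp
   also have "... <= ?w k s ta*1" by (rule mult_left_mono[OF m1 less_imp_le[OF w(1)]])
   finally have wc: "c/2 <= ?w k s ta" by simp
   have "\<bar>s\<bar>*(c/2) <= \<bar>s\<bar>*?w k s ta" using wc by (intro mult_left_mono) auto
   also have "... <= 1" by (rule gw_pos(3))
   finally have "\<bar>s\<bar> <= 2/c" using c by (simp add: field_simps)
   hence s: "s \<in> {-2/c..2/c}" by (simp add: abs_le_iff)
   have dn: "dstp (ed i j*?w k s ta*ta) ~= 0" using False unfolding cutd_def arg by auto
   hence a: "0 < ed i j*?w k s ta*ta" "ed i j*?w k s ta*ta < 1"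
    using stp_simps(3,4)[of "ed i j*?w k s ta*ta"] by linarith+
   have t0: "0 < ta" by (rule zero_less_mult_pos[OF a(1) mult_pos_pos[OF d0 w(1)]])
   have "ed i j*(c/2)*ta <= ed i j*?w k s ta*ta" using wc d0 t0 by (intro mult_right_mono mult_left_mono) auto
   hence "ta <= ?r" using a(2) c d0 by (simp add: field_simps)
   hence t: "ta \<in> {0..?r}" using t0 by simp
   have "dstp (ed i j*?w k s ta*ta)*cutp (K k) i j (?Y k s ta)*F (?Y k s ta)*(?w k s ta)^3 <= 2*1*B*1"
    using dstp_bounds cutp_bounds F(3)[OF Y] B[OF Y] w[of s ta k]
    by (intro mult_mono power_le_one mult_nonneg_nonneg) (auto intro: order_trans[OF F(3)[OF Y] B[OF Y]])
   thus ?thesis using s t unfolding g_def by (simp add: ennreal_leI)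
  qed
  let ?L = "\<lambda>s. ennreal (F (gY i j s 0)*(gw s 0)^2/ed i j)*indicator {s. gY i j s 0 \<in> ccell i} s"
  have Kinf: "filterlim K at_top sequentially"
   unfolding K_def by (intro filterlim_compose[OF filterlim_real_sequentially] filterlim_add_const_nat_at_top)
  have inner: "(\<lambda>k. NL ta. g k s ta) \<longlonglongrightarrow> ?L s"
   if gen: "\<forall>l\<in>{1..N}-{i}-{j}. (ea i j + s *R eb i j) \<bullet> (x l - x i) ~= 0" for s
  proof -
   let ?c = "ed i j*gw s 0" and ?ya = "gY i j s 0"
   let ?\<chi> = "if ?ya \<in> ccell i then 1 else 0 :: real"
   have c0: "?c > 0" using d0 gw_pos(1)[of s 0] by simp
   have Y0: "?ya \<in> S2" by (rule gY_props(1)[OF ij4])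
   have q0: "?ya \<bullet> (x i - x l) ~= 0" if "l \<in> {1..N}-{i}-{j}" for l
    using bspec[OF gen that] gw_pos(1)[of s 0] unfolding gY_props(2)[OF ij4] by (simp add: inner_diff_right)
   have qj: "?ya \<bullet> x j = ?ya \<bullet> x i"
   proof -
    have "?ya \<bullet> en i j = 0" unfolding gY_props(2)[OF ij4] using fr by (simp add: frame3_def inner_simps)
    thus ?thesis using d0 by (simp add: en_def inner_diff_right)
   qed
   have lim: "(\<lambda>k. g k s ta) \<longlonglongrightarrow> ennreal (dstp (?c*ta)*?\<chi>*F ?ya*(gw s 0)^3)" for ta
   proof -
    have tk: "(\<lambda>k. - ta/K k) \<longlonglongrightarrow> 0" by (intro tendsto_divide_0[OF tendsto_const] filterlim_at_top_imp_at_infinity Kinf)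
    note Yl = gY_tendsto[OF ij4 tk, of s]
    have FY: "(\<lambda>k. F (?Y k s ta)) \<longlonglongrightarrow> F ?ya"
     by (rule continuous_on_tendsto_compose[OF F(2) Yl(1) Y0]) (use Y in auto)
    have "eventually (\<lambda>k. \<forall>l\<in>{1..N}-{i}-{j}. stp (K k*(?Y k s ta \<bullet> (x i - x l))) = (if ?ya \<bullet> (x i - x l) > 0 then 1 else 0)) sequentially"
     by (intro eventually_ball_finite ballI stp_scaled_limit Yl(1) Kinf q0) auto
    hence "eventually (\<lambda>k. cutp (K k) i j (?Y k s ta) = ?\<chi>) sequentially"
    proof eventually_elim
     case (elim k)
     hence e: "cutp (K k) i j (?Y k s ta) = (\<Prod>l\<in>{1..N}-{i}-{j}. if ?ya \<bullet> (x i - x l) > 0 then 1 else 0)"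
      unfolding cutp_def by (intro prod.cong) auto
     show ?case
     proof (cases "?ya \<in> ccell i")
      case True
      hence "?ya \<bullet> (x i - x l) > 0" if "l \<in> {1..N}-{i}-{j}" for l
       using q0[OF that] that by (auto simp: ccell_def inner_diff_right order.strict_iff_order)
      thus ?thesis unfolding e using True by (auto intro!: prod.neutral)
     next
      case False
      then obtain l where l: "l \<in> {1..N}" "?ya \<bullet> x i < ?ya \<bullet> x l" using Y0 by (auto simp: ccell_def not_le)
      hence "l \<in> {1..N}-{i}-{j}" "\<not> ?ya \<bullet> (x i - x l) > 0" using qj by (auto simp: inner_diff_right)
      thus ?thesis unfolding e using False by (auto intro!: prod_zero)
     qed
    qed
    hence "(\<lambda>k. cutp (K k) i j (?Y k s ta)) \<longlonglongrightarrow> ?\<chi>" by (rule tendsto_eventually)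
    moreover have "(\<lambda>k. dstp (ed i j*?w k s ta*ta)) \<longlonglongrightarrow> dstp (?c*ta)"
     by (intro continuous_on_tendsto_compose[OF stp_cont(2)[of UNIV]] tendsto_intros Yl(2)) auto
    ultimately show ?thesis unfolding g_def by (intro tendsto_ennrealI tendsto_mult tendsto_power FY Yl(2))
   qed
   have "(\<lambda>k. NL ta. g k s ta) \<longlonglongrightarrow> (NL ta. ennreal (dstp (?c*ta)*?\<chi>*F ?ya*(gw s 0)^3))"
   proof (rule nn_integral_dominated_convergence[where w="\<lambda>ta. ennreal (2*B)*indicator {0..?r} ta"])
    show "AE ta in lborel. g k s ta <= ennreal (2*B)*indicator {0..?r} ta" for k
     using gb[of k s] by (intro AE_I2) (rule order_trans, assumption, auto simp: indicator_def)
    show "(NL ta. ennreal (2*B)*indicator {0..?r} ta) < \<infinity>"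
     by (subst nn_integral_cmult_indicator) (auto simp: ennreal_mult_less_top emeasure_lborel_Icc_eq)
    show "AE ta in lborel. (\<lambda>k. g k s ta) \<longlonglongrightarrow> ennreal (dstp (?c*ta)*?\<chi>*F ?ya*(gw s 0)^3)" using lim by simp
   qed measurable
   also have "(NL ta. ennreal (dstp (?c*ta)*?\<chi>*F ?ya*(gw s 0)^3)) = ?L s"
   proof (cases "?ya \<in> ccell i")
    case True
    have nn: "0 <= F ?ya*(gw s 0)^3" using F(3)[OF Y0] gw_pos(1)[of s 0] by simp
    have "(NL ta. ennreal (dstp (?c*ta)*?\<chi>*F ?ya*(gw s 0)^3)) = (NL ta. ennreal (F ?ya*(gw s 0)^3)*ennreal (dstp (?c*ta)))"
     unfolding ennreal_mult[OF nn dstp_bounds(1), symmetric] using True by (simp add: mult_ac)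
    also have "... = ennreal (F ?ya*(gw s 0)^3)*ennreal (1/?c)"
     by (subst nn_integral_cmult) (simp_all add: nn_integral_dstp[OF c0])
    also have "... = ennreal (F ?ya*(gw s 0)^3*(1/?c))" by (simp only: ennreal_mult'[OF nn])
    also have "F ?ya*(gw s 0)^3*(1/?c) = F ?ya*(gw s 0)^2/ed i j"
     using gw_pos(1)[of s 0] d0 by (simp add: power3_eq_cube power2_eq_square)
    finally show ?thesis using True by simp
   qed simp
   finally show ?thesis .
  qed
  have "(\<lambda>k. NL s. NL ta. g k s ta) \<longlonglongrightarrow> (NL s. ?L s)"
  proof (rule nn_integral_dominated_convergence[where w="\<lambda>s. ennreal (2*B)*ennreal ?r*indicator {-2/c..2/c} s"])
   have r0: "0 <= ?r" using c d0 by simp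
   show "AE s in lborel. (NL ta. g k s ta) <= ennreal (2*B)*ennreal ?r*indicator {-2/c..2/c} s" for k
   proof (intro AE_I2)
    fix s
    have "(NL ta. g k s ta) <= (NL ta. ennreal (2*B)*indicator {0..?r} ta*indicator {-2/c..2/c} s)"
     by (intro nn_integral_mono gb)
    also have "... = ennreal (2*B)*ennreal ?r*indicator {-2/c..2/c} s"
     using r0 by (subst nn_integral_multc) (simp_all add: nn_integral_cmult_indicator)
    finally show "(NL ta. g k s ta) <= ennreal (2*B)*ennreal ?r*indicator {-2/c..2/c} s" .
   qed
   show "(NL s. ennreal (2*B)*ennreal ?r*indicator {-2/c..2/c} s) < \<infinity>"
    by (subst nn_integral_cmult_indicator) (auto simp: ennreal_mult_less_top emeasure_lborel_Icc_eq)
   show "AE s in lborel. (\<lambda>k. NL ta. g k s ta) \<longlonglongrightarrow> ?L s"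
    using AE_generic[OF ij4] by eventually_elim (use inner in blast)
  qed measurable
  also have "(NL s. ?L s) = ennreal (integral (eE i j) (\<lambda>th. F (ez i j th))/ed i j)"
   by (rule edge_integral_gnomonic[OF ij4]) (use F in auto)
  finally show ?thesis unfolding repr .
 qed
 thus ?thesis unfolding K_def by (rule LIMSEQ_offset)
qed

text \<open>The limit in \<open>cutd_limit\<close> is stated with nonnegative integrals; it is
  applied to the positive and the negative part of \<open>F\<close>.\<close>

lemma cutd_edge:
 assumes ij: "i \<in> {1..N}" "j \<in> {1..N}" "i ~= j" and F: "F \<in> borel_measurable borel" "continuous_on S2 F"
 shows "(\<lambda>k. SI y. cutd (real k) i j y*F y) \<longlonglongrightarrow> integral (eE i j) (\<lambda>th. F (ez i j th))/ed i j"
proof -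
 have pos: "(\<lambda>k. SI y. cutd (real k) i j y*G y) \<longlonglongrightarrow> integral (eE i j) (\<lambda>th. G (ez i j th))/ed i j"
  if G: "G \<in> borel_measurable borel" "continuous_on S2 G" "\<And>y. y \<in> S2 ==> 0 <= G y" for G
 proof (rule iffD1[OF tendsto_ennreal_iff])
  have nn: "0 <= cutd (real k) i j y*G y" if "y \<in> S2" for k y
   unfolding cutd_def using G(3)[OF that] dstp_bounds(1) cutp_bounds(1) by (intro mult_nonneg_nonneg) auto
  thus "eventually (\<lambda>k. 0 <= (SI y. cutd (real k) i j y*G y)) sequentially"
   by (auto intro!: always_eventually integral_nonneg_AE AE_I2)
  show "0 <= integral (eE i j) (\<lambda>th. G (ez i j th))/ed i j"
   using ed_pos[OF ij] edge_integral_cont[OF ij G(2)] G(3) ccell_S2 by (intro divide_nonneg_pos Henstock_Kurzweil_Integration.integral_nonneg) (auto simp: eE_def)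
  have "integrable sph (\<lambda>y. cutd (real k) i j y*G y)" for k by (intro continuous_S2_integrable continuous_intros cutd_cont G(2))
  hence "(NI y. ennreal (cutd (real k) i j y*G y)) = ennreal (SI y. cutd (real k) i j y*G y)" for k
   using nn by (intro nn_integral_eq_integral AE_I2) auto
  moreover have "(\<lambda>k. NI y. ennreal (cutd (real k) i j y*G y)) \<longlonglongrightarrow> ennreal (integral (eE i j) (\<lambda>th. G (ez i j th))/ed i j)"
   by (rule cutd_limit[OF ij]) (use G in auto)
  ultimately show "(\<lambda>k. ennreal (SI y. cutd (real k) i j y*G y)) \<longlonglongrightarrow> ennreal (integral (eE i j) (\<lambda>th. G (ez i j th))/ed i j)" by simp
 qed
 let ?P = "\<lambda>y. max 0 (F y)" and ?M = "\<lambda>y. max 0 (- F y)"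
 have split: "F y = ?P y - ?M y" for y by (simp add: max_def)
 have c: "continuous_on S2 ?P" "continuous_on S2 ?M" by (intro continuous_intros F(2))+
 have m: "?P \<in> borel_measurable borel" "?M \<in> borel_measurable borel" using F(1) by measurable
 have i: "integrable sph (\<lambda>y. cutd (real k) i j y*?P y)" "integrable sph (\<lambda>y. cutd (real k) i j y*?M y)" for k
  by (intro continuous_S2_integrable continuous_on_mult cutd_cont c)+
 have 1: "(SI y. cutd (real k) i j y*F y) = (SI y. cutd (real k) i j y*?P y) - (SI y. cutd (real k) i j y*?M y)" for k
  unfolding Bochner_Integration.integral_diff[OF i, symmetric] right_diff_distrib[symmetric] split[symmetric] ..
 have 2: "integral (eE i j) (\<lambda>th. F (ez i j th)) = integral (eE i j) (\<lambda>th. ?P (ez i j th)) - integral (eE i j) (\<lambda>th. ?M (ez i j th))"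
  unfolding Henstock_Kurzweil_Integration.integral_diff[OF edge_integral_cont(2)[OF ij c(1)] edge_integral_cont(2)[OF ij c(2)], symmetric] split[symmetric] ..
 show ?thesis unfolding 1 2 diff_divide_distrib
  by (intro tendsto_diff pos m c) auto
qed

text \<open>Exchanging \<open>i\<close> and \<open>j\<close> keeps \<open>ea\<close> and reverses
  \<open>en\<close>, hence also \<open>eb\<close>, so the same edge is traversed with
  \<open>th\<close> replaced by \<open>- th\<close>.\<close>

lemma edge_flux_antisym:
 assumes ij: "i \<in> {1..N}" "j \<in> {1..N}" "i ~= j"
 shows "integral (eE j i) (\<lambda>th. F (ez j i th) \<bullet> (x j - x i))/ed j i = - (integral (eE i j) (\<lambda>th. F (ez i j th) \<bullet> (x i - x j))/ed i j)"
proof (cases "em i j = 0")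
 case True
 hence "em j i = 0" by (simp add: em_def add.commute)
 thus ?thesis using eE_empty True by simp
next
 case False
 have e: "em j i = em i j" "ed j i = ed i j" by (simp_all add: em_def ed_def add.commute norm_minus_commute)
 hence n: "en j i = - en i j" "ea j i = ea i j" by (simp_all add: en_def ea_def scaleR_diff_right)
 hence "eb j i = - eb i j" by (simp add: eb_def)
 hence z: "ez j i th = ez i j (- th)" for th using n by (simp add: ez_def)
 obtain al be where E: "eE i j = {al..be}" using eE_interval[OF ij] by blast
 have "eE j i = {-be..-al}"
 proof -
  have "th \<in> eE j i \<longleftrightarrow> - th \<in> eE i j" for th
   using eE_sym_ccell[OF ij False, of "- th"] by (auto simp: eE_def z)
  thus ?thesis unfolding E by (auto simp: set_eq_iff minus_le_iff le_minus_iff)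
 qed
 hence "integral (eE j i) (\<lambda>th. F (ez j i th) \<bullet> (x j - x i)) = integral (eE i j) (\<lambda>th. F (ez i j th) \<bullet> (x j - x i))"
  unfolding z E by (simp add: Henstock_Kurzweil_Integration.integral_reflect_real[of be al "\<lambda>th. F (ez i j th) \<bullet> (x j - x i)"])
 also have "... = - integral (eE i j) (\<lambda>th. F (ez i j th) \<bullet> (x i - x j))"
  by (simp add: Henstock_Kurzweil_Integration.integral_neg[symmetric] inner_diff_right)
 finally show ?thesis by (simp add: e)
qed

text \<open>The hypothesis says that \<open>H\<close> is minus the weak divergence of
  \<open>F\<close>. The products of steps tend to the indicator of the cell, while by
  \<open>cutd_edge\<close> their gradients concentrate on the edges. The vector
  \<open>x i - x j\<close> over \<open>ed i j\<close> is the inner unit normal, in accordance with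
  the sign of \<open>H\<close>.\<close>

lemma cell_gauss:
 fixes F :: "real^3 => real^3" and H :: "real^3 => real"
 assumes F: "F \<in> borel_measurable borel" "continuous_on S2 F" and H: "integrable sph H"
  and parts: "\<And>ps. C1_fun ps ==> (SI y. F y \<bullet> grad ps y) = (SI y. H y*ps y)" and i: "i \<in> {1..N}"
 shows "(SI y. H y*indicator (V i) y) = (\<Sum>j\<in>{1..N}-{i}. integral (eE i j) (\<lambda>th. F (ez i j th) \<bullet> (x i - x j))/ed i j)"
proof -
 define ps where "ps k y = (\<Prod>l\<in>{1..N}-{i}. stp (real k*(y \<bullet> (x i - x l))))" for k y
 let ?G = "\<lambda>k y. \<Sum>j\<in>{1..N}-{i}. cutd (real k) i j y *R (x i - x j)"
 have d: "(ps k has_derivative (\<lambda>h. ?G k y \<bullet> h)) (at y)" for k y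
 proof -
  have "((\<lambda>y. stp (real k*(y \<bullet> v))) has_derivative (\<lambda>h. real k*(h \<bullet> v)*dstp (real k*(y \<bullet> v)))) (at y)" for v
  proof -
   have "((\<lambda>y. real k*(y \<bullet> v)) has_derivative (\<lambda>h. real k*(h \<bullet> v))) (at y)" by (auto intro!: derivative_eq_intros)
   from has_derivative_compose[OF this stp_deriv[THEN has_field_derivative_imp_has_derivative]] show ?thesis by (simp add: mult.commute)
  qed
  thus ?thesis unfolding ps_def[abs_def]
   by (intro has_derivative_eq_rhs[OF has_derivative_prod]) (assumption, simp add: fun_eq_iff inner_sum_left inner_sum_right cutd_def cutp_def inner_commute mult_ac)
 qed
 have "continuous_on UNIV (?G k)" for k by (intro continuous_intros cutd_cont)
 note C = C1_funI[OF d this]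
 have int: "integrable sph (\<lambda>y. cutd (real k) i j y*(F y \<bullet> (x i - x j)))" for k j
  by (intro continuous_S2_integrable continuous_intros cutd_cont F(2))
 have "(SI y. H y*ps k y) = (SI y. (\<Sum>j\<in>{1..N}-{i}. cutd (real k) i j y*(F y \<bullet> (x i - x j))))" for k
  unfolding parts[OF C(1), symmetric] C(2) by (simp add: inner_sum_right)
 hence e: "(SI y. H y*ps k y) = (\<Sum>j\<in>{1..N}-{i}. SI y. cutd (real k) i j y*(F y \<bullet> (x i - x j)))" for k
  using int by simp
 have "(\<lambda>k. SI y. H y*ps k y) \<longlonglongrightarrow> (\<Sum>j\<in>{1..N}-{i}. integral (eE i j) (\<lambda>th. F (ez i j th) \<bullet> (x i - x j))/ed i j)"
  unfolding e using i F by (intro tendsto_sum cutd_edge) (auto intro!: continuous_intros)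
 moreover have "(\<lambda>k. SI y. H y*ps k y) \<longlonglongrightarrow> (SI y. H y*indicator (V i) y)"
 proof (rule integral_dominated_convergence[where w="\<lambda>y. \<bar>H y\<bar>"])
  have Hm: "H \<in> borel_measurable sph" using H by simp
  show "(\<lambda>y. H y*indicator (V i) y) \<in> borel_measurable sph" "(\<lambda>y. H y*ps k y) \<in> borel_measurable sph" for k
   by (intro borel_measurable_times[OF Hm borel_measurable_sphereI] borel_measurable_indicator vcell_borel i
     borel_measurable_continuous_onI C1_fun_cont(1)[OF C(1)])+
  show "integrable sph (\<lambda>y. \<bar>H y\<bar>)" using H by simp
  have "0 <= ps k y" "ps k y <= 1" for k y unfolding ps_def by (intro prod_nonneg prod_le_1 ballI conjI stp_bounds)+
  thus "AE y in sph. norm (H y*ps k y) <= \<bar>H y\<bar>" for k by (simp add: abs_mult mult_left_le)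
  have "AE y in sph. \<forall>l\<in>{1..N}-{i}. y \<bullet> (x i - x l) ~= 0"
   using AE_sphere_not_orthogonal x_inj i by (intro AE_finite_allI) auto
  thus "AE y in sph. (\<lambda>k. H y*ps k y) \<longlonglongrightarrow> H y*indicator (V i) y"
   using AE_space
  proof eventually_elim
   case (elim y)
   have "eventually (\<lambda>k. \<forall>l\<in>{1..N}-{i}. stp (real k*(y \<bullet> (x i - x l))) = (if y \<bullet> (x i - x l) > 0 then 1 else 0)) sequentially"
    using elim(1) by (intro eventually_ball_finite ballI stp_scaled_limit tendsto_const filterlim_real_sequentially) auto
   hence "eventually (\<lambda>k. ps k y = indicator (V i) y) sequentially"
   proof eventually_elim
    case (elim k)
    hence "ps k y = (\<Prod>l\<in>{1..N}-{i}. if y \<bullet> (x i - x l) > 0 then 1 else 0)" unfolding ps_def by (intro prod.cong) auto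
    also have "... = indicator (V i) y"
    proof (cases "y \<in> V i")
     case True
     thus ?thesis unfolding vcell_eq[OF i] by (auto simp: inner_diff_right intro!: prod.neutral)
    next
     case False
     then obtain l where "l \<in> {1..N}-{i}" "\<not> y \<bullet> (x i - x l) > 0"
      using \<open>y \<in> space sph\<close> unfolding vcell_eq[OF i] by (auto simp: inner_diff_right)
     thus ?thesis using False by (auto intro!: prod_zero)
    qed
    finally show ?case .
   qed
   thus ?case by (intro tendsto_mult tendsto_const tendsto_eventually)
  qed
 qed
 ultimately show ?thesis using LIMSEQ_unique by blast
qed

text \<open>Sum the identities of the cells with the weights \<open>e i\<close>. Since fluxes are
  antisymmetric, the mean of this sum and its transpose contains only differences of the
  weights.\<close>

lemma voronoi_gauss:
 fixes F :: "real^3 => real^3" and H :: "real^3 => real" and e :: "nat => real"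
 assumes F: "F \<in> borel_measurable borel" "continuous_on S2 F" and H: "integrable sph H"
  and parts: "\<And>ps. C1_fun ps ==> (SI y. F y \<bullet> grad ps y) = (SI y. H y*ps y)"
 shows "(SI y. H y*(\<Sum>i\<in>{1..N}. e i*indicator (V i) y))
  = (1/2)*(\<Sum>i\<in>{1..N}. \<Sum>j\<in>{1..N}-{i}. (e i - e j)*(integral (eE i j) (\<lambda>th. F (ez i j th) \<bullet> (x i - x j))/ed i j))"
proof -
 define f where "f i j = (if j = i then 0 else integral (eE i j) (\<lambda>th. F (ez i j th) \<bullet> (x i - x j))/ed i j)" for i j
 have anti: "f j i = - f i j" if "i \<in> {1..N}" "j \<in> {1..N}" for i j
  using edge_flux_antisym[OF that, of F] by (auto simp: f_def)
 have ci: "integrable sph (\<lambda>y. H y*indicator (V i) y)" if i: "i \<in> {1..N}" for i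
 proof -
  have "V i \<in> sets sph" by (rule sets_sphere_borel[OF vcell_borel[OF i]]) (auto simp: vcell_def)
  thus ?thesis using integrable_mult_indicator[OF _ H] by (simp add: mult.commute)
 qed
 have full: "(\<Sum>j\<in>{1..N}-{i}. c j*(integral (eE i j) (\<lambda>th. F (ez i j th) \<bullet> (x i - x j))/ed i j)) = (\<Sum>j\<in>{1..N}. c j*f i j)" for i c
  by (rule sum.mono_neutral_cong_left) (auto simp: f_def)
 have "(SI y. H y*(\<Sum>i\<in>{1..N}. e i*indicator (V i) y)) = (SI y. (\<Sum>i\<in>{1..N}. e i*(H y*indicator (V i) y)))"
  by (simp only: sum_distrib_left mult.left_commute)
 also have "... = (\<Sum>i\<in>{1..N}. e i*(SI y. H y*indicator (V i) y))"
  using ci by (subst Bochner_Integration.integral_sum) auto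
 also have "... = (\<Sum>i\<in>{1..N}. \<Sum>j\<in>{1..N}. e i*f i j)"
  using full[of "\<lambda>_. 1"] by (intro sum.cong refl) (simp add: cell_gauss[OF F H parts] sum_distrib_left)
 finally have a: "(SI y. H y*(\<Sum>i\<in>{1..N}. e i*indicator (V i) y)) = (\<Sum>i\<in>{1..N}. \<Sum>j\<in>{1..N}. e i*f i j)" .
 also have "... = (\<Sum>i\<in>{1..N}. \<Sum>j\<in>{1..N}. - e j*f i j)"
  by (subst sum.swap, intro sum.cong refl) (subst anti, assumption+, simp only: mult_minus_left mult_minus_right)
 finally show ?thesis unfolding full using a by (simp add: left_diff_distrib sum_subtractf sum_negf)
qed

end

section \<open>Three points of the sphere and their circumcenter\<close>

lemma cross3_expand: "(p \<bullet> cross3 q r) *R z = (z \<bullet> cross3 q r) *R p + (z \<bullet> cross3 r p) *R q + (z \<bullet> cross3 p q) *R r"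
 by (simp add: forall_3 vec_eq_iff cross3_def inner_vec_def sum_3 algebra_simps)

lemma S2_line:
 assumes p: "p \<in> S2" "q \<in> S2" "r \<in> S2" and r: "r = p + s *R (q - p)" and ne: "q ~= p"
 shows "s = 0 \<or> s = 1"
proof -
 have pp: "p \<bullet> p = 1" "q \<bullet> q = 1" "r \<bullet> r = 1" using p inner_S2_self by auto
 have "r \<bullet> r = p \<bullet> p + 2 * s * (p \<bullet> q - p \<bullet> p) + s^2*(p \<bullet> p - 2*(p \<bullet> q) + q \<bullet> q)"
  unfolding r by (simp add: inner_simps inner_commute power2_eq_square algebra_simps)
 hence "2*(s * (s - 1))*(1 - p \<bullet> q) = 0" unfolding pp by (simp add: power2_eq_square algebra_simps)
 moreover have "p \<bullet> q < 1" by (rule inner_S2_less) (use p ne in auto)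
 ultimately show ?thesis by auto
qed

text \<open>Equal products with three points means orthogonality to two chords. The chords are
  independent, as no line meets the sphere in three points, so only the multiples of their cross
  product remain.\<close>

lemma three_points:
 assumes p: "p \<in> S2" "q \<in> S2" "r \<in> S2" and ne: "p ~= q" "p ~= r" "q ~= r"
 defines "n \<equiv> cross3 (q - p) (r - p)"
 shows "n ~= 0" and "v \<bullet> p = v \<bullet> q ==> v \<bullet> p = v \<bullet> r ==> \<exists>ta. v = ta *R n" and "n \<bullet> p = p \<bullet> cross3 q r"
proof -
 show n0: "n ~= 0"
 proof
  assume "n = 0"
  hence "collinear {0, q - p, r - p}" by (simp add: n_def cross_eq_0)
  then obtain s where "r - p = s *R (q - p)" unfolding collinear_lemma using ne by auto
  hence r: "r = p + s *R (q - p)" by (simp add: algebra_simps)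
  from S2_line[OF p r] ne have "s = 0 \<or> s = 1" by auto
  thus False using r ne by auto
 qed
 show "\<exists>ta. v = ta *R n" if "v \<bullet> p = v \<bullet> q" "v \<bullet> p = v \<bullet> r"
 proof -
  have z: "v \<bullet> (q - p) = 0" "v \<bullet> (r - p) = 0" using that by (auto simp: inner_diff_right)
  have "(n \<bullet> n) *R v = (n \<bullet> v) *R n"
  proof -
   have "cross3 v n = 0" unfolding n_def Lagrange using z by (simp add: inner_commute)
   hence "cross3 n (cross3 v n) = 0" by simp
   thus ?thesis unfolding Lagrange by (simp add: inner_commute)
  qed
  hence "(1/(n \<bullet> n)) *R ((n \<bullet> n) *R v) = (1/(n \<bullet> n)) *R ((n \<bullet> v) *R n)" by simp
  hence "v = ((n \<bullet> v)/(n \<bullet> n)) *R n" using n0 by simp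
  thus ?thesis by blast
 qed
 show "n \<bullet> p = p \<bullet> cross3 q r" unfolding n_def by (simp add: cross3_def inner_vec_def sum_3 algebra_simps)
qed

section \<open>Interpolation on the Delaunay decomposition\<close>

context vmesh
begin

lemma nbrs_in: "j \<in> nbrs N x i ==> j \<in> {1..N} \<and> j ~= i"
 by (auto simp: nbrs_def)

text \<open>An edge of positive length is an arc with two different ends, and at least one of them
  is not \<open>c\<close>.\<close>

lemma nbrs_second_point:
 assumes i: "i \<in> {1..N}" and j: "j \<in> nbrs N x i"
 shows "\<exists>y\<in>ccell i \<inter> ccell j. y ~= c"
proof -
 have ij: "i \<in> {1..N}" "j \<in> {1..N}" "i ~= j" using i nbrs_in[OF j] by auto
 obtain al be where E: "eE i j = {al..be}" using eE_interval[OF ij] by blast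
 have "measure lborel {al..be} > 0" using j unfolding nbrs_def edge_length[OF ij, symmetric] E[symmetric] by simp
 hence ab: "al < be" by (cases "al < be") (auto simp: measure_def emeasure_lborel_Icc_eq split: if_splits)
 have m: "al \<in> eE i j" "be \<in> eE i j" using ab E by auto
 have "ez i j al ~= ez i j be"
 proof
  assume eq: "ez i j al = ez i j be"
  have em: "em i j ~= 0" by (rule eE_cos_pos(1)[OF ij m(1)])
  note fr = edge_frame[OF ij em]
  have "ez i j th \<bullet> eb i j = sin th" for th using fr by (simp add: ez_def frame3_def inner_simps norm_eq_1)
  hence "sin al = sin be" using eq by metis
  moreover have "- (pi/2) <= al" "be <= pi/2" using eE_cos_pos(3,4)[OF ij m(1)] eE_cos_pos(3,4)[OF ij m(2)] by auto
  ultimately show False using sin_monotone_2pi[of al be] ab by auto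
 qed
 moreover have "ez i j al \<in> ccell i \<inter> ccell j" "ez i j be \<in> ccell i \<inter> ccell j" using m ccell_inter[OF ij] by auto
 ultimately show ?thesis by metis
qed

text \<open>Three vertices are equidistant from two antipodal points of the sphere only, here
  \<open>c\<close> and \<open>- c\<close>, and \<open>- c\<close> has negative products with them. A
  second point of the edge between \<open>x j\<close> and \<open>x k\<close> is therefore strictly
  nearer to these two than to \<open>x i\<close>.\<close>

lemma edge_side:
 assumes i: "i \<in> {1..N}" "j \<in> {1..N}" "i ~= j" "i ~= k" and k: "k \<in> nbrs N x j"
  and c: "c \<in> S2" "c \<bullet> x i > 0" "c \<bullet> x j = c \<bullet> x i" "c \<bullet> x k = c \<bullet> x i"
 shows "\<exists>y. y \<bullet> x k = y \<bullet> x j \<and> y \<bullet> x i < y \<bullet> x j \<and> (\<forall>l\<in>{1..N}. y \<bullet> x l <= y \<bullet> x j)"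
proof -
 have k': "k \<in> {1..N}" "k ~= j" using nbrs_in[OF k] by auto
 obtain y where y: "y \<in> ccell j" "y \<in> ccell k" "y ~= c" using nbrs_second_point[OF i(2) k, of c] by blast
 have le: "y \<bullet> x l <= y \<bullet> x j" "y \<bullet> x l <= y \<bullet> x k" if "l \<in> {1..N}" for l using y that by (auto simp: ccell_def)
 have eq: "y \<bullet> x k = y \<bullet> x j" using le[OF k'(1)] le[OF i(2)] by linarith
 have "y \<bullet> x i ~= y \<bullet> x j"
 proof
  assume yi: "y \<bullet> x i = y \<bullet> x j"
  have ne: "x i ~= x j" "x i ~= x k" "x j ~= x k" using x_inj i k' by auto
  note tp = three_points[OF x_S2[OF i(1)] x_S2[OF i(2)] x_S2[OF k'(1)] ne]
  let ?n = "cross3 (x j - x i) (x k - x i)"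
  obtain ta where ta: "y = ta *R ?n" using tp(2)[of y, OF yi yi[folded eq]] by blast
  obtain ta' where ta': "c = ta' *R ?n" using tp(2)[of c, OF c(3)[symmetric] c(4)[symmetric]] by blast
  have "norm y = 1" "norm c = 1" using ccell_S2[OF y(1)] c(1) by auto
  hence "\<bar>ta\<bar>*norm ?n = \<bar>ta'\<bar>*norm ?n" using ta ta' by (metis norm_scaleR)
  hence "\<bar>ta\<bar> = \<bar>ta'\<bar>" using tp(1) by simp
  hence "ta = ta' \<or> ta = - ta'" by linarith
  moreover have "y ~= - c" using ccell_pos[OF i(2) y(1)] c by auto
  ultimately show False using y(3) ta ta' by auto
 qed
 moreover have "y \<bullet> x i <= y \<bullet> x j" by (rule le(1)[OF i(1)])
 ultimately have "y \<bullet> x i < y \<bullet> x j" by simp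
 thus ?thesis using le(1) eq by blast
qed

text \<open>A second point of the Voronoi edge \<open>jk\<close> is a support functional of the hull of the four
 vertices, so a fourth vertex \<open>x l\<close> on the circumcircle lies in the triangle.\<close>

lemma delaunay_circumcenter:
 assumes t: "t \<in> delaunay N x"
 obtains i j k c where "t = {i, j, k}" "i \<in> {1..N}" "j \<in> {1..N}" "k \<in> {1..N}" "i ~= j" "i ~= k" "j ~= k"
  "c \<in> ccell i" "c \<in> ccell j" "c \<in> ccell k" "c \<bullet> x j = c \<bullet> x i" "c \<bullet> x k = c \<bullet> x i"
  "x i \<bullet> cross3 (x j) (x k) ~= 0" "\<And>l. l \<in> {1..N} ==> c \<bullet> x l = c \<bullet> x i ==> l \<in> t"
proof -
 obtain i j k where tt: "t = {i, j, k}" "i \<in> {1..N}" "j \<in> nbrs N x i" "k \<in> nbrs N x i" "k \<in> nbrs N x j"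
  and ne: "closure (V i) \<inter> closure (V j) \<inter> closure (V k) ~= {}" using t unfolding delaunay_def by blast
 have I: "i \<in> {1..N}" "j \<in> {1..N}" "k \<in> {1..N}" and d: "i ~= j" "i ~= k" "j ~= k"
  using tt(2) nbrs_in[OF tt(3)] nbrs_in[OF tt(4)] nbrs_in[OF tt(5)] by auto
 obtain c where c: "c \<in> ccell i" "c \<in> ccell j" "c \<in> ccell k"
  using ne unfolding closure_vcell[OF I(1)] closure_vcell[OF I(2)] closure_vcell[OF I(3)] by blast
 have eq: "c \<bullet> x j = c \<bullet> x i" "c \<bullet> x k = c \<bullet> x i" using c I by (auto simp: ccell_def intro: order.antisym)
 have M: "c \<bullet> x i > 0" by (rule ccell_pos[OF I(1) c(1)])
 have M2: "c \<bullet> x j > 0" and M3: "c \<bullet> x k > 0" unfolding eq by (rule M)+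
 have cS: "c \<in> S2" by (rule ccell_S2[OF c(1)])
 have xne: "x i ~= x j" "x i ~= x k" "x j ~= x k" using x_inj I d by auto
 note tp = three_points[OF x_S2[OF I(1)] x_S2[OF I(2)] x_S2[OF I(3)] xne]
 define D where "D = x i \<bullet> cross3 (x j) (x k)"
 have D: "D ~= 0"
 proof -
  obtain ta where ta: "c = ta *R cross3 (x j - x i) (x k - x i)" using tp(2)[of c, OF eq(1)[symmetric] eq(2)[symmetric]] by blast
  have "c \<bullet> x i = ta*D" unfolding D_def tp(3)[symmetric] by (subst ta) simp
  thus ?thesis using M by auto
 qed
 have conc: "l \<in> t" if l: "l \<in> {1..N}" "c \<bullet> x l = c \<bullet> x i" for l
 proof (rule ccontr)
  assume lt: "l \<notin> t"
  define z where "z = x l"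
  \<comment> \<open>Coordinates of the fourth vertex by Cramer's rule, where \<open>D\<close> is the
    determinant of the three vertices. Pairing with \<open>c\<close> shows that they sum to 1, so
    they are barycentric.\<close>
  define p q r where "p = (z \<bullet> cross3 (x j) (x k))/D" and "q = (z \<bullet> cross3 (x k) (x i))/D" and "r = (z \<bullet> cross3 (x i) (x j))/D"
  have "(1/D) *R (D *R z) = p *R x i + q *R x j + r *R x k"
   unfolding cross3_expand[of "x i" "x j" "x k" z, folded D_def] p_def q_def r_def by (simp add: scaleR_add_right)
  hence z: "z = p *R x i + q *R x j + r *R x k" using D by simp
  have yz: "y \<bullet> z = p*(y \<bullet> x i) + q*(y \<bullet> x j) + r*(y \<bullet> x k)" for y by (subst z) (simp add: inner_simps)
  have "(p + q + r)*(c \<bullet> x i) = c \<bullet> x i" using yz[of c] l(2) eq unfolding z_def by (simp add: algebra_simps)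
  hence s1: "p + q + r = 1" using M by simp
  have nonneg: "0 <= al" if "y \<bullet> z = al*u + (1 - al) * m" "u < m" "y \<bullet> z <= m" for y al u m
  proof -
   have "al*(m - u) \<ge> 0" using that by (simp add: algebra_simps)
   thus ?thesis using that(2) by (simp add: zero_le_mult_iff)
  qed
  have p0: "0 <= p"
  proof -
   obtain y where y: "y \<bullet> x k = y \<bullet> x j" "y \<bullet> x i < y \<bullet> x j" "\<forall>l\<in>{1..N}. y \<bullet> x l <= y \<bullet> x j"
    using edge_side[OF I(1,2) d(1,2) tt(5) cS M eq] by blast
   have e: "q + r = 1 - p" using s1 by simp
   have "y \<bullet> z = p*(y \<bullet> x i) + (1 - p)*(y \<bullet> x j)" unfolding yz y(1) e[symmetric] by (simp add: algebra_simps)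
   thus ?thesis by (rule nonneg) (use y l in \<open>auto simp: z_def\<close>)
  qed
  have q0: "0 <= q"
  proof -
   obtain y where y: "y \<bullet> x k = y \<bullet> x i" "y \<bullet> x j < y \<bullet> x i" "\<forall>l\<in>{1..N}. y \<bullet> x l <= y \<bullet> x i"
    using edge_side[OF I(2,1) d(1)[symmetric] d(3) tt(4) cS M2 eq(1)[symmetric] trans[OF eq(2) eq(1)[symmetric]]] by blast
   have e: "p + r = 1 - q" using s1 by simp
   have "y \<bullet> z = q*(y \<bullet> x j) + (1 - q)*(y \<bullet> x i)" unfolding yz y(1) e[symmetric] by (simp add: algebra_simps)
   thus ?thesis by (rule nonneg) (use y l in \<open>auto simp: z_def\<close>)
  qed
  have r0: "0 <= r"
  proof -
   obtain y where y: "y \<bullet> x j = y \<bullet> x i" "y \<bullet> x k < y \<bullet> x i" "\<forall>l\<in>{1..N}. y \<bullet> x l <= y \<bullet> x i"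
    using edge_side[OF I(3,1) d(2)[symmetric] d(3)[symmetric] tt(3) cS M3 eq(2)[symmetric] trans[OF eq(1) eq(2)[symmetric]]] by blast
   have e: "p + q = 1 - r" using s1 by simp
   have "y \<bullet> z = r*(y \<bullet> x k) + (1 - r)*(y \<bullet> x i)" unfolding yz y(1) e[symmetric] by (simp add: algebra_simps)
   thus ?thesis by (rule nonneg) (use y l in \<open>auto simp: z_def\<close>)
  qed
  \<comment> \<open>With nonnegative coordinates the fourth vertex is a convex combination of three
    other points of the sphere. Strict convexity forbids this: its product with itself would be
    below 1.\<close>
  have zl: "z \<bullet> x m < 1" if "m \<in> {i, j, k}" for m
  proof -
   have m: "m \<in> {1..N}" "l ~= m" using that I lt tt(1) by auto
   hence "x l ~= x m" using x_inj[OF l(1)] by blast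
   thus ?thesis unfolding z_def by (rule inner_S2_less[OF x_S2[OF l(1)] x_S2[OF m(1)]])
  qed
  have "z \<bullet> z = p*(z \<bullet> x i) + q*(z \<bullet> x j) + r*(z \<bullet> x k)" by (rule yz)
  also have "... < p + q + r"
  proof -
   have "p*(1 - z \<bullet> x i) + q*(1 - z \<bullet> x j) + r*(1 - z \<bullet> x k) > 0"
   proof -
    have nn: "p*(1 - z \<bullet> x i) \<ge> 0" "q*(1 - z \<bullet> x j) \<ge> 0" "r*(1 - z \<bullet> x k) \<ge> 0"
     using p0 q0 r0 zl by (auto intro!: mult_nonneg_nonneg simp: less_imp_le)
    consider "p > 0" | "q > 0" | "r > 0" using s1 p0 q0 r0 by linarith
    thus ?thesis
    proof cases
     case 1 hence "p*(1 - z \<bullet> x i) > 0" using zl by simp thus ?thesis using nn by linarith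
    next
     case 2 hence "q*(1 - z \<bullet> x j) > 0" using zl by simp thus ?thesis using nn by linarith
    next
     case 3 hence "r*(1 - z \<bullet> x k) > 0" using zl by simp thus ?thesis using nn by linarith
    qed
   qed
   thus ?thesis by (simp add: algebra_simps)
  qed
  finally show False using s1 inner_S2_self[OF x_S2[OF l(1)]] unfolding z_def by simp
 qed
 show thesis by (rule that[OF tt(1) I d c eq D[unfolded D_def] conc])
qed

end

section \<open>Piecewise affine functions with given vertex values\<close>

context vmesh
begin

lemma delaunay_finite: "t \<in> delaunay N x ==> finite t"
 using delaunay_subset finite_subset by blast

lemma delaunay_finite_set: "finite (delaunay N x)"
 by (rule finite_subset[of _ "Pow {1..N}"]) (use delaunay_subset in auto)

lemma planar_tri_rep:
 assumes t: "t \<in> delaunay N x" and p: "p \<in> planar_tri x t"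
 obtains al where "\<And>m. m \<in> t ==> 0 <= al m" "sum al t = 1" "p = (\<Sum>m\<in>t. al m *R x m)"
proof -
 have inj: "inj_on x t" using inj_on_subset[OF vd_parts(2) delaunay_subset[OF t]] .
 have fin: "finite (x ` t)" using delaunay_finite[OF t] by simp
 obtain u where u: "\<forall>y\<in>x ` t. 0 <= u y" "sum u (x ` t) = 1" "(\<Sum>y\<in>x ` t. u y *R y) = p"
  using p unfolding planar_tri_def convex_hull_finite[OF fin] by blast
 show thesis
  by (rule that[of "\<lambda>m. u (x m)"]) (use u in \<open>simp_all add: sum.reindex[OF inj]\<close>)
qed

lemma planar_triI:
 assumes "t \<in> delaunay N x" "\<And>m. m \<in> t ==> 0 <= al m" "sum al t = 1"
 shows "(\<Sum>m\<in>t. al m *R x m) \<in> planar_tri x t"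
 unfolding planar_tri_def
 by (rule convex_sum[OF delaunay_finite convex_convex_hull]) (use assms in \<open>auto intro: hull_inc\<close>)

text \<open>The cross products of the other two vertices in cyclic order, divided by the
  determinant, are the dual basis of the three vertices.\<close>

lemma delaunay_dual:
 assumes t: "t \<in> delaunay N x"
 shows "\<exists>g. \<forall>m\<in>t. g \<bullet> x m = e m" and "(\<Sum>m\<in>t. nu m *R x m) = 0 ==> m \<in> t ==> nu m = 0"
proof -
 obtain i j k c where t3: "t = {i, j, k}" and d: "i ~= j" "i ~= k" "j ~= k" and D: "x i \<bullet> cross3 (x j) (x k) ~= 0"
  by (rule delaunay_circumcenter[OF t])
 let ?D = "x i \<bullet> cross3 (x j) (x k)"
 have D2: "x j \<bullet> cross3 (x k) (x i) = ?D" "x k \<bullet> cross3 (x i) (x j) = ?D"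
  by (simp_all add: cross3_def inner_vec_def sum_3 algebra_simps)
 note z = dot_cross_self
 show "\<exists>g. \<forall>m\<in>t. g \<bullet> x m = e m"
  by (rule exI[of _ "(1/?D) *R (e i *R cross3 (x j) (x k) + e j *R cross3 (x k) (x i) + e k *R cross3 (x i) (x j))"])
   (use D in \<open>simp add: t3 inner_add_left z D2 inner_commute[of "cross3 _ _"]\<close>)
 show "nu m = 0" if s: "(\<Sum>m\<in>t. nu m *R x m) = 0" and m: "m \<in> t"
 proof -
  have s0: "nu i *R x i + (nu j *R x j + nu k *R x k) = 0" using s d by (simp add: t3)
  have "nu i*?D = 0" using arg_cong[OF s0, of "\<lambda>y. y \<bullet> cross3 (x j) (x k)"] by (simp add: inner_add_left z)
  moreover have "nu j*?D = 0" using arg_cong[OF s0, of "\<lambda>y. y \<bullet> cross3 (x k) (x i)"] by (simp add: inner_add_left z D2)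
  moreover have "nu k*?D = 0" using arg_cong[OF s0, of "\<lambda>y. y \<bullet> cross3 (x i) (x j)"] by (simp add: inner_add_left z D2)
  ultimately show ?thesis using D m by (auto simp: t3)
 qed
qed

text \<open>The circumcenter of \<open>t\<close> supports the polyhedral surface, so that a common point of two
 triangles is a combination of common vertices.\<close>

lemma barycentric_unique:
 assumes st: "s \<in> delaunay N x" "t \<in> delaunay N x"
  and al: "\<And>m. m \<in> s ==> 0 <= al m" "sum al s = 1" and mu: "\<And>m. m \<in> t ==> 0 <= mu m" "sum mu t = 1"
  and eq: "(\<Sum>m\<in>s. al m *R x m) = (\<Sum>m\<in>t. mu m *R x m)"
 shows "(\<Sum>m\<in>s. al m*e m) = (\<Sum>m\<in>t. mu m*(e m :: real))"
proof -
 obtain i j k c where t3: "t = {i, j, k}" and I: "i \<in> {1..N}" and c: "c \<in> ccell i"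
  and ceq: "c \<bullet> x j = c \<bullet> x i" "c \<bullet> x k = c \<bullet> x i" and conc: "\<And>l. l \<in> {1..N} ==> c \<bullet> x l = c \<bullet> x i ==> l \<in> t"
  by (rule delaunay_circumcenter[OF st(2)]) blast
 let ?M = "c \<bullet> x i"
 note fin = delaunay_finite[OF st(1)] delaunay_finite[OF st(2)]
 have "c \<bullet> (\<Sum>m\<in>t. mu m *R x m) = (\<Sum>m\<in>t. mu m*?M)"
  unfolding inner_sum_right by (intro sum.cong refl) (auto simp: t3 ceq)
 also have "... = ?M" using mu(2) by (simp add: sum_distrib_right[symmetric])
 finally have "(\<Sum>m\<in>s. al m*(c \<bullet> x m)) = ?M" unfolding eq[symmetric] by (simp add: inner_sum_right)
 hence z: "(\<Sum>m\<in>s. al m*(?M - c \<bullet> x m)) = 0"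
  using al(2) by (simp add: right_diff_distrib sum_subtractf sum_distrib_right[symmetric])
 \<comment> \<open>The common point attains the maximum \<open>?M\<close> of the functional
   \<open>c\<close> over all vertices, so its positive weights sit on maximisers, and these are
   vertices of \<open>t\<close> by the circumcenter property.\<close>
 have "m \<in> t" if m: "m \<in> s" "al m ~= 0" for m
 proof -
  have le: "c \<bullet> x l <= ?M" if "l \<in> s" for l using c delaunay_subset[OF st(1)] that by (auto simp: ccell_def)
  have "\<forall>m\<in>s. al m*(?M - c \<bullet> x m) = 0"
   using z by (subst (asm) sum_nonneg_eq_0_iff[OF fin(1)]) (use al(1) le in \<open>auto intro!: mult_nonneg_nonneg\<close>)
  hence "c \<bullet> x m = ?M" using m by auto
  thus ?thesis using conc delaunay_subset[OF st(1)] m by auto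
 qed
 hence out: "al m = 0" if "m \<in> s" "m \<notin> t" for m using that by blast
 define nu where "nu m = (if m \<in> s then al m else 0)" for m
 have ext: "(\<Sum>m\<in>s. al m *R f m) = (\<Sum>m\<in>t. nu m *R f m)" for f :: "nat => 'b::real_vector"
 proof -
  have "(\<Sum>m\<in>s. al m *R f m) = (\<Sum>m\<in>s \<inter> t. nu m *R f m)"
   using fin out by (intro sum.mono_neutral_cong_right) (auto simp: nu_def)
  also have "... = (\<Sum>m\<in>t. nu m *R f m)"
   using fin by (intro sum.mono_neutral_left) (auto simp: nu_def)
  finally show ?thesis .
 qed
 have "(\<Sum>m\<in>t. (nu m - mu m) *R x m) = 0"
  using eq unfolding ext by (simp add: scaleR_diff_left sum_subtractf)
 hence "nu m - mu m = 0" if "m \<in> t" for m using delaunay_dual(2)[OF st(2), of "\<lambda>m. nu m - mu m" m] that by simp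
 hence "nu m = mu m" if "m \<in> t" for m using that by simp
 thus ?thesis using ext[of e] by simp
qed

lemma planar_tri_nonzero: "t \<in> delaunay N x ==> p \<in> planar_tri x t ==> p ~= 0"
proof
 assume t: "t \<in> delaunay N x" and p: "p \<in> planar_tri x t" and "p = 0"
 hence "rp 0 \<in> S2" using vd_parts(3) by (force simp: geo_tri_def)
 thus False by (simp add: radial_proj_def)
qed

lemma poly_surface_compact: "compact (poly_surface N x)"
 unfolding poly_surface_def planar_tri_def
 by (intro compact_UN delaunay_finite_set compact_convex_hull finite_imp_compact finite_imageI delaunay_finite)

lemma poly_surface_nonzero: "p \<in> poly_surface N x ==> p ~= 0"
 using planar_tri_nonzero by (auto simp: poly_surface_def)

lemma poly_surface_image: "rp ` poly_surface N x = S2"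
 using vd_parts(3) unfolding poly_surface_def geo_tri_def image_UN .

text \<open>Some triangle has a point \<open>p\<close> with \<open>rp p = x l\<close>, and it lies
  on the plane where \<open>c\<close> has the value \<open>c . x i\<close>. As
  \<open>norm p <= 1\<close>, the projection has at least this value; it cannot exceed it because
  \<open>c\<close> is in the cell of \<open>i\<close>. So \<open>x l\<close> is on the circumcircle
  and is a vertex of the triangle.\<close>

lemma x_in_delaunay:
 assumes l: "l \<in> {1..N}"
 obtains t where "t \<in> delaunay N x" "l \<in> t"
proof -
 obtain t p where t: "t \<in> delaunay N x" and p: "p \<in> planar_tri x t" "x l = rp p" using cover[OF x_S2[OF l]] by blast
 obtain al where al: "\<And>m. m \<in> t ==> 0 <= al m" "sum al t = 1" "p = (\<Sum>m\<in>t. al m *R x m)" by (rule planar_tri_rep[OF t p(1)]) blast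
 obtain i j k c where t3: "t = {i, j, k}" and I: "i \<in> {1..N}" and c: "c \<in> ccell i"
  and ceq: "c \<bullet> x j = c \<bullet> x i" "c \<bullet> x k = c \<bullet> x i" and conc: "\<And>l. l \<in> {1..N} ==> c \<bullet> x l = c \<bullet> x i ==> l \<in> t"
  by (rule delaunay_circumcenter[OF t]) blast
 have "c \<bullet> p = (\<Sum>m\<in>t. al m*(c \<bullet> x i))"
  unfolding al(3) inner_sum_right by (intro sum.cong refl) (auto simp: t3 ceq)
 also have "... = c \<bullet> x i" using al(2) by (simp add: sum_distrib_right[symmetric])
 finally have cp: "c \<bullet> p = c \<bullet> x i" .
 have M: "c \<bullet> x i > 0" by (rule ccell_pos[OF I c])
 have "norm p <= (\<Sum>m\<in>t. norm (al m *R x m))" unfolding al(3) by (rule norm_sum)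
 also have "... = sum al t" using al(1) x_S2 delaunay_subset[OF t] by (intro sum.cong refl) auto
 finally have np: "norm p <= 1" using al(2) by simp
 have p0: "p ~= 0" by (rule planar_tri_nonzero[OF t p(1)])
 have "c \<bullet> x l = c \<bullet> p/norm p" unfolding p(2) radial_proj_def by (simp add: divide_inverse_commute)
 also have "... \<ge> c \<bullet> x i" using np p0 M unfolding cp by (simp add: field_simps mult_left_le)
 finally have "c \<bullet> x l \<ge> c \<bullet> x i" .
 moreover have "c \<bullet> x l <= c \<bullet> x i" using c l by (auto simp: ccell_def)
 ultimately show thesis using that[OF t] conc[OF l] by simp
qed

lemma x_in_planar_tri: "t \<in> delaunay N x ==> m \<in> t ==> x m \<in> planar_tri x t"
 by (auto simp: planar_tri_def intro: hull_inc)

lemma inv_proj_x: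
 assumes l: "l \<in> {1..N}"
 shows "the_inv_into (poly_surface N x) rp (x l) = x l" "x l \<in> poly_surface N x"
proof -
 obtain t where t: "t \<in> delaunay N x" "l \<in> t" by (rule x_in_delaunay[OF l])
 thus P: "x l \<in> poly_surface N x" using x_in_planar_tri by (auto simp: poly_surface_def)
 have "rp (x l) = x l" using x_S2[OF l] by (simp add: radial_proj_def)
 thus "the_inv_into (poly_surface N x) rp (x l) = x l" by (rule the_inv_into_f_eq[OF vd_parts(4) _ P])
qed

lemma inv_proj_continuous: "continuous_on S2 (the_inv_into (poly_surface N x) rp)"
proof -
 have "continuous_on (poly_surface N x) rp"
  unfolding radial_proj_def using poly_surface_nonzero by (intro continuous_intros) auto
 from continuous_on_inv[OF this poly_surface_compact] show ?thesis
  using the_inv_into_f_f[OF vd_parts(4)] unfolding poly_surface_image by blast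
qed

lemma U_h_rep:
 assumes u: "u \<in> U_h N x" and y: "y \<in> S2"
 obtains t al where "t \<in> delaunay N x" "\<And>m. m \<in> t ==> 0 <= al m" "sum al t = 1"
  "y = rp (\<Sum>m\<in>t. al m *R x m)" "u y = (\<Sum>m\<in>t. al m*u (x m))"
proof -
 obtain w where w: "\<And>t. t \<in> delaunay N x ==> \<exists>a b. \<forall>y\<in>planar_tri x t. w y = a \<bullet> y + b"
  and uw: "\<And>y. y \<in> S2 ==> u y = w (the_inv_into (poly_surface N x) rp y)"
  using u unfolding U_h_def by blast
 obtain t p where t: "t \<in> delaunay N x" and p: "p \<in> planar_tri x t" "y = rp p" using cover[OF y] by blast
 obtain al where al: "\<And>m. m \<in> t ==> 0 <= al m" "sum al t = 1" "p = (\<Sum>m\<in>t. al m *R x m)" by (rule planar_tri_rep[OF t p(1)]) blast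
 obtain a b where ab: "\<And>y. y \<in> planar_tri x t ==> w y = a \<bullet> y + b" using w[OF t] by blast
 have "p \<in> poly_surface N x" using t p(1) by (auto simp: poly_surface_def)
 hence "u y = w p" using uw[OF y] p(2) the_inv_into_f_f[OF vd_parts(4)] by simp
 also have "... = (\<Sum>m\<in>t. al m*(a \<bullet> x m)) + (\<Sum>m\<in>t. al m)*b" unfolding ab[OF p(1)] using al(2,3) by (simp add: inner_sum_right)
 also have "... = (\<Sum>m\<in>t. al m*(a \<bullet> x m + b))" by (simp add: sum_distrib_right sum.distrib distrib_left)
 also have "... = (\<Sum>m\<in>t. al m*u (x m))"
 proof (intro sum.cong refl)
  fix m assume m: "m \<in> t"
  hence mN: "m \<in> {1..N}" using delaunay_subset[OF t] by blast
  show "al m*(a \<bullet> x m + b) = al m*u (x m)"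
   using uw[OF x_S2[OF mN]] inv_proj_x(1)[OF mN] ab[OF x_in_planar_tri[OF t m]] by simp
 qed
 finally show thesis using that[OF t al(1,2)] p(2) al(3) by blast
qed

lemma U_h_continuous:
 assumes u: "u \<in> U_h N x"
 shows "continuous_on S2 u"
proof -
 obtain w where w: "continuous_on (poly_surface N x) w"
  and uw: "\<And>y. y \<in> S2 ==> u y = w (the_inv_into (poly_surface N x) rp y)"
  using u unfolding U_h_def by blast
 have "continuous_on S2 (\<lambda>y. w (the_inv_into (poly_surface N x) rp y))"
  by (rule continuous_on_compose2[OF w inv_proj_continuous])
   (use the_inv_into_into[OF vd_parts(4) _ order_refl] poly_surface_image in blast)
 thus ?thesis by (rule continuous_on_eq) (use uw in auto)
qed

text \<open>On each triangle the values are interpolated by a linear form, and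
  \<open>barycentric_unique\<close> makes the forms agree on common points. The mean-zero condition
  of \<open>U_h\<close> costs the additive constant \<open>ka\<close>, which drops out of the scheme
  when \<open>f\<close> has mean zero.\<close>

lemma U_h_exists:
 fixes e :: "nat => real"
 shows "\<exists>v\<in>U_h N x. \<exists>ka. \<forall>i\<in>{1..N}. v (x i) = e i + ka"
proof -
 obtain g where g: "\<And>t m. t \<in> delaunay N x ==> m \<in> t ==> g t \<bullet> x m = e m"
  using delaunay_dual(1)[of _ e] by metis
 define w0 where "w0 p = g (SOME t. t \<in> delaunay N x \<and> p \<in> planar_tri x t) \<bullet> p" for p
 have gval: "g t \<bullet> (\<Sum>m\<in>t. al m *R x m) = (\<Sum>m\<in>t. al m*e m)" if "t \<in> delaunay N x" for t al
  unfolding inner_sum_right using g[OF that] by (intro sum.cong refl) simp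
 have w0: "w0 p = g t \<bullet> p" if t: "t \<in> delaunay N x" "p \<in> planar_tri x t" for t p
 proof -
  define s where "s = (SOME t. t \<in> delaunay N x \<and> p \<in> planar_tri x t)"
  have s: "s \<in> delaunay N x" "p \<in> planar_tri x s"
   using someI[of "\<lambda>t. t \<in> delaunay N x \<and> p \<in> planar_tri x t" t] t unfolding s_def by auto
  obtain al where al: "\<And>m. m \<in> s ==> 0 <= al m" "sum al s = 1" "p = (\<Sum>m\<in>s. al m *R x m)" by (rule planar_tri_rep[OF s]) blast
  obtain mu where mu: "\<And>m. m \<in> t ==> 0 <= mu m" "sum mu t = 1" "p = (\<Sum>m\<in>t. mu m *R x m)" by (rule planar_tri_rep[OF t]) blast
  have "g s \<bullet> p = (\<Sum>m\<in>s. al m*e m)" unfolding al(3) by (rule gval[OF s(1)])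
  also have "... = (\<Sum>m\<in>t. mu m*e m)"
   by (rule barycentric_unique[OF s(1) t(1)]) (use al mu in auto)
  also have "... = g t \<bullet> p" unfolding mu(3) by (rule gval[OF t(1), symmetric])
  finally show ?thesis by (simp add: w0_def s_def)
 qed
 have w0c: "continuous_on (poly_surface N x) w0"
  unfolding poly_surface_def
 proof (rule continuous_on_closed_Union[OF delaunay_finite_set])
  fix t assume t: "t \<in> delaunay N x"
  show "closed (planar_tri x t)"
   unfolding planar_tri_def using delaunay_finite[OF t] by (intro compact_imp_closed compact_convex_hull finite_imp_compact) simp
  have "continuous_on (planar_tri x t) (\<lambda>p. g t \<bullet> p)" by (intro continuous_intros)
  thus "continuous_on (planar_tri x t) w0" by (rule continuous_on_eq) (use w0[OF t] in auto)
 qed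
 let ?inv = "the_inv_into (poly_surface N x) rp"
 define ka where "ka = - (SI y. w0 (?inv y)) / measure sph S2"
 define v where "v y = w0 (?inv y) + ka" for y
 have "continuous_on S2 (\<lambda>y. w0 (?inv y))"
  by (rule continuous_on_compose2[OF w0c inv_proj_continuous])
   (use the_inv_into_into[OF vd_parts(4) _ order_refl] poly_surface_image in blast)
 hence int: "integrable sph (\<lambda>y. w0 (?inv y))" by (rule continuous_S2_integrable)
 have pos: "measure sph S2 > 0"
 proof -
  have "0 < measure sph (ball (axis 1 1) 1 \<inter> S2)" by (rule measure_cap_pos) auto
  also have "... <= measure sph S2" using sets.top[of sph] by (intro sphere.finite_measure_mono) auto
  finally show ?thesis .
 qed
 have "(SI y. v y) = (SI y. w0 (?inv y)) + ka * measure sph S2"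
  unfolding v_def using int by (subst Bochner_Integration.integral_add) (auto simp: mult.commute)
 hence "(SI y. v y) = 0" using pos by (simp add: ka_def)
 moreover have "continuous_on (poly_surface N x) (\<lambda>p. w0 p + ka)" by (intro continuous_intros w0c)
 moreover have "\<exists>a b. \<forall>y\<in>planar_tri x t. w0 y + ka = a \<bullet> y + b" if "t \<in> delaunay N x" for t
  using w0[OF that] by auto
 ultimately have "v \<in> U_h N x" unfolding U_h_def v_def by blast
 moreover have "v (x i) = e i + ka" if i: "i \<in> {1..N}" for i
 proof -
  obtain t where t: "t \<in> delaunay N x" "i \<in> t" by (rule x_in_delaunay[OF i])
  show ?thesis unfolding v_def inv_proj_x(1)[OF i] using w0[OF t(1) x_in_planar_tri[OF t]] g[OF t] by simp
 qed
 ultimately show ?thesis by blast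
qed

end

lemma has_weak_rot_unique:
 assumes "has_weak_rot u a" "has_weak_rot u a'"
 shows "AE y in sph. a y = a' y"
proof -
 have i: "integrable sph a" "integrable sph a'" using assms by (auto simp: has_weak_rot_def)
 have "AE y in sph. a y $ k - a' y $ k = 0" for k
 proof (rule AE_zero_of_tests)
  show "integrable sph (\<lambda>y. a y $ k - a' y $ k)" using i by (intro Bochner_Integration.integrable_diff integrable_bounded_linear[OF bounded_linear_vec_nth])
  fix ph assume C: "C1_fun ph"
  have ii: "integrable sph (\<lambda>y. ph y *R a y)" "integrable sph (\<lambda>y. ph y *R a' y)"
   using i C1_fun_cont(1)[OF C] by (auto intro: integrable_mult_continuous)
  have "(SI y. ph y *R a y) = (SI y. ph y *R a' y)" using assms C by (simp add: has_weak_rot_def)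
  hence "(SI y. ph y *R a y - ph y *R a' y) = 0" using ii by (subst Bochner_Integration.integral_diff) auto
  hence "(SI y. (ph y *R a y - ph y *R a' y) $ k) = 0"
   using integral_bounded_linear[OF bounded_linear_vec_nth Bochner_Integration.integrable_diff[OF ii], of k] by simp
  thus "(SI y. ph y*(a y $ k - a' y $ k)) = 0" by (simp add: right_diff_distrib)
 qed
 hence "AE y in sph. \<forall>k\<in>UNIV. a y $ k - a' y $ k = 0" by (intro AE_finite_allI) auto
 thus ?thesis by eventually_elim (simp add: vec_eq_iff)
qed

lemma continuous_in_Lp_2:
 assumes "continuous_on S2 v"
 shows "in_Lp 2 v"
proof -
 have "integrable sph (\<lambda>y. \<bar>v y\<bar> powr 2)"
  by (rule continuous_S2_integrable) (use assms in \<open>auto intro!: continuous_intros\<close>)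
 thus ?thesis unfolding in_Lp_def using borel_measurable_sphere_cont[OF assms] by simp
qed

lemma C1_fun_in_H1_0:
 assumes C: "C1_fun v" and z: "(SI y. v y) = 0"
 shows "v \<in> H1_0"
proof -
 have "has_weak_grad v (\<lambda>y. grad v y - (grad v y \<bullet> y) *R y)" by (rule has_weak_grad_sph_C1[OF C1_fun_sph_C1[OF C]])
 moreover have "in_Lp 2 (\<lambda>y. (grad v y - (grad v y \<bullet> y) *R y) $ i)" for i
  by (intro continuous_in_Lp_2 continuous_intros C1_fun_cont(2)[OF C])
 ultimately show ?thesis
  using z continuous_in_Lp_2[OF C1_fun_cont(1)[OF C]] unfolding H1_0_def One_nat_def in_Sobolev.simps by blast
qed

section \<open>Edge residuals\<close>

definition molv :: "nat => (real^3 => real^3) => real^3 => real^3" where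
 "molv n a x = (\<chi> k. mol n (\<lambda>y. a y $ k) x)"

lemma molv_rot: "has_weak_rot w a ==> cross3 x (grad (mol n w) x) = molv n a x"
 by (simp add: vec_eq_iff molv_def mol_rot)

text \<open>For a unit vector \<open>y\<close>, \<open>- cross3 y (molv n a y)\<close> is the
  tangential gradient of \<open>mol n u\<close>. Self-adjointness moves the mollifier to the test
  side, where it yields the rotation derivative of \<open>mol n ps\<close>; after a shift by a
  constant this is admissible in \<open>H1_0\<close>, and the constant does not matter as
  \<open>f\<close> has mean zero. Moving the mollifier back puts it on \<open>f\<close>.\<close>

lemma weak_solution_flux:
 assumes sol: "weak_solution f u" and f: "in_Lp 2 f" "(SI y. f y) = 0" and a: "has_weak_rot u a" and C: "C1_fun ps"
 shows "(SI y. (- cross3 y (molv n a y)) \<bullet> grad ps y) = (SI y. mol n f y*ps y)"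
proof -
 let ?g = "weak_grad u"
 have fi: "integrable sph f" by (rule Lp_norm_2(4)[OF f(1)])
 have "in_Sobolev 1 2 u" using sol by (simp add: weak_solution_def H1_0_def)
 then obtain g0 where "has_weak_grad u g0" by auto
 hence wg: "has_weak_grad u ?g" by (rule has_weak_grad_weak_grad)
 have aeq: "AE y in sph. a y = cross3 y (?g y)" by (rule has_weak_rot_unique[OF a has_weak_grad_imp_rot[OF wg]])
 have ai: "integrable sph a" "integrable sph (\<lambda>y. a y $ k)" for k using a by (auto simp: has_weak_rot_def intro: integrable_bounded_linear[OF bounded_linear_vec_nth])
 have psi: "integrable sph ps" by (rule continuous_S2_integrable[OF C1_fun_cont(1)[OF C]])
 have psr: "has_weak_rot ps (\<lambda>y. cross3 y (grad ps y))" by (rule has_weak_rot_sph_C1[OF C1_fun_sph_C1[OF C]])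
 let ?c = "\<lambda>y. cross3 y (grad ps y)"
 have cc: "continuous_on S2 (\<lambda>y. ?c y $ k)" for k by (intro continuous_intros continuous_on_cross C1_fun_cont(2)[OF C])
 have bdd: "\<exists>B. \<forall>y\<in>S2. \<bar>c y\<bar> <= B" if "continuous_on S2 c" for c :: "real^3 => real"
  using compact_imp_bounded[OF compact_continuous_image[OF that compact_sphere]] unfolding bounded_iff by auto
 let ?ph = "mol n ps"
 have Cph: "C1_fun ?ph" by (rule mol_C1(1)[OF psi])
 have "(SI y. (- cross3 y (molv n a y)) \<bullet> grad ps y) = (SI y. (\<Sum>k\<in>UNIV. mol n (\<lambda>y. a y $ k) y*?c y $ k))"
  by (intro Bochner_Integration.integral_cong refl) (simp add: cross3_def inner_vec_def sum_3 molv_def algebra_simps)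
 also have "... = (\<Sum>k\<in>UNIV. SI y. mol n (\<lambda>y. a y $ k) y*?c y $ k)"
  by (intro Bochner_Integration.integral_sum continuous_S2_integrable continuous_on_mult mol_continuous ai cc)
 also have "... = (\<Sum>k\<in>UNIV. SI y. a y $ k * mol n (\<lambda>y. ?c y $ k) y)"
 proof (intro sum.cong refl)
  fix k
  obtain B where B: "\<forall>y\<in>S2. \<bar>?c y $ k\<bar> <= B" using bdd[OF cc] by blast
  show "(SI y. mol n (\<lambda>y. a y $ k) y*?c y $ k) = (SI y. a y $ k * mol n (\<lambda>y. ?c y $ k) y)"
   by (rule mol_selfadjoint[OF ai(2) borel_measurable_sphere_cont[OF cc], where B=B]) (use B in blast)
 qed
 also have "... = (\<Sum>k\<in>UNIV. SI y. a y $ k*cross3 y (grad ?ph y) $ k)"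
  unfolding mol_rot[OF psr] ..
 also have "... = (SI y. (\<Sum>k\<in>UNIV. a y $ k*cross3 y (grad ?ph y) $ k))"
 proof (intro Bochner_Integration.integral_sum[symmetric])
  fix k
  have "integrable sph (\<lambda>y. cross3 y (grad ?ph y) $ k *R (a y $ k))"
   by (intro integrable_mult_continuous ai continuous_intros continuous_on_cross C1_fun_cont(2)[OF Cph])
  thus "integrable sph (\<lambda>y. a y $ k*cross3 y (grad ?ph y) $ k)" by (simp add: mult.commute)
 qed
 also have "... = (SI y. a y \<bullet> cross3 y (grad ?ph y))" by (simp add: inner_vec_def)
 also have "... = (SI y. ?g y \<bullet> (grad ?ph y - (grad ?ph y \<bullet> y) *R y))"
 proof (rule integral_cong_AE)
  have am [measurable]: "a \<in> borel_measurable sph" "?g \<in> borel_measurable sph"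
   using ai wg by (auto simp: has_weak_grad_def)
  have gm [measurable]: "grad ?ph \<in> borel_measurable sph" "(\<lambda>y. cross3 y (grad ?ph y)) \<in> borel_measurable sph"
   by (intro borel_measurable_sphere_cont continuous_on_cross continuous_intros C1_fun_cont(2)[OF Cph])+
  have [measurable]: "(\<lambda>y::real^3. y) \<in> borel_measurable sph" by (intro borel_measurable_sphere_cont continuous_intros)
  show "(\<lambda>y. a y \<bullet> cross3 y (grad ?ph y)) \<in> borel_measurable sph" by (intro borel_measurable_inner am gm)
  show "(\<lambda>y. ?g y \<bullet> (grad ?ph y - (grad ?ph y \<bullet> y) *R y)) \<in> borel_measurable sph" by measurable
  show "AE y in sph. a y \<bullet> cross3 y (grad ?ph y) = ?g y \<bullet> (grad ?ph y - (grad ?ph y \<bullet> y) *R y)"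
   using aeq AE_space
  proof eventually_elim
   case (elim y)
   hence "y \<bullet> y = 1" by (simp add: norm_eq_1)
   thus ?case using elim(1) by (simp add: cross3_inner inner_diff_right inner_commute algebra_simps)
  qed
 qed
 finally have 1: "(SI y. (- cross3 y (molv n a y)) \<bullet> grad ps y) = (SI y. ?g y \<bullet> (grad ?ph y - (grad ?ph y \<bullet> y) *R y))" .
 define ka where "ka = - (SI y. ?ph y) / measure sph S2"
 define v where "v y = ?ph y + ka" for y
 have Cv: "C1_fun v" unfolding v_def by (intro C1_fun_add Cph C1_fun_const)
 have gv: "grad v = grad ?ph"
 proof
  fix y
  have "(v has_derivative (\<lambda>h. grad ?ph y \<bullet> h)) (at y)"
   unfolding v_def by (rule has_derivative_eq_rhs[OF has_derivative_add[OF C1_fun_has_derivative[OF Cph] has_derivative_const]]) simp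
  thus "grad v y = grad ?ph y" by (rule grad_unique)
 qed
 have pos: "measure sph S2 > 0"
 proof -
  have "0 < measure sph (ball (axis 1 1) 1 \<inter> S2)" by (rule measure_cap_pos) auto
  also have "... <= measure sph S2" using sets.top[of sph] by (intro sphere.finite_measure_mono) auto
  finally show ?thesis .
 qed
 have iph: "integrable sph ?ph" by (rule continuous_S2_integrable[OF C1_fun_cont(1)[OF Cph]])
 have "(SI y. v y) = 0"
  unfolding v_def using iph pos by (subst Bochner_Integration.integral_add) (auto simp: ka_def)
 hence vH: "v \<in> H1_0" by (rule C1_fun_in_H1_0[OF Cv])
 have gw: "has_weak_grad v (\<lambda>y. grad ?ph y - (grad ?ph y \<bullet> y) *R y)" using has_weak_grad_sph_C1[OF C1_fun_sph_C1[OF Cv]] unfolding gv .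
 have "AE y in sph. weak_grad v y = grad ?ph y - (grad ?ph y \<bullet> y) *R y"
  by (rule has_weak_grad_unique[OF has_weak_grad_weak_grad[OF gw] gw])
 hence "(SI y. ?g y \<bullet> (grad ?ph y - (grad ?ph y \<bullet> y) *R y)) = (SI y. ?g y \<bullet> weak_grad v y)"
 proof (intro integral_cong_AE)
  have gm: "?g \<in> borel_measurable sph" "weak_grad v \<in> borel_measurable sph" "(\<lambda>y. grad ?ph y - (grad ?ph y \<bullet> y) *R y) \<in> borel_measurable sph"
   using wg has_weak_grad_weak_grad[OF gw] gw by (auto simp: has_weak_grad_def)
  show "(\<lambda>y. ?g y \<bullet> weak_grad v y) \<in> borel_measurable sph" "(\<lambda>y. ?g y \<bullet> (grad ?ph y - (grad ?ph y \<bullet> y) *R y)) \<in> borel_measurable sph"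
   by (intro borel_measurable_inner gm)+
 qed (auto elim: eventually_mono)
 also have "... = (SI y. f y * v y)" using sol vH unfolding weak_solution_def by blast
 also have "... = (SI y. f y*?ph y) + (SI y. ka*f y)"
 proof -
  have "integrable sph (\<lambda>y. ?ph y *R f y)" by (rule integrable_mult_continuous[OF fi C1_fun_cont(1)[OF Cph]])
  hence "integrable sph (\<lambda>y. f y*?ph y)" by (simp add: mult.commute)
  thus ?thesis unfolding v_def distrib_left using fi by (subst Bochner_Integration.integral_add) (auto simp: mult.commute)
 qed
 also have "... = (SI y. f y*?ph y)" using f(2) by simp
 also have "... = (SI y. mol n f y*ps y)"
 proof -
  obtain B where B: "\<forall>y\<in>S2. \<bar>ps y\<bar> <= B" using bdd[OF C1_fun_cont(1)[OF C]] by blast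
  show ?thesis
   by (rule mol_selfadjoint[OF fi borel_measurable_sphere_cont[OF C1_fun_cont(1)[OF C]], where B=B, symmetric]) (use B in blast)
 qed
 finally show ?thesis using 1 by simp
qed

lemma mol_rot_smooth:
 assumes "rot_data u a b M Q"
 shows "rot_smooth (mol n u) (molv n a) (\<lambda>k. molv n (b k))"
proof -
 have r: "has_weak_rot u a" "\<And>k. has_weak_rot (\<lambda>y. a y $ k) (b k)" using assms by (auto simp: rot_data_def)
 have i: "integrable sph u" "\<And>k. integrable sph (\<lambda>y. a y $ k)" using r by (auto simp: has_weak_rot_def)
 show ?thesis
  unfolding rot_smooth_def using mol_C1(1)[OF i(1)] mol_C1(1)[OF i(2)] molv_rot[OF r(1)] molv_rot[OF r(2)]
  by (simp add: molv_def)
qed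

text \<open>Mollification preserves the sup and square bounds of each component. In the sup bound
  \<open>72 = 4*9 + 12*3\<close>. For the squares Cauchy-Schwarz gives
  \<open>192 = 3*4^2 + 12^2\<close>, and there are \<open>3 + 9\<close> components, so
  \<open>2304 = 192*12\<close>.\<close>

lemma mol_rot_size:
 fixes n :: nat
 assumes d: "rot_data u a b M Q" and M: "0 <= M"
 defines "q \<equiv> rot_size (molv n a) (\<lambda>k. molv n (b k))"
 shows "y \<in> S2 ==> \<bar>mol n u y\<bar> <= M" "y \<in> S2 ==> norm (molv n a y) <= 3*M" "y \<in> S2 ==> q y <= 72*M"
  "(SI y. (q y)^2) <= 2304*Q^2"
proof -
 have r: "has_weak_rot u a" "\<And>k. has_weak_rot (\<lambda>y. a y $ k) (b k)" using d by (auto simp: rot_data_def)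
 have i: "integrable sph u" "\<And>k. integrable sph (\<lambda>y. a y $ k)" "\<And>k m. integrable sph (\<lambda>y. b k y $ m)"
  using r by (auto simp: has_weak_rot_def intro: integrable_bounded_linear[OF bounded_linear_vec_nth])
 have B: "y \<in> S2 ==> \<bar>mol n (\<lambda>y. a y $ k) y\<bar> <= M" "y \<in> S2 ==> \<bar>mol n (\<lambda>y. b k y $ m) y\<bar> <= M" for k m y
  using mol_bound[OF i(2)] mol_bound[OF i(3)] d by (auto simp: rot_data_def)
 show "y \<in> S2 ==> \<bar>mol n u y\<bar> <= M" using mol_bound[OF i(1)] d by (auto simp: rot_data_def)
 have n3: "norm (v :: real^3) <= \<bar>v $ 1\<bar> + \<bar>v $ 2\<bar> + \<bar>v $ 3\<bar>" for v using norm_le_l1_cart[of v] by (simp add: sum_3)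
 show l: "norm (molv n a y) <= 3*M" if y: "y \<in> S2"
  using n3[of "molv n a y"] B(1)[OF y, of 1] B(1)[OF y, of 2] B(1)[OF y, of 3] by (simp add: molv_def)
 show "q y <= 72*M" if y: "y \<in> S2"
 proof -
  have "norm (molv n (b k) y) <= 3*M" for k
   using n3[of "molv n (b k) y"] B(2)[OF y, of k 1] B(2)[OF y, of k 2] B(2)[OF y, of k 3] by (simp add: molv_def)
  hence "(\<Sum>k\<in>UNIV. norm (molv n (b k) y)) <= (\<Sum>k\<in>(UNIV::3 set). 3*M)" by (intro sum_mono)
  thus ?thesis unfolding q_def rot_size_def using l[OF y] by simp
 qed
 let ?A = "\<lambda>k y. mol n (\<lambda>y. a y $ k) y" and ?B = "\<lambda>k m y. mol n (\<lambda>y. b k y $ m) y"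
 have q2: "(q y)^2 <= 192*((\<Sum>k\<in>UNIV. (?A k y)^2) + (\<Sum>k\<in>UNIV. \<Sum>m\<in>UNIV. (?B k m y)^2))" for y
 proof -
  have nv: "(norm (molv n v y))^2 = (\<Sum>k\<in>UNIV. (mol n (\<lambda>y. v y $ k) y)^2)" for v
   unfolding power2_norm_eq_inner inner_vec_def by (simp add: molv_def power2_eq_square)
  have "(q y)^2 <= 192*((norm (molv n a y))^2 + (\<Sum>k\<in>UNIV. (norm (molv n (b k) y))^2))"
  proof -
   have CS: "(4*(p + r + s) + 12*t)^2 <= 192*(t^2 + (p^2 + r^2 + s^2))" for p r s t :: real
   proof -
    have "192*(t^2 + (p^2 + r^2 + s^2)) - (4*(p + r + s) + 12*t)^2
     = 16*((p - r)^2 + (r - s)^2 + (p - s)^2) + 16*((t - 3*p)^2 + (t - 3*r)^2 + (t - 3 * s)^2)"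
     by (simp add: power2_eq_square algebra_simps)
    moreover have "... \<ge> 0" by simp
    ultimately show ?thesis by linarith
   qed
   show ?thesis unfolding q_def rot_size_def sum_3 by (rule CS)
  qed
  thus ?thesis unfolding nv .
 qed
 have ci: "integrable sph (\<lambda>y. (?A k y)^2)" "integrable sph (\<lambda>y. (?B k m y)^2)" for k m
  by (intro continuous_S2_integrable continuous_on_power mol_continuous i)+
 have "(SI y. (q y)^2) <= (SI y. 192*((\<Sum>k\<in>UNIV. (?A k y)^2) + (\<Sum>k\<in>UNIV. \<Sum>m\<in>UNIV. (?B k m y)^2)))"
 proof (intro integral_mono)
  show "integrable sph (\<lambda>y. (q y)^2)" unfolding q_def
   by (intro continuous_S2_integrable continuous_on_power rot_smooth_cont(3)[OF mol_rot_smooth[OF d]])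
  show "integrable sph (\<lambda>y. 192*((\<Sum>k\<in>UNIV. (?A k y)^2) + (\<Sum>k\<in>UNIV. \<Sum>m\<in>UNIV. (?B k m y)^2)))"
   by (intro integrable_mult_right Bochner_Integration.integrable_add Bochner_Integration.integrable_sum ci)
 qed (rule q2)
 also have "... = 192*((\<Sum>k\<in>UNIV. (SI y. (?A k y)^2)) + (\<Sum>k\<in>UNIV. \<Sum>m\<in>UNIV. (SI y. (?B k m y)^2)))"
  using ci by (simp add: Bochner_Integration.integral_add Bochner_Integration.integral_sum)
 also have "... <= 192*((\<Sum>k\<in>(UNIV::3 set). Q^2) + (\<Sum>k\<in>(UNIV::3 set). \<Sum>m\<in>(UNIV::3 set). Q^2))"
 proof (intro mult_left_mono add_mono sum_mono)
  have L: "integrable sph (\<lambda>y. (a y $ k)^2)" "(SI y. (a y $ k)^2) <= Q^2" "integrable sph (\<lambda>y. (b k y $ m)^2)" "(SI y. (b k y $ m)^2) <= Q^2" for k m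
   using d by (auto simp: rot_data_def)
  show "(SI y. (?A k y)^2) <= Q^2" for k using mol_L2[OF i(2) L(1)] L(2) by (rule order_trans)
  show "(SI y. (?B k m y)^2) <= Q^2" for k m using mol_L2[OF i(3) L(3)] L(4) by (rule order_trans)
 qed simp
 also have "... = 2304*Q^2" by simp
 finally show "(SI y. (q y)^2) <= 2304*Q^2" .
qed

lemma has_real_derivative_along:
 assumes "(f has_derivative D) (at (p + t *R w))"
 shows "((\<lambda>t. f (p + t *R w) :: real) has_real_derivative D w) (at t)"
proof -
 have "((\<lambda>t. p + t *R w) has_derivative (\<lambda>h. h *R w)) (at t)" by (auto intro!: derivative_eq_intros)
 from has_derivative_compose[OF this assms]
 have "((\<lambda>t. f (p + t *R w)) has_derivative (\<lambda>h. D (h *R w))) (at t)" .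
 moreover have "(\<lambda>h. D (h *R w)) = (*) (D w)"
  using has_derivative_linear[OF assms] by (auto simp: linear_cmul)
 ultimately show ?thesis unfolding has_field_derivative_def by simp
qed

lemma dirv_scale: "dirv l (c *R n) y = c*dirv l n y"
 by (simp add: dirv_def cross_mult_right)

lemma dirv_le:
 assumes "1/2 <= norm y" "norm (l (rp y)) <= L"
 shows "\<bar>dirv l w y\<bar> <= 2*L*norm w"
proof -
 have r: "norm y > 0" using assms(1) by linarith
 have "\<bar>dirv l w y\<bar> <= norm (l (rp y))*(norm y*norm w)/(norm y)^2"
  unfolding dirv_def abs_divide abs_power2
  by (rule divide_right_mono[OF order_trans[OF Cauchy_Schwarz_ineq2 mult_left_mono[OF norm_cross3_le norm_ge_zero]] zero_le_power2])
 also have "... = norm (l (rp y))*norm w/norm y" using r by (simp add: power2_eq_square)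
 also have "... <= (L*norm w)/(1/2)"
  using assms order_trans[OF norm_ge_zero assms(2)] by (intro divide_mono mult_right_mono) auto
 finally show ?thesis by simp
qed

lemma segment_mean_value:
 assumes sm: "rot_smooth u l m" and seg: "\<And>t. 0 <= t ==> t <= 1 ==> 1/2 <= norm (p + t *R w)"
 obtains xi where "0 < xi" "xi < 1" "u (rp (p + w)) - u (rp p) = dirv l w (p + xi *R w)"
proof -
 have nz: "p + t *R w ~= 0" if "0 <= t" "t <= 1" for t using seg[OF that] by auto
 have "\<exists>z>0. z < 1 \<and> u (rp (p + 1 *R w)) - u (rp (p + 0 *R w)) = (1 - 0)*dirv l w (p + z *R w)"
  by (rule MVT2) (auto intro!: has_real_derivative_along[OF rot_smooth_deriv[OF sm nz]])
 thus thesis using that by auto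
qed

text \<open>Two mean value theorems: one for the extension of \<open>u\<close> along the segment,
  one for its derivative in the unit direction of \<open>w\<close>.\<close>

lemma dirv_taylor:
 assumes sm: "rot_smooth u l m" and seg: "\<And>t. 0 <= t ==> t <= 1 ==> 1/2 <= norm (p + t *R w)"
  and K: "\<And>y. y \<in> S2 ==> rot_size l m y <= K"
 shows "\<bar>u (rp (p + w)) - u (rp p) - dirv l w p\<bar> <= (norm w)^2*K"
proof (cases "w = 0")
 case False
 define n where "n = w /\<^sub>R norm w"
 have n: "norm n = 1" "w = norm w *R n" using False by (auto simp: n_def)
 obtain xi where xi: "0 < xi" "xi < 1" "u (rp (p + w)) - u (rp p) = dirv l w (p + xi *R w)"
  by (rule segment_mean_value[OF sm seg])
 have nz: "p + t *R w ~= 0" if "0 <= t" "t <= 1" for t using seg[OF that] by auto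
 define D where "D t = (\<Sum>k\<in>UNIV. (m k (rp (p + t *R w)) \<bullet> cross3 (p + t *R w) w)/(norm (p + t *R w))^2*(cross3 (p + t *R w) n $ k))/(norm (p + t *R w))^2
  + (l (rp (p + t *R w)) \<bullet> cross3 w n)/(norm (p + t *R w))^2 - 2*((p + t *R w) \<bullet> w)*(l (rp (p + t *R w)) \<bullet> cross3 (p + t *R w) n)/norm (p + t *R w)^4" for t
 have der: "((\<lambda>t. dirv l n (p + t *R w)) has_real_derivative D t) (at t)" if "0 <= t" "t <= 1" for t
  unfolding D_def by (rule has_real_derivative_along[OF dirv_deriv[OF sm nz[OF that]]])
 have "\<exists>z>0. z < xi \<and> dirv l n (p + xi *R w) - dirv l n (p + 0 *R w) = (xi - 0)*D z"
  by (rule MVT2[OF xi(1)]) (use xi(2) der in auto)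
 then obtain z where z: "0 < z" "z < xi" "dirv l n (p + xi *R w) - dirv l n p = xi*D z" by auto
 have s: "1/2 <= norm (p + z *R w)" using seg[of z] z xi by auto
 have S: "rp (p + z *R w) \<in> S2" using nz[of z] z xi by (intro radial_proj_S2) auto
 have "\<bar>D z\<bar> <= norm w*rot_size l m (rp (p + z *R w))"
  unfolding D_def by (rule dirv_deriv_bound[OF n(1) s])
 also have "... <= norm w*K" using K[OF S] by (intro mult_left_mono) auto
 finally have Dz: "\<bar>D z\<bar> <= norm w*K" .
 have "u (rp (p + w)) - u (rp p) - dirv l w p = norm w*(xi*D z)"
  unfolding xi(3) z(3)[symmetric] by (simp add: dirv_scale[symmetric] right_diff_distrib n(2)[symmetric])
 hence "\<bar>u (rp (p + w)) - u (rp p) - dirv l w p\<bar> = norm w*(xi*\<bar>D z\<bar>)"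
  using xi by (simp add: abs_mult)
 also have "... <= norm w*(1*(norm w*K))" using xi Dz by (intro mult_left_mono mult_mono) auto
 finally show ?thesis by (simp add: power2_eq_square mult_ac)
qed (simp add: dirv_def)

lemma cos_ge_half: "0 <= t ==> t <= 1 ==> 1/2 <= cos (t::real)"
 using cos_monotone_0_pi_le[of t "pi/3"] pi_gt3 by (simp add: cos_60)

context vmesh
begin

text \<open>All vertices of the triangle are within \<open>h\<close> of the circumcenter
  \<open>c\<close>. The bound \<open>c . x m >= cos h >= 1/2\<close> passes to convex
  combinations.\<close>

lemma tri_points:
 assumes t: "t \<in> delaunay N x" and h1: "h <= 1"
 shows "m \<in> t ==> q \<in> t ==> norm (x m - x q) <= 2*h" "p \<in> planar_tri x t ==> 1/2 <= norm p"
proof -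
 obtain i j k c where T: "t = {i, j, k}" "i \<in> {1..N}" "j \<in> {1..N}" "k \<in> {1..N}" "c \<in> ccell i" "c \<in> ccell j" "c \<in> ccell k"
  by (rule delaunay_circumcenter[OF t]) blast
 have near: "norm (c - x m) <= h" "cos h <= c \<bullet> x m" if "m \<in> t" for m
  using that T ccell_norm ccell_cos h_le_pi by auto
 show "norm (x m - x q) <= 2*h" if "m \<in> t" "q \<in> t"
  using near(1)[OF that(1)] near(1)[OF that(2)] norm_triangle_ineq[of "x m - c" "c - x q"] by (simp add: norm_minus_commute)
 show "1/2 <= norm p" if "p \<in> planar_tri x t"
 proof -
  obtain al where al: "\<And>m. m \<in> t ==> 0 <= al m" "sum al t = 1" "p = (\<Sum>m\<in>t. al m *R x m)" by (rule planar_tri_rep[OF t \<open>p \<in> _\<close>]) blast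
  have "1/2 = (\<Sum>m\<in>t. al m*(1/2))" unfolding sum_distrib_right[symmetric] al(2) by simp
  also have "... <= (\<Sum>m\<in>t. al m*(c \<bullet> x m))"
   using near(2) cos_ge_half[OF h_nonneg h1] al(1) by (intro sum_mono mult_left_mono) (auto intro: order_trans)
  also have "... = c \<bullet> p" unfolding al(3) by (simp add: inner_sum_right)
  also have "... <= norm c*norm p" by (rule norm_cauchy_schwarz)
  finally show ?thesis using ccell_S2[OF T(5)] by simp
 qed
qed

text \<open>Expand at the planar point \<open>p\<close> towards the vertices: the first-order terms
  cancel, since the barycentric mean of \<open>x m - p\<close> is 0. For \<open>h > 1\<close> the
  triangle may come close to the origin, and the sup norm suffices because
  \<open>h^2 >= 1\<close>.\<close>

lemma interpolation_error:
 assumes sm: "rot_smooth u l m" and K: "\<And>y. y \<in> S2 ==> rot_size l m y <= K" and M: "\<And>y. y \<in> S2 ==> \<bar>u y\<bar> <= K"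
  and t: "t \<in> delaunay N x" and al: "\<And>m. m \<in> t ==> 0 <= al m" "sum al t = 1"
 shows "\<bar>u (rp (\<Sum>m\<in>t. al m *R x m)) - (\<Sum>m\<in>t. al m*u (x m))\<bar> <= 4*h^2*K"
proof -
 define p where "p = (\<Sum>m\<in>t. al m *R x m)"
 have pt: "p \<in> planar_tri x t" unfolding p_def by (rule planar_triI[OF t al])
 have K0: "0 <= K" using M[of "axis 1 1"] by simp
 have tN: "m \<in> {1..N}" if "m \<in> t" for m using that delaunay_subset[OF t] by blast
 have avg: "(\<Sum>m\<in>t. al m*c) = c" for c :: real using al(2) by (simp add: sum_distrib_right[symmetric])
 have "\<bar>\<Sum>m\<in>t. al m*(u (x m) - u (rp p))\<bar> <= 4*h^2*K"
 proof (cases "h <= 1")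
  case True
  have w: "norm (x m - p) <= 2*h" if m: "m \<in> t" for m
  proof -
   have "x m - p = (\<Sum>q\<in>t. al q *R (x m - x q))"
    using al(2) by (simp add: p_def scaleR_diff_right sum_subtractf scaleR_sum_left[symmetric])
   also have "norm ... <= (\<Sum>q\<in>t. norm (al q *R (x m - x q)))" by (rule norm_sum)
   also have "... <= (\<Sum>q\<in>t. al q*(2*h))"
    using tri_points(1)[OF t True m] al(1) by (intro sum_mono) (simp add: mult_left_mono)
   finally show ?thesis unfolding avg .
  qed
  have seg: "1/2 <= norm (p + s *R (x m - p))" if "m \<in> t" "0 <= s" "s <= 1" for m s
  proof -
   have "(1 - s) *R p + s *R x m \<in> planar_tri x t"
    using pt x_in_planar_tri[OF t that(1)] that(2,3) unfolding planar_tri_def by (intro convexD[OF convex_convex_hull]) auto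
   moreover have "(1 - s) *R p + s *R x m = p + s *R (x m - p)" by (simp add: algebra_simps)
   ultimately show ?thesis using tri_points(2)[OF t True] by metis
  qed
  have "(\<Sum>m\<in>t. al m *R (x m - p)) = 0"
   using al(2) by (simp add: p_def scaleR_diff_right sum_subtractf scaleR_sum_left[symmetric])
  moreover have "linear (\<lambda>w. dirv l w p)"
   by (rule has_derivative_linear[OF rot_smooth_deriv[OF sm planar_tri_nonzero[OF t pt]]])
  hence "(\<Sum>m\<in>t. al m*dirv l (x m - p) p) = dirv l (\<Sum>m\<in>t. al m *R (x m - p)) p"
   by (simp only: linear_sum[of "\<lambda>w. dirv l w p"] dirv_scale)
  ultimately have z: "(\<Sum>m\<in>t. al m*dirv l (x m - p) p) = 0" by (simp add: dirv_def)
  have "\<bar>\<Sum>m\<in>t. al m*(u (x m) - u (rp p))\<bar> = \<bar>\<Sum>m\<in>t. al m*(u (x m) - u (rp p) - dirv l (x m - p) p)\<bar>"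
   using z by (simp add: right_diff_distrib sum_subtractf)
  also have "... <= (\<Sum>m\<in>t. \<bar>al m*(u (x m) - u (rp p) - dirv l (x m - p) p)\<bar>)" by (rule sum_abs)
  also have "... <= (\<Sum>m\<in>t. al m*(4*h^2*K))"
  proof (intro sum_mono)
   fix q assume q: "q \<in> t"
   have "\<bar>u (rp (p + (x q - p))) - u (rp p) - dirv l (x q - p) p\<bar> <= (norm (x q - p))^2*K"
    by (rule dirv_taylor[OF sm seg[OF q] K])
   also have "... <= (2*h)^2*K" using w[OF q] K0 by (intro mult_right_mono power_mono) auto
   finally have "\<bar>u (x q) - u (rp p) - dirv l (x q - p) p\<bar> <= 4*h^2*K"
    using radial_proj_id[OF x_S2[OF tN[OF q]]] by (simp add: power_mult_distrib)
   thus "\<bar>al q*(u (x q) - u (rp p) - dirv l (x q - p) p)\<bar> <= al q*(4*h^2*K)"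
    using al(1)[OF q] by (simp add: abs_mult mult_left_mono)
  qed
  finally show ?thesis unfolding avg .
 next
  case False
  have S: "rp p \<in> S2" by (rule radial_proj_S2[OF planar_tri_nonzero[OF t pt]])
  have "\<bar>\<Sum>m\<in>t. al m*(u (x m) - u (rp p))\<bar> <= (\<Sum>m\<in>t. \<bar>al m*(u (x m) - u (rp p))\<bar>)" by (rule sum_abs)
  also have "... <= (\<Sum>m\<in>t. al m*(2*K))"
  proof (intro sum_mono)
   fix q assume q: "q \<in> t"
   have "\<bar>u (x q) - u (rp p)\<bar> <= 2*K" using M[OF S] M[OF x_S2[OF tN[OF q]]] by linarith
   thus "\<bar>al q*(u (x q) - u (rp p))\<bar> <= al q*(2*K)" using al(1)[OF q] by (simp add: abs_mult mult_left_mono)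
  qed
  also have "... = 2*1*K" unfolding avg by simp
  also have "... <= 4*h^2*K"
  proof -
   have "1 <= h^2" using False by (simp add: one_le_power)
   thus ?thesis using K0 by (intro mult_right_mono) auto
  qed
  finally show ?thesis .
 qed
 moreover have "(\<Sum>m\<in>t. al m*(u (x m) - u (rp p))) = (\<Sum>m\<in>t. al m*u (x m)) - u (rp p)"
  by (simp add: right_diff_distrib sum_subtractf avg)
 ultimately show ?thesis unfolding p_def by (simp add: abs_minus_commute)
qed

end

text \<open>The product \<open>384*6912*864\<close>: the number of neighbours, the constant of
  \<open>edge_estimate\<close>, and the overlap of the balls of radius \<open>4*h\<close>. The first
  and the last of these carry one factor \<open>C\<^sub>1\<close> each.\<close>

definition residual_const :: "real => real" where "residual_const c = 2293235712*c^2"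

locale uniform_vmesh = vmesh +
 fixes C\<^sub>0 C\<^sub>1 :: real
 assumes C0: "0 < C\<^sub>0" and C1: "0 < C\<^sub>1" and au: "almost_uniform C\<^sub>0 C\<^sub>1 N x"
begin

abbreviation "me i j \<equiv> measure lborel (eE i j)"

lemma me_sym: "i \<in> {1..N} ==> j \<in> {1..N} ==> i ~= j ==> me i j = me j i"
 using edge_length[of i j] edge_length[of j i] by (simp add: vedge_def Int_commute)

lemma me_le:
 assumes ij: "i \<in> {1..N}" "j \<in> {1..N}" "i ~= j"
 shows "me i j <= C\<^sub>0*h"
proof (cases "me i j > 0")
 case True
 hence "j \<in> nbrs N x i" using ij edge_length[OF ij] by (simp add: nbrs_def)
 thus ?thesis using au ij(1) unfolding almost_uniform_def edge_length[OF ij, symmetric] by blast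
next
 case False
 thus ?thesis using C0 h_pos by (smt (verit) mult_pos_pos)
qed

lemma me_le_4: "me i j <= 4"
proof -
 have "me i j <= measure lborel {-pi/2..pi/2}"
 proof (rule measure_mono_fmeasurable)
  show "eE i j \<in> sets lborel" using borel_compact[OF eE_compact] by simp
  show "{-pi/2..pi/2} \<in> fmeasurable lborel" by (rule fmeasurableI) (simp_all add: emeasure_lborel_Icc_eq)
 qed (auto simp: eE_def)
 also have "... = pi" by (simp add: measure_def emeasure_lborel_Icc_eq)
 finally show ?thesis using pi_less_4 by linarith
qed

lemma me_near:
 assumes ij: "i \<in> {1..N}" "j \<in> {1..N}" "i ~= j" and m: "me i j > 0"
 shows "norm (x j - x i) <= 2*h"
proof -
 have "eE i j ~= {}" using m by auto
 then obtain y where "y \<in> ccell i" "y \<in> ccell j" using ccell_inter[OF ij] by blast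
 hence "norm (y - x i) <= h" "norm (y - x j) <= h" using ccell_norm ij by auto
 thus ?thesis using norm_triangle_ineq[of "x j - y" "y - x i"] by (simp add: norm_minus_commute)
qed

lemma area_vcell: "i \<in> {1..N} ==> h^2 / C\<^sub>1 <= measure sph (V i)"
 using au unfolding almost_uniform_def area_def by blast

lemma vcell_sets: "i \<in> {1..N} ==> V i \<in> sets sph"
 by (rule sets_sphere_borel[OF vcell_borel]) (auto simp: vcell_def)

text \<open>Packing: the cells of these vertices are disjoint, have area at least
  \<open>h^2 / C\<^sub>1\<close>, and lie within \<open>r + h\<close> of \<open>z\<close>. The
  larger radius \<open>r + 2*h\<close> allows an open ball.\<close>

lemma card_near:
 assumes z: "z \<in> S2" and r: "0 <= r"
 shows "real (card {i\<in>{1..N}. norm (x i - z) <= r}) <= 24 * C\<^sub>1*((r + 2*h)/h)^2"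
proof -
 let ?A = "{i\<in>{1..N}. norm (x i - z) <= r}"
 have "real (card ?A)*(h^2 / C\<^sub>1) = (\<Sum>i\<in>?A. h^2 / C\<^sub>1)" by simp
 also have "... <= (\<Sum>i\<in>?A. measure sph (V i))" using area_vcell by (intro sum_mono) auto
 also have "... = measure sph (\<Union>i\<in>?A. V i)"
 proof (rule sphere.finite_measure_finite_Union[symmetric])
  show "disjoint_family_on V ?A"
   unfolding disjoint_family_on_def vcell_def by fastforce
 qed (use vcell_sets in auto)
 also have "... <= measure sph (ball z (r + 2*h) \<inter> S2)"
 proof (rule sphere.finite_measure_mono)
  show "(\<Union>i\<in>?A. V i) \<subseteq> ball z (r + 2*h) \<inter> S2"
  proof
   fix y assume "y \<in> (\<Union>i\<in>?A. V i)"
   then obtain i where i: "i \<in> {1..N}" "norm (x i - z) <= r" "y \<in> V i" by auto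
   have "norm (y - x i) <= h" using ccell_norm[OF i(1)] vcell_subset_ccell[OF i(1)] i(3) by blast
   hence "norm (y - z) < r + 2*h" using i(2) h_pos norm_triangle_ineq[of "y - x i" "x i - z"] by simp
   thus "y \<in> ball z (r + 2*h) \<inter> S2" using i(3) by (auto simp: dist_norm norm_minus_commute vcell_def)
  qed
 qed (intro sets_sphere_Int, simp)
 also have "... <= 24*(r + 2*h)^2"
  using emeasure_cap_le[OF z, of "r + 2*h"] r h_pos by (simp add: sphere.emeasure_eq_measure)
 finally have "real (card ?A)*h^2 <= 24 * C\<^sub>1*(r + 2*h)^2" using C1 by (simp add: field_simps)
 thus ?thesis using h_pos by (simp add: power_divide field_simps)
qed

lemma card_nbrs:
 assumes i: "i \<in> {1..N}"
 shows "real (card {j\<in>{1..N}-{i}. me i j > 0}) <= 384 * C\<^sub>1"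
proof -
 have "real (card {j\<in>{1..N}-{i}. me i j > 0}) <= real (card {j\<in>{1..N}. norm (x j - x i) <= 2*h})"
  using me_near[OF i] by (intro of_nat_mono card_mono) auto
 also have "... <= 24 * C\<^sub>1*((2*h + 2*h)/h)^2" using h_pos by (intro card_near x_S2 i) auto
 also have "... = 384 * C\<^sub>1" using h_pos by (simp add: power_divide power2_eq_square)
 finally show ?thesis .
qed

text \<open>Edges of length 0 contribute nothing, so the sum over neighbours extends to all other
  vertices; the symmetry of length and distance then permits summation by parts.\<close>

lemma A_h_sym:
 "A_h N x u v = (1/2)*(\<Sum>i\<in>{1..N}. \<Sum>j\<in>{1..N}-{i}. me i j/ed i j*(u (x i) - u (x j))*(v (x i) - v (x j)))"
proof -
 let ?w = "\<lambda>i j. me i j/ed i j*(u (x i) - u (x j))"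
 have split: "(\<Sum>i\<in>{1..N}. \<Sum>j\<in>{1..N}-{i}. f i j) = (\<Sum>i\<in>{1..N}. \<Sum>j\<in>{1..N}. if j = i then 0 else f i j)" for f :: "nat => nat => real"
  by (intro sum.cong refl sum.mono_neutral_cong_left) auto
 have "A_h N x u v = (\<Sum>i\<in>{1..N}. \<Sum>j\<in>{1..N}-{i}. ?w i j * v (x i))"
  unfolding A_h_def
 proof (intro sum.cong refl)
  fix i assume i: "i \<in> {1..N}"
  have "(\<Sum>j\<in>nbrs N x i. fv_flux N x u i j) = (\<Sum>j\<in>{1..N}-{i}. ?w i j)"
  proof (rule sum.mono_neutral_cong_left)
   show "nbrs N x i \<subseteq> {1..N} - {i}" by (auto simp: nbrs_def)
   show "\<forall>j\<in>{1..N} - {i} - nbrs N x i. ?w i j = 0"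
   proof
    fix j assume j: "j \<in> {1..N} - {i} - nbrs N x i"
    hence "\<not> me i j > 0" using edge_length[OF i, of j] by (auto simp: nbrs_def)
    hence "me i j = 0" using measure_nonneg[of lborel "eE i j"] by linarith
    thus "?w i j = 0" by simp
   qed
   fix j assume "j \<in> nbrs N x i"
   hence "j \<in> {1..N}" "i ~= j" using nbrs_in by auto
   from edge_length[OF i this] show "fv_flux N x u i j = ?w i j" unfolding fv_flux_def ed_def by (simp add: field_simps)
  qed simp
  thus "v (x i)*(\<Sum>j\<in>nbrs N x i. fv_flux N x u i j) = (\<Sum>j\<in>{1..N}-{i}. ?w i j * v (x i))"
   by (simp add: sum_distrib_left mult.commute)
 qed
 also have "... = (1/2)*((\<Sum>i\<in>{1..N}. \<Sum>j\<in>{1..N}-{i}. ?w i j * v (x i)) + (\<Sum>i\<in>{1..N}. \<Sum>j\<in>{1..N}-{i}. ?w j i * v (x j)))"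
 proof -
  have "(\<Sum>i\<in>{1..N}. \<Sum>j\<in>{1..N}-{i}. ?w j i * v (x j)) = (\<Sum>i\<in>{1..N}. \<Sum>j\<in>{1..N}-{i}. ?w i j * v (x i))"
   unfolding split by (subst sum.swap) (intro sum.cong refl, auto)
  thus ?thesis by simp
 qed
 also have "... = (1/2)*(\<Sum>i\<in>{1..N}. \<Sum>j\<in>{1..N}-{i}. ?w i j * v (x i) + ?w j i * v (x j))"
  by (simp add: sum.distrib)
 also have "... = (1/2)*(\<Sum>i\<in>{1..N}. \<Sum>j\<in>{1..N}-{i}. ?w i j*(v (x i) - v (x j)))"
 proof (intro arg_cong2[where f="(*)"] refl sum.cong)
  fix i j assume "i \<in> {1..N}" "j \<in> {1..N} - {i}"
  hence "me j i = me i j" "ed j i = ed i j" using me_sym by (auto simp: ed_def norm_minus_commute)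
  hence "?w j i = - ?w i j" by (simp only: mult_minus_right[symmetric] minus_diff_eq)
  thus "?w i j * v (x i) + ?w j i * v (x j) = ?w i j*(v (x i) - v (x j))" by (simp only: right_diff_distrib mult_minus_left add_uminus_conv_diff)
 qed
 finally show ?thesis .
qed

text \<open>If \<open>l\<close> is the rotation derivative of \<open>u\<close>, then
  \<open>- cross3 y (l y)\<close> is its tangential gradient on the sphere. The integral term is
  thus the exact flux through the edge, signed by the inner normal, and the other term its two-point
  approximation.\<close>

definition res :: "(real^3 => real) => (real^3 => real^3) => nat => nat => real" where
 "res u l i j = integral (eE i j) (\<lambda>th. (- cross3 (ez i j th) (l (ez i j th))) \<bullet> (x i - x j))/ed i j - me i j/ed i j*(u (x i) - u (x j))"

lemma me_interval: "eE i j = {al..be} ==> me i j = (if al <= be then be - al else 0)"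
 by (simp add: measure_def emeasure_lborel_Icc_eq)

lemma dot_cross_swap: "cross3 z l \<bullet> n = - (l \<bullet> cross3 z n)"
 by (simp add: cross3_def inner_vec_def sum_3 algebra_simps)

lemma res_dirv:
 assumes ij: "i \<in> {1..N}" "j \<in> {1..N}" "i ~= j"
 shows "ed i j*res u l i j = - (ed i j*integral (eE i j) (\<lambda>th. dirv l (en i j) (ez i j th)) - me i j*(u (x j) - u (x i)))"
proof -
 have d: "ed i j > 0" by (rule ed_pos[OF ij])
 have "integral (eE i j) (\<lambda>th. (- cross3 (ez i j th) (l (ez i j th))) \<bullet> (x i - x j)) = integral (eE i j) (\<lambda>th. - ed i j*dirv l (en i j) (ez i j th))"
 proof (intro Henstock_Kurzweil_Integration.integral_cong)
  fix th assume "th \<in> eE i j"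
  hence z: "ez i j th \<in> S2" using ccell_S2 by (auto simp: eE_def)
  have "x i - x j = - (ed i j *R en i j)" using d by (simp add: en_def)
  thus "(- cross3 (ez i j th) (l (ez i j th))) \<bullet> (x i - x j) = - ed i j*dirv l (en i j) (ez i j th)"
   unfolding dirv_def radial_proj_id[OF z] \<open>x i - x j = _\<close> inner_minus_left inner_minus_right inner_scaleR_right
   using z dot_cross_swap[of "ez i j th" "l (ez i j th)" "en i j"] by simp
 qed
 also have "... = - ed i j*integral (eE i j) (\<lambda>th. dirv l (en i j) (ez i j th))" by (rule Henstock_Kurzweil_Integration.integral_mult_right)
 finally show ?thesis using d unfolding res_def by (simp add: field_simps)
qed

text \<open>Every point of the chord is within \<open>h\<close> of every point of the edge. For an
  edge point \<open>z\<close> and \<open>h <= 1\<close>, products with \<open>z\<close> are at least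
  \<open>cos h >= 1/2\<close> along the chord, which keeps the hull away from the origin. The hull
  lies within \<open>2*h\<close> of \<open>x i\<close>, and radial projection moves a point by its
  distance to the sphere, so \<open>4*h\<close> suffices afterwards.\<close>

lemma res_small:
 assumes ij: "i \<in> {1..N}" "j \<in> {1..N}" "i ~= j" and h1: "h <= 1" and sm: "rot_smooth u l m" and E: "me i j > 0"
 shows "(res u l i j)^2 <= me i j/ed i j*(6912*h^2*(SI y. (rot_size l m y)^2*indicator (cball (x i) (4*h)) y))"
proof -
 have d: "ed i j > 0" by (rule ed_pos[OF ij])
 obtain al be where I: "eE i j = {al..be}" using eE_interval[OF ij] by blast
 have ab: "al < be" "me i j = be - al" using E unfolding me_interval[OF I] by (auto split: if_splits)
 have c: "1/2 <= cos h" by (rule cos_ge_half[OF h_nonneg h1])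
 have em: "em i j ~= 0" using ab eE_cos_pos(1)[OF ij, of al] I by auto
 note fr = edge_frame[OF ij em] and pts = edge_points[OF ij em]
 let ?r = "norm (em i j)"
 have "?r^2 <= 1^2" unfolding one_power2 using pts(3) zero_le_power2[of "ed i j/2"] by linarith
 from power2_le_imp_le[OF this] have r1: "?r <= 1" by simp
 have zc: "cos h <= ?r*cos th" "cos th > 0" "\<bar>th\<bar> < pi/2" "ez i j th \<in> ccell i" "ez i j th \<in> ccell j" if "th \<in> eE i j" for th
 proof -
  show zi: "ez i j th \<in> ccell i" using that by (simp add: eE_def)
  thus "ez i j th \<in> ccell j" using eE_sym_ccell[OF ij em, of th] by blast
  show "cos h <= ?r*cos th" using ccell_cos[OF ij(1) zi h_le_pi] unfolding ez_props(4)[OF ij em] .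
  show "cos th > 0" by (rule eE_cos_pos(2)[OF ij that])
  show "\<bar>th\<bar> < pi/2" using eE_cos_pos(3,4)[OF ij that] by linarith
 qed
 have rho: "1/2 <= ?r"
 proof -
  have "cos h <= ?r*cos al" using zc(1)[of al] I ab by auto
  also have "... <= ?r*1" by (intro mult_left_mono) auto
  finally show ?thesis using c by simp
 qed
 have th: "\<bar>th\<bar> <= 1" if "th \<in> eE i j" for th
 proof (rule ccontr)
  assume "\<not> \<bar>th\<bar> <= 1"
  hence "cos \<bar>th\<bar> < cos h" using zc(3)[OF that] h1 h_nonneg by (intro cos_monotone_0_pi) auto
  moreover have "?r*cos th <= 1*cos th" using r1 zc(2)[OF that] by (intro mult_right_mono) auto
  ultimately show False using zc(1)[OF that] by simp
 qed
 define s where "s ta = ?r *R ea i j + ta *R en i j" for ta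
 have seg: "\<exists>c. 0 <= c \<and> c <= 1 \<and> s ta = (1 - c) *R x i + c *R x j" if "\<bar>ta\<bar> <= ed i j/2" for ta
 proof -
  have "s ta = (1 - (ta/ed i j + 1/2)) *R x i + (ta/ed i j + 1/2) *R x j"
  proof -
   have "(1 - (ta/ed i j + 1/2)) *R (?r *R ea i j + (- (ed i j/2)) *R en i j) + (ta/ed i j + 1/2) *R (?r *R ea i j + (ed i j/2) *R en i j)
    = ((1 - (ta/ed i j + 1/2))*?r + (ta/ed i j + 1/2)*?r) *R ea i j + ((1 - (ta/ed i j + 1/2))*(- (ed i j/2)) + (ta/ed i j + 1/2)*(ed i j/2)) *R en i j"
    by (simp only: scaleR_add_right scaleR_add_left scaleR_scaleR add.assoc add.left_commute)
   also have "(1 - (ta/ed i j + 1/2))*?r + (ta/ed i j + 1/2)*?r = ?r" by (simp add: algebra_simps)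
   also have "(1 - (ta/ed i j + 1/2))*(- (ed i j/2)) + (ta/ed i j + 1/2)*(ed i j/2) = ta" using d by (simp add: field_simps)
   finally show ?thesis using pts(1,2) unfolding s_def by metis
  qed
  moreover have "0 <= ta/ed i j + 1/2" "ta/ed i j + 1/2 <= 1" using that d by (simp_all add: field_simps abs_le_iff)
  ultimately show ?thesis by blast
 qed
 have zi: "norm (x i - ez i j th) <= h" "norm (x j - ez i j th) <= h" if "th \<in> eE i j" for th
  using ccell_norm[OF ij(1) zc(4)[OF that]] ccell_norm[OF ij(2) zc(5)[OF that]] by (simp_all add: norm_minus_commute)
 have Hs: "norm (s ta - ez i j th) <= h" if "th \<in> eE i j" and tau: "\<bar>ta\<bar> <= ed i j/2" for th ta
 proof -
  obtain c where c: "0 <= c" "c <= 1" "s ta = (1 - c) *R x i + c *R x j" using seg[OF tau] by blast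
  have "(1 - c) *R x i + c *R x j \<in> cball (ez i j th) h"
   using zi[OF that(1)] c by (intro convexD[OF convex_cball]) (auto simp: dist_norm norm_minus_commute)
  thus ?thesis unfolding c(3) by (simp add: dist_norm norm_minus_commute)
 qed
 have half: "1/2 <= norm ((1 - t) *R ez i j th + t *R s ta)" if "th \<in> eE i j" "\<bar>ta\<bar> <= ed i j/2" "0 <= t" "t <= 1" for th ta t
 proof -
  have z1: "ez i j th \<bullet> ez i j th = 1" by (rule inner_S2_self[OF ez_props(1)[OF ij em]])
  have "ez i j th \<bullet> s ta = ?r*cos th" unfolding s_def using ez_props[OF ij em, of th] by (simp add: inner_add_right)
  hence "ez i j th \<bullet> s ta \<ge> 1/2" using zc(1)[OF that(1)] c by linarith
  hence "(1 - t)*1 + t*(ez i j th \<bullet> s ta) \<ge> (1 - t)*(1/2) + t*(1/2)" using that(3,4) by (intro add_mono mult_left_mono) auto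
  also have "(1 - t)*1 + t*(ez i j th \<bullet> s ta) = ez i j th \<bullet> ((1 - t) *R ez i j th + t *R s ta)" by (simp add: inner_add_right z1)
  also have "... <= norm (ez i j th)*norm ((1 - t) *R ez i j th + t *R s ta)" by (rule norm_cauchy_schwarz)
  finally show ?thesis using ez_props(1)[OF ij em, of th] by (simp add: field_simps)
 qed
 have near: "rp ((1 - t) *R ez i j th + t *R s ta) \<in> cball (x i) (4*h)" if "th \<in> eE i j" "\<bar>ta\<bar> <= ed i j/2" "0 <= t" "t <= 1" for th ta t
 proof -
  let ?p = "(1 - t) *R ez i j th + t *R s ta"
  have p0: "norm ?p > 0" using half[OF that] by linarith
  have "?p \<in> cball (ez i j th) h"
   using Hs[OF that(1,2)] that(3,4) h_nonneg by (intro convexD[OF convex_cball]) (auto simp: dist_norm norm_minus_commute)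
  hence "norm (?p - ez i j th) <= h" by (simp add: dist_norm norm_minus_commute)
  hence pi: "norm (?p - x i) <= 2*h"
   using norm_diff_triangle_le[OF _ zi(1)[OF that(1), unfolded norm_minus_commute[of "x i"]], of ?p h] by simp
  have "rp ?p - ?p = (1/norm ?p - 1) *R ?p" by (simp add: radial_proj_def scaleR_diff_left inverse_eq_divide)
  hence "norm (rp ?p - ?p) = \<bar>1/norm ?p - 1\<bar>*norm ?p" by (simp only: norm_scaleR real_norm_def)
  also have "... = \<bar>(1/norm ?p - 1)*norm ?p\<bar>" by (simp add: abs_mult)
  also have "(1/norm ?p - 1)*norm ?p = norm (x i) - norm ?p" using p0 x_S2[OF ij(1)] by (simp add: left_diff_distrib)
  also have "\<bar>norm (x i) - norm ?p\<bar> <= norm (x i - ?p)" by (rule norm_triangle_ineq3)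
  finally have "norm (rp ?p - ?p) <= 2*h" using pi by (simp add: norm_minus_commute)
  thus ?thesis using pi norm_triangle_ineq[of "rp ?p - ?p" "?p - x i"] by (simp add: dist_norm norm_minus_commute)
 qed
 have th': "-1 <= al" "be <= 1" using th[of al] th[of be] ab(1) unfolding I by (auto simp: abs_le_iff)
 have sx: "rp (s (ed i j/2)) = x j" "rp (s (- (ed i j/2))) = x i"
  unfolding s_def pts(1,2)[symmetric] using radial_proj_id x_S2 ij by auto
 let ?I = "SI y. (rot_size l m y)^2*indicator (cball (x i) (4*h)) y"
 have "(2*(ed i j/2)*integral {al..be} (\<lambda>th. dirv l (en i j) (cos th *R ea i j + sin th *R eb i j))
   - (be - al)*(u (rp (?r *R ea i j + (ed i j/2) *R en i j)) - u (rp (?r *R ea i j + (- (ed i j/2)) *R en i j))))^2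
  <= 6912*h^2*(2*(ed i j/2))*(be - al)*?I"
  unfolding ez_def[symmetric] s_def[symmetric]
  by (rule edge_estimate[OF sm fr, of ?r "ed i j/2" al be "cball (x i) (4*h)" h, folded ez_def s_def])
   (use pts(3) rho d ab(1) th' Hs[unfolded I] half[unfolded I] near[unfolded I] in auto)
 hence "(ed i j*integral (eE i j) (\<lambda>th. dirv l (en i j) (ez i j th)) - me i j*(u (x j) - u (x i)))^2 <= 6912*h^2*ed i j * me i j*?I"
  unfolding ez_def[symmetric] s_def[symmetric] sx I ab(2) by simp
 hence "(ed i j*res u l i j)^2 <= 6912*h^2*ed i j * me i j*?I" unfolding res_dirv[OF ij] power2_minus .
 hence "ed i j*(ed i j*(res u l i j)^2) <= ed i j*(6912*h^2 * me i j*?I)" by (simp add: power2_eq_square mult_ac)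
 hence "ed i j*(res u l i j)^2 <= 6912*h^2 * me i j*?I" using d by (simp only: mult_le_cancel_left_pos)
 thus ?thesis using d by (simp add: field_simps)
qed

text \<open>The chord is orthogonal to \<open>em i j\<close>, so its distance to the origin is
  \<open>norm (em i j)\<close>. If this is at least \<open>1/2\<close>, the mean value theorem
  applies along the chord; otherwise the vertices are at least 1 apart and the sup bound
  suffices.\<close>

lemma vertex_difference:
 assumes ij: "i \<in> {1..N}" "j \<in> {1..N}" "i ~= j" and sm: "rot_smooth u l m"
  and M: "\<And>y. y \<in> S2 ==> \<bar>u y\<bar> <= M" and L: "\<And>y. y \<in> S2 ==> norm (l y) <= 3*M"
 shows "\<bar>u (x j) - u (x i)\<bar> <= 6*M*ed i j"
proof (cases "1/2 <= norm (em i j)")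
 case True
 have seg: "1/2 <= norm (x i + t *R (x j - x i))" for t
 proof -
  have xe: "x i = em i j - (1/2) *R (x j - x i)" by (simp add: em_def vec_eq_iff field_simps)
  have "em i j \<bullet> (x i + t *R (x j - x i)) = em i j \<bullet> x i" unfolding inner_add_right inner_scaleR_right em_orth[OF ij(1,2)] by simp
  also have "... = em i j \<bullet> em i j" by (subst xe) (simp only: inner_diff_right[of _ "em i j"] inner_scaleR_right em_orth[OF ij(1,2)] mult_zero_right diff_zero)
  finally have "norm (em i j)*norm (em i j) <= norm (em i j)*norm (x i + t *R (x j - x i))"
   using norm_cauchy_schwarz[of "em i j" "x i + t *R (x j - x i)"] by (simp add: norm_eq_sqrt_inner)
  hence "norm (em i j) <= norm (x i + t *R (x j - x i))"
   using True by (subst (asm) mult_le_cancel_left_pos) linarith+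
  thus ?thesis using True by linarith
 qed
 obtain xi where xi: "u (rp (x i + (x j - x i))) - u (rp (x i)) = dirv l (x j - x i) (x i + xi *R (x j - x i))"
  by (rule segment_mean_value[OF sm, of "x i" "x j - x i"]) (use seg in auto)
 have nz: "x i + xi *R (x j - x i) ~= 0" using seg[of xi] by (metis norm_zero not_less zero_less_divide_1_iff zero_less_numeral)
 have "\<bar>dirv l (x j - x i) (x i + xi *R (x j - x i))\<bar> <= 2*(3*M)*norm (x j - x i)"
  by (rule dirv_le[where l=l, OF seg L[OF radial_proj_S2[OF nz]]])
 thus ?thesis using xi radial_proj_id x_S2 ij by (simp add: ed_def)
next
 case False
 hence e: "em i j \<bullet> em i j <= 1/4"
  using power_mono[of "norm (em i j)" "1/2" 2] unfolding power2_norm_eq_inner by (simp add: power_divide)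
 have "(ed i j)^2 = 4 - 4*(em i j \<bullet> em i j)"
  unfolding ed_def em_def norm_diff_S2[OF x_S2[OF ij(2)] x_S2[OF ij(1)]]
  using inner_S2_self[OF x_S2[OF ij(1)]] inner_S2_self[OF x_S2[OF ij(2)]] by (simp add: inner_simps inner_commute field_simps)
 hence "1^2 <= (ed i j)^2" using e by simp
 hence d: "1 <= ed i j" by (rule power2_le_imp_le) (simp add: ed_def)
 have "0 <= M" using M[OF x_S2[OF ij(1)]] by simp
 hence "2*M*1 <= 6*M*ed i j" using d by (intro mult_mono) auto
 thus ?thesis using M[OF x_S2[OF ij(1)]] M[OF x_S2[OF ij(2)]] by linarith
qed

text \<open>Both terms of the residual are bounded by first derivatives and sup norms, without
  gaining a power of \<open>h\<close>. To produce the weight of the energy, one factor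
  \<open>me i j\<close> is traded for \<open>8/ed i j\<close>, using \<open>me i j <= 4\<close> and
  \<open>ed i j <= 2\<close>; hence \<open>1152 = 144*8\<close>.\<close>

lemma res_large:
 assumes ij: "i \<in> {1..N}" "j \<in> {1..N}" "i ~= j" and sm: "rot_smooth u l m"
  and M: "\<And>y. y \<in> S2 ==> \<bar>u y\<bar> <= M" and L: "\<And>y. y \<in> S2 ==> norm (l y) <= 3*M"
 shows "(res u l i j)^2 <= me i j/ed i j*(1152*M^2)"
proof (cases "eE i j = {}")
 case True
 thus ?thesis by (simp add: res_def)
next
 case False
 have d: "ed i j > 0" by (rule ed_pos[OF ij])
 have M0: "0 <= M" using M[OF x_S2[OF ij(1)]] by simp
 obtain al be where I: "eE i j = {al..be}" using eE_interval[OF ij] by blast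
 have me: "al <= be" "me i j = be - al" using False unfolding me_interval[OF I] by (auto simp: I)
 have em: "em i j ~= 0" using False eE_empty by blast
 have "norm (integral {al..be} (\<lambda>th. dirv l (en i j) (ez i j th))) <= (6*M)*(be - al)"
 proof (rule integral_bound[OF me(1)])
  have ezn: "ez i j th ~= 0" "ez i j th \<in> S2" for th using ez_props(1)[OF ij em, of th] by auto
  have cl: "continuous_on UNIV l" by (rule rot_smooth_cont(1)[OF sm])
  show "continuous_on {al..be} (\<lambda>th. dirv l (en i j) (ez i j th))"
   unfolding dirv_def radial_proj_id[OF ezn(2)] using ezn(1)
   by (intro continuous_intros continuous_on_cross continuous_on_compose2[OF cl ez_cont] ez_cont) auto
  fix th
  have "\<bar>dirv l (en i j) (ez i j th)\<bar> <= 2*(3*M)*norm (en i j)"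
  proof (rule dirv_le)
   show "1/2 <= norm (ez i j th)" using ezn(2)[of th] by simp
   show "norm (l (rp (ez i j th))) <= 3*M" unfolding radial_proj_id[OF ezn(2)] by (rule L[OF ezn(2)])
  qed
  thus "norm (dirv l (en i j) (ez i j th)) <= 6*M" using edge_frame[OF ij em] by (simp add: frame3_def)
 qed
 hence A: "\<bar>ed i j*integral (eE i j) (\<lambda>th. dirv l (en i j) (ez i j th))\<bar> <= 6*M * me i j*ed i j"
  unfolding I[symmetric] me(2)[symmetric] using d by (simp add: abs_mult mult_ac mult_left_mono)
 have B: "\<bar>me i j*(u (x j) - u (x i))\<bar> <= 6*M * me i j*ed i j"
  using mult_left_mono[OF vertex_difference[OF ij sm M L] measure_nonneg[of lborel "eE i j"]] by (simp add: abs_mult mult_ac)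
 have "\<bar>ed i j*res u l i j\<bar> <= 12*M * me i j*ed i j" unfolding res_dirv[OF ij] using A B by linarith
 hence "ed i j*\<bar>res u l i j\<bar> <= ed i j*(12*M * me i j)" using d by (simp add: abs_mult mult_ac)
 hence "\<bar>res u l i j\<bar> <= 12*M * me i j" using d by (simp only: mult_le_cancel_left_pos)
 hence "\<bar>res u l i j\<bar>^2 <= (12*M * me i j)^2" by (intro power_mono) auto
 also have "... = me i j*(144*M^2) * me i j" by (simp add: power2_eq_square)
 also have "... <= me i j*(144*M^2)*(8/ed i j)"
 proof (intro mult_left_mono)
  have "ed i j <= 2" using norm_triangle_ineq4[of "x j" "x i"] x_S2 ij by (simp add: ed_def)
  hence "me i j*ed i j <= 4*2" using me_le_4 d by (intro mult_mono) auto
  thus "me i j <= 8/ed i j" using d by (simp add: field_simps)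
 qed simp
 finally show ?thesis by (simp add: mult_ac)
qed

text \<open>The weight \<open>me i j/ed i j\<close> is split off to match the energy. For
  \<open>h <= 1/2\<close> a vertex has at most \<open>384 * C\<^sub>1\<close> neighbours, and a
  point lies in at most \<open>864 * C\<^sub>1\<close> of the balls of radius \<open>4*h\<close>, so
  the local square integrals add up to the global one. For larger \<open>h\<close> the number of
  vertices itself is bounded by packing, and the crude residual bound is summed.\<close>

lemma residual_sum:
 assumes sm: "rot_smooth u l m"
  and M: "\<And>y. y \<in> S2 ==> \<bar>u y\<bar> <= M" and L: "\<And>y. y \<in> S2 ==> norm (l y) <= 3*M"
 shows "\<exists>G. (\<forall>i\<in>{1..N}. \<forall>j\<in>{1..N}-{i}. 0 <= G i j \<and> (res u l i j)^2 <= me i j/ed i j*G i j) \<and>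
  (\<Sum>i\<in>{1..N}. \<Sum>j\<in>{1..N}-{i}. G i j) <= residual_const C\<^sub>1*(if h <= 1/2 then h^2*(SI y. (rot_size l m y)^2) else M^2)"
proof (cases "h <= 1/2")
 case True
 let ?q = "\<lambda>y. (rot_size l m y)^2"
 have h1: "h <= 1" using True by simp
 let ?I = "\<lambda>i. SI y. ?q y*indicator (cball (x i) (4*h)) y"
 define G where "G i j = (if me i j > 0 then 6912*h^2*?I i else 0)" for i j
 have I0: "0 <= ?I i" for i by (intro Bochner_Integration.integral_nonneg) simp
 have qi: "integrable sph ?q"
  by (intro continuous_S2_integrable continuous_on_power rot_smooth_cont(3)[OF sm])
 have qc: "integrable sph (\<lambda>y. ?q y*indicator (cball (x i) (4*h)) y)" for i
 proof -
  have "cball (x i) (4*h) \<inter> space sph \<in> sets sph" using sets_sphere_Int[of "cball (x i) (4*h)"] by simp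
  hence "integrable sph (\<lambda>y. indicator (cball (x i) (4*h) \<inter> space sph) y *R ?q y)" by (rule integrable_mult_indicator[OF _ qi])
  thus ?thesis by (rule Bochner_Integration.integrable_cong[OF refl, THEN iffD1, rotated]) (auto simp: indicator_def)
 qed
 have "(\<Sum>i\<in>{1..N}. \<Sum>j\<in>{1..N}-{i}. G i j) <= (\<Sum>i\<in>{1..N}. 384 * C\<^sub>1*(6912*h^2*?I i))"
 proof (intro sum_mono)
  fix i assume i: "i \<in> {1..N}"
  have "(\<Sum>j\<in>{1..N}-{i}. G i j) = (\<Sum>j\<in>{j\<in>{1..N}-{i}. me i j > 0}. 6912*h^2*?I i)"
   unfolding G_def by (intro sum.inter_filter[symmetric]) simp
  also have "... = real (card {j\<in>{1..N}-{i}. me i j > 0})*(6912*h^2*?I i)" by simp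
  also have "... <= 384 * C\<^sub>1*(6912*h^2*?I i)" using I0[of i] by (intro mult_right_mono card_nbrs i) simp
  finally show "(\<Sum>j\<in>{1..N}-{i}. G i j) <= 384 * C\<^sub>1*(6912*h^2*?I i)" .
 qed
 also have "... = 384 * C\<^sub>1*(6912*h^2)*(\<Sum>i\<in>{1..N}. ?I i)" by (simp add: sum_distrib_left mult.assoc)
 also have "(\<Sum>i\<in>{1..N}. ?I i) = (SI y. (\<Sum>i\<in>{1..N}. ?q y*indicator (cball (x i) (4*h)) y))"
  using qc by (intro Bochner_Integration.integral_sum[symmetric]) auto
 also have "384 * C\<^sub>1*(6912*h^2)*... <= 384 * C\<^sub>1*(6912*h^2)*(SI y. 864 * C\<^sub>1*?q y)"
 proof (intro mult_left_mono integral_mono)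
  fix y assume "y \<in> space sph"
  hence y: "y \<in> S2" by simp
  have "(\<Sum>i\<in>{1..N}. ?q y*indicator (cball (x i) (4*h)) y) = ?q y*real (card {i\<in>{1..N}. norm (x i - y) <= 4*h})"
   by (simp add: sum_distrib_left[symmetric] indicator_def dist_norm sum.If_cases Int_def)
  also have "... <= ?q y*(24 * C\<^sub>1*((4*h + 2*h)/h)^2)" using h_pos by (intro mult_left_mono card_near y) auto
  also have "... = 864 * C\<^sub>1*?q y" using h_pos by (simp add: power_divide power2_eq_square)
  finally show "(\<Sum>i\<in>{1..N}. ?q y*indicator (cball (x i) (4*h)) y) <= 864 * C\<^sub>1*?q y" .
 next
  show "integrable sph (\<lambda>y. \<Sum>i\<in>{1..N}. ?q y*indicator (cball (x i) (4*h)) y)" by (intro Bochner_Integration.integrable_sum qc)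
  show "integrable sph (\<lambda>y. 864 * C\<^sub>1*?q y)" by (intro integrable_mult_right qi)
 qed (use C1 in simp)
 also have "... = residual_const C\<^sub>1*(h^2*(SI y. ?q y))" by (simp add: residual_const_def power2_eq_square)
 finally have "(\<Sum>i\<in>{1..N}. \<Sum>j\<in>{1..N}-{i}. G i j) <= residual_const C\<^sub>1*(h^2*(SI y. ?q y))" .
 moreover have "0 <= G i j \<and> (res u l i j)^2 <= me i j/ed i j*G i j" if "i \<in> {1..N}" "j \<in> {1..N}-{i}" for i j
 proof (cases "me i j > 0")
  case m: True
  thus ?thesis using res_small[OF _ _ _ h1 sm m] that I0[of i] by (simp add: G_def)
 next
  case False
  hence "me i j = 0" using measure_nonneg[of lborel "eE i j"] by linarith
  hence "(res u l i j)^2 <= 0" using res_large[OF _ _ _ sm M L, of i j] that by auto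
  thus ?thesis using False by (simp add: G_def)
 qed
 ultimately show ?thesis using True by (intro exI[of _ G]) auto
next
 case False
 have h1: "1 <= 2*h" using False by simp
 have "real N = real (card {i\<in>{1..N}. norm (x i - x 1) <= 2})"
 proof -
  have "norm (x i - x 1) <= 2" if "i \<in> {1..N}" for i
   using norm_triangle_ineq4[of "x i" "x 1"] x_S2[OF that] x_S2[of 1] N_pos by simp
  hence "{i\<in>{1..N}. norm (x i - x 1) <= 2} = {1..N}" by auto
  thus ?thesis by simp
 qed
 also have "... <= 24 * C\<^sub>1*((2 + 2*h)/h)^2" using N_pos by (intro card_near x_S2) auto
 also have "... <= 24 * C\<^sub>1*6^2" using h1 C1 by (intro mult_left_mono power_mono) (auto simp: field_simps)
 finally have N: "real N <= 864 * C\<^sub>1" by simp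
 have "(\<Sum>i\<in>{1..N}. \<Sum>j\<in>{1..N}-{i}. 1152*M^2) <= (\<Sum>i\<in>{1..N}. \<Sum>j\<in>{1..N}. 1152*M^2)"
  by (intro sum_mono sum_mono2) auto
 also have "... = (real N)^2*(1152*M^2)" by (simp add: power2_eq_square)
 also have "... <= (864 * C\<^sub>1)^2*(1152*M^2)" using N by (intro mult_right_mono power_mono) auto
 also have "... = 859963392*(C\<^sub>1^2*M^2)" by (simp add: power_mult_distrib)
 also have "... <= residual_const C\<^sub>1*M^2" unfolding residual_const_def mult.assoc by (intro mult_right_mono) auto
 finally show ?thesis using False res_large[OF _ _ _ sm M L]
  by (intro exI[of _ "\<lambda>_ _. 1152*M^2"]) auto
qed

section \<open>The discrete energy estimate\<close>

definition energy :: "(nat => real) => real" where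
 "energy e = (1/2)*(\<Sum>i\<in>{1..N}. \<Sum>j\<in>{1..N}-{i}. me i j/ed i j*(e i - e j)^2)"

text \<open>Young's inequality on every edge, between the weighted square of
  \<open>e i - e j\<close> and \<open>G i j\<close>. Half of the energy is absorbed on the left,
  which doubles \<open>de\<close>.\<close>

lemma energy_residual:
 assumes G: "\<And>i j. i \<in> {1..N} ==> j \<in> {1..N}-{i} ==> 0 <= G i j \<and> (r i j)^2 <= me i j/ed i j*G i j"
  and E: "energy e = de - (1/2)*(\<Sum>i\<in>{1..N}. \<Sum>j\<in>{1..N}-{i}. (e i - e j)*r i j)"
 shows "energy e <= 2*de + (1/2)*(\<Sum>i\<in>{1..N}. \<Sum>j\<in>{1..N}-{i}. G i j)"
proof -
 have "- ((e i - e j)*r i j) <= (1/2)*(me i j/ed i j*(e i - e j)^2 + G i j)" if "i \<in> {1..N}" "j \<in> {1..N}-{i}" for i j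
 proof -
  let ?w = "me i j/ed i j" and ?d = "e i - e j"
  have w: "0 <= ?w" by (simp add: ed_def)
  have g: "0 <= G i j" "(r i j)^2 <= ?w*G i j" using G[OF that] by auto
  have "(?d*r i j)^2 <= ?d^2*(?w*G i j)" unfolding power_mult_distrib by (intro mult_left_mono g) simp
  also have "... = (?w*?d^2)*G i j" by simp
  also have "... <= ((1/2)*(?w*?d^2 + G i j))^2"
  proof -
   have "p*q <= ((1/2)*(p + q))^2" for p q :: real
    using zero_le_power2[of "p - q"] by (simp add: power2_eq_square algebra_simps)
   thus ?thesis .
  qed
  finally have "\<bar>?d*r i j\<bar> <= \<bar>(1/2)*(?w*?d^2 + G i j)\<bar>" by (rule abs_le_square_iff[THEN iffD2])
  also have "... = (1/2)*(?w*?d^2 + G i j)" by (intro abs_of_nonneg mult_nonneg_nonneg add_nonneg_nonneg w g(1)) simp_all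
  finally show ?thesis by linarith
 qed
 hence "(\<Sum>i\<in>{1..N}. \<Sum>j\<in>{1..N}-{i}. - ((e i - e j)*r i j))
   <= (\<Sum>i\<in>{1..N}. \<Sum>j\<in>{1..N}-{i}. (1/2)*(me i j/ed i j*(e i - e j)^2 + G i j))"
  by (intro sum_mono) blast
 also have "... = energy e + (1/2)*(\<Sum>i\<in>{1..N}. \<Sum>j\<in>{1..N}-{i}. G i j)"
  unfolding energy_def sum_distrib_left distrib_left sum.distrib ..
 finally show ?thesis using E by (simp add: sum_negf)
qed

end

section \<open>From mollified to given data\<close>

context vmesh
begin

lemma vcell_open: "i \<in> {1..N} ==> \<exists>U. open U \<and> V i = S2 \<inter> U"
proof -
 assume i: "i \<in> {1..N}"
 have "V i = S2 \<inter> (\<Inter>j\<in>{1..N}-{i}. {y. (x j - x i) \<bullet> y < 0})"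
  by (auto simp: vcell_eq[OF i] inner_diff_left inner_commute[of _ "x _"])
 moreover have "open (\<Inter>j\<in>{1..N}-{i}. {y. (x j - x i) \<bullet> y < 0})" by (intro open_INT ballI open_halfspace_lt) auto
 ultimately show ?thesis by blast
qed

lemma vcell_disjoint: "i \<in> {1..N} ==> j \<in> {1..N} ==> y \<in> V i ==> y \<in> V j ==> i = j"
 unfolding vcell_def by fastforce

text \<open>The mollifier is moved to the indicator of the cell, which is bounded and continuous at
  almost every point of the sphere. Convergence is then dominated by \<open>f\<close>, of which only
  integrability is known.\<close>

lemma mol_vcell_tendsto:
 assumes i: "i \<in> {1..N}" and f: "integrable sph f"
 shows "(\<lambda>n. (SI y. mol n f y*indicator (V i) y)) \<longlonglongrightarrow> (SI y. f y*indicator (V i) y)"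
proof -
 let ?v = "indicator (V i) :: real^3 => real"
 have vm: "?v \<in> borel_measurable sph" by (intro borel_measurable_sphereI borel_measurable_indicator vcell_borel i)
 have vb: "\<bar>?v y\<bar> <= 1" for y by (simp add: indicator_def)
 have fm: "f \<in> borel_measurable sph" using f by simp
 have vi: "integrable sph ?v" by (rule bounded_sphere_integrable[OF vm vb])
 have mm: "mol n ?v \<in> borel_measurable sph" for n by (rule borel_measurable_sphere_cont[OF mol_continuous[OF vi]])
 have "(\<lambda>n. (SI y. f y * mol n ?v y)) \<longlonglongrightarrow> (SI y. f y*?v y)"
 proof (rule integral_dominated_convergence[where w="\<lambda>y. \<bar>f y\<bar>"])
  show "(\<lambda>y. f y*?v y) \<in> borel_measurable sph" "(\<lambda>y. f y * mol n ?v y) \<in> borel_measurable sph" for n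
   by (intro borel_measurable_times fm vm mm)+
  show "integrable sph (\<lambda>y. \<bar>f y\<bar>)" using f by simp
  show "AE y in sph. norm (f y * mol n ?v y) <= \<bar>f y\<bar>" for n
  proof (intro AE_I2)
   fix y assume "y \<in> space sph"
   hence "\<bar>mol n ?v y\<bar> <= 1" using vb by (intro mol_bound[OF vi]) auto
   thus "norm (f y * mol n ?v y) <= \<bar>f y\<bar>" by (simp add: abs_mult mult_left_le)
  qed
  show "AE y in sph. (\<lambda>n. f y * mol n ?v y) \<longlonglongrightarrow> f y*?v y"
   using AE_vcell
  proof eventually_elim
   fix y assume "\<exists>!i. i \<in> {1..N} \<and> y \<in> V i"
   then obtain j where j: "j \<in> {1..N}" "y \<in> V j" by blast
   obtain U where U: "open U" "V j = S2 \<inter> U" using vcell_open[OF j(1)] by blast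
   have "eventually (\<lambda>z. z \<in> U) (nhds y)" using U j by (intro eventually_nhds_in_open) auto
   hence "eventually (\<lambda>z. z \<in> U) (at y within S2)" by (rule filter_leD[OF at_within_le_nhds])
   moreover have "eventually (\<lambda>z. z \<in> S2) (at y within S2)" by (simp add: eventually_at_filter)
   ultimately have "eventually (\<lambda>z. ?v z = ?v y) (at y within S2)"
   proof eventually_elim
    case (elim z)
    hence "z \<in> V j" using U by blast
    thus ?case using vcell_disjoint[OF i j(1)] j(2) by (auto simp: indicator_def)
   qed
   hence "continuous (at y within S2) ?v" unfolding continuous_within by (rule tendsto_eventually)
   moreover have "y \<in> S2" using j(2) by (simp add: vcell_def)
   ultimately show "(\<lambda>n. f y * mol n ?v y) \<longlonglongrightarrow> f y*?v y"
    by (intro tendsto_mult tendsto_const mol_tendsto[OF vm vb])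
  qed
 qed
 moreover have "(SI y. mol n f y*?v y) = (SI y. f y * mol n ?v y)" for n
  by (rule mol_selfadjoint[OF f vm vb])
 ultimately show ?thesis by simp
qed

end

context uniform_vmesh
begin

text \<open>\<open>U_h\<close> realises prescribed nodal values up to a constant. The constant
  changes neither side: fluxes are paired with differences, and \<open>f\<close> has mean
  zero.\<close>

lemma fv_equation:
 assumes fv: "fv_solution N x f uh" and f: "integrable sph f" "(SI y. f y) = 0"
 shows "(SI y. f y*(\<Sum>i\<in>{1..N}. e i*indicator (V i) y))
  = (1/2)*(\<Sum>i\<in>{1..N}. \<Sum>j\<in>{1..N}-{i}. me i j/ed i j*(uh (x i) - uh (x j))*(e i - e j))"
proof -
 obtain v ka where v: "v \<in> U_h N x" "\<And>i. i \<in> {1..N} ==> v (x i) = e i + ka" using U_h_exists[of e] by blast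
 let ?I = "\<lambda>e y. (\<Sum>i\<in>{1..N}. e i*indicator (V i) y)"
 have Im: "?I e \<in> borel_measurable sph" for e :: "nat => real"
  by (intro borel_measurable_sum borel_measurable_times borel_measurable_const borel_measurable_sphereI borel_measurable_indicator vcell_borel)
 have fm: "f \<in> borel_measurable sph" using f by simp
 have II: "I_h N x v = ?I (\<lambda>i. e i + ka)" unfolding I_h_def using v(2) by (intro ext sum.cong refl) simp
 have fI: "integrable sph (\<lambda>y. f y*?I e y)" for e :: "nat => real"
 proof (rule Bochner_Integration.integrable_bound[where f="\<lambda>y. (\<Sum>i\<in>{1..N}. \<bar>e i\<bar>)*f y"])
  show "AE y in sph. norm (f y*?I e y) <= norm ((\<Sum>i\<in>{1..N}. \<bar>e i\<bar>)*f y)"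
  proof (intro AE_I2)
   fix y
   have "\<bar>?I e y\<bar> <= (\<Sum>i\<in>{1..N}. \<bar>e i*indicator (V i) y\<bar>)" by (rule sum_abs)
   also have "... <= (\<Sum>i\<in>{1..N}. \<bar>e i\<bar>)" by (intro sum_mono) (simp add: indicator_def)
   finally have "\<bar>?I e y\<bar> <= \<bar>\<Sum>i\<in>{1..N}. \<bar>e i\<bar>\<bar>" by simp
   thus "norm (f y*?I e y) <= norm ((\<Sum>i\<in>{1..N}. \<bar>e i\<bar>)*f y)"
    unfolding real_norm_def abs_mult mult.commute[of "\<bar>f y\<bar>"] by (intro mult_right_mono) auto
  qed
 qed (use f in simp, intro borel_measurable_times fm Im)
 have "(SI y. f y*?I (\<lambda>i. e i + ka) y) = (SI y. f y*?I e y + ka*f y)"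
 proof (rule integral_cong_AE)
  show "(\<lambda>y. f y*?I (\<lambda>i. e i + ka) y) \<in> borel_measurable sph" by (intro borel_measurable_times fm Im)
  show "(\<lambda>y. f y*?I e y + ka*f y) \<in> borel_measurable sph" by (intro borel_measurable_add borel_measurable_times fm Im borel_measurable_const)
  show "AE y in sph. f y*?I (\<lambda>i. e i + ka) y = f y*?I e y + ka*f y"
   using AE_vcell
  proof eventually_elim
   fix y assume "\<exists>!i. i \<in> {1..N} \<and> y \<in> V i"
   then obtain j where j: "j \<in> {1..N}" "y \<in> V j" by blast
   have "(\<Sum>i\<in>{1..N}. g i*indicator (V i) y) = g j" for g :: "nat => real"
   proof -
    have "(\<Sum>i\<in>{1..N}. g i*indicator (V i) y) = (\<Sum>i\<in>{j}. g i*indicator (V i) y)"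
    proof (intro sum.mono_neutral_right ballI)
     fix i assume "i \<in> {1..N} - {j}"
     hence "y \<notin> V i" using vcell_disjoint[of i j y] j by blast
     thus "g i*indicator (V i) y = 0" by simp
    qed (use j in auto)
    thus ?thesis using j(2) by simp
   qed
   note this[of "\<lambda>i. e i + ka"] this[of e]
   thus "f y*?I (\<lambda>i. e i + ka) y = f y*?I e y + ka*f y" by (simp only: distrib_left mult.commute)
  qed
 qed
 also have "... = (SI y. f y*?I e y) + (SI y. ka*f y)"
  by (rule Bochner_Integration.integral_add[OF fI]) (use f in simp)
 also have "(SI y. ka*f y) = 0" using f by simp
 finally have "(SI y. f y*?I e y) = (SI y. f y*I_h N x v y)" unfolding II by simp
 also have "... = A_h N x uh v" using fv v(1) unfolding fv_solution_def by simp
 also have "... = (1/2)*(\<Sum>i\<in>{1..N}. \<Sum>j\<in>{1..N}-{i}. me i j/ed i j*(uh (x i) - uh (x j))*(e i - e j))"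
  unfolding A_h_sym using v(2) by (intro arg_cong2[where f="(*)"] refl sum.cong) auto
 finally show ?thesis .
qed

text \<open>The divergence theorem is available for \<open>mol n u\<close> and
  \<open>mol n f\<close>, whereas the scheme contains \<open>f\<close> itself. The defect
  \<open>de n\<close> is a sum over the finitely many cells and tends to 0. No rate in
  \<open>h\<close> is claimed for it, as the limit is taken with the mesh fixed.\<close>

lemma energy_limit:
 assumes sol: "weak_solution f u" and f: "in_Lp 2 f" "(SI y. f y) = 0" and fv: "fv_solution N x f uh"
  and rd: "rot_data u a b M Q" and M: "0 <= M" and et: "et > 0"
 shows "eventually (\<lambda>n. energy (\<lambda>i. mol n u (x i) - uh (x i)) <= residual_const C\<^sub>1/2*(if h <= 1/2 then h^2*(2304*Q^2) else M^2) + et) sequentially"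
proof -
 have fi: "integrable sph f" by (rule Lp_norm_2(4)[OF f(1)])
 have ra: "has_weak_rot u a" using rd by (simp add: rot_data_def)
 define e where "e n i = mol n u (x i) - uh (x i)" for n i
 let ?I = "\<lambda>e y. (\<Sum>i\<in>{1..N}. e i*indicator (V i) y)"
 define d where "d n i = (SI y. mol n f y*indicator (V i) y) - (SI y. f y*indicator (V i) y)" for n i
 define de where "de n = (\<Sum>i\<in>{1..N}. e n i*d n i)" for n
 have ci: "integrable sph (\<lambda>y. g y*indicator (V i) y)" if i: "i \<in> {1..N}" and "integrable sph g" for i and g :: "real^3 => real"
  using integrable_mult_indicator[OF vcell_sets[OF i] that(2)] by (simp add: mult.commute)
 have gI: "(SI y. g y*?I e y) = (\<Sum>i\<in>{1..N}. e i*(SI y. g y*indicator (V i) y))" if g: "integrable sph g" for g :: "real^3 => real" and e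
 proof -
  have "(SI y. g y*?I e y) = (SI y. (\<Sum>i\<in>{1..N}. e i*(g y*indicator (V i) y)))"
   by (intro Bochner_Integration.integral_cong refl) (simp only: sum_distrib_left mult.left_commute)
  also have "... = (\<Sum>i\<in>{1..N}. SI y. e i*(g y*indicator (V i) y))"
   by (intro Bochner_Integration.integral_sum integrable_mult_right ci g)
  finally show ?thesis by simp
 qed
 have mi: "integrable sph (mol n f)" for n by (rule continuous_S2_integrable[OF mol_continuous[OF fi]])
 have bound: "energy (e n) <= 2*de n + residual_const C\<^sub>1/2*(if h <= 1/2 then h^2*(2304*Q^2) else M^2)" for n
 proof -
  let ?u = "mol n u" and ?l = "molv n a" and ?q = "rot_size (molv n a) (\<lambda>k. molv n (b k))"
  let ?F = "\<lambda>y. - cross3 y (?l y)"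
  have sm: "rot_smooth ?u ?l (\<lambda>k. molv n (b k))" by (rule mol_rot_smooth[OF rd])
  have cF: "continuous_on A ?F" for A by (intro continuous_intros continuous_on_cross rot_smooth_cont(1)[OF sm])
  have "(SI y. mol n f y*?I (e n) y)
   = (1/2)*(\<Sum>i\<in>{1..N}. \<Sum>j\<in>{1..N}-{i}. (e n i - e n j)*(integral (eE i j) (\<lambda>th. ?F (ez i j th) \<bullet> (x i - x j))/ed i j))"
   by (rule voronoi_gauss[OF borel_measurable_continuous_onI[OF cF] cF mi weak_solution_flux[OF sol f ra]])
  also have "... = (1/2)*(\<Sum>i\<in>{1..N}. \<Sum>j\<in>{1..N}-{i}. (e n i - e n j)*res ?u ?l i j + me i j/ed i j*(?u (x i) - ?u (x j))*(e n i - e n j))"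
   by (intro arg_cong2[where f="(*)"] refl sum.cong) (simp add: res_def right_diff_distrib mult_ac)
  finally have 1: "(SI y. mol n f y*?I (e n) y) = ..." .
  have "de n = (SI y. mol n f y*?I (e n) y) - (SI y. f y*?I (e n) y)"
   unfolding gI[OF mi] gI[OF fi] de_def d_def by (simp add: right_diff_distrib sum_subtractf)
  also have "... = (1/2)*(\<Sum>i\<in>{1..N}. \<Sum>j\<in>{1..N}-{i}. (e n i - e n j)*res ?u ?l i j + me i j/ed i j*(?u (x i) - ?u (x j))*(e n i - e n j)
    - me i j/ed i j*(uh (x i) - uh (x j))*(e n i - e n j))"
   unfolding 1 fv_equation[OF fv fi f(2)] by (simp only: right_diff_distrib[symmetric] sum_subtractf[symmetric])
  also have "... = (1/2)*(\<Sum>i\<in>{1..N}. \<Sum>j\<in>{1..N}-{i}. (e n i - e n j)*res ?u ?l i j + me i j/ed i j*(e n i - e n j)^2)"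
  proof (intro arg_cong2[where f="(*)"] refl sum.cong)
   fix i j
   have id: "p + w*U*D - w*W*D = p + w*D^2" if "D = U - W" for p w U W D :: real
    unfolding that by (simp add: power2_eq_square algebra_simps)
   show "(e n i - e n j)*res ?u ?l i j + me i j/ed i j*(?u (x i) - ?u (x j))*(e n i - e n j) - me i j/ed i j*(uh (x i) - uh (x j))*(e n i - e n j)
    = (e n i - e n j)*res ?u ?l i j + me i j/ed i j*(e n i - e n j)^2" by (rule id) (simp add: e_def)
  qed
  finally have E: "energy (e n) = de n - (1/2)*(\<Sum>i\<in>{1..N}. \<Sum>j\<in>{1..N}-{i}. (e n i - e n j)*res ?u ?l i j)"
   unfolding energy_def sum.distrib distrib_left by simp
  obtain G where G: "\<forall>i\<in>{1..N}. \<forall>j\<in>{1..N}-{i}. 0 <= G i j \<and> (res ?u ?l i j)^2 <= me i j/ed i j*G i j"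
   "(\<Sum>i\<in>{1..N}. \<Sum>j\<in>{1..N}-{i}. G i j) <= residual_const C\<^sub>1*(if h <= 1/2 then h^2*(SI y. (?q y)^2) else M^2)"
   using residual_sum[OF sm mol_rot_size(1)[OF rd M] mol_rot_size(2)[OF rd M]] by blast
  have "energy (e n) <= 2*de n + (1/2)*(\<Sum>i\<in>{1..N}. \<Sum>j\<in>{1..N}-{i}. G i j)"
   by (rule energy_residual[OF _ E]) (use G in blast)
  also have "... <= 2*de n + (1/2)*(residual_const C\<^sub>1*(if h <= 1/2 then h^2*(2304*Q^2) else M^2))"
  proof (intro add_left_mono mult_left_mono order_trans[OF G(2)])
   show "(if h <= 1/2 then h^2*(SI y. (?q y)^2) else M^2) <= (if h <= 1/2 then h^2*(2304*Q^2) else M^2)"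
    using mol_rot_size(4)[OF rd M] by (auto intro: mult_left_mono)
  qed (simp_all add: residual_const_def)
  finally show ?thesis by simp
 qed
 have "de \<longlonglongrightarrow> 0"
 proof (rule Lim_null_comparison)
  have eb: "\<bar>e n i\<bar> <= M + \<bar>uh (x i)\<bar>" if "i \<in> {1..N}" for n i
   using mol_rot_size(1)[OF rd M x_S2[OF that], of n] by (simp add: e_def)
  show "eventually (\<lambda>n. norm (de n) <= (\<Sum>i\<in>{1..N}. (M + \<bar>uh (x i)\<bar>)*\<bar>d n i\<bar>)) sequentially"
  proof (intro always_eventually allI)
   fix n
   have "\<bar>de n\<bar> <= (\<Sum>i\<in>{1..N}. \<bar>e n i*d n i\<bar>)" unfolding de_def by (rule sum_abs)
   also have "... <= (\<Sum>i\<in>{1..N}. (M + \<bar>uh (x i)\<bar>)*\<bar>d n i\<bar>)"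
    unfolding abs_mult by (intro sum_mono mult_right_mono eb) auto
   finally show "norm (de n) <= (\<Sum>i\<in>{1..N}. (M + \<bar>uh (x i)\<bar>)*\<bar>d n i\<bar>)" by simp
  qed
  have "(\<lambda>n. d n i) \<longlonglongrightarrow> 0" if "i \<in> {1..N}" for i
   unfolding d_def using mol_vcell_tendsto[OF that fi] by (rule LIM_zero)
  hence "(\<lambda>n. \<Sum>i\<in>{1..N}. (M + \<bar>uh (x i)\<bar>)*\<bar>d n i\<bar>) \<longlonglongrightarrow> (\<Sum>i\<in>{1..N}. (M + \<bar>uh (x i)\<bar>)*\<bar>0\<bar>)"
   by (intro tendsto_sum tendsto_mult tendsto_const tendsto_rabs) auto
  thus "(\<lambda>n. \<Sum>i\<in>{1..N}. (M + \<bar>uh (x i)\<bar>)*\<bar>d n i\<bar>) \<longlonglongrightarrow> 0" by simp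
 qed
 hence "eventually (\<lambda>n. de n < et/2) sequentially" using et by (intro order_tendstoD(2)) auto
 thus ?thesis
 proof eventually_elim
  case (elim n)
  thus ?case using bound[of n] unfolding e_def by linarith
 qed
qed

end

section \<open>The logarithmic Green function\<close>

lemma cross_cross_trace: "(\<Sum>k\<in>UNIV. cross3 y (cross3 z (axis k 1)) $ k) = - 2*(y \<bullet> (z :: real^3))"
 by (simp add: cross3_def inner_vec_def sum_3 axis_def algebra_simps)

text \<open>The field is the tangential gradient of \<open>ln (1 + ep - y . z)\<close>, up to a
  factor a regularised Green function with pole \<open>z\<close>; the term with \<open>ep\<close> is
  its smoothed point mass. For the proof, \<open>c k\<close> is minus the \<open>k\<close>-th
  component of \<open>cross3 y z\<close> over \<open>w\<close>: the \<open>k\<close>-th component of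
  the rotation derivative of \<open>c k y * ps y\<close> has integral 0, and the sum over
  \<open>k\<close> is the difference of the two integrands.\<close>

lemma log_green:
 assumes z: "z \<in> S2" and eps: "ep > 0" and C: "C1_fun ps"
 shows "(SI y. ((1/(1 + ep - y \<bullet> z)) *R cross3 y (cross3 y z)) \<bullet> grad ps y)
  = (SI y. (1 - ep*(2 + ep)/(1 + ep - y \<bullet> z)^2)*ps y)"
proof -
 define w where "w y = 1 + ep - y \<bullet> z" for y :: "real^3"
 have w: "w y > 0" if "y \<in> S2" for y using inner_S2_le[OF that z] eps by (simp add: w_def abs_le_iff)
 have cw: "continuous_on S2 w" unfolding w_def by (intro continuous_intros)
 define c where "c k y = - (1/w y)*(y \<bullet> cross3 z (axis k 1))" for k :: 3 and y
 define G where "G k y = - ((y \<bullet> cross3 z (axis k 1))/(w y)^2) *R z - (1/w y) *R cross3 z (axis k 1)" for k :: 3 and y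
 have cC: "sph_C1 (c k) (G k)" for k
  unfolding sph_C1_def
 proof (intro conjI ballI)
  fix y :: "real^3" assume y: "y \<in> S2"
  have wn: "w y ~= 0" using w[OF y] by simp
  have dw: "(w has_derivative (\<lambda>h. - (h \<bullet> z))) (at y)" unfolding w_def by (auto intro!: derivative_eq_intros)
  have "((\<lambda>y. - inverse (w y)*(y \<bullet> cross3 z (axis k 1))) has_derivative
   (\<lambda>h. - inverse (w y)*(h \<bullet> cross3 z (axis k 1)) + (- (- (inverse (w y)*(- (h \<bullet> z))*inverse (w y))))*(y \<bullet> cross3 z (axis k 1)))) (at y)"
   by (intro has_derivative_mult has_derivative_minus Deriv.has_derivative_inverse[OF wn dw] has_derivative_inner_left has_derivative_ident)
  moreover have "(\<lambda>y. - inverse (w y)*(y \<bullet> cross3 z (axis k 1))) = c k" by (simp add: c_def fun_eq_iff divide_inverse)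
  moreover have "(\<lambda>h. - inverse (w y)*(h \<bullet> cross3 z (axis k 1)) + (- (- (inverse (w y)*(- (h \<bullet> z))*inverse (w y))))*(y \<bullet> cross3 z (axis k 1))) = (\<lambda>h. G k y \<bullet> h)"
   using wn by (simp add: G_def fun_eq_iff inner_diff_left inner_commute divide_inverse power2_eq_square algebra_simps)
  ultimately show "(c k has_derivative (\<lambda>h. G k y \<bullet> h)) (at y)" by simp
 next
  show "continuous_on S2 (G k)" unfolding G_def using w by (intro continuous_intros cw) (auto simp: less_imp_neq[symmetric])
 qed
 have cont: "continuous_on S2 (\<lambda>y. cross3 y (c k y *R grad ps y + ps y *R G k y))" for k
  using cC[of k] sph_C1_continuous[OF cC[of k]]
  by (intro continuous_on_cross continuous_intros C1_fun_cont[OF C]) (auto simp: sph_C1_def)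
 have z0: "(SI y. cross3 y (c k y *R grad ps y + ps y *R G k y) $ k) = 0" for k
  using integral_cross_grad[OF sph_C1_mult[OF cC[of k] C1_fun_sph_C1[OF C]]]
   integral_bounded_linear[OF bounded_linear_vec_nth continuous_S2_integrable[OF cont[of k]], of k] by simp
 let ?F = "\<lambda>y. (1/w y) *R cross3 y (cross3 y z)" and ?H = "\<lambda>y. 1 - ep*(2 + ep)/(w y)^2"
 have pt: "(\<Sum>k\<in>UNIV. cross3 y (c k y *R grad ps y + ps y *R G k y) $ k) = ?F y \<bullet> grad ps y - ?H y*ps y" if y: "y \<in> S2" for y
 proof -
  let ?s = "y \<bullet> z"
  have wy: "w y > 0" by (rule w[OF y])
  have yy: "y \<bullet> y = 1" "z \<bullet> z = 1" using y z inner_S2_self by auto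
  have e: "y \<bullet> cross3 z (axis k 1) = cross3 y z $ k" for k
   by (simp add: cross3_def inner_vec_def sum_3 axis_def) (metis (full_types) exhaust_3 vector_3)
  have "(\<Sum>k\<in>UNIV. cross3 y (c k y *R grad ps y) $ k) = - (1/w y)*(\<Sum>k\<in>UNIV. cross3 y z $ k*cross3 y (grad ps y) $ k)"
   unfolding c_def e by (simp add: cross_mult_right sum_distrib_left mult_ac)
  also have "... = - (1/w y)*(cross3 y z \<bullet> cross3 y (grad ps y))" by (simp add: inner_vec_def)
  also have "cross3 y z \<bullet> cross3 y (grad ps y) = - (cross3 y (cross3 y z) \<bullet> grad ps y)"
   by (simp add: cross3_def inner_vec_def sum_3 algebra_simps)
  finally have 1: "(\<Sum>k\<in>UNIV. cross3 y (c k y *R grad ps y) $ k) = ?F y \<bullet> grad ps y" by simp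
  have "(\<Sum>k\<in>UNIV. cross3 y (G k y) $ k) = (\<Sum>k\<in>UNIV. - (cross3 y z $ k*cross3 y z $ k)/(w y)^2 - (1/w y)*cross3 y (cross3 z (axis k 1)) $ k)"
   unfolding G_def e by (intro sum.cong refl) (simp add: Cross3.right_diff_distrib cross_mult_right cross_minus_right)
  also have "... = - (\<Sum>k\<in>UNIV. cross3 y z $ k*cross3 y z $ k)/(w y)^2 - (1/w y)*(\<Sum>k\<in>UNIV. cross3 y (cross3 z (axis k 1)) $ k)"
   by (simp add: sum_subtractf sum_distrib_left sum_negf sum_divide_distrib)
  also have "(\<Sum>k\<in>UNIV. cross3 y z $ k*cross3 y z $ k) = 1 - ?s^2"
  proof -
   have "cross3 y z \<bullet> cross3 y z = 1 - ?s^2" unfolding cross3_inner yy inner_commute[of z y] by (simp add: power2_eq_square)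
   thus ?thesis by (simp add: inner_vec_def)
  qed
  also have "(\<Sum>k\<in>UNIV. cross3 y (cross3 z (axis k 1)) $ k) = - 2*?s" by (rule cross_cross_trace)
  also have "- (1 - ?s^2)/(w y)^2 - (1/w y)*(- 2*?s) = (- (1 - ?s^2) + 2*?s * w y)/(w y)^2"
   using wy by (simp add: field_simps power2_eq_square)
  also have "- (1 - ?s^2) + 2*?s * w y = ep*(2 + ep) - (w y)^2" unfolding w_def by (simp add: power2_eq_square algebra_simps)
  also have "(ep*(2 + ep) - (w y)^2)/(w y)^2 = - ?H y" using wy by (simp add: diff_divide_distrib)
  finally have 2: "(\<Sum>k\<in>UNIV. cross3 y (G k y) $ k) = - ?H y" .
  have "(\<Sum>k\<in>UNIV. cross3 y (c k y *R grad ps y + ps y *R G k y) $ k)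
   = (\<Sum>k\<in>UNIV. cross3 y (c k y *R grad ps y) $ k) + ps y*(\<Sum>k\<in>UNIV. cross3 y (G k y) $ k)"
   by (simp add: cross_add_right cross_mult_right sum.distrib sum_distrib_left)
  thus ?thesis unfolding 1 2 by (simp only: mult_minus_right add_uminus_conv_diff mult.commute[of "ps y"])
 qed
 have Fi: "integrable sph (\<lambda>y. ?F y \<bullet> grad ps y)" "integrable sph (\<lambda>y. ?H y*ps y)"
  using w by (intro continuous_S2_integrable continuous_intros cw continuous_on_cross C1_fun_cont[OF C]; force)+
 have "0 = (\<Sum>k\<in>UNIV. SI y. cross3 y (c k y *R grad ps y + ps y *R G k y) $ k)" unfolding z0 by simp
 also have "... = (SI y. (\<Sum>k\<in>UNIV. cross3 y (c k y *R grad ps y + ps y *R G k y) $ k))"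
  by (intro Bochner_Integration.integral_sum[symmetric] continuous_S2_integrable continuous_on_component cont)
 also have "... = (SI y. ?F y \<bullet> grad ps y - ?H y*ps y)"
  using pt by (intro Bochner_Integration.integral_cong refl) auto
 also have "... = (SI y. ?F y \<bullet> grad ps y) - (SI y. ?H y*ps y)" by (rule Bochner_Integration.integral_diff[OF Fi])
 finally show ?thesis unfolding w_def by simp
qed

text \<open>With \<open>s = y . z\<close>, the cross product of \<open>y\<close> and
  \<open>z\<close> has square \<open>(1 - s)*(1 + s)\<close> and the distance has square
  \<open>2*(1 - s)\<close>. Their product is at most the square of \<open>2*(1 - s)\<close>, and
  \<open>1 - s\<close> is below the denominator.\<close>

lemma green_field_bound:
 assumes y: "y \<in> S2" and z: "z \<in> S2" and eps: "ep > 0"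
 shows "norm ((1/(1 + ep - y \<bullet> z)) *R cross3 y (cross3 y z))*norm (y - z) <= 2"
proof -
 let ?s = "y \<bullet> z"
 have s: "?s <= 1" "-1 <= ?s" using inner_S2_le[OF y z] by (auto simp: abs_le_iff)
 have n: "norm (cross3 y (cross3 y z)) <= norm (cross3 y z)" using norm_cross3_le[of y "cross3 y z"] y by simp
 have "(norm (cross3 y z))^2 = (1 - ?s)*(1 + ?s)"
  unfolding power2_norm_eq_inner cross3_inner using inner_S2_self[OF y] inner_S2_self[OF z] by (simp add: inner_commute algebra_simps)
 hence "(norm (cross3 y z)*norm (y - z))^2 = (1 - ?s)*(1 + ?s)*(2*(1 - ?s))"
  unfolding power_mult_distrib norm_diff_S2[OF y z] by simp
 also have "... <= (1 - ?s)*2*(2*(1 - ?s))" using s by (intro mult_right_mono mult_left_mono) auto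
 also have "... = (2*(1 - ?s))^2" by (simp add: power2_eq_square)
 finally have a: "norm (cross3 y z)*norm (y - z) <= 2*(1 - ?s)" by (rule power2_le_imp_le) (use s in simp)
 have w: "1 + ep - ?s > 0" using s eps by simp
 have "norm (cross3 y (cross3 y z))*norm (y - z) <= norm (cross3 y z)*norm (y - z)" using n by (intro mult_right_mono) auto
 also have "... <= 2*(1 + ep - ?s)" using a eps by simp
 finally show ?thesis using w by (simp add: field_simps)
qed

section \<open>The discrete Sobolev inequality\<close>

context vmesh
begin

text \<open>A point of an edge has two nearest vertices, a point of an open cell only one. This
  makes the integrands \<open>1/norm (ez i j th - z)\<close> continuous along the edges.\<close>

lemma edge_point_ne:
 assumes ij: "i \<in> {1..N}" "j \<in> {1..N}" "i ~= j" and th: "th \<in> eE i j" and p: "p \<in> {1..N}" and z: "z \<in> V p"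
 shows "ez i j th ~= z"
proof
 assume eq: "ez i j th = z"
 have "ez i j th \<in> ccell i" "ez i j th \<in> ccell j" using th ccell_inter[OF ij] by auto
 hence "z \<bullet> x p <= z \<bullet> x i" "z \<bullet> x p <= z \<bullet> x j" using eq p by (auto simp: ccell_def)
 hence "i = p" "j = p" using z ij unfolding vcell_eq[OF p] by (auto simp: not_less[symmetric])
 thus False using ij by simp
qed

text \<open>Pair the step function with the regularised Green field. Near \<open>z\<close> the step
  function is constantly \<open>e p\<close>, and away from \<open>z\<close> the smoothed point mass
  is of order \<open>ep\<close>, so that up to a term \<open>ep*K\<close> the left side is the flux
  sum of \<open>voronoi_gauss\<close>. The factor \<open>1/2\<close> there cancels the 2 of
  \<open>green_field_bound\<close>.\<close>

lemma thomson_pointwise: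
 assumes p: "p \<in> {1..N}" and z: "z \<in> V p"
 shows "\<bar>(SI y. (\<Sum>i\<in>{1..N}. e i*indicator (V i) y)) - measure sph S2*e p\<bar>
  <= (\<Sum>i\<in>{1..N}. \<Sum>j\<in>{1..N}-{i}. \<bar>e i - e j\<bar>*integral (eE i j) (\<lambda>th. 1/norm (ez i j th - z)))"
proof -
 let ?L = "\<lambda>i j. integral (eE i j) (\<lambda>th. 1/norm (ez i j th - z))"
 let ?I = "\<lambda>y. \<Sum>i\<in>{1..N}. e i*indicator (V i) y"
 let ?R = "\<Sum>i\<in>{1..N}. \<Sum>j\<in>{1..N}-{i}. \<bar>e i - e j\<bar>*?L i j"
 let ?S = "measure sph S2"
 have zS: "z \<in> S2" using z by (simp add: vcell_def)
 obtain U where U: "open U" "V p = S2 \<inter> U" using vcell_open[OF p] by blast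
 obtain r where r: "r > 0" "ball z r \<subseteq> U" using U z openE by blast
 define B where "B = \<bar>e p\<bar> + (\<Sum>i\<in>{1..N}. \<bar>e i\<bar>)"
 have Im: "?I \<in> borel_measurable sph"
  by (intro borel_measurable_sum borel_measurable_times borel_measurable_const borel_measurable_sphereI borel_measurable_indicator vcell_borel)
 have Ib: "\<bar>?I y\<bar> <= (\<Sum>i\<in>{1..N}. \<bar>e i\<bar>)" for y
 proof -
  have "\<bar>?I y\<bar> <= (\<Sum>i\<in>{1..N}. \<bar>e i*indicator (V i) y\<bar>)" by (rule sum_abs)
  also have "... <= (\<Sum>i\<in>{1..N}. \<bar>e i\<bar>)" by (intro sum_mono) (simp add: indicator_def)
  finally show ?thesis .
 qed
 have Ii: "integrable sph ?I" by (rule bounded_sphere_integrable[OF Im Ib])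
 have Ip: "?I y = e p" if "y \<in> V p" for y
 proof -
  have "?I y = (\<Sum>i\<in>{p}. e i*indicator (V i) y)"
  proof (intro sum.mono_neutral_right ballI)
   fix i assume "i \<in> {1..N} - {p}"
   hence "y \<notin> V i" using vcell_disjoint[of i p y] p that by blast
   thus "e i*indicator (V i) y = 0" by simp
  qed (use p in auto)
  thus ?thesis using that by simp
 qed
 define K where "K = 12*(2/r^2)^2*B*?S"
 have K0: "0 <= K" unfolding K_def B_def by (intro mult_nonneg_nonneg add_nonneg_nonneg sum_nonneg) auto
 have main: "\<bar>(SI y. ?I y) - ?S*e p\<bar> <= ?R + ep*K" if eps: "0 < ep" "ep <= 1" for ep
 proof -
  define w where "w y = 1 + ep - y \<bullet> z" for y :: "real^3"
  have w: "w y > 0" if "y \<in> S2" for y using inner_S2_le[OF that zS] eps by (simp add: w_def abs_le_iff)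
  have cw: "continuous_on A w" for A unfolding w_def by (intro continuous_intros)
  let ?F = "\<lambda>y. (1/w y) *R cross3 y (cross3 y z)"
  let ?f = "\<lambda>i j. integral (eE i j) (\<lambda>th. ?F (ez i j th) \<bullet> (x i - x j))"
  let ?k = "\<lambda>y. ep*(2 + ep)/(w y)^2"
  have ck: "continuous_on S2 ?k" using w by (intro continuous_intros cw) force
  have ki: "integrable sph ?k" by (rule continuous_S2_integrable[OF ck])
  have Fm: "?F \<in> borel_measurable borel"
   by (intro borel_measurable_scaleR borel_measurable_divide borel_measurable_const borel_measurable_continuous_onI cw continuous_on_cross continuous_intros)
  have Fc: "continuous_on S2 ?F" using w by (intro continuous_intros cw continuous_on_cross) force
  have Hi: "integrable sph (\<lambda>y. 1 - ?k y)" using ki by (intro Bochner_Integration.integrable_diff) auto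
  have parts: "(SI y. ?F y \<bullet> grad ps y) = (SI y. (1 - ?k y)*ps y)" if "C1_fun ps" for ps
   unfolding w_def by (rule log_green[OF zS eps(1) that])
  \<comment> \<open>The test function 1 yields the total mass of the smoothed point mass without
    computing an integral.\<close>
  have "(SI y. (1 - ?k y)*1) = 0" using parts[OF C1_fun_const(1), of 1] by (simp add: C1_fun_const(2))
  hence k1: "(SI y. ?k y) = ?S"
   using ki by (subst (asm) mult_1_right, subst (asm) Bochner_Integration.integral_diff) auto
  have vg: "(SI y. (1 - ?k y)*?I y)
  = (1/2)*(\<Sum>i\<in>{1..N}. \<Sum>j\<in>{1..N}-{i}. (e i - e j)*(?f i j/ed i j))"
   by (rule voronoi_gauss[OF Fm Fc Hi parts])
  have kI: "integrable sph (\<lambda>y. ?k y*?I y)"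
  proof (rule Bochner_Integration.integrable_bound[where f="\<lambda>y. (\<Sum>i\<in>{1..N}. \<bar>e i\<bar>)*?k y"])
   show "AE y in sph. norm (?k y*?I y) <= norm ((\<Sum>i\<in>{1..N}. \<bar>e i\<bar>)*?k y)"
   proof (intro AE_I2)
    fix y
    have "\<bar>?I y\<bar> <= \<bar>\<Sum>i\<in>{1..N}. \<bar>e i\<bar>\<bar>" using Ib[of y] by linarith
    thus "norm (?k y*?I y) <= norm ((\<Sum>i\<in>{1..N}. \<bar>e i\<bar>)*?k y)"
     unfolding real_norm_def abs_mult mult.commute[of "\<bar>?k y\<bar>"] by (intro mult_right_mono) auto
   qed
   show "integrable sph (\<lambda>y. (\<Sum>i\<in>{1..N}. \<bar>e i\<bar>)*?k y)" by (intro integrable_mult_right ki)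
   show "(\<lambda>y. ?k y*?I y) \<in> borel_measurable sph" by (intro borel_measurable_times Im borel_measurable_sphere_cont ck)
  qed
  have "(SI y. (1 - ?k y)*?I y) = (SI y. ?I y - ?k y*?I y)" by (simp only: left_diff_distrib mult_1)
  also have "... = (SI y. ?I y) - (SI y. ?k y*?I y)" by (rule Bochner_Integration.integral_diff[OF Ii kI])
  finally have l: "(SI y. ?I y) - (SI y. ?k y*?I y) = (SI y. (1 - ?k y)*?I y)" by simp
  have "(SI y. ?k y*(?I y - e p)) = (SI y. ?k y*?I y - e p*?k y)" by (simp only: right_diff_distrib mult.commute)
  also have "... = (SI y. ?k y*?I y) - (SI y. e p*?k y)" by (rule Bochner_Integration.integral_diff[OF kI integrable_mult_right[OF ki]])
  also have "(SI y. e p*?k y) = e p*(SI y. ?k y)" by (rule integral_mult_right_zero)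
  finally have d: "(SI y. ?k y*(?I y - e p)) = (SI y. ?k y*?I y) - ?S*e p" unfolding k1 by (simp add: mult.commute)
  have db: "\<bar>(SI y. ?k y*(?I y - e p))\<bar> <= ep*K"
  proof -
   have "norm (SI y. ?k y*(?I y - e p)) <= (SI y. ep*3*(2/r^2)^2*B)"
   proof (rule Bochner_Integration.integral_norm_bound_integral)
    show "integrable sph (\<lambda>y. ?k y*(?I y - e p))"
     using Bochner_Integration.integrable_diff[OF kI integrable_mult_right[OF ki, of "e p"]] by (simp only: right_diff_distrib mult.commute)
    show "integrable sph (\<lambda>y. ep*3*(2/r^2)^2*B)" by simp
    fix y assume "y \<in> space sph"
    hence y: "y \<in> S2" by simp
    have B0: "0 <= B" unfolding B_def by (intro add_nonneg_nonneg sum_nonneg) auto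
    show "norm (?k y*(?I y - e p)) <= ep*3*(2/r^2)^2*B"
    proof (cases "y \<in> V p")
     case True
     thus ?thesis using Ip[OF True] eps B0 by simp
    next
     case False
     hence "y \<notin> ball z r" using U r y by blast
     hence "\<not> norm (y - z) < r" by (simp add: dist_norm norm_minus_commute)
     hence "r^2 <= (norm (y - z))^2" using r by (intro power_mono) auto
     hence "r^2/2 <= w y" unfolding norm_diff_S2[OF y zS] w_def using eps by simp
     hence "1/w y <= 1/(r^2/2)" using r w[OF y] by (intro divide_left_mono) (auto intro!: mult_pos_pos)
     hence wb: "1/w y <= 2/r^2" by simp
     have "\<bar>?I y - e p\<bar> <= B" using Ib[of y] unfolding B_def by linarith
     moreover have "?k y = ep*(2 + ep)*(1/w y)^2" by (simp add: power_divide)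
     moreover have "ep*(2 + ep)*(1/w y)^2 <= ep*3*(2/r^2)^2"
      using eps w[OF y] wb by (intro mult_mono power_mono) auto
     ultimately have "\<bar>?k y\<bar>*\<bar>?I y - e p\<bar> <= (ep*3*(2/r^2)^2)*B"
      using eps by (intro mult_mono) auto
     thus ?thesis by (simp only: real_norm_def abs_mult)
    qed
   qed
   also have "... = ep*3*(2/r^2)^2*B*?S" by simp
   also have "... <= ep*K" unfolding K_def using eps B_def by (simp add: mult_ac sum_nonneg mult_left_mono mult_right_mono)
   finally show ?thesis by simp
  qed
  have "\<bar>\<Sum>i\<in>{1..N}. \<Sum>j\<in>{1..N}-{i}. (e i - e j)*(?f i j/ed i j)\<bar>
   <= (\<Sum>i\<in>{1..N}. \<bar>\<Sum>j\<in>{1..N}-{i}. (e i - e j)*(?f i j/ed i j)\<bar>)" by (rule sum_abs)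
  also have "... <= (\<Sum>i\<in>{1..N}. \<Sum>j\<in>{1..N}-{i}. \<bar>(e i - e j)*(?f i j/ed i j)\<bar>)"
   by (intro sum_mono sum_abs)
  also have "... <= (\<Sum>i\<in>{1..N}. \<Sum>j\<in>{1..N}-{i}. 2*(\<bar>e i - e j\<bar>*?L i j))"
  proof (intro sum_mono)
   fix i j assume ij': "i \<in> {1..N}" "j \<in> {1..N}-{i}"
   hence ij: "i \<in> {1..N}" "j \<in> {1..N}" "i ~= j" by auto
   have d: "ed i j > 0" by (rule ed_pos[OF ij])
   have ne: "ez i j th ~= z" "ez i j th \<in> S2" if "th \<in> eE i j" for th
    using edge_point_ne[OF ij that p z] ccell_S2 that by (auto simp: eE_def)
   have c1: "continuous_on (eE i j) (\<lambda>th. 2*ed i j*(1/norm (ez i j th - z)))"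
    using ne by (intro continuous_intros ez_cont) auto
   have c2: "(\<lambda>th. ?F (ez i j th) \<bullet> (x i - x j)) integrable_on (eE i j)"
    by (rule edge_integral_cont(2)[OF ij]) (intro continuous_intros Fc)
   obtain al be where E: "eE i j = {al..be}" using eE_interval[OF ij] by blast
   have "norm (?f i j) <= integral (eE i j) (\<lambda>th. 2*ed i j*(1/norm (ez i j th - z)))"
   proof (rule integral_norm_bound_integral[OF c2])
    show "(\<lambda>th. 2*ed i j*(1/norm (ez i j th - z))) integrable_on eE i j" using c1 unfolding E by (rule integrable_continuous_real)
    fix th assume th: "th \<in> eE i j"
    have n: "norm (ez i j th - z) > 0" using ne(1)[OF th] by simp
    have "norm (?F (ez i j th))*norm (ez i j th - z) <= 2" unfolding w_def by (rule green_field_bound[OF ne(2)[OF th] zS eps(1)])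
    hence "norm (?F (ez i j th)) <= 2*(1/norm (ez i j th - z))" using n by (simp add: field_simps)
    hence "norm (?F (ez i j th))*ed i j <= 2*(1/norm (ez i j th - z))*ed i j" using d by (intro mult_right_mono) auto
    moreover have "\<bar>?F (ez i j th) \<bullet> (x i - x j)\<bar> <= norm (?F (ez i j th))*ed i j"
     using Cauchy_Schwarz_ineq2[of "?F (ez i j th)" "x i - x j"] by (simp only: ed_def norm_minus_commute)
    ultimately show "norm (?F (ez i j th) \<bullet> (x i - x j)) <= 2*ed i j*(1/norm (ez i j th - z))"
     unfolding real_norm_def by (simp only: mult_ac)
   qed
   also have "... = 2*ed i j*?L i j" by (rule Henstock_Kurzweil_Integration.integral_mult_right)
   finally have "\<bar>?f i j/ed i j\<bar> <= 2*?L i j"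
    using d by (simp add: field_simps)
   thus "\<bar>(e i - e j)*(?f i j/ed i j)\<bar> <= 2*(\<bar>e i - e j\<bar>*?L i j)"
    unfolding abs_mult[of "e i - e j"] using mult_left_mono[OF _ abs_ge_zero[of "e i - e j"]] by (simp only: mult.left_commute[of 2])
  qed
  also have "... = 2*?R" by (simp only: sum_distrib_left)
  finally have "\<bar>(SI y. (1 - ?k y)*?I y)\<bar> <= ?R" unfolding vg by simp
  thus ?thesis using l d db by linarith
 qed
 show ?thesis
 proof (rule field_le_epsilon)
  fix et :: real assume et: "et > 0"
  define ep where "ep = min 1 (et/(K + 1))"
  have "0 < ep" "ep <= 1" using et K0 by (auto simp: ep_def)
  from main[OF this] have "\<bar>(SI y. ?I y) - ?S*e p\<bar> <= ?R + ep*K" .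
  also have "ep*K <= et/(K + 1)*(K + 1)" using K0 et by (intro mult_mono) (auto simp: ep_def)
  also have "... = et" using K0 by simp
  finally show "\<bar>(SI y. ?I y) - ?S*e p\<bar> <= ?R + et" by simp
 qed
qed

end

section \<open>Averaging the pole over a cell\<close>

interpretation lborel_sphere: pair_sigma_finite "lborel :: real measure" sphere_measure ..

text \<open>On the shell between the radii \<open>R/2^Suc k\<close> and \<open>R/2^k\<close> the
  integrand is at most \<open>2^Suc k / R\<close>, and the cap has area at most
  \<open>24*(R/2^k)^2\<close>. The resulting series of \<open>48 * R*(1/2)^k\<close> has sum
  \<open>96 * R\<close>. At \<open>z = y\<close> the integrand is 0 by convention.\<close>

lemma nn_integral_inverse_dist:
 assumes y: "y \<in> S2" and R: "R > 0"
 shows "(NI z. ennreal (1/norm (y - z))*indicator (ball y R) z) <= ennreal (96 * R)"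
proof -
 let ?f = "\<lambda>k z. ennreal (2^Suc k / R)*indicator (ball y (R/2^k)) z"
 have [measurable]: "ball y (R/2^k) \<in> sets borel" for k by (rule borel_open) simp
 have pt: "ennreal (1/norm (y - z))*indicator (ball y R) z <= (\<Sum>k. ?f k z)" for z
 proof (cases "z \<in> ball y R \<and> z ~= y")
  case True
  let ?t = "norm (y - z)"
  have t: "0 < ?t" "?t < R" using True by (auto simp: dist_norm)
  obtain n where n: "(1/2)^n < ?t / R" using real_arch_pow_inv[of "?t / R" "1/2"] t R by auto
  have ex: "R/2^n <= ?t" using n R by (simp add: power_divide field_simps)
  define m where "m = (LEAST n. R/2^n <= ?t)"
  have m: "R/2^m <= ?t" unfolding m_def by (rule LeastI[of "\<lambda>n. R/2^n <= ?t", OF ex])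
  have "m ~= 0" using m t by (intro notI) simp
  then obtain k where k: "m = Suc k" using not0_implies_Suc by blast
  have "\<not> R/2^k <= ?t" using not_less_Least[of k "\<lambda>n. R/2^n <= ?t"] k unfolding m_def by simp
  hence "z \<in> ball y (R/2^k)" by (simp add: dist_norm)
  moreover have "1/?t <= 2^Suc k / R" using m t R unfolding k by (simp add: field_simps)
  ultimately have "ennreal (1/?t)*indicator (ball y R) z <= ?f k z" using True by (simp add: ennreal_leI)
  also have "... = sum (\<lambda>k. ?f k z) {k}" by (simp only: sum.insert sum.empty finite.emptyI empty_iff not_False_eq_True add_0_right)
  also have "... <= (\<Sum>k. ?f k z)" by (intro sum_le_suminf summableI) auto
  finally show ?thesis .
 qed auto
 have "(NI z. ennreal (1/norm (y - z))*indicator (ball y R) z) <= (NI z. (\<Sum>k. ?f k z))"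
  by (intro nn_integral_mono pt)
 also have "... = (\<Sum>k. NI z. ?f k z)" by (rule nn_integral_suminf) measurable
 also have "... <= (\<Sum>k. ennreal (48 * R*(1/2)^k))"
 proof (intro suminf_le summableI)
  fix k
  have "(NI z. ?f k z) = ennreal (2^Suc k / R)*emeasure sph (ball y (R/2^k) \<inter> S2)"
  proof -
   have "(NI z. ?f k z) = (NI z. ennreal (2^Suc k / R)*indicator (ball y (R/2^k) \<inter> S2) z)"
    by (intro nn_integral_cong) (auto simp: indicator_def)
   also have "... = ennreal (2^Suc k / R)*emeasure sph (ball y (R/2^k) \<inter> S2)"
    by (rule nn_integral_cmult_indicator) (intro sets_sphere_Int, simp)
   finally show ?thesis .
  qed
  also have "... <= ennreal (2^Suc k / R)*ennreal (24*(R/2^k)^2)"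
   using R by (intro mult_left_mono emeasure_cap_le y) auto
  also have "... = ennreal (2^Suc k / R*(24*(R/2^k)^2))" using R by (intro ennreal_mult[symmetric]) auto
  also have "2^Suc k / R*(24*(R/2^k)^2) = 48 * R*(1/2)^k" using R by (simp add: power2_eq_square power_divide)
  finally show "(NI z. ?f k z) <= ennreal (48 * R*(1/2)^k)" .
 qed
 also have "... = ennreal (48 * R*2)"
 proof (rule suminf_ennreal_eq)
  have "(\<lambda>k. 48 * R*(1/2)^k) sums (48 * R*(1/(1 - 1/2)))" by (intro sums_mult geometric_sums) simp
  thus "(\<lambda>k. 48 * R*(1/2)^k) sums (48 * R*2)" by simp
 qed (use R in simp)
 finally show ?thesis by simp
qed

lemma double_sum_ennreal:
 assumes nn: "\<And>i j. i \<in> A ==> j \<in> B i ==> 0 <= f i j"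
 shows "(\<Sum>i\<in>A. \<Sum>j\<in>B i. ennreal (f i j)) = ennreal (\<Sum>i\<in>A. \<Sum>j\<in>B i. f i j)"
proof -
 have "(\<Sum>i\<in>A. \<Sum>j\<in>B i. ennreal (f i j)) = (\<Sum>i\<in>A. ennreal (\<Sum>j\<in>B i. f i j))"
  by (intro sum.cong refl sum_ennreal nn)
 also have "... = ennreal (\<Sum>i\<in>A. \<Sum>j\<in>B i. f i j)" by (intro sum_ennreal sum_nonneg nn)
 finally show ?thesis .
qed

text \<open>The number is \<open>4*2304^2*2*768*3456\<close>, collected in
  \<open>discrete_sobolev\<close>; the 4 comes from comparing two vertices with the mean, and the
  area is squared because it multiplies the difference of values.\<close>

definition sobolev_const :: "real => real => real" where
 "sobolev_const c d = 112717121716224*c*d^4/(measure sph S2)^2"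

context uniform_vmesh
begin

text \<open>If \<open>y\<close> is within \<open>2*h\<close> of \<open>x p\<close>, the cell lies in
  a ball of radius \<open>4*h\<close> around \<open>y\<close>, over which the singular integral is
  of order \<open>h\<close>. Otherwise the integrand is at most
  \<open>3/(h + norm (y - x p))\<close> on the cell, whose area is of order
  \<open>h^2\<close>.\<close>

lemma vcell_inverse_dist:
 assumes p: "p \<in> {1..N}" and y: "y \<in> S2"
 shows "(NI z. ennreal (1/norm (y - z))*indicator (V p) z) <= ennreal (1152*h^2/(h + norm (y - x p)))"
proof -
 let ?t = "norm (y - x p)"
 have near: "norm (z - x p) <= h" if "z \<in> V p" for z using ccell_norm[OF p] vcell_subset_ccell[OF p] that by blast
 show ?thesis
 proof (cases "?t < 2*h")
  case True
  have "V p \<subseteq> ball y (4*h)"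
  proof
   fix z assume z: "z \<in> V p"
   have "norm (y - z) <= ?t + h" by (rule norm_diff_triangle_le[OF order_refl near[OF z, unfolded norm_minus_commute[of z]]])
   thus "z \<in> ball y (4*h)" using True h_pos by (simp add: dist_norm)
  qed
  hence "(NI z. ennreal (1/norm (y - z))*indicator (V p) z) <= (NI z. ennreal (1/norm (y - z))*indicator (ball y (4*h)) z)"
   by (intro nn_integral_mono mult_left_mono) (auto simp: indicator_def)
  also have "... <= ennreal (96*(4*h))" using h_pos by (intro nn_integral_inverse_dist y) simp
  also have "... <= ennreal (1152*h^2/(h + ?t))"
  proof (intro ennreal_leI)
   have "384*h*(h + ?t) <= 384*h*(3*h)" using True h_pos by (intro mult_left_mono) auto
   moreover have "0 < h + ?t" using h_pos by (simp add: add_pos_nonneg)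
   ultimately show "96*(4*h) <= 1152*h^2/(h + ?t)" by (simp add: pos_le_divide_eq power2_eq_square)
  qed
  finally show ?thesis .
 next
  case False
  have t0: "0 < h + ?t" using h_pos by (simp add: add_pos_nonneg)
  have "(NI z. ennreal (1/norm (y - z))*indicator (V p) z) <= (NI z. ennreal (3/(h + ?t))*indicator (ball (x p) (2*h) \<inter> S2) z)"
  proof (intro nn_integral_mono)
   fix z
   show "ennreal (1/norm (y - z))*indicator (V p) z <= ennreal (3/(h + ?t))*indicator (ball (x p) (2*h) \<inter> S2) z"
   proof (cases "z \<in> V p")
    case True
    have "?t <= norm (y - z) + h" by (rule norm_diff_triangle_le[OF order_refl near[OF True]])
    hence "(h + ?t)/3 <= norm (y - z)" using False by simp
    hence "1/norm (y - z) <= 1/((h + ?t)/3)" using t0 by (intro divide_left_mono) (auto intro!: mult_pos_pos simp: divide_pos_pos order_less_le_trans)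
    moreover have "z \<in> ball (x p) (2*h) \<inter> S2" using near[OF True] h_pos True by (simp add: dist_norm norm_minus_commute vcell_def)
    ultimately show ?thesis using True by (simp add: ennreal_leI)
   qed simp
  qed
  also have "... = ennreal (3/(h + ?t))*emeasure sph (ball (x p) (2*h) \<inter> S2)"
   by (rule nn_integral_cmult_indicator) (intro sets_sphere_Int, simp)
  also have "... <= ennreal (3/(h + ?t))*ennreal (24*(2*h)^2)" using h_pos by (intro mult_left_mono emeasure_cap_le x_S2 p) auto
  also have "... = ennreal (3/(h + ?t)*(24*(2*h)^2))" using t0 by (intro ennreal_mult[symmetric]) auto
  also have "... <= ennreal (1152*h^2/(h + ?t))"
  proof (intro ennreal_leI)
   have "3/(h + ?t)*(24*(2*h)^2) = 288*h^2/(h + ?t)" by (simp add: power_mult_distrib)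
   also have "... <= 1152*h^2/(h + ?t)" using t0 by (intro divide_right_mono) auto
   finally show "3/(h + ?t)*(24*(2*h)^2) <= 1152*h^2/(h + ?t)" .
  qed
  finally show ?thesis .
 qed
qed

text \<open>After exchanging the integrals, the inner one runs over the pole at a fixed edge point.
  Replacing the edge point by \<open>x i\<close>, at distance at most \<open>h\<close>, doubles the
  constant.\<close>

lemma edge_cell_average:
 assumes ij: "i \<in> {1..N}" "j \<in> {1..N}" "i ~= j" and p: "p \<in> {1..N}"
 shows "(NI z. (NL th. ennreal (1/norm (ez i j th - z))*indicator (V p) z*indicator (eE i j) th))
  <= ennreal (2304*h^2/(h + norm (x i - x p)) * me i j)"
proof -
 let ?g = "\<lambda>th z. ennreal (1/norm (ez i j th - z))*indicator (V p) z*indicator (eE i j) th"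
 have [measurable]: "eE i j \<in> sets borel" by (rule borel_compact[OF eE_compact])
 have [measurable]: "V p \<in> sets borel" by (rule vcell_borel[OF p])
 have [measurable]: "ez i j \<in> borel_measurable borel" by (intro borel_measurable_continuous_onI ez_cont)
 have id [measurable]: "(\<lambda>z::real^3. z) \<in> borel_measurable sph" by (intro borel_measurable_sphere_cont continuous_intros)
 have "(NI z. (NL th. ?g th z))
  = (NL th. (NI z. ?g th z))"
 proof (rule lborel_sphere.Fubini'[of "\<lambda>th z. ?g th z"])
  have s: "snd \<in> measurable (lborel \<Otimes>\<^sub>M sph) (borel :: (real^3) measure)" using measurable_compose[OF measurable_snd id] by (simp add: comp_def)
  have f: "fst \<in> measurable (lborel \<Otimes>\<^sub>M sph) (borel :: real measure)" by measurable
  have "(\<lambda>q. ennreal (1/norm (ez i j (fst q) - snd q))*indicator (V p) (snd q)*indicator (eE i j) (fst q)) \<in> borel_measurable (lborel \<Otimes>\<^sub>M sph)"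
   using s f by measurable
  thus "(\<lambda>(th, z). ?g th z) \<in> borel_measurable (lborel \<Otimes>\<^sub>M sph)"
   by (simp add: case_prod_unfold)
 qed
 also have "... <= (NL th. ennreal (2304*h^2/(h + norm (x i - x p)))*indicator (eE i j) th)"
 proof (intro nn_integral_mono)
  fix th
  show "(NI z. ?g th z) <= ennreal (2304*h^2/(h + norm (x i - x p)))*indicator (eE i j) th"
  proof (cases "th \<in> eE i j")
   case True
   hence c: "ez i j th \<in> ccell i" by (simp add: eE_def)
   let ?y = "ez i j th"
   have "norm (x i - x p) <= h + norm (?y - x p)"
    by (rule norm_diff_triangle_le[OF ccell_norm[OF ij(1) c, unfolded norm_minus_commute[of _ "x i"]] order_refl])
   moreover have "H + a <= 2*(H + b)" if "a <= H + b" "0 <= b" for a b H :: real unfolding distrib_left using that by linarith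
   ultimately have d: "h + norm (x i - x p) <= 2*(h + norm (?y - x p))" using norm_ge_zero by blast
   have pos: "0 < h + norm (x i - x p)" "0 < h + norm (?y - x p)" using h_pos by (simp_all add: add_pos_nonneg)
   have "(NI z. ennreal (1/norm (?y - z))*indicator (V p) z) <= ennreal (1152*h^2/(h + norm (?y - x p)))"
    by (rule vcell_inverse_dist[OF p ccell_S2[OF c]])
   also have "... <= ennreal (2304*h^2/(h + norm (x i - x p)))"
   proof (intro ennreal_leI)
    have "2304*h^2/(2*(h + norm (?y - x p))) <= 2304*h^2/(h + norm (x i - x p))"
     using d pos by (intro divide_left_mono) (auto intro!: mult_pos_pos)
    moreover have "2304*h^2/(2*b) = 1152*h^2/b" for b :: real by simp
    ultimately show "1152*h^2/(h + norm (?y - x p)) <= 2304*h^2/(h + norm (x i - x p))" by metis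
   qed
   finally show ?thesis using True by simp
  qed simp
 qed
 also have "... = ennreal (2304*h^2/(h + norm (x i - x p)))*emeasure lborel (eE i j)"
  by (rule nn_integral_cmult_indicator) simp
 also have "emeasure lborel (eE i j) = ennreal (me i j)"
  using emeasure_compact_finite[OF eE_compact, of i j] by (simp add: emeasure_eq_ennreal_measure top.not_eq_extremum)
 also have "ennreal (2304*h^2/(h + norm (x i - x p)))*ennreal (me i j) = ennreal (2304*h^2/(h + norm (x i - x p)) * me i j)"
  using h_pos by (intro ennreal_mult[symmetric]) auto
 finally show ?thesis .
qed

text \<open>The left side of \<open>thomson_pointwise\<close> does not depend on the pole, so it may
  be integrated over the cell of \<open>p\<close>. Division by the area, at least
  \<open>h^2 / C\<^sub>1\<close>, cancels the \<open>h^2\<close> of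
  \<open>edge_cell_average\<close>. The bound is insensitive to the position of \<open>x p\<close>
  within its cell.\<close>

lemma thomson_average:
 assumes p: "p \<in> {1..N}"
 shows "\<bar>(SI y. (\<Sum>i\<in>{1..N}. e i*indicator (V i) y)) - measure sph S2*e p\<bar>
  <= 2304 * C\<^sub>1*(\<Sum>i\<in>{1..N}. \<Sum>j\<in>{1..N}-{i}. \<bar>e i - e j\<bar>*(me i j/(h + norm (x i - x p))))"
proof -
 let ?D = "\<bar>(SI y. (\<Sum>i\<in>{1..N}. e i*indicator (V i) y)) - measure sph S2*e p\<bar>"
 let ?J = "\<lambda>i j z. NL th. ennreal (1/norm (ez i j th - z))*indicator (V p) z*indicator (eE i j) th"
 let ?b = "\<lambda>i j. 2304*h^2/(h + norm (x i - x p)) * me i j"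
 have [measurable]: "V p \<in> sets borel" by (rule vcell_borel[OF p])
 have id [measurable]: "(\<lambda>z::real^3. z) \<in> borel_measurable sph" by (intro borel_measurable_sphere_cont continuous_intros)
 have Jm: "?J i j \<in> borel_measurable sph" if "i \<in> {1..N}" for i j
 proof -
  have [measurable]: "eE i j \<in> sets borel" by (rule borel_compact[OF eE_compact])
  have [measurable]: "ez i j \<in> borel_measurable borel" by (intro borel_measurable_continuous_onI ez_cont)
  have s: "fst \<in> measurable (sph \<Otimes>\<^sub>M lborel) (borel :: (real^3) measure)" using measurable_compose[OF measurable_fst id] by (simp add: comp_def)
  have f: "snd \<in> measurable (sph \<Otimes>\<^sub>M lborel) (borel :: real measure)" by measurable
  have "(\<lambda>q. ennreal (1/norm (ez i j (snd q) - fst q))*indicator (V p) (fst q)*indicator (eE i j) (snd q)) \<in> borel_measurable (sph \<Otimes>\<^sub>M lborel)"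
   using s f by measurable
  hence "(\<lambda>(z, th). ennreal (1/norm (ez i j th - z))*indicator (V p) z*indicator (eE i j) th) \<in> borel_measurable (sph \<Otimes>\<^sub>M lborel)"
   by (simp add: case_prod_unfold)
  thus ?thesis by (rule lborel.borel_measurable_nn_integral)
 qed
 have pt: "ennreal ?D*indicator (V p) z <= (\<Sum>i\<in>{1..N}. \<Sum>j\<in>{1..N}-{i}. ennreal \<bar>e i - e j\<bar>*?J i j z)" for z
 proof (cases "z \<in> V p")
  case z: True
  let ?L = "\<lambda>i j. integral (eE i j) (\<lambda>th. 1/norm (ez i j th - z))"
  have J: "?J i j z = ennreal (?L i j)" "0 <= ?L i j"
   if ij: "i \<in> {1..N}" "j \<in> {1..N}-{i}" for i j
  proof -
   obtain al be where E: "eE i j = {al..be}" using eE_interval[of i j] ij by auto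
   have c: "continuous_on (eE i j) (\<lambda>th. 1/norm (ez i j th - z))"
    using edge_point_ne[of i j _ p z] ij p z by (intro continuous_intros ez_cont) auto
   hence int: "(\<lambda>th. 1/norm (ez i j th - z)) integrable_on (eE i j)" unfolding E by (rule integrable_continuous_real)
   have "?J i j z = (NL th. ennreal (indicator (eE i j) th*(1/norm (ez i j th - z))))"
    using z by (intro nn_integral_cong) (simp add: indicator_def)
   also have "... = ennreal (?L i j)"
    by (rule nn_integral_has_integral_lebesgue[OF _ integrable_integral[OF int]]) simp
   finally show "?J i j z = ennreal (?L i j)" .
   show "0 <= ?L i j" by (rule Henstock_Kurzweil_Integration.integral_nonneg[OF int]) simp
  qed
  have "ennreal ?D <= ennreal (\<Sum>i\<in>{1..N}. \<Sum>j\<in>{1..N}-{i}. \<bar>e i - e j\<bar>*?L i j)"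
   by (intro ennreal_leI thomson_pointwise p z)
  also have "... = (\<Sum>i\<in>{1..N}. \<Sum>j\<in>{1..N}-{i}. ennreal (\<bar>e i - e j\<bar>*?L i j))"
   using J(2) by (intro double_sum_ennreal[symmetric] mult_nonneg_nonneg) auto
  also have "... = (\<Sum>i\<in>{1..N}. \<Sum>j\<in>{1..N}-{i}. ennreal \<bar>e i - e j\<bar>*?J i j z)"
   using J by (intro sum.cong refl) (simp add: ennreal_mult)
  finally show ?thesis using z by simp
 qed simp
 have "ennreal ?D*emeasure sph (V p) = (NI z. ennreal ?D*indicator (V p) z)"
  by (rule nn_integral_cmult_indicator[OF vcell_sets[OF p], symmetric])
 also have "... <= (NI z. (\<Sum>i\<in>{1..N}. \<Sum>j\<in>{1..N}-{i}. ennreal \<bar>e i - e j\<bar>*?J i j z))"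
  by (intro nn_integral_mono pt)
 also have "... = (\<Sum>i\<in>{1..N}. \<Sum>j\<in>{1..N}-{i}. ennreal \<bar>e i - e j\<bar>*(NI z. ?J i j z))"
  by (subst nn_integral_sum, intro borel_measurable_sum borel_measurable_times_ennreal borel_measurable_const Jm, assumption, intro sum.cong refl,
    subst nn_integral_sum, intro borel_measurable_times_ennreal borel_measurable_const Jm, assumption, intro sum.cong refl nn_integral_cmult Jm)
 also have "... <= (\<Sum>i\<in>{1..N}. \<Sum>j\<in>{1..N}-{i}. ennreal \<bar>e i - e j\<bar>*ennreal (?b i j))"
  by (intro sum_mono mult_left_mono edge_cell_average p) auto
 also have "... = ennreal (\<Sum>i\<in>{1..N}. \<Sum>j\<in>{1..N}-{i}. \<bar>e i - e j\<bar>*?b i j)"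
 proof -
  have "0 <= ?b i j" for i j using h_pos by (intro mult_nonneg_nonneg divide_nonneg_nonneg add_nonneg_nonneg) auto
  thus ?thesis by (subst double_sum_ennreal[symmetric]) (simp_all only: ennreal_mult[OF abs_ge_zero] abs_ge_zero mult_nonneg_nonneg)
 qed
 finally have "ennreal (?D * measure sph (V p)) <= ennreal (\<Sum>i\<in>{1..N}. \<Sum>j\<in>{1..N}-{i}. \<bar>e i - e j\<bar>*?b i j)"
  by (simp add: sphere.emeasure_eq_measure ennreal_mult)
 hence A: "?D * measure sph (V p) <= (\<Sum>i\<in>{1..N}. \<Sum>j\<in>{1..N}-{i}. \<bar>e i - e j\<bar>*?b i j)"
  using h_pos by (subst (asm) ennreal_le_iff) (auto intro!: sum_nonneg)
 have "?D*(h^2 / C\<^sub>1) <= ?D * measure sph (V p)" by (intro mult_left_mono area_vcell p) simp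
 also note A
 also have "(\<Sum>i\<in>{1..N}. \<Sum>j\<in>{1..N}-{i}. \<bar>e i - e j\<bar>*?b i j) = 2304*h^2*(\<Sum>i\<in>{1..N}. \<Sum>j\<in>{1..N}-{i}. \<bar>e i - e j\<bar>*(me i j/(h + norm (x i - x p))))"
  by (simp add: sum_distrib_left mult_ac)
 finally have "h^2*?D <= h^2*(2304 * C\<^sub>1*(\<Sum>i\<in>{1..N}. \<Sum>j\<in>{1..N}-{i}. \<bar>e i - e j\<bar>*(me i j/(h + norm (x i - x p)))))"
  using C1 by (simp add: field_simps)
 thus ?thesis using h_pos by (subst (asm) mult_le_cancel_left_pos) auto
qed

text \<open>Assign each vertex to the first scale \<open>2^k*h\<close> that reaches it. The summand
  is then at most \<open>4/4^k\<close>, and packing allows at most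
  \<open>24 * C\<^sub>1*9*4^k\<close> vertices, so each scale contributes at most
  \<open>864 * C\<^sub>1\<close>. The number of scales up to the diameter of the sphere is the
  origin of the logarithm.\<close>

lemma dyadic_sum:
 assumes z: "z \<in> S2"
 shows "(\<Sum>i\<in>{1..N}. h^2/(h + norm (x i - z))^2) <= 3456 * C\<^sub>1*(1 + \<bar>ln h\<bar>)"
proof -
 \<comment> \<open>The number of doublings that carry \<open>h\<close> to the diameter 2; for
   \<open>h >= 2\<close> it is 0.\<close>
 define K where "K = nat \<lceil>log 2 (2/h)\<rceil>"
 have K: "2 <= 2^K*h"
 proof -
  have "log 2 (2/h) <= real K" unfolding K_def by linarith
  hence "2 powr log 2 (2/h) <= 2 powr real K" by (intro powr_mono) auto
  hence "2/h <= 2^K" using h_pos by (simp add: powr_realpow)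
  thus ?thesis using h_pos by (simp add: field_simps)
 qed
 have Kle: "real (Suc K) <= 4*(1 + \<bar>ln h\<bar>)"
 proof -
  have "log 2 (2/h) = 1 - ln h/ln 2" using h_pos by (simp add: log_def ln_div diff_divide_distrib)
  also have "... <= 1 + 2*\<bar>ln h\<bar>"
  proof -
   have "\<bar>ln h\<bar>/ln 2 <= \<bar>ln h\<bar>/(1/2)" using ln2_ge_two_thirds by (intro divide_left_mono) auto
   hence 1: "\<bar>ln h\<bar>/ln 2 <= 2*\<bar>ln h\<bar>" by simp
   have "(- ln h)/ln 2 <= \<bar>ln h\<bar>/ln 2" by (intro divide_right_mono) auto
   hence 2: "- (ln h/ln 2) <= \<bar>ln h\<bar>/ln 2" by simp
   show ?thesis using 1 2 by linarith
  qed
  finally have "real K <= 2 + 2*\<bar>ln h\<bar>" unfolding K_def by linarith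
  thus ?thesis by simp
 qed
 let ?f = "\<lambda>k r. 4/4^k*(if r <= 2^k*h then 1 else 0 :: real)"
 have pt: "h^2/(h + r)^2 <= (\<Sum>k\<le>K. ?f k r)" if r: "0 <= r" "r <= 2" for r
 proof -
  have ex: "r <= 2^K*h" using K r by simp
  define m where "m = (LEAST n. r <= 2^n*h)"
  have m: "r <= 2^m*h" unfolding m_def by (rule LeastI[of "\<lambda>n. r <= 2^n*h", OF ex])
  have mK: "m <= K" unfolding m_def by (rule Least_le[of "\<lambda>n. r <= 2^n*h", OF ex])
  have "2^m*h <= 2*(h + r)"
  proof (cases m)
   case 0
   thus ?thesis using r h_pos by simp
  next
   case (Suc k)
   have "\<not> r <= 2^k*h" using not_less_Least[of k "\<lambda>n. r <= 2^n*h"] Suc unfolding m_def by simp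
   thus ?thesis using Suc h_pos by simp
  qed
  hence "(2^m*h)^2 <= (2*(h + r))^2" using h_pos by (intro power_mono) auto
  also have "(2^m*h)^2 = 4^m*h^2" by (simp add: power_mult_distrib power_even_eq[symmetric] power_commutes) (simp add: power_mult[symmetric] mult.commute[of m] power_mult)
  also have "(2*(h + r))^2 = 4*(h + r)^2" by (simp only: power_mult_distrib) simp
  finally have "h^2/(h + r)^2 <= 4/4^m" using h_pos r by (simp add: field_simps)
  also have "... = (\<Sum>k\<in>{m}. ?f k r)" using m by simp
  also have "... <= (\<Sum>k\<le>K. ?f k r)" using mK by (intro sum_mono2) auto
  finally show ?thesis .
 qed
 have "(\<Sum>i\<in>{1..N}. h^2/(h + norm (x i - z))^2) <= (\<Sum>i\<in>{1..N}. \<Sum>k\<le>K. ?f k (norm (x i - z)))"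
 proof (intro sum_mono pt)
  fix i assume "i \<in> {1..N}"
  thus "norm (x i - z) <= 2" using norm_triangle_ineq4[of "x i" z] x_S2[of i] z by simp
 qed simp
 also have "... = (\<Sum>k\<le>K. 4/4^k*real (card {i\<in>{1..N}. norm (x i - z) <= 2^k*h}))"
 proof -
  have "(\<Sum>i\<in>{1..N}. if P i then 1 else 0 :: real) = real (card {i\<in>{1..N}. P i})" for P
   by (subst sum.inter_filter[symmetric]) auto
  thus ?thesis by (subst sum.swap) (simp only: sum_distrib_left[symmetric])
 qed
 also have "... <= (\<Sum>k\<le>K. 864 * C\<^sub>1)"
 proof (intro sum_mono)
  fix k
  have "real (card {i\<in>{1..N}. norm (x i - z) <= 2^k*h}) <= 24 * C\<^sub>1*((2^k*h + 2*h)/h)^2"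
   using h_pos by (intro card_near z) auto
  also have "(2^k*h + 2*h)/h = 2^k + 2" using h_pos by (simp add: field_simps)
  also have "24 * C\<^sub>1*(2^k + 2)^2 <= 24 * C\<^sub>1*(3*2^k)^2" using C1 by (intro mult_left_mono power_mono) auto
  also have "(3*2^k)^2 = 9*(4^k :: real)" by (simp add: power_mult_distrib) (simp add: power_mult[symmetric] mult.commute[of k] power_mult)
  finally have "4/4^k*real (card {i\<in>{1..N}. norm (x i - z) <= 2^k*h}) <= 4/4^k*(24 * C\<^sub>1*(9*4^k))" by (intro mult_left_mono) auto
  thus "4/4^k*real (card {i\<in>{1..N}. norm (x i - z) <= 2^k*h}) <= 864 * C\<^sub>1" by simp
 qed
 also have "... = 864 * C\<^sub>1*real (Suc K)" by simp
 also have "... <= 864 * C\<^sub>1*(4*(1 + \<bar>ln h\<bar>))" using C1 Kle by (intro mult_left_mono) auto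
 also have "864 * C\<^sub>1*(4*(1 + \<bar>ln h\<bar>)) = 3456 * C\<^sub>1*(1 + \<bar>ln h\<bar>)" by (simp only: mult.assoc mult.left_commute[of C\<^sub>1 4])
 finally show ?thesis .
qed

text \<open>In \<open>thomson_average\<close> write \<open>me i j\<close> as the product of
  \<open>sqrt (me i j/ed i j)\<close> and \<open>sqrt (me i j*ed i j)\<close>. By Cauchy-Schwarz the
  first factor gives the energy. The second gives the dyadic sum, since \<open>me i j*ed i j\<close>
  is at most \<open>2 * C\<^sub>0*h^2\<close> and a vertex has boundedly many neighbours. The
  unknown mean \<open>?m\<close> disappears in the difference of two vertices.\<close>

lemma discrete_sobolev:
 assumes pq: "p \<in> {1..N}" "q \<in> {1..N}"
 shows "(e p - e q)^2 <= sobolev_const C\<^sub>0 C\<^sub>1*(1 + \<bar>ln h\<bar>)*energy e"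
proof -
 let ?S = "measure sph S2" and ?L = "1 + \<bar>ln h\<bar>"
 let ?m = "SI y. (\<Sum>i\<in>{1..N}. e i*indicator (V i) y)"
 have S: "?S > 0"
 proof -
  have "0 < measure sph (ball (axis 1 1) 1 \<inter> S2)" by (rule measure_cap_pos) auto
  also have "... <= ?S" using sets.top[of sph] by (intro sphere.finite_measure_mono) auto
  finally show ?thesis .
 qed
 have D: "(?m - ?S*e p)^2 <= 28179280429056 * C\<^sub>0 * C\<^sub>1^4*?L*energy e" if p: "p \<in> {1..N}" for p
 proof -
  let ?A = "Sigma {1..N} (\<lambda>i. {1..N}-{i})"
  let ?a = "\<lambda>(i, j). sqrt (me i j/ed i j)*\<bar>e i - e j\<bar>" and ?b = "\<lambda>(i, j). sqrt (me i j*ed i j)/(h + norm (x i - x p))"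
  have sg: "(\<Sum>i\<in>{1..N}. \<Sum>j\<in>{1..N}-{i}. f i j) = (\<Sum>(i,j)\<in>?A. f i j)" for f :: "nat => nat => real" by (rule sum.Sigma) auto
  have "(\<Sum>i\<in>{1..N}. \<Sum>j\<in>{1..N}-{i}. \<bar>e i - e j\<bar>*(me i j/(h + norm (x i - x p)))) = (\<Sum>k\<in>?A. ?a k*?b k)"
   unfolding sg
  proof (intro sum.cong refl)
   fix k assume "k \<in> ?A"
   then obtain i j where k: "k = (i, j)" "i \<in> {1..N}" "j \<in> {1..N}" "i ~= j" by (elim SigmaE) blast
   have "sqrt (me i j/ed i j) * sqrt (me i j*ed i j) = me i j"
    using ed_pos[OF k(2-4)] by (simp add: real_sqrt_mult[symmetric])
   thus "(case k of (i, j) => \<bar>e i - e j\<bar>*(me i j/(h + norm (x i - x p)))) = ?a k*?b k"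
    unfolding k by (simp add: mult_ac)
  qed
  with thomson_average[OF p, of e] have "\<bar>?m - ?S*e p\<bar> <= 2304 * C\<^sub>1*(\<Sum>k\<in>?A. ?a k*?b k)" by (simp only:)
  from power_mono[OF this abs_ge_zero, of 2] have "(?m - ?S*e p)^2 <= (2304 * C\<^sub>1*(\<Sum>k\<in>?A. ?a k*?b k))^2"
   unfolding power2_abs .
  also have "... = (2304 * C\<^sub>1)^2*(\<Sum>k\<in>?A. ?a k*?b k)^2" by (rule power_mult_distrib)
  also have "... <= (2304 * C\<^sub>1)^2*((\<Sum>k\<in>?A. (?a k)^2)*(\<Sum>k\<in>?A. (?b k)^2))"
   by (intro mult_left_mono Cauchy_Schwarz_ineq_sum) simp
  also have "(\<Sum>k\<in>?A. (?a k)^2) = 2*energy e"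
   unfolding energy_def sg by (simp add: case_prod_unfold power_mult_distrib ed_def)
  also have "(2304 * C\<^sub>1)^2*(2*energy e*(\<Sum>k\<in>?A. (?b k)^2)) <= (2304 * C\<^sub>1)^2*(2*energy e*(768 * C\<^sub>0 * C\<^sub>1*(3456 * C\<^sub>1*?L)))"
  proof (intro mult_left_mono)
   have "(\<Sum>k\<in>?A. (?b k)^2) = (\<Sum>i\<in>{1..N}. \<Sum>j\<in>{1..N}-{i}. me i j*ed i j/(h + norm (x i - x p))^2)"
    unfolding sg by (simp add: case_prod_unfold power_divide ed_def)
   also have "... <= (\<Sum>i\<in>{1..N}. 768 * C\<^sub>0 * C\<^sub>1*(h^2/(h + norm (x i - x p))^2))"
   proof (intro sum_mono)
    fix i assume i: "i \<in> {1..N}"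
    let ?w = "1/(h + norm (x i - x p))^2"
    have "(\<Sum>j\<in>{1..N}-{i}. me i j*ed i j/(h + norm (x i - x p))^2) <= (\<Sum>j\<in>{1..N}-{i}. if me i j > 0 then C\<^sub>0*h*(2*h)*?w else 0)"
    proof (intro sum_mono)
     fix j assume j: "j \<in> {1..N}-{i}"
     show "me i j*ed i j/(h + norm (x i - x p))^2 <= (if me i j > 0 then C\<^sub>0*h*(2*h)*?w else 0)"
     proof (cases "me i j > 0")
      case True
      have "me i j*ed i j <= C\<^sub>0*h*(2*h)"
       using me_le[of i j] me_near[of i j] i j True C0 h_pos unfolding ed_def by (intro mult_mono) auto
      hence "me i j*ed i j*?w <= C\<^sub>0*h*(2*h)*?w" by (intro mult_right_mono) auto
      thus ?thesis using True by simp
     next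
      case False
      hence "me i j = 0" using measure_nonneg[of lborel "eE i j"] by linarith
      thus ?thesis by simp
     qed
    qed
    also have "... = real (card {j\<in>{1..N}-{i}. me i j > 0})*(C\<^sub>0*h*(2*h)*?w)"
     by (subst sum.inter_filter[symmetric]) auto
    also have "... <= 384 * C\<^sub>1*(C\<^sub>0*h*(2*h)*?w)" using C0 h_pos by (intro mult_right_mono card_nbrs i) auto
    also have "... = 768 * C\<^sub>0 * C\<^sub>1*(h^2/(h + norm (x i - x p))^2)" by (simp add: power2_eq_square)
    finally show "(\<Sum>j\<in>{1..N}-{i}. me i j*ed i j/(h + norm (x i - x p))^2) <= 768 * C\<^sub>0 * C\<^sub>1*(h^2/(h + norm (x i - x p))^2)" .
   qed
   also have "... = 768 * C\<^sub>0 * C\<^sub>1*(\<Sum>i\<in>{1..N}. h^2/(h + norm (x i - x p))^2)" by (rule sum_distrib_left[symmetric])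
   also have "... <= 768 * C\<^sub>0 * C\<^sub>1*(3456 * C\<^sub>1*?L)" using C0 C1 by (intro mult_left_mono dyadic_sum x_S2 p) auto
   finally show "(\<Sum>k\<in>?A. (?b k)^2) <= 768 * C\<^sub>0 * C\<^sub>1*(3456 * C\<^sub>1*?L)" .
   show "0 <= 2*energy e" unfolding energy_def ed_def by (intro mult_nonneg_nonneg sum_nonneg) auto
  qed simp
  also have "... = 28179280429056 * C\<^sub>0 * C\<^sub>1^4*?L*energy e" by (simp add: power2_eq_square eval_nat_numeral)
  finally show ?thesis .
 qed
 have "(?S*(e p - e q))^2 = ((?m - ?S*e q) - (?m - ?S*e p))^2" by (simp add: algebra_simps)
 also have "... <= 2*(?m - ?S*e q)^2 + 2*(?m - ?S*e p)^2"
 proof -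
  have "(a - b)^2 <= 2*a^2 + 2*b^2" for a b :: real using zero_le_power2[of "a + b"] by (simp add: power2_eq_square algebra_simps)
  thus ?thesis .
 qed
 also have "... <= 112717121716224 * C\<^sub>0 * C\<^sub>1^4*(?L*energy e)" using D[OF pq(1)] D[OF pq(2)] by linarith
 finally have "?S^2*(e p - e q)^2 <= 112717121716224 * C\<^sub>0 * C\<^sub>1^4*(?L*energy e)" by (simp add: power_mult_distrib)
 hence "(e p - e q)^2 <= 112717121716224 * C\<^sub>0 * C\<^sub>1^4*(?L*energy e)/?S^2" using S by (simp add: pos_le_divide_eq mult.commute)
 thus ?thesis unfolding sobolev_const_def by (simp add: mult_ac)
qed

end

lemma measure_S2_pos: "measure sph S2 > 0"
proof -
 have "0 < measure sph (ball (axis 1 1) 1 \<inter> S2)" by (rule measure_cap_pos) auto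
 also have "... <= measure sph S2" using sets.top[of sph] by (intro sphere.finite_measure_mono) auto
 finally show ?thesis .
qed

section \<open>Removal of the mollifier\<close>

lemma mol_weak_limit:
 assumes u: "integrable sph u" and c: "continuous_on UNIV ph"
 shows "(\<lambda>n. SI y. mol n u y*ph y) \<longlonglongrightarrow> (SI y. u y*ph y)"
proof -
 have cS: "continuous_on S2 ph" using c continuous_on_subset by blast
 obtain B where "\<forall>y\<in>S2. \<bar>ph y\<bar> <= B"
  using compact_imp_bounded[OF compact_continuous_image[OF cS compact_sphere]] unfolding bounded_iff by auto
 hence B: "\<And>y. y \<in> S2 ==> \<bar>ph y\<bar> <= B" by blast
 have m: "ph \<in> borel_measurable sph" by (rule borel_measurable_sphere_cont[OF cS])
 have i: "integrable sph ph" by (rule continuous_S2_integrable[OF cS])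
 have um: "u \<in> borel_measurable sph" using u by simp
 have "(\<lambda>n. SI y. u y * mol n ph y) \<longlonglongrightarrow> (SI y. u y*ph y)"
 proof (rule integral_dominated_convergence[where w="\<lambda>y. \<bar>u y\<bar>*B"])
  show "(\<lambda>y. u y*ph y) \<in> borel_measurable sph" by (intro borel_measurable_times um m)
  show "(\<lambda>y. u y * mol n ph y) \<in> borel_measurable sph" for n
   by (intro borel_measurable_times um borel_measurable_sphere_cont mol_continuous i)
  show "integrable sph (\<lambda>y. \<bar>u y\<bar>*B)" using u by simp
  show "AE y in sph. norm (u y * mol n ph y) <= \<bar>u y\<bar>*B" for n
  proof (intro AE_I2)
   fix y assume "y \<in> space sph"
   hence "\<bar>mol n ph y\<bar> <= B" using B by (intro mol_bound[OF i]) auto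
   thus "norm (u y * mol n ph y) <= \<bar>u y\<bar>*B" by (simp add: abs_mult mult_left_mono)
  qed
  show "AE y in sph. (\<lambda>n. u y * mol n ph y) \<longlonglongrightarrow> u y*ph y"
  proof (intro AE_I2 tendsto_mult tendsto_const)
   fix y assume "y \<in> space sph"
   hence y: "y \<in> S2" by simp
   show "(\<lambda>n. mol n ph y) \<longlonglongrightarrow> ph y"
    by (rule mol_tendsto[OF m B y]) (use cS y in \<open>auto simp: continuous_on_eq_continuous_within\<close>)
  qed
 qed
 moreover have "(SI y. mol n u y*ph y) = (SI y. u y * mol n ph y)" for n by (rule mol_selfadjoint[OF u m B])
 ultimately show ?thesis by simp
qed

lemma AE_le_of_mol_le:
 assumes u: "integrable sph u" and v: "continuous_on S2 v"
  and le: "eventually (\<lambda>n. \<forall>y\<in>S2. s * (mol n u y - v y) <= W) sequentially"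
 shows "AE y in sph. s * (u y - v y) <= W"
proof -
 have vi: "integrable sph v" by (rule continuous_S2_integrable[OF v])
 have "AE y in sph. 0 <= W - s * (u y - v y)"
 proof (rule AE_nonneg_of_tests)
  show "integrable sph (\<lambda>y. W - s * (u y - v y))" using u vi by (intro Bochner_Integration.integrable_diff integrable_mult_right) auto
  fix ph :: "real^3 => real" assume c: "continuous_on UNIV ph" and nn: "\<And>y. 0 <= ph y"
  have cS: "continuous_on S2 ph" using c continuous_on_subset by blast
  have i1: "integrable sph (\<lambda>y. ph y*(W + s * v y))" by (intro continuous_S2_integrable continuous_intros cS v)
  have split: "(SI y. ph y*(W - s * (g y - v y))) = (SI y. ph y*(W + s * v y)) - s * (SI y. g y*ph y)" if g: "integrable sph g" for g
  proof -
   have i2: "integrable sph (\<lambda>y. g y*ph y)" using integrable_cont_mult[OF g cS] by (simp add: mult.commute)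
   have "(SI y. ph y*(W - s * (g y - v y))) = (SI y. ph y*(W + s * v y) - s * (g y*ph y))"
    by (intro Bochner_Integration.integral_cong refl) (simp add: algebra_simps)
   also have "... = (SI y. ph y*(W + s * v y)) - (SI y. s * (g y*ph y))"
    by (rule Bochner_Integration.integral_diff[OF i1 integrable_mult_right[OF i2]])
   finally show ?thesis by simp
  qed
  have mi: "integrable sph (mol n u)" for n by (rule continuous_S2_integrable[OF mol_continuous[OF u]])
  have "(\<lambda>n. SI y. ph y*(W - s * (mol n u y - v y))) \<longlonglongrightarrow> (SI y. ph y*(W - s * (u y - v y)))"
   unfolding split[OF u] split[OF mi] by (intro tendsto_diff tendsto_mult tendsto_const mol_weak_limit u c)
  moreover have "eventually (\<lambda>n. 0 <= (SI y. ph y*(W - s * (mol n u y - v y)))) sequentially"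
   using le by eventually_elim (intro Bochner_Integration.integral_nonneg, auto intro!: mult_nonneg_nonneg nn)
  ultimately show "0 <= (SI y. ph y*(W - s * (u y - v y)))"
   by (rule tendsto_lowerbound) simp
 qed
 thus ?thesis by eventually_elim simp
qed

section \<open>The error estimate\<close>

context uniform_vmesh
begin

text \<open>The Sobolev inequality bounds the oscillation of the nodal errors, and hence of their
  convex combinations; interpolation adds \<open>288*h^2*M\<close> at each of two points of the
  sphere. Since \<open>mol n u\<close> and \<open>uh\<close> have integral 0, averaging
  \<open>w y - w y'\<close> over \<open>y'\<close> turns the bound on the oscillation into one on
  \<open>w y\<close>.\<close>

lemma mol_error:
 assumes sol: "weak_solution f u" and fv: "fv_solution N x f uh" and rd: "rot_data u a b M Q" and M: "0 <= M"
  and E: "energy (\<lambda>i. mol n u (x i) - uh (x i)) <= B" and y: "y \<in> S2"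
 shows "\<bar>mol n u y - uh y\<bar> <= sqrt (sobolev_const C\<^sub>0 C\<^sub>1*(1 + \<bar>ln h\<bar>)*B) + 576*h^2*M"
proof -
 define e where "e i = mol n u (x i) - uh (x i)" for i
 define w where "w y = mol n u y - uh y" for y
 let ?O = "sqrt (sobolev_const C\<^sub>0 C\<^sub>1*(1 + \<bar>ln h\<bar>)*B)" and ?I = "288*h^2*M" and ?S = "measure sph S2"
 have uhU: "uh \<in> U_h N x" using fv by (simp add: fv_solution_def)
 have ui: "integrable sph u" using rd by (simp add: rot_data_def has_weak_rot_def)
 have kt: "0 <= sobolev_const C\<^sub>0 C\<^sub>1" using C0 C1 by (simp add: sobolev_const_def)
 have osc: "e p - e q <= ?O" if "p \<in> {1..N}" "q \<in> {1..N}" for p q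
 proof -
  have "(e p - e q)^2 <= sobolev_const C\<^sub>0 C\<^sub>1*(1 + \<bar>ln h\<bar>)*energy e" by (rule discrete_sobolev[OF that])
  also have "... <= sobolev_const C\<^sub>0 C\<^sub>1*(1 + \<bar>ln h\<bar>)*B" using E kt unfolding e_def by (intro mult_left_mono) auto
  finally show ?thesis by (rule real_le_rsqrt)
 qed
 have rep: "\<exists>t al. t \<subseteq> {1..N} \<and> (\<forall>m\<in>t. 0 <= al m) \<and> sum al t = 1 \<and> \<bar>w y - (\<Sum>m\<in>t. al m*e m)\<bar> <= ?I" if y: "y \<in> S2" for y
 proof -
  obtain t al where t: "t \<in> delaunay N x" "\<And>m. m \<in> t ==> 0 <= al m" "sum al t = 1"
   "y = rp (\<Sum>m\<in>t. al m *R x m)" "uh y = (\<Sum>m\<in>t. al m*uh (x m))" by (rule U_h_rep[OF uhU y]) blast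
  have "\<bar>mol n u (rp (\<Sum>m\<in>t. al m *R x m)) - (\<Sum>m\<in>t. al m * mol n u (x m))\<bar> <= 4*h^2*(72*M)"
  proof (rule interpolation_error[OF mol_rot_smooth[OF rd] mol_rot_size(3)[OF rd M] _ t(1-3)])
   fix y :: "real^3" assume "y \<in> S2"
   thus "\<bar>mol n u y\<bar> <= 72*M" using mol_rot_size(1)[OF rd M, of y n] M by simp
  qed
  moreover have "w y - (\<Sum>m\<in>t. al m*e m) = mol n u y - (\<Sum>m\<in>t. al m * mol n u (x m))"
   unfolding w_def e_def t(5) by (simp add: right_diff_distrib sum_subtractf)
  ultimately have "\<bar>w y - (\<Sum>m\<in>t. al m*e m)\<bar> <= ?I" unfolding t(4)[symmetric] by simp
  thus ?thesis using t(2,3) delaunay_subset[OF t(1)] by blast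
 qed
 have diff: "w y - w y' <= ?O + 576*h^2*M" if yy: "y \<in> S2" "y' \<in> S2" for y y'
 proof -
  obtain t al where t: "t \<subseteq> {1..N}" "\<forall>m\<in>t. 0 <= al m" "sum al t = 1" "\<bar>w y - (\<Sum>m\<in>t. al m*e m)\<bar> <= ?I" using rep[OF yy(1)] by blast
  obtain s be where s: "s \<subseteq> {1..N}" "\<forall>m\<in>s. 0 <= be m" "sum be s = 1" "\<bar>w y' - (\<Sum>m\<in>s. be m*e m)\<bar> <= ?I" using rep[OF yy(2)] by blast
  have "(\<Sum>m\<in>t. al m*e m) - c <= ?O" if c: "\<And>m. m \<in> t ==> e m - c <= ?O" for c
  proof -
   have "(\<Sum>m\<in>t. al m*e m) - c = (\<Sum>m\<in>t. al m*(e m - c))" using t(3) by (simp add: right_diff_distrib sum_subtractf sum_distrib_right[symmetric])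
   also have "... <= (\<Sum>m\<in>t. al m*?O)" using t(2) c by (intro sum_mono mult_left_mono) auto
   also have "... = ?O" using t(3) by (simp add: sum_distrib_right[symmetric])
   finally show ?thesis .
  qed
  moreover have "e m - (\<Sum>m\<in>s. be m*e m) <= ?O" if m: "m \<in> t" for m
  proof -
   have "e m - (\<Sum>q\<in>s. be q*e q) = (\<Sum>q\<in>s. be q*(e m - e q))" using s(3) by (simp add: right_diff_distrib sum_subtractf sum_distrib_right[symmetric])
   also have "... <= (\<Sum>q\<in>s. be q*?O)" using s(1,2) t(1) m by (intro sum_mono mult_left_mono osc) auto
   also have "... = ?O" using s(3) by (simp add: sum_distrib_right[symmetric])
   finally show ?thesis .
  qed
  ultimately have "(\<Sum>m\<in>t. al m*e m) - (\<Sum>m\<in>s. be m*e m) <= ?O" by blast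
  thus ?thesis using t(4) s(4) by linarith
 qed
 have mi: "integrable sph (mol n u)" by (rule continuous_S2_integrable[OF mol_continuous[OF ui]])
 have uhi: "integrable sph uh" by (rule continuous_S2_integrable[OF U_h_continuous[OF uhU]])
 have wi: "integrable sph w" unfolding w_def by (rule Bochner_Integration.integrable_diff[OF mi uhi])
 have "(SI y. mol n u y*1) = (SI y. u y * mol n (\<lambda>_. 1) y)" by (rule mol_selfadjoint[OF ui, of _ 1]) auto
 also have "... = (SI y. u y)" by (intro Bochner_Integration.integral_cong refl) (simp add: mol_one)
 also have "... = 0" using sol by (simp add: weak_solution_def H1_0_def)
 finally have "(SI y. mol n u y) = 0" by simp
 moreover have "(SI y. uh y) = 0" using uhU by (simp add: U_h_def)
 ultimately have w0: "(SI y. w y) = 0" unfolding w_def Bochner_Integration.integral_diff[OF mi uhi] by simp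
 let ?W = "?O + 576*h^2*M"
 have c: "(SI y'. c) = ?S*c" for c by simp
 have "w y*?S <= ?W*?S"
 proof -
  have "(SI y'. w y - w y') <= (SI y'. ?W)" using wi diff[OF y] by (intro integral_mono) auto
  moreover have "(SI y'. w y - w y') = ?S*w y" using wi w0 by (subst Bochner_Integration.integral_diff) auto
  ultimately show ?thesis unfolding c by (simp only: mult.commute)
 qed
 moreover have "(- w y)*?S <= ?W*?S"
 proof -
  have "(SI y'. w y' - w y) <= (SI y'. ?W)" using wi diff[OF _ y] by (intro integral_mono) auto
  moreover have "(SI y'. w y' - w y) = ?S*(- w y)" using wi w0 by (subst Bochner_Integration.integral_diff) auto
  ultimately show ?thesis unfolding c by (simp only: mult.commute)
 qed
 ultimately have "w y <= ?W" "- w y <= ?W" using measure_S2_pos by (simp_all only: mult_le_cancel_right_pos)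
 thus ?thesis unfolding w_def by linarith
qed

lemma max_norm_error:
 assumes sol: "weak_solution f u" and f: "in_Lp 2 f" "(SI y. f y) = 0" and fv: "fv_solution N x f uh"
  and rd: "rot_data u a b M Q" and M: "0 <= M"
 defines "B \<equiv> residual_const C\<^sub>1/2*(if h <= 1/2 then h^2*(2304*Q^2) else M^2)"
 shows "Lp_norm \<infinity> (\<lambda>y. u y - uh y) <= sqrt (sobolev_const C\<^sub>0 C\<^sub>1*(1 + \<bar>ln h\<bar>)*B) + 576*h^2*M"
proof (rule field_le_epsilon)
 fix ep :: real assume ep: "ep > 0"
 let ?K = "sobolev_const C\<^sub>0 C\<^sub>1*(1 + \<bar>ln h\<bar>)"
 have K: "?K > 0" using C0 C1 measure_S2_pos unfolding sobolev_const_def by (intro mult_pos_pos divide_pos_pos zero_less_power) auto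
 have B0: "0 <= B" unfolding B_def residual_const_def by auto
 \<comment> \<open>Chosen so that \<open>sqrt (?K*et) = ep\<close>: the slack left by
   \<open>energy_limit\<close> costs exactly \<open>ep\<close> in the final bound.\<close>
 define et where "et = ep^2/?K"
 have et: "et > 0" using ep K by (simp add: et_def)
 let ?W = "sqrt (?K*(B + et)) + 576*h^2*M"
 have ui: "integrable sph u" using rd by (simp add: rot_data_def has_weak_rot_def)
 have uhc: "continuous_on S2 uh" by (rule U_h_continuous) (use fv in \<open>simp add: fv_solution_def\<close>)
 have ev: "eventually (\<lambda>n. \<forall>y\<in>S2. \<bar>mol n u y - uh y\<bar> <= ?W) sequentially"
  using energy_limit[OF sol f fv rd M et] unfolding B_def[symmetric]
  by eventually_elim (use mol_error[OF sol fv rd M] in blast)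
 have 1: "AE y in sph. 1*(u y - uh y) <= ?W"
  by (rule AE_le_of_mol_le[OF ui uhc]) (use ev in \<open>auto elim!: eventually_mono simp: abs_le_iff\<close>)
 have 2: "AE y in sph. (-1)*(u y - uh y) <= ?W"
  by (rule AE_le_of_mol_le[OF ui uhc]) (use ev in \<open>auto elim!: eventually_mono simp: abs_le_iff\<close>)
 have "Lp_norm \<infinity> (\<lambda>y. u y - uh y) <= ?W"
 proof (rule Lp_norm_inf_le)
  have "u \<in> borel_measurable sph" using ui by simp
  thus "(\<lambda>y. u y - uh y) \<in> borel_measurable sph" by (intro borel_measurable_diff borel_measurable_sphere_cont[OF uhc])
  show "AE y in sph. \<bar>u y - uh y\<bar> <= ?W" using 1 2 by eventually_elim (simp add: abs_le_iff)
 qed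
 also have "sqrt (?K*(B + et)) <= sqrt (?K*B) + sqrt (?K*et)"
  using K B0 et by (simp only: distrib_left) (intro sqrt_add_le_add_sqrt mult_nonneg_nonneg; simp)
 also have "sqrt (?K*et) = ep"
 proof -
  have kn: "?K ~= 0" using K by (rule less_imp_neq[symmetric])
  show ?thesis unfolding et_def times_divide_eq_right nonzero_mult_div_cancel_left[OF kn] using ep by simp
 qed
 finally show "Lp_norm \<infinity> (\<lambda>y. u y - uh y) <= sqrt (?K*B) + 576*h^2*M + ep" by simp
qed

end

theorem theorem5p10:
  fixes C\<^sub>0 C\<^sub>1 :: real
  assumes "C\<^sub>0 > 0" and "C\<^sub>1 > 0"
  shows "\<exists>C>0. \<forall>(N::nat) (x :: nat \<Rightarrow> real^3) (f :: real^3 \<Rightarrow> real) (u :: real^3 \<Rightarrow> real) (u\<^sub>h :: real^3 \<Rightarrow> real).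
    voronoi_delaunay N x \<longrightarrow>
    almost_uniform C\<^sub>0 C\<^sub>1 N x \<longrightarrow>
    in_Lp 2 f \<longrightarrow>
    (\<integral>y. f y \<partial>sphere_measure) = 0 \<longrightarrow>
    weak_solution f u \<longrightarrow>
    in_Sobolev 2 \<infinity> u \<longrightarrow>
    in_Sobolev 2 2 u \<longrightarrow>
    u \<in> H1_0 \<longrightarrow>
    fv_solution N x f u\<^sub>h \<longrightarrow>
    (let h = mesh_size N x in
      Lp_norm \<infinity> (\<lambda>y. u y - u\<^sub>h y)
        \<le> C * h * sqrt \<bar>ln h\<bar> * (Sobolev_norm 2 2 u + Lp_norm 2 f)
          + C * h\<^sup>2 * Sobolev_norm 2 \<infinity> u)"
proof -
 let ?T = "sobolev_const C\<^sub>0 C\<^sub>1" and ?R = "residual_const C\<^sub>1"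
 have TR: "0 <= ?T" "0 <= ?R" using assms by (simp_all add: sobolev_const_def residual_const_def)
 \<comment> \<open>For \<open>h <= 1/2\<close> one has \<open>1 + |ln h| <= 3*|ln h|\<close>, and
   \<open>221184 = 3*2304*8^2/2\<close>. For \<open>h > 1/2\<close> one has
   \<open>1 + |ln h| <= 4\<close>, and \<open>128 = 4*8^2/2\<close>; the 4 before the root
   compensates \<open>h^2 >= 1/4\<close>.\<close>
 define c1 c2 where "c1 = sqrt (221184*?T*?R)" and "c2 = 4 * sqrt (128*?T*?R)"
 have c0: "0 <= c1" "0 <= c2" using TR by (simp_all add: c1_def c2_def)
 \<comment> \<open>The summand \<open>4608 = 576*8\<close> covers the interpolation term, the 8
   being the factor of \<open>rot_data_exists\<close>.\<close>
 define C where "C = c1 + c2 + 4608"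
 show ?thesis
 proof (intro exI[of _ C] conjI allI impI, unfold Let_def)
  show "C > 0" using c0 by (simp add: C_def)
  fix N :: nat and x :: "nat => real^3" and f u u\<^sub>h :: "real^3 => real"
  assume H: "voronoi_delaunay N x" "almost_uniform C\<^sub>0 C\<^sub>1 N x" "in_Lp 2 f" "(SI y. f y) = 0" "weak_solution f u"
   "in_Sobolev 2 \<infinity> u" "in_Sobolev 2 2 u" "fv_solution N x f u\<^sub>h"
  interpret uniform_vmesh N x C\<^sub>0 C\<^sub>1 by unfold_locales (fact H assms)+
  let ?M = "Sobolev_norm 2 \<infinity> u" and ?Q = "Sobolev_norm 2 2 u" and ?F = "Lp_norm 2 f"
  obtain a b where rd: "rot_data u a b (8*?M) (8*?Q)" using rot_data_exists[OF H(7,6)] by blast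
  have F0: "0 <= ?F" by (rule Lp_norm_2(5)[OF H(3)])
  have Q0: "0 <= ?Q"
   using Lp_norm_2(5)[OF in_Sobolev_2_weak_grad(1)[OF H(7)]] Sobolev_norm_Suc_2_ge(1)[of u 1] by (simp add: numeral_eq_Suc)
  have "0 <= Lp_norm \<infinity> u" using esssup_sphere_nonneg[of u] by (simp add: Lp_norm_def real_of_ereal_pos)
  hence M0: "0 <= ?M" using Sobolev_norm_Suc_inf_ge(1)[of u 1] by (simp add: numeral_eq_Suc)
  let ?L = "1 + \<bar>ln h\<bar>"
  let ?B = "?R/2*(if h <= 1/2 then h^2*(2304*(8*?Q)^2) else (8*?M)^2)"
  have err: "Lp_norm \<infinity> (\<lambda>y. u y - u\<^sub>h y) <= sqrt (?T*?L*?B) + 576*h^2*(8*?M)"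
   by (rule max_norm_error[OF H(5,3,4,8) rd]) (use M0 in simp)
  have l0: "0 <= h * sqrt \<bar>ln h\<bar>" using h_pos by simp
  show "Lp_norm \<infinity> (\<lambda>y. u y - u\<^sub>h y) <= C*h * sqrt \<bar>ln h\<bar>*(?Q + ?F) + C*h^2*?M"
  proof (cases "h <= 1/2")
   case True
   have "ln h <= ln (1/2)" using True h_pos by simp
   hence "2/3 <= - ln h" using ln2_ge_two_thirds by (simp add: ln_div)
   hence L: "?L <= 3*\<bar>ln h\<bar>" by linarith
   have "?T*?L*?B <= ?T*(3*\<bar>ln h\<bar>)*(?R/2*(h^2*(2304*(8*?Q)^2)))"
    using True TR L by (simp only: if_True) (intro mult_right_mono mult_left_mono mult_nonneg_nonneg; simp)
   also have "... = 221184*?T*?R*(h^2*\<bar>ln h\<bar>*?Q^2)" by (simp add: power_mult_distrib)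
   finally have "sqrt (?T*?L*?B) <= sqrt (221184*?T*?R*(h^2*\<bar>ln h\<bar>*?Q^2))" by (rule real_sqrt_le_mono)
   also have "... = c1*(h * sqrt \<bar>ln h\<bar>*?Q)" using h_pos Q0 by (simp add: c1_def real_sqrt_mult)
   also have "... <= C*(h * sqrt \<bar>ln h\<bar>*(?Q + ?F))"
    using c0 l0 Q0 F0 by (intro mult_mono mult_left_mono) (auto simp: C_def intro!: mult_nonneg_nonneg)
   finally have "sqrt (?T*?L*?B) <= C*h * sqrt \<bar>ln h\<bar>*(?Q + ?F)" by (simp add: mult.assoc)
   moreover have "576*h^2*(8*?M) <= C*h^2*?M"
    using c0 M0 mult_right_mono[of 4608 C "h^2*?M"] by (simp add: C_def mult_ac)
   ultimately show ?thesis using err by linarith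
  next
   case False
   have "ln h <= h - 1" by (rule ln_le_minus_one[OF h_pos])
   hence 1: "ln h <= 3" using h_le_pi pi_less_4 by linarith
   have "ln (1/h) <= 1/h - 1" using h_pos by (intro ln_le_minus_one) simp
   moreover have "1/h <= 2" using False h_pos by (simp add: field_simps)
   ultimately have "- ln h <= 1" using h_pos by (simp add: ln_div)
   hence L: "?L <= 4" using 1 by linarith
   have "?T*?L*?B <= ?T*4*(?R/2*(8*?M)^2)"
    using False TR L by (simp only: if_False) (intro mult_right_mono mult_left_mono mult_nonneg_nonneg; simp)
   also have "... = 128*?T*?R*?M^2" by (simp add: power_mult_distrib)
   finally have "sqrt (?T*?L*?B) <= sqrt (128*?T*?R*?M^2)" by (rule real_sqrt_le_mono)
   also have "... = c2*(1/4*?M)" using M0 by (simp add: c2_def real_sqrt_mult)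
   also have "... <= c2*(h^2*?M)"
   proof -
    have "(1/2)^2 <= h^2" using False by (intro power_mono) auto
    thus ?thesis using c0 M0 by (intro mult_left_mono mult_right_mono) (auto simp: power_divide)
   qed
   finally have "sqrt (?T*?L*?B) <= c2*(h^2*?M)" .
   moreover have "(c2 + 4608)*(h^2*?M) <= C*(h^2*?M)"
    using c0 M0 by (intro mult_right_mono) (auto simp: C_def)
   moreover have "0 <= C*h * sqrt \<bar>ln h\<bar>*(?Q + ?F)"
    using c0 h_pos Q0 F0 by (intro mult_nonneg_nonneg) (auto simp: C_def)
   ultimately show ?thesis using err by (simp add: algebra_simps)
  qed
 qed
qed

end
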